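(* Let $k$ be a commutative ring with unit. For $a,b\in\mathbb{N}$ there are isomorphisms of $k$-modules $$\mathrm{Hom}_{\mathcal{F}(\overline{\mathbf{Fin}};k)}\big(\overline{k[-]}^{\otimes a},\overline{k[-]}^{\otimes b}\big)\cong\begin{cases}k^{\oplus \mathrm{Rk}(b,a)} & b\ge a>0\\ 0 & b<a,\end{cases}$$ $$\mathrm{Ext}^1_{\mathcal{F}(\overline{\mathbf{Fin}};k)}\big(\overline{k[-]}^{\otimes a},\overline{k[-]}^{\otimes b}\big)\cong\begin{cases}k & b=a+1\\ 0&\text{otherwise.}\end{cases}$$
   Context: $\mathbb{N}$ denotes the non-negative integers. $\overline{\mathbf{Fin}}$ is the category of finite non-empty sets and all maps. For an essentially small category $\mathcal{C}$, $\mathcal{F}(\mathcal{C};k)$ is the abelian category of functors from $\mathcal{C}$ to $k$-modules, with the pointwise tensor product $\otimes$ over $k$, whose unit is the constant functor with value $k$. The functor $\overline{k[-]}\in\mathcal{F}(\overline{\mathbf{Fin}};k)$ sends a finite non-empty set $X$ to the kernel of the augmentation $k[X]\to k$, $[x]\mapsto 1$, where $k[X]$ is the free $k$-module on $X$; $\overline{k[-]}^{\otimes 0}$ is the constant functor $\overline{k}$ with value $k$. The function $\mathrm{Rk}:\mathbb{N}\times\mathbb{N}\to\mathbb{N}$ is the function determined by: - $\mathrm{Rk}(0,0)=1$ and $\mathrm{Rk}(b,0)=0$ for $b>0$; - $\mathrm{Rk}(b,a)=0$ for $b<a$; - $\mathrm{Rk}(a,a)=a!$; - $\mathrm{Rk}(b,1)=0$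 for $b>1$; - $\mathrm{Rk}(a+1,a)=(a-2)\frac{(a+1)!}{2}+1$ for $a>1$; - $\mathrm{Rk}(b,a)=a\,\mathrm{Rk}(b-1,a-1)+(a-1)\,\mathrm{Rk}(b-1,a)$ for $b-1>a>1$. *)

theory Defs
  imports "HOL-Algebra.Module" "HOL-Algebra.AbelCoset"
begin

section \<open>Modules over a commutative ring\<close>

text \<open>
  The fields \<open>mult\<close> and \<open>one\<close> of a module record carry no information, and are left undefined.
  Linear maps are extensional on the carrier of their domain.
\<close>

definition mod_hom ::
    "('k, 'r) ring_scheme \<Rightarrow> ('k, 'm, 'x) module_scheme \<Rightarrow> ('k, 'n, 'y) module_scheme \<Rightarrow> ('m \<Rightarrow> 'n) set"
  where "mod_hom R M N = {f \<in> carrier M \<rightarrow>\<^sub>E carrier N.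
     (\<forall>x\<in>carrier M. \<forall>y\<in>carrier M. f (x \<oplus>\<^bsub>M\<^esub> y) = f x \<oplus>\<^bsub>N\<^esub> f y) \<and>
     (\<forall>r\<in>carrier R. \<forall>x\<in>carrier M. f (r \<odot>\<^bsub>M\<^esub> x) = r \<odot>\<^bsub>N\<^esub> f x)}"

definition mod_iso ::
    "('k, 'r) ring_scheme \<Rightarrow> ('k, 'm, 'x) module_scheme \<Rightarrow> ('k, 'n, 'y) module_scheme \<Rightarrow> bool"
  where "mod_iso R M N \<longleftrightarrow> (\<exists>f\<in>mod_hom R M N. bij_betw f (carrier M) (carrier N))"

definition ring_mod :: "('k, 'r) ring_scheme \<Rightarrow> ('k, 'k) module"
  where "ring_mod R = \<lparr>carrier = carrier R, mult = undefined, one = undefined,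
     zero = \<zero>\<^bsub>R\<^esub>, add = (\<oplus>\<^bsub>R\<^esub>), smult = (\<otimes>\<^bsub>R\<^esub>)\<rparr>"

definition zero_mod :: "('k, 'r) ring_scheme \<Rightarrow> ('k, 'k) module"
  where "zero_mod R = (ring_mod R)\<lparr>carrier := {\<zero>\<^bsub>R\<^esub>}\<rparr>"

definition quot_mod :: "('k, 'm, 'x) module_scheme \<Rightarrow> 'm set \<Rightarrow> ('k, 'm set) module"
  where "quot_mod M N = \<lparr>carrier = a_rcosets\<^bsub>M\<^esub> N, mult = undefined, one = undefined,
     zero = N, add = (\<lambda>C D. C <+>\<^bsub>M\<^esub> D), smult = (\<lambda>r C. N <+>\<^bsub>M\<^esub> ((\<lambda>x. r \<odot>\<^bsub>M\<^esub> x) ` C))\<rparr>"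

definition submod_span :: "('k, 'r) ring_scheme \<Rightarrow> ('k, 'm) module \<Rightarrow> 'm set \<Rightarrow> 'm set"
  where "submod_span R M A = \<Inter>{H. submodule H R M \<and> A \<subseteq> H}"

subsection \<open>Free modules\<close>

definition supp :: "('k, 'r) ring_scheme \<Rightarrow> 's set \<Rightarrow> ('s \<Rightarrow> 'k) \<Rightarrow> 's set"
  where "supp R S v = {s \<in> S. v s \<noteq> \<zero>\<^bsub>R\<^esub>}"

definition free_mod :: "('k, 'r) ring_scheme \<Rightarrow> 's set \<Rightarrow> ('k, 's \<Rightarrow> 'k) module"
  where "free_mod R S = \<lparr>carrier = {v \<in> S \<rightarrow>\<^sub>E carrier R. finite (supp R S v)},
     mult = undefined, one = undefined,
     zero = (\<lambda>s\<in>S. \<zero>\<^bsub>R\<^esub>), add = (\<lambda>u v. \<lambda>s\<in>S. u s \<oplus>\<^bsub>R\<^esub> v s),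
     smult = (\<lambda>r v. \<lambda>s\<in>S. r \<otimes>\<^bsub>R\<^esub> v s)\<rparr>"

definition free_gen :: "('k, 'r) ring_scheme \<Rightarrow> 's set \<Rightarrow> 's \<Rightarrow> 's \<Rightarrow> 'k"
  where "free_gen R S s = (\<lambda>t\<in>S. if t = s then \<one>\<^bsub>R\<^esub> else \<zero>\<^bsub>R\<^esub>)"

text \<open>The linear extension to \<open>free_mod R S\<close> of a map \<open>\<phi>\<close> from \<open>S\<close> to a module.\<close>

definition free_lift ::
    "('k, 'r) ring_scheme \<Rightarrow> 's set \<Rightarrow> ('k, 'm) module \<Rightarrow> ('s \<Rightarrow> 'm) \<Rightarrow> ('s \<Rightarrow> 'k) \<Rightarrow> 'm"
  where "free_lift R S M \<phi> =
     (\<lambda>v\<in>carrier (free_mod R S). \<Oplus>\<^bsub>M\<^esub>s\<in>supp R S v. v s \<odot>\<^bsub>M\<^esub> \<phi> s)"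

definition free_map ::
    "('k, 'r) ring_scheme \<Rightarrow> 's set \<Rightarrow> 't set \<Rightarrow> ('s \<Rightarrow> 't) \<Rightarrow> ('s \<Rightarrow> 'k) \<Rightarrow> 't \<Rightarrow> 'k"
  where "free_map R S T h = free_lift R S (free_mod R T) (\<lambda>s. free_gen R T (h s))"

subsection \<open>Tensor powers\<close>

text \<open>
  The \<open>a\<close>-fold tensor power of \<open>M\<close> is the free module on \<open>a\<close>-tuples of elements of \<open>M\<close> modulo the
  relations of multilinearity. For \<open>a = 0\<close> there is exactly one tuple and there are no relations,
  so that one gets the free module of rank one.
\<close>

definition tuples :: "('k, 'm) module \<Rightarrow> nat \<Rightarrow> (nat \<Rightarrow> 'm) set"
  where "tuples M a = {..<a} \<rightarrow>\<^sub>E carrier M"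

definition multilin_rels ::
    "('k, 'r) ring_scheme \<Rightarrow> ('k, 'm) module \<Rightarrow> nat \<Rightarrow> ((nat \<Rightarrow> 'm) \<Rightarrow> 'k) set"
  where "multilin_rels R M a = (let F = free_mod R (tuples M a); e = free_gen R (tuples M a) in
     {e (x(i := u \<oplus>\<^bsub>M\<^esub> v)) \<ominus>\<^bsub>F\<^esub> (e (x(i := u)) \<oplus>\<^bsub>F\<^esub> e (x(i := v))) | x i u v.
        x \<in> tuples M a \<and> i < a \<and> u \<in> carrier M \<and> v \<in> carrier M} \<union>
     {e (x(i := r \<odot>\<^bsub>M\<^esub> u)) \<ominus>\<^bsub>F\<^esub> (r \<odot>\<^bsub>F\<^esub> e (x(i := u))) | x i r u.
        x \<in> tuples M a \<and> i < a \<and> r \<in> carrier R \<and> u \<in> carrier M})"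

definition multilin_span ::
    "('k, 'r) ring_scheme \<Rightarrow> ('k, 'm) module \<Rightarrow> nat \<Rightarrow> ((nat \<Rightarrow> 'm) \<Rightarrow> 'k) set"
  where "multilin_span R M a = submod_span R (free_mod R (tuples M a)) (multilin_rels R M a)"

definition tensor_pow ::
    "('k, 'r) ring_scheme \<Rightarrow> ('k, 'm) module \<Rightarrow> nat \<Rightarrow> ('k, ((nat \<Rightarrow> 'm) \<Rightarrow> 'k) set) module"
  where "tensor_pow R M a = quot_mod (free_mod R (tuples M a)) (multilin_span R M a)"

definition tuple_map :: "nat \<Rightarrow> ('m \<Rightarrow> 'n) \<Rightarrow> (nat \<Rightarrow> 'm) \<Rightarrow> (nat \<Rightarrow> 'n)"
  where "tuple_map a f = (\<lambda>x. \<lambda>i\<in>{..<a}. f (x i))"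

text \<open>The map induced by a linear map \<open>f\<close>: the coset of \<open>[x]\<close> goes to the coset of \<open>[f \<circ> x]\<close>.\<close>

definition tensor_pow_map ::
    "('k, 'r) ring_scheme \<Rightarrow> ('k, 'm) module \<Rightarrow> ('k, 'n) module \<Rightarrow> nat \<Rightarrow> ('m \<Rightarrow> 'n)
      \<Rightarrow> ((nat \<Rightarrow> 'm) \<Rightarrow> 'k) set \<Rightarrow> ((nat \<Rightarrow> 'n) \<Rightarrow> 'k) set"
  where "tensor_pow_map R M N a f = (\<lambda>C\<in>carrier (tensor_pow R M a).
     multilin_span R N a <+>\<^bsub>free_mod R (tuples N a)\<^esub>
       (free_map R (tuples M a) (tuples N a) (tuple_map a f) ` C))"

section \<open>Functors from finite non-empty sets to modules\<close>

text \<open>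
  The category of finite non-empty sets is replaced by the equivalent small full subcategory on the
  finite non-empty sets of natural numbers. Maps are extensional.
\<close>

definition fin_obj :: "nat set set"
  where "fin_obj = {X. finite X \<and> X \<noteq> {}}"

definition fin_hom :: "nat set \<Rightarrow> nat set \<Rightarrow> (nat \<Rightarrow> nat) set"
  where "fin_hom X Y = X \<rightarrow>\<^sub>E Y"

record ('k, 'm) fin_functor =
  fobj :: "nat set \<Rightarrow> ('k, 'm) module"
  fmor :: "nat set \<Rightarrow> nat set \<Rightarrow> (nat \<Rightarrow> nat) \<Rightarrow> 'm \<Rightarrow> 'm"

definition is_functor :: "('k, 'r) ring_scheme \<Rightarrow> ('k, 'm) fin_functor \<Rightarrow> bool"
  where "is_functor R F \<longleftrightarrow>
     (\<forall>X\<in>fin_obj. module R (fobj F X)) \<and>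
     (\<forall>X\<in>fin_obj. \<forall>Y\<in>fin_obj. \<forall>f\<in>fin_hom X Y. fmor F X Y f \<in> mod_hom R (fobj F X) (fobj F Y)) \<and>
     (\<forall>X\<in>fin_obj. fmor F X X (\<lambda>x\<in>X. x) = (\<lambda>m\<in>carrier (fobj F X). m)) \<and>
     (\<forall>X\<in>fin_obj. \<forall>Y\<in>fin_obj. \<forall>Z\<in>fin_obj. \<forall>f\<in>fin_hom X Y. \<forall>g\<in>fin_hom Y Z.
        fmor F X Z (compose X g f) = compose (carrier (fobj F X)) (fmor F Y Z g) (fmor F X Y f))"

definition nat_trans ::
    "('k, 'r) ring_scheme \<Rightarrow> ('k, 'm) fin_functor \<Rightarrow> ('k, 'n) fin_functor \<Rightarrow> (nat set \<Rightarrow> 'm \<Rightarrow> 'n) set"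
  where "nat_trans R F G = {\<eta> \<in> \<Pi>\<^sub>E X\<in>fin_obj. mod_hom R (fobj F X) (fobj G X).
     \<forall>X\<in>fin_obj. \<forall>Y\<in>fin_obj. \<forall>f\<in>fin_hom X Y. \<forall>m\<in>carrier (fobj F X).
       \<eta> Y (fmor F X Y f m) = fmor G X Y f (\<eta> X m)}"

text \<open>The module of morphisms in the functor category.\<close>

definition Hom_mod ::
    "('k, 'r) ring_scheme \<Rightarrow> ('k, 'm) fin_functor \<Rightarrow> ('k, 'n) fin_functor \<Rightarrow> ('k, nat set \<Rightarrow> 'm \<Rightarrow> 'n) module"
  where "Hom_mod R F G = \<lparr>carrier = nat_trans R F G, mult = undefined, one = undefined,
     zero = (\<lambda>X\<in>fin_obj. \<lambda>m\<in>carrier (fobj F X). \<zero>\<^bsub>fobj G X\<^esub>),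
     add = (\<lambda>\<eta> \<theta>. \<lambda>X\<in>fin_obj. \<lambda>m\<in>carrier (fobj F X). \<eta> X m \<oplus>\<^bsub>fobj G X\<^esub> \<theta> X m),
     smult = (\<lambda>r \<eta>. \<lambda>X\<in>fin_obj. \<lambda>m\<in>carrier (fobj F X). r \<odot>\<^bsub>fobj G X\<^esub> \<eta> X m)\<rparr>"

definition nt_comp ::
    "('k, 'm) fin_functor \<Rightarrow> (nat set \<Rightarrow> 'n \<Rightarrow> 'p) \<Rightarrow> (nat set \<Rightarrow> 'm \<Rightarrow> 'n) \<Rightarrow> (nat set \<Rightarrow> 'm \<Rightarrow> 'p)"
  where "nt_comp F \<theta> \<eta> = (\<lambda>X\<in>fin_obj. compose (carrier (fobj F X)) (\<theta> X) (\<eta> X))"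

definition ker_functor ::
    "('k, 'm) fin_functor \<Rightarrow> ('k, 'n) fin_functor \<Rightarrow> (nat set \<Rightarrow> 'm \<Rightarrow> 'n) \<Rightarrow> ('k, 'm) fin_functor"
  where "ker_functor F G \<eta> = (let K = (\<lambda>X. {m \<in> carrier (fobj F X). \<eta> X m = \<zero>\<^bsub>fobj G X\<^esub>}) in
     \<lparr>fobj = (\<lambda>X. (fobj F X)\<lparr>carrier := K X\<rparr>), fmor = (\<lambda>X Y f. restrict (fmor F X Y f) (K X))\<rparr>)"

subsection \<open>The functors of the statement\<close>

definition const_functor :: "('k, 'm) module \<Rightarrow> ('k, 'm) fin_functor"
  where "const_functor M = \<lparr>fobj = (\<lambda>X. M), fmor = (\<lambda>X Y f. \<lambda>m\<in>carrier M. m)\<rparr>"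

definition lin_functor :: "('k, 'r) ring_scheme \<Rightarrow> ('k, nat \<Rightarrow> 'k) fin_functor"
  where "lin_functor R = \<lparr>fobj = (\<lambda>X. free_mod R X), fmor = (\<lambda>X Y f. free_map R X Y f)\<rparr>"

definition augmentation :: "('k, 'r) ring_scheme \<Rightarrow> nat set \<Rightarrow> (nat \<Rightarrow> 'k) \<Rightarrow> 'k"
  where "augmentation R = (\<lambda>X\<in>fin_obj. free_lift R X (ring_mod R) (\<lambda>x. \<one>\<^bsub>R\<^esub>))"

definition red_functor :: "('k, 'r) ring_scheme \<Rightarrow> ('k, nat \<Rightarrow> 'k) fin_functor"
  where "red_functor R = ker_functor (lin_functor R) (const_functor (ring_mod R)) (augmentation R)"

definition tensor_functor ::
    "('k, 'r) ring_scheme \<Rightarrow> ('k, 'm) fin_functor \<Rightarrow> nat \<Rightarrow> ('k, ((nat \<Rightarrow> 'm) \<Rightarrow> 'k) set) fin_functor"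
  where "tensor_functor R F a = \<lparr>fobj = (\<lambda>X. tensor_pow R (fobj F X) a),
     fmor = (\<lambda>X Y f. tensor_pow_map R (fobj F X) (fobj F Y) a (fmor F X Y f))\<rparr>"

subsection \<open>First extension groups\<close>

text \<open>
  \<open>cover R F\<close> is the direct sum, over all objects \<open>X\<close> and all \<open>x\<close> in \<open>F X\<close>, of the representable
  projective functors \<open>k[Hom(X, -)]\<close>. The component of \<open>cover_map R F\<close> at \<open>(X, x)\<close> corresponds to \<open>x\<close>
  under the Yoneda lemma.
\<close>

definition cover_gens ::
    "('k, 'm) fin_functor \<Rightarrow> nat set \<Rightarrow> (nat set \<times> 'm \<times> (nat \<Rightarrow> nat)) set"
  where "cover_gens F Y = {(X, x, f). X \<in> fin_obj \<and> x \<in> carrier (fobj F X) \<and> f \<in> fin_hom X Y}"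

definition cover ::
    "('k, 'r) ring_scheme \<Rightarrow> ('k, 'm) fin_functor
      \<Rightarrow> ('k, nat set \<times> 'm \<times> (nat \<Rightarrow> nat) \<Rightarrow> 'k) fin_functor"
  where "cover R F = \<lparr>fobj = (\<lambda>Y. free_mod R (cover_gens F Y)),
     fmor = (\<lambda>Y Z g. free_map R (cover_gens F Y) (cover_gens F Z)
               (\<lambda>(X, x, f). (X, x, compose X g f)))\<rparr>"

definition cover_map ::
    "('k, 'r) ring_scheme \<Rightarrow> ('k, 'm) fin_functor
      \<Rightarrow> nat set \<Rightarrow> (nat set \<times> 'm \<times> (nat \<Rightarrow> nat) \<Rightarrow> 'k) \<Rightarrow> 'm"
  where "cover_map R F = (\<lambda>Y\<in>fin_obj. free_lift R (cover_gens F Y) (fobj F Y)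
     (\<lambda>(X, x, f). fmor F X Y f x))"

text \<open>
  The beginning \<open>P2 \<rightarrow> P1 \<rightarrow> P0 \<rightarrow> F\<close> of a projective resolution of \<open>F\<close>: each term covers the kernel
  of the preceding map. The kernels are subfunctors, so that their covering maps are also the
  differentials.
\<close>

definition syz1 where "syz1 R F = ker_functor (cover R F) F (cover_map R F)"
definition syz2 where "syz2 R F = syz1 R (syz1 R F)"

definition res0 where "res0 R F = cover R F"
definition res1 where "res1 R F = cover R (syz1 R F)"
definition res2 where "res2 R F = cover R (syz2 R F)"
definition diff1 where "diff1 R F = cover_map R (syz1 R F)"
definition diff2 where "diff2 R F = cover_map R (syz2 R F)"

text \<open>The first cohomology of \<open>Hom(P0, G) \<rightarrow> Hom(P1, G) \<rightarrow> Hom(P2, G)\<close>.\<close>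

definition ext1_cocycles ::
  "('k, 'r) ring_scheme \<Rightarrow> ('k, 'm) fin_functor \<Rightarrow> ('k, 'n) fin_functor \<Rightarrow> _ set"
  where "ext1_cocycles R F G =
     {\<phi> \<in> nat_trans R (res1 R F) G. nt_comp (res2 R F) \<phi> (diff2 R F) = \<zero>\<^bsub>Hom_mod R (res2 R F) G\<^esub>}"

definition ext1_coboundaries ::
  "('k, 'r) ring_scheme \<Rightarrow> ('k, 'm) fin_functor \<Rightarrow> ('k, 'n) fin_functor \<Rightarrow> _ set"
  where "ext1_coboundaries R F G =
     (\<lambda>\<psi>. nt_comp (res1 R F) \<psi> (diff1 R F)) ` nat_trans R (res0 R F) G"

definition Ext1_mod ::
  "('k, 'r) ring_scheme \<Rightarrow> ('k, 'm) fin_functor \<Rightarrow> ('k, 'n) fin_functor \<Rightarrow> ('k, _) module"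
  where "Ext1_mod R F G =
     quot_mod ((Hom_mod R (res1 R F) G)\<lparr>carrier := ext1_cocycles R F G\<rparr>) (ext1_coboundaries R F G)"

section \<open>The ranks\<close>

function Rk :: "nat \<Rightarrow> nat \<Rightarrow> nat" where
  "Rk b a =
    (if b < a then 0
     else if b = a then fact a
     else if a \<le> 1 then 0
     else if b = a + 1 then (a - 2) * (fact (a + 1) div 2) + 1
     else a * Rk (b - 1) (a - 1) + (a - 1) * Rk (b - 1) a)"
  by pat_completeness auto
termination by (relation "measure fst") auto

declare Rk.simps [simp del]

lemma Rk_equations:
  shows "Rk 0 0 = 1"
    and "b > 0 \<Longrightarrow> Rk b 0 = 0"
    and "b < a \<Longrightarrow> Rk b a = 0"
    and "Rk a a = fact a"
    and "b > 1 \<Longrightarrow> Rk b 1 = 0"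
    and "a > 1 \<Longrightarrow> Rk (a + 1) a = (a - 2) * (fact (a + 1) div 2) + 1"
    and "b - 1 > a \<Longrightarrow> a > 1 \<Longrightarrow> Rk b a = a * Rk (b - 1) (a - 1) + (a - 1) * Rk (b - 1) a"
  by (auto simp add: Rk.simps[of 0 0] Rk.simps[of b 0] Rk.simps[of b a] Rk.simps[of a a]
    Rk.simps[of b "Suc 0"] Rk.simps[of "Suc a" a] simp del: fact_Suc)

lemma even_fact_Suc: "a > 1 \<Longrightarrow> even (fact (a + 1) :: nat)"
  by (rule dvd_fact) simp_all

section \<open>Well-definedness\<close>

text \<open>
  The constructions above yield functors and modules (in particular \<open>Hom_mod\<close> and \<open>Ext1_mod\<close>, see
  \<open>Hom_module\<close> and \<open>Ext1_module\<close>), and the complex used for the extension group is the beginning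
  of a projective resolution (\<open>cover_map_surj\<close>, \<open>exact0\<close>, \<open>exact1\<close>, \<open>cover_projective\<close>).
\<close>

subsection \<open>Free modules\<close>

lemma free_simps:
  "carrier (free_mod R S) = {v \<in> S \<rightarrow>\<^sub>E carrier R. finite (supp R S v)}"
  "zero (free_mod R S) = (\<lambda>s\<in>S. \<zero>\<^bsub>R\<^esub>)"
  "add (free_mod R S) u v = (\<lambda>s\<in>S. u s \<oplus>\<^bsub>R\<^esub> v s)"
  "smult (free_mod R S) r v = (\<lambda>s\<in>S. r \<otimes>\<^bsub>R\<^esub> v s)"
  by (auto simp: free_mod_def)

lemma supp_add: assumes "cring R" "u \<in> carrier (free_mod R S)" "v \<in> carrier (free_mod R S)"
  shows "supp R S (\<lambda>s\<in>S. u s \<oplus>\<^bsub>R\<^esub> v s) \<subseteq> supp R S u \<union> supp R S v"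
proof -
  interpret cring R by fact
  show ?thesis by (auto simp: supp_def)
qed

lemma supp_smult: assumes "cring R" "r \<in> carrier R"
  shows "supp R S (\<lambda>s\<in>S. r \<otimes>\<^bsub>R\<^esub> v s) \<subseteq> supp R S v"
proof -
  interpret cring R by fact
  show ?thesis using assms by (auto simp: supp_def)
qed

lemma free_add_closed: assumes "cring R" "u \<in> carrier (free_mod R S)" "v \<in> carrier (free_mod R S)"
  shows "(\<lambda>s\<in>S. u s \<oplus>\<^bsub>R\<^esub> v s) \<in> carrier (free_mod R S)"
proof -
  interpret cring R by fact
  show ?thesis using assms finite_subset[OF supp_add[OF assms]] by (auto simp: free_simps)
qed

lemma free_smult_closed: assumes "cring R" "r \<in> carrier R" "v \<in> carrier (free_mod R S)"
  shows "(\<lambda>s\<in>S. r \<otimes>\<^bsub>R\<^esub> v s) \<in> carrier (free_mod R S)"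
proof -
  interpret cring R by fact
  show ?thesis using assms finite_subset[OF supp_smult[OF assms(1,2)]] by (auto simp: free_simps)
qed

lemma free_zero_closed: assumes "cring R"
  shows "(\<lambda>s\<in>S. \<zero>\<^bsub>R\<^esub>) \<in> carrier (free_mod R S)"
proof -
  interpret cring R by fact
  have "supp R S (\<lambda>s\<in>S. \<zero>\<^bsub>R\<^esub>) = {}" by (auto simp: supp_def)
  thus ?thesis by (auto simp: free_simps)
qed

lemma free_app: "v \<in> carrier (free_mod R S) \<Longrightarrow> s \<in> S \<Longrightarrow> v s \<in> carrier R"
  by (auto simp: free_simps)

lemma free_eqI: "u \<in> carrier (free_mod R S) \<Longrightarrow> v \<in> carrier (free_mod R S) \<Longrightarrow> (\<And>s. s \<in> S \<Longrightarrow> u s = v s) \<Longrightarrow> u = v"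
  by (auto simp: free_simps intro: PiE_ext)

lemma free_module: assumes "cring R" shows "module R (free_mod R S)"
proof -
  interpret cring R by fact
  note cl = free_add_closed[OF assms] free_smult_closed[OF assms] free_zero_closed[OF assms]
  show ?thesis
  proof (rule moduleI)
    show "abelian_group (free_mod R S)"
    proof (rule abelian_groupI, goal_cases)
      case (1 x y) thus ?case using cl by (simp add: free_simps(3))
    next case 2 thus ?case using cl by (simp add: free_simps(2))
    next case (3 x y z) thus ?case
        by (auto simp: free_simps(3) free_app a_assoc intro!: restrict_ext)
    next case (4 x y) thus ?case by (auto simp: free_simps(3) free_app a_comm intro!: restrict_ext)
    next case (5 x)
      show ?case by (rule free_eqI[of _ R S])
        (use 5 cl(1)[OF cl(3) 5] in \<open>auto simp: free_simps(2,3) free_app cong: restrict_cong\<close>)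
    next case (6 x)
      have "(\<lambda>s\<in>S. (\<ominus>\<^bsub>R\<^esub> \<one>\<^bsub>R\<^esub>) \<otimes>\<^bsub>R\<^esub> x s) \<in> carrier (free_mod R S)"
        by (rule cl(2)) (use 6 in auto)
      moreover have "(\<lambda>s\<in>S. (\<ominus>\<^bsub>R\<^esub> \<one>\<^bsub>R\<^esub>) \<otimes>\<^bsub>R\<^esub> x s) \<oplus>\<^bsub>free_mod R S\<^esub> x = \<zero>\<^bsub>free_mod R S\<^esub>"
        using 6 by (auto simp: free_simps(2,3) free_app l_minus l_neg intro!: restrict_ext)
      ultimately show ?case by blast
    qed
  next
    fix x assume x: "x \<in> carrier (free_mod R S)"
    show "\<one>\<^bsub>R\<^esub> \<odot>\<^bsub>free_mod R S\<^esub> x = x"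
      by (rule free_eqI[of _ R S]) (use x cl(2)[OF one_closed x] in \<open>auto simp: free_simps(4) free_app cong: restrict_cong\<close>)
  qed (use cl in \<open>auto simp: free_simps(3,4) free_app l_distr r_distr m_assoc assms intro!: restrict_ext\<close>)
qed

lemma finsum_supp:
  assumes "module R M" "v \<in> carrier (free_mod R S)" "\<phi> \<in> S \<rightarrow> carrier M"
    and "finite A" "supp R S v \<subseteq> A" "A \<subseteq> S"
  shows "(\<Oplus>\<^bsub>M\<^esub>s\<in>supp R S v. v s \<odot>\<^bsub>M\<^esub> \<phi> s) = (\<Oplus>\<^bsub>M\<^esub>s\<in>A. v s \<odot>\<^bsub>M\<^esub> \<phi> s)"
proof -
  interpret module R M by fact
  have c: "i \<in> A \<Longrightarrow> v i \<in> carrier R \<and> \<phi> i \<in> carrier M" for i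
    using assms by (auto simp: free_app)
  show ?thesis unfolding finsum_def
    by (rule comm_monoid.finprod_mono_neutral_cong_left[OF M.a_comm_monoid])
     (use assms(4-6) c in \<open>auto simp: supp_def subset_iff\<close>)
qed

lemma mod_homI: "\<lbrakk>f \<in> carrier M \<rightarrow>\<^sub>E carrier N;
     \<And>x y. x\<in>carrier M \<Longrightarrow> y\<in>carrier M \<Longrightarrow> f (x \<oplus>\<^bsub>M\<^esub> y) = f x \<oplus>\<^bsub>N\<^esub> f y;
     \<And>r x. r\<in>carrier R \<Longrightarrow> x\<in>carrier M \<Longrightarrow> f (r \<odot>\<^bsub>M\<^esub> x) = r \<odot>\<^bsub>N\<^esub> f x\<rbrakk> \<Longrightarrow> f \<in> mod_hom R M N"
  by (auto simp: mod_hom_def)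

lemma mod_homD:
  assumes "f \<in> mod_hom R M N"
  shows "f \<in> carrier M \<rightarrow>\<^sub>E carrier N"
    "x\<in>carrier M \<Longrightarrow> f x \<in> carrier N"
    "x\<in>carrier M \<Longrightarrow> y\<in>carrier M \<Longrightarrow> f (x \<oplus>\<^bsub>M\<^esub> y) = f x \<oplus>\<^bsub>N\<^esub> f y"
    "r\<in>carrier R \<Longrightarrow> x\<in>carrier M \<Longrightarrow> f (r \<odot>\<^bsub>M\<^esub> x) = r \<odot>\<^bsub>N\<^esub> f x"
  using assms by (auto simp: mod_hom_def)

lemma mod_hom_zero: assumes "f \<in> mod_hom R M N" "module R M" "module R N"
  shows "f \<zero>\<^bsub>M\<^esub> = \<zero>\<^bsub>N\<^esub>"
proof -
  interpret M: module R M by fact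
  interpret N: module R N by fact
  have "f (\<zero>\<^bsub>R\<^esub> \<odot>\<^bsub>M\<^esub> \<zero>\<^bsub>M\<^esub>) = \<zero>\<^bsub>R\<^esub> \<odot>\<^bsub>N\<^esub> f \<zero>\<^bsub>M\<^esub>"
    using assms by (intro mod_homD(4)) auto
  thus ?thesis using mod_homD(2)[OF assms(1)] by auto
qed

lemma free_lift_hom:
  assumes "module R M" "\<phi> \<in> S \<rightarrow> carrier M"
  shows "free_lift R S M \<phi> \<in> mod_hom R (free_mod R S) M"
proof (rule mod_homI)
  interpret module R M by fact
  interpret F: module R "free_mod R S" using free_module R.is_cring by blast
  show "free_lift R S M \<phi> \<in> carrier (free_mod R S) \<rightarrow>\<^sub>E carrier M"
    using assms(2) by (auto simp: free_lift_def supp_def free_app intro!: M.finsum_closed)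
  fix x y assume xy: "x \<in> carrier (free_mod R S)" "y \<in> carrier (free_mod R S)"
  define A where "A = supp R S x \<union> supp R S y"
  have A: "finite A" "A \<subseteq> S" using xy by (auto simp: A_def free_simps supp_def)
  have xyc: "x \<oplus>\<^bsub>free_mod R S\<^esub> y \<in> carrier (free_mod R S)" using xy by simp
  have s: "supp R S (x \<oplus>\<^bsub>free_mod R S\<^esub> y) \<subseteq> A"
    using supp_add[OF R.is_cring xy] by (simp add: A_def free_simps)
  have p: "s \<in> A \<Longrightarrow> x s \<in> carrier R \<and> y s \<in> carrier R \<and> \<phi> s \<in> carrier M" for s
    using A xy assms(2) by (auto simp: free_app)
  have "free_lift R S M \<phi> (x \<oplus>\<^bsub>free_mod R S\<^esub> y) = (\<Oplus>\<^bsub>M\<^esub>s\<in>A. (x \<oplus>\<^bsub>free_mod R S\<^esub> y) s \<odot>\<^bsub>M\<^esub> \<phi> s)"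
    using finsum_supp[OF assms(1) xyc assms(2) A(1) s A(2)] xyc by (simp add: free_lift_def)
  also have "\<dots> = (\<Oplus>\<^bsub>M\<^esub>s\<in>A. x s \<odot>\<^bsub>M\<^esub> \<phi> s \<oplus>\<^bsub>M\<^esub> y s \<odot>\<^bsub>M\<^esub> \<phi> s)"
    by (rule M.finsum_cong') (use A p in \<open>auto simp: free_simps smult_l_distr subset_iff\<close>)
  also have "\<dots> = (\<Oplus>\<^bsub>M\<^esub>s\<in>A. x s \<odot>\<^bsub>M\<^esub> \<phi> s) \<oplus>\<^bsub>M\<^esub> (\<Oplus>\<^bsub>M\<^esub>s\<in>A. y s \<odot>\<^bsub>M\<^esub> \<phi> s)"
    by (rule M.finsum_addf) (use p in auto)
  also have "\<dots> = free_lift R S M \<phi> x \<oplus>\<^bsub>M\<^esub> free_lift R S M \<phi> y"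
    using finsum_supp[OF assms(1) xy(1) assms(2) A(1) _ A(2)] finsum_supp[OF assms(1) xy(2) assms(2) A(1) _ A(2)] xy
    by (simp add: free_lift_def A_def)
  finally show "free_lift R S M \<phi> (x \<oplus>\<^bsub>free_mod R S\<^esub> y) = free_lift R S M \<phi> x \<oplus>\<^bsub>M\<^esub> free_lift R S M \<phi> y" .
next
  interpret module R M by fact
  interpret F: module R "free_mod R S" using free_module R.is_cring by blast
  fix r x assume r: "r \<in> carrier R" and x: "x \<in> carrier (free_mod R S)"
  define A where "A = supp R S x"
  have A: "finite A" "A \<subseteq> S" using x by (auto simp: A_def free_simps supp_def)
  have xyc: "r \<odot>\<^bsub>free_mod R S\<^esub> x \<in> carrier (free_mod R S)" using x r by simp
  have s: "supp R S (r \<odot>\<^bsub>free_mod R S\<^esub> x) \<subseteq> A"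
    using supp_smult[OF R.is_cring r] by (simp add: A_def free_simps)
  have p: "s \<in> A \<Longrightarrow> x s \<in> carrier R \<and> \<phi> s \<in> carrier M" for s
    using A x assms(2) by (auto simp: free_app)
  have "free_lift R S M \<phi> (r \<odot>\<^bsub>free_mod R S\<^esub> x) = (\<Oplus>\<^bsub>M\<^esub>s\<in>A. (r \<odot>\<^bsub>free_mod R S\<^esub> x) s \<odot>\<^bsub>M\<^esub> \<phi> s)"
    using finsum_supp[OF assms(1) xyc assms(2) A(1) s A(2)] xyc by (simp add: free_lift_def)
  also have "\<dots> = (\<Oplus>\<^bsub>M\<^esub>s\<in>A. r \<odot>\<^bsub>M\<^esub> (x s \<odot>\<^bsub>M\<^esub> \<phi> s))"
    by (rule M.finsum_cong') (use A p r in \<open>auto simp: free_simps smult_assoc1 subset_iff\<close>)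
  also have "\<dots> = r \<odot>\<^bsub>M\<^esub> (\<Oplus>\<^bsub>M\<^esub>s\<in>A. x s \<odot>\<^bsub>M\<^esub> \<phi> s)"
    by (rule finsum_smult_ldistr[symmetric]) (use p r A in auto)
  finally show "free_lift R S M \<phi> (r \<odot>\<^bsub>free_mod R S\<^esub> x) = r \<odot>\<^bsub>M\<^esub> free_lift R S M \<phi> x"
    using x by (simp add: free_lift_def A_def)
qed

lemma free_gen_closed: assumes "cring R" "s \<in> S" shows "free_gen R S s \<in> carrier (free_mod R S)"
proof -
  interpret cring R by fact
  have "supp R S (free_gen R S s) \<subseteq> {s}" by (auto simp: supp_def free_gen_def)
  thus ?thesis by (auto simp: free_simps free_gen_def intro: finite_subset)
qed

lemma free_lift_gen:
  assumes "module R M" "\<phi> \<in> S \<rightarrow> carrier M" "s \<in> S"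
  shows "free_lift R S M \<phi> (free_gen R S s) = \<phi> s"
proof -
  interpret module R M by fact
  have c: "free_gen R S s \<in> carrier (free_mod R S)" by (rule free_gen_closed) (use assms R.is_cring in auto)
  have "supp R S (free_gen R S s) \<subseteq> {s}" by (auto simp: supp_def free_gen_def)
  hence "free_lift R S M \<phi> (free_gen R S s) = (\<Oplus>\<^bsub>M\<^esub>t\<in>{s}. free_gen R S s t \<odot>\<^bsub>M\<^esub> \<phi> t)"
    using finsum_supp[OF assms(1) c assms(2), of "{s}"] c assms by (simp add: free_lift_def)
  also have "\<dots> = \<phi> s" using assms by (auto simp: free_gen_def Pi_iff)
  finally show ?thesis .
qed

lemma free_induct:
  assumes "cring R" "v \<in> carrier (free_mod R S)"
    and "P \<zero>\<^bsub>free_mod R S\<^esub>"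
    and step: "\<And>r s w. r \<in> carrier R \<Longrightarrow> s \<in> S \<Longrightarrow> w \<in> carrier (free_mod R S) \<Longrightarrow> P w \<Longrightarrow>
        P (r \<odot>\<^bsub>free_mod R S\<^esub> free_gen R S s \<oplus>\<^bsub>free_mod R S\<^esub> w)"
  shows "P v"
proof -
  interpret cring R by fact
  have "finite A \<Longrightarrow> v \<in> carrier (free_mod R S) \<Longrightarrow> supp R S v = A \<Longrightarrow> P v" for A v
  proof (induction A arbitrary: v rule: finite_induct)
    case empty
    hence "v = \<zero>\<^bsub>free_mod R S\<^esub>"
      by (intro free_eqI[of _ R S]) (auto simp: free_zero_closed assms supp_def free_simps(2))
    thus ?case using assms by simp
  next
    case (insert s A)
    have s: "s \<in> S" using insert by (auto simp: supp_def)
    define w where "w = v(s := \<zero>\<^bsub>R\<^esub>)"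
    have sw: "supp R S w = A" using insert s by (auto simp: supp_def w_def)
    have w: "w \<in> carrier (free_mod R S)"
      using insert s sw by (auto simp: free_simps w_def PiE_iff extensional_def)
    have vs: "v s \<in> carrier R" using insert s by (auto simp: free_app)
    have eq: "v s \<odot>\<^bsub>free_mod R S\<^esub> free_gen R S s \<oplus>\<^bsub>free_mod R S\<^esub> w = v"
    proof (rule free_eqI[of _ R S])
      interpret F: module R "free_mod R S" by (rule free_module) fact
      show "v s \<odot>\<^bsub>free_mod R S\<^esub> free_gen R S s \<oplus>\<^bsub>free_mod R S\<^esub> w \<in> carrier (free_mod R S)"
        using vs s w free_gen_closed[OF assms(1) s] by blast
    qed (use insert vs s w in \<open>auto simp: free_simps(3,4) free_gen_def w_def free_app\<close>)
    show ?case using step[OF vs s w insert.IH[OF w sw]] eq by simp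
  qed
  thus ?thesis using assms(2) by (auto simp: free_simps)
qed

lemma free_hom_eqI:
  assumes "module R M" "f \<in> mod_hom R (free_mod R S) M" "g \<in> mod_hom R (free_mod R S) M"
    and "\<And>s. s \<in> S \<Longrightarrow> f (free_gen R S s) = g (free_gen R S s)"
  shows "f = g"
proof (rule PiE_ext)
  show "f \<in> carrier (free_mod R S) \<rightarrow>\<^sub>E carrier M" "g \<in> carrier (free_mod R S) \<rightarrow>\<^sub>E carrier M"
    using assms by (auto simp: mod_hom_def)
  interpret module R M by fact
  interpret F: module R "free_mod R S" by (rule free_module) (rule R.is_cring)
  fix v assume "v \<in> carrier (free_mod R S)"
  thus "f v = g v"
  proof (rule free_induct[OF R.is_cring, where P="\<lambda>v. f v = g v"], goal_cases)
    case 1 thus ?case using mod_hom_zero assms F.module_axioms by metis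
  next case (2 r s w)
    thus ?case using free_gen_closed[OF R.is_cring 2(2)] assms
      by (simp add: mod_homD[OF assms(2)] mod_homD[OF assms(3)])
  qed
qed

lemma mod_hom_compose:
  assumes "f \<in> mod_hom R M N" "g \<in> mod_hom R N P"  "module R M"
  shows "compose (carrier M) g f \<in> mod_hom R M P"
proof -
  interpret module R M by fact
  show ?thesis
    using assms by (auto intro!: mod_homI simp: compose_def mod_homD[OF assms(1)] mod_homD[OF assms(2)])
qed

lemma mod_hom_id: assumes "module R M" shows "(\<lambda>m\<in>carrier M. m) \<in> mod_hom R M M"
proof -
  interpret module R M by fact
  show ?thesis by (auto intro!: mod_homI)
qed

lemma free_map_hom: "cring R \<Longrightarrow> h \<in> S \<rightarrow> T \<Longrightarrow> free_map R S T h \<in> mod_hom R (free_mod R S) (free_mod R T)"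
  unfolding free_map_def by (rule free_lift_hom) (auto simp: free_module intro!: free_gen_closed)

lemma free_map_gen: "cring R \<Longrightarrow> h \<in> S \<rightarrow> T \<Longrightarrow> s \<in> S \<Longrightarrow> free_map R S T h (free_gen R S s) = free_gen R T (h s)"
  unfolding free_map_def by (rule free_lift_gen) (auto simp: free_module intro!: free_gen_closed)

lemma free_map_id:
  assumes "cring R" "\<And>s. s \<in> S \<Longrightarrow> h s = s"
  shows "free_map R S S h = (\<lambda>v\<in>carrier (free_mod R S). v)"
  by (rule free_hom_eqI[OF free_module free_map_hom mod_hom_id[OF free_module]])
    (use assms in \<open>auto simp: free_map_gen free_gen_closed\<close>)

lemma free_map_comp:
  assumes "cring R" "h \<in> S \<rightarrow> T" "h' \<in> T \<rightarrow> U" "\<And>s. s \<in> S \<Longrightarrow> h'' s = h' (h s)"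
  shows "free_map R S U h'' = compose (carrier (free_mod R S)) (free_map R T U h') (free_map R S T h)"
proof (rule free_hom_eqI[OF free_module free_map_hom mod_hom_compose[OF free_map_hom free_map_hom free_module]])
  show "h'' \<in> S \<rightarrow> U" using assms by (auto simp: Pi_iff)
  fix s assume "s \<in> S"
  thus "free_map R S U h'' (free_gen R S s) = compose (carrier (free_mod R S)) (free_map R T U h') (free_map R S T h) (free_gen R S s)"
    using \<open>h'' \<in> S \<rightarrow> U\<close> assms
    by (auto simp: free_map_gen free_gen_closed compose_def Pi_iff)
qed (use assms in auto)

subsection \<open>Functors and natural transformations\<close>

lemma fin_hom_id: "(\<lambda>x\<in>X. x) \<in> fin_hom X X" by (auto simp: fin_hom_def)
lemma fin_hom_compose: "f \<in> fin_hom X Y \<Longrightarrow> g \<in> fin_hom Y Z \<Longrightarrow> compose X g f \<in> fin_hom X Z"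
  by (auto simp: fin_hom_def compose_def)

lemma is_functorI:
  assumes "\<And>X. X \<in> fin_obj \<Longrightarrow> module R (fobj F X)"
   "\<And>X Y f. X \<in> fin_obj \<Longrightarrow> Y \<in> fin_obj \<Longrightarrow> f \<in> fin_hom X Y \<Longrightarrow> fmor F X Y f \<in> mod_hom R (fobj F X) (fobj F Y)"
   "\<And>X. X \<in> fin_obj \<Longrightarrow> fmor F X X (\<lambda>x\<in>X. x) = (\<lambda>m\<in>carrier (fobj F X). m)"
   "\<And>X Y Z f g. X \<in> fin_obj \<Longrightarrow> Y \<in> fin_obj \<Longrightarrow> Z \<in> fin_obj \<Longrightarrow> f \<in> fin_hom X Y \<Longrightarrow> g \<in> fin_hom Y Z \<Longrightarrow>
      fmor F X Z (compose X g f) = compose (carrier (fobj F X)) (fmor F Y Z g) (fmor F X Y f)"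
  shows "is_functor R F" using assms unfolding is_functor_def by blast

lemma is_functorD:
  assumes "is_functor R F"
  shows "\<And>X. X \<in> fin_obj \<Longrightarrow> module R (fobj F X)"
   "\<And>X Y f. X \<in> fin_obj \<Longrightarrow> Y \<in> fin_obj \<Longrightarrow> f \<in> fin_hom X Y \<Longrightarrow> fmor F X Y f \<in> mod_hom R (fobj F X) (fobj F Y)"
   "\<And>X. X \<in> fin_obj \<Longrightarrow> fmor F X X (\<lambda>x\<in>X. x) = (\<lambda>m\<in>carrier (fobj F X). m)"
   "\<And>X Y Z f g. X \<in> fin_obj \<Longrightarrow> Y \<in> fin_obj \<Longrightarrow> Z \<in> fin_obj \<Longrightarrow> f \<in> fin_hom X Y \<Longrightarrow> g \<in> fin_hom Y Z \<Longrightarrow>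
      fmor F X Z (compose X g f) = compose (carrier (fobj F X)) (fmor F Y Z g) (fmor F X Y f)"
  using assms unfolding is_functor_def by blast+

lemma cover_functor: assumes "cring R" shows "is_functor R (cover R F)"
proof (rule is_functorI)
  have m: "(\<lambda>(X, x, f). (X, x, compose X g f)) \<in> cover_gens F Y \<rightarrow> cover_gens F Z" if "g \<in> fin_hom Y Z" for Y Z g
    using that by (auto simp: cover_gens_def fin_hom_compose)
  show "module R (fobj (cover R F) X)" for X by (simp add: cover_def free_module assms)
  show "fmor (cover R F) X Y f \<in> mod_hom R (fobj (cover R F) X) (fobj (cover R F) Y)" if "f \<in> fin_hom X Y" for X Y f
    using free_map_hom[OF assms m[OF that]] by (simp add: cover_def)
  show "fmor (cover R F) X X (\<lambda>x\<in>X. x) = (\<lambda>m\<in>carrier (fobj (cover R F) X). m)" for X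
  proof -
    have "free_map R (cover_gens F X) (cover_gens F X) (\<lambda>(Z, x, f). (Z, x, compose Z (\<lambda>x\<in>X. x) f)) = (\<lambda>m\<in>carrier (free_mod R (cover_gens F X)). m)"
      by (rule free_map_id[OF assms]) (auto simp: cover_gens_def fin_hom_def Id_compose PiE_def)
    thus ?thesis by (simp add: cover_def)
  qed
  fix X Y Z f g assume fg: "f \<in> fin_hom X Y" "g \<in> fin_hom Y Z"
  have "free_map R (cover_gens F X) (cover_gens F Z) (\<lambda>(W, x, h). (W, x, compose W (compose X g f) h)) =
     compose (carrier (free_mod R (cover_gens F X))) (free_map R (cover_gens F Y) (cover_gens F Z) (\<lambda>(X, x, f). (X, x, compose X g f)))
      (free_map R (cover_gens F X) (cover_gens F Y) (\<lambda>(X, x, h). (X, x, compose X f h)))"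
    by (rule free_map_comp[OF assms m[OF fg(1)] m[OF fg(2)]])
      (use fg in \<open>auto simp: cover_gens_def fin_hom_def intro!: compose_assoc[symmetric]\<close>)
  thus "fmor (cover R F) X Z (compose X g f) = compose (carrier (fobj (cover R F) X)) (fmor (cover R F) Y Z g) (fmor (cover R F) X Y f)"
    by (simp add: cover_def)
qed

lemma lin_functor_functor: "cring R \<Longrightarrow> is_functor R (lin_functor R)"
  by (rule is_functorI)
    (auto simp: lin_functor_def free_module fin_hom_def compose_eq intro!: free_map_hom free_map_id free_map_comp)

lemma ring_mod_module: assumes "cring R" shows "module R (ring_mod R)"
proof -
  interpret cring R by fact
  show ?thesis
    by (rule moduleI, fact, rule abelian_groupI)
      (auto simp: ring_mod_def a_ac m_assoc l_distr r_distr intro: bexI[of _ "\<ominus>\<^bsub>R\<^esub> _"] l_neg)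
qed

lemma const_functor_functor: "module R M \<Longrightarrow> is_functor R (const_functor M)"
  by (rule is_functorI) (auto simp: const_functor_def mod_hom_id compose_def)

lemma nat_transI:
  assumes "\<And>X. X \<in> fin_obj \<Longrightarrow> \<eta> X \<in> mod_hom R (fobj F X) (fobj G X)" "\<eta> \<in> extensional fin_obj"
    "\<And>X Y f m. X\<in>fin_obj \<Longrightarrow> Y\<in>fin_obj \<Longrightarrow> f\<in>fin_hom X Y \<Longrightarrow> m\<in>carrier (fobj F X) \<Longrightarrow>
       \<eta> Y (fmor F X Y f m) = fmor G X Y f (\<eta> X m)"
  shows "\<eta> \<in> nat_trans R F G"
  using assms by (auto simp: nat_trans_def PiE_def)

lemma nat_transD:
  assumes "\<eta> \<in> nat_trans R F G"
  shows "X \<in> fin_obj \<Longrightarrow> \<eta> X \<in> mod_hom R (fobj F X) (fobj G X)" "\<eta> \<in> extensional fin_obj"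
    "X\<in>fin_obj \<Longrightarrow> Y\<in>fin_obj \<Longrightarrow> f\<in>fin_hom X Y \<Longrightarrow> m\<in>carrier (fobj F X) \<Longrightarrow>
       \<eta> Y (fmor F X Y f m) = fmor G X Y f (\<eta> X m)"
  using assms by (auto simp: nat_trans_def PiE_def)

lemma augmentation_nat: assumes "cring R"
  shows "augmentation R \<in> nat_trans R (lin_functor R) (const_functor (ring_mod R))"
proof (rule nat_transI)
  interpret cring R by fact
  note M = ring_mod_module[OF assms]
  have one: "(\<lambda>x. \<one>\<^bsub>R\<^esub>) \<in> X \<rightarrow> carrier (ring_mod R)" for X by (auto simp: ring_mod_def)
  show "augmentation R X \<in> mod_hom R (fobj (lin_functor R) X) (fobj (const_functor (ring_mod R)) X)" if "X \<in> fin_obj" for X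
    using that free_lift_hom[OF M one] by (auto simp: augmentation_def lin_functor_def const_functor_def)
  show "augmentation R \<in> extensional fin_obj" by (simp add: augmentation_def)
  fix X Y f m assume *: "X\<in>fin_obj" "Y\<in>fin_obj" "f\<in>fin_hom X Y" "m\<in>carrier (fobj (lin_functor R) X)"
  have f: "f \<in> X \<rightarrow> Y" using * by (auto simp: fin_hom_def)
  have "compose (carrier (free_mod R X)) (free_lift R Y (ring_mod R) (\<lambda>x. \<one>\<^bsub>R\<^esub>)) (free_map R X Y f) = free_lift R X (ring_mod R) (\<lambda>x. \<one>\<^bsub>R\<^esub>)"
    by (rule free_hom_eqI[OF M mod_hom_compose[OF free_map_hom free_lift_hom] free_lift_hom])
      (use f in \<open>auto simp: assms M one free_module free_map_gen free_lift_gen[OF M one] free_gen_closed compose_eq Pi_iff\<close>)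
  from fun_cong[OF this, of m] *
  show "augmentation R Y (fmor (lin_functor R) X Y f m) = fmor (const_functor (ring_mod R)) X Y f (augmentation R X m)"
    using mod_homD(2)[OF free_lift_hom[OF M one], of m X]
    by (simp add: augmentation_def lin_functor_def const_functor_def compose_eq)
qed

lemma ker_submodule:
  assumes "module R M" "module R N" "f \<in> mod_hom R M N"
  shows "submodule {m \<in> carrier M. f m = \<zero>\<^bsub>N\<^esub>} R M"
proof -
  interpret M: module R M by fact
  interpret N: module R N by fact
  show ?thesis
  proof (rule M.submoduleI)
    fix a assume "a \<in> {m \<in> carrier M. f m = \<zero>\<^bsub>N\<^esub>}"
    hence a: "a \<in> carrier M" "f a = \<zero>\<^bsub>N\<^esub>" by auto
    have "f (a \<oplus>\<^bsub>M\<^esub> \<ominus>\<^bsub>M\<^esub> a) = \<zero>\<^bsub>N\<^esub> \<oplus>\<^bsub>N\<^esub> f (\<ominus>\<^bsub>M\<^esub> a)"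
      using a mod_homD(3)[OF assms(3), of a "\<ominus>\<^bsub>M\<^esub> a"] by simp
    thus "\<ominus>\<^bsub>M\<^esub> a \<in> {m \<in> carrier M. f m = \<zero>\<^bsub>N\<^esub>}"
      using a mod_hom_zero[OF assms(3,1,2)] mod_homD(2)[OF assms(3), of "\<ominus>\<^bsub>M\<^esub> a"] by (simp add: M.r_neg)
  qed (use mod_hom_zero[OF assms(3,1,2)] in \<open>auto simp: mod_homD[OF assms(3)]\<close>)
qed

lemma ker_functor_functor:
  assumes F: "is_functor R F" and G: "is_functor R G" and "\<eta> \<in> nat_trans R F G"
  shows "is_functor R (ker_functor F G \<eta>)"
proof (rule is_functorI)
  note n = nat_transD[OF assms(3)]
  note FD = is_functorD[OF F] note GD = is_functorD[OF G]
  define K where "K = (\<lambda>X. {m \<in> carrier (fobj F X). \<eta> X m = \<zero>\<^bsub>fobj G X\<^esub>})"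
  have sub: "submodule (K X) R (fobj F X)" if "X \<in> fin_obj" for X
    unfolding K_def by (rule ker_submodule) (use that FD GD n in auto)
  have simps: "fobj (ker_functor F G \<eta>) X = (fobj F X)\<lparr>carrier := K X\<rparr>"
    "fmor (ker_functor F G \<eta>) X Y f = restrict (fmor F X Y f) (K X)" for X Y f
    by (auto simp: ker_functor_def K_def Let_def)
  show "module R (fobj (ker_functor F G \<eta>) X)" if "X \<in> fin_obj" for X
    using submodule.submodule_is_module[OF sub] that FD by (simp add: simps)
  have mem: "fmor F X Y f m \<in> K Y" if "X\<in>fin_obj" "Y\<in>fin_obj" "f\<in>fin_hom X Y" "m\<in>K X" for X Y f m
    using that n(3)[of X Y f m] mod_hom_zero[OF GD(2) GD(1) GD(1)] mod_homD(2)[OF FD(2)]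
    by (auto simp: K_def)
  have KF: "m \<in> K X \<Longrightarrow> m \<in> carrier (fobj F X)" for m X by (auto simp: K_def)
  show "fmor (ker_functor F G \<eta>) X Y f \<in> mod_hom R (fobj (ker_functor F G \<eta>) X) (fobj (ker_functor F G \<eta>) Y)"
    if h: "X\<in>fin_obj" "Y\<in>fin_obj" "f\<in>fin_hom X Y" for X Y f
  proof -
    interpret S: submodule "K X" R "fobj F X" using sub h by auto
    have cl: "x \<in> K X \<Longrightarrow> y \<in> K X \<Longrightarrow> x \<oplus>\<^bsub>fobj F X\<^esub> y \<in> K X" for x y using S.m_closed by simp
    show ?thesis
    by (rule mod_homI) (use h mem KF cl S.smult_closed mod_homD[OF FD(2)] in \<open>auto simp: simps\<close>)
  qed
  show "fmor (ker_functor F G \<eta>) X X (\<lambda>x\<in>X. x) = (\<lambda>m\<in>carrier (fobj (ker_functor F G \<eta>) X). m)" if "X\<in>fin_obj" for X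
    using FD(3) that by (auto simp: simps KF intro!: restrict_ext)
  fix X Y Z f g
  assume h: "X\<in>fin_obj" "Y\<in>fin_obj" "Z\<in>fin_obj" "f\<in>fin_hom X Y" "g \<in> fin_hom Y Z"
  show "fmor (ker_functor F G \<eta>) X Z (compose X g f) = compose (carrier (fobj (ker_functor F G \<eta>) X)) (fmor (ker_functor F G \<eta>) Y Z g) (fmor (ker_functor F G \<eta>) X Y f)"
    using FD(4)[OF h] mem[OF h(1,2,4)] by (auto simp: simps compose_def KF)
qed

lemma red_functor_functor: "cring R \<Longrightarrow> is_functor R (red_functor R)"
  unfolding red_functor_def
  by (intro ker_functor_functor lin_functor_functor const_functor_functor ring_mod_module augmentation_nat)

lemma cover_map_nat: assumes R: "cring R" and F: "is_functor R F"
  shows "cover_map R F \<in> nat_trans R (cover R F) F"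
proof (rule nat_transI)
  note FD = is_functorD[OF F]
  have p: "(\<lambda>(X, x, f). fmor F X Y f x) \<in> cover_gens F Y \<rightarrow> carrier (fobj F Y)" if "Y \<in> fin_obj" for Y
    using that mod_homD(2)[OF FD(2)] by (auto simp: cover_gens_def)
  show "cover_map R F X \<in> mod_hom R (fobj (cover R F) X) (fobj F X)" if "X \<in> fin_obj" for X
    using free_lift_hom[OF FD(1) p] that by (simp add: cover_map_def cover_def)
  show "cover_map R F \<in> extensional fin_obj" by (simp add: cover_map_def)
  fix X Y f m assume *: "X\<in>fin_obj" "Y\<in>fin_obj" "f\<in>fin_hom X Y" "m\<in>carrier (fobj (cover R F) X)"
  have m: "(\<lambda>(X, x, g). (X, x, compose X f g)) \<in> cover_gens F X \<rightarrow> cover_gens F Y"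
    using * by (auto simp: cover_gens_def fin_hom_compose)
  have "compose (carrier (free_mod R (cover_gens F X))) (free_lift R (cover_gens F Y) (fobj F Y) (\<lambda>(X, x, f). fmor F X Y f x)) (free_map R (cover_gens F X) (cover_gens F Y) (\<lambda>(X, x, g). (X, x, compose X f g)))
      = compose (carrier (free_mod R (cover_gens F X))) (fmor F X Y f) (free_lift R (cover_gens F X) (fobj F X) (\<lambda>(Z, x, f). fmor F Z X f x))"
  proof (rule free_hom_eqI[OF FD(1)[OF *(2)] mod_hom_compose[OF free_map_hom free_lift_hom] mod_hom_compose[OF free_lift_hom FD(2)]])
    fix s assume s: "s \<in> cover_gens F X"
    obtain Z x g where [simp]: "s = (Z, x, g)" by (cases s)
    have g: "Z \<in> fin_obj" "x \<in> carrier (fobj F Z)" "g \<in> fin_hom Z X" using s by (auto simp: cover_gens_def)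
    have s2: "(Z, x, compose Z f g) \<in> cover_gens F Y" using funcset_mem[OF m s] by simp
    show "compose (carrier (free_mod R (cover_gens F X))) (free_lift R (cover_gens F Y) (fobj F Y) (\<lambda>(X, x, f). fmor F X Y f x)) (free_map R (cover_gens F X) (cover_gens F Y) (\<lambda>(X, x, g). (X, x, compose X f g))) (free_gen R (cover_gens F X) s)
      = compose (carrier (free_mod R (cover_gens F X))) (fmor F X Y f) (free_lift R (cover_gens F X) (fobj F X) (\<lambda>(Z, x, f). fmor F Z X f x)) (free_gen R (cover_gens F X) s)"
      using free_lift_gen[OF FD(1)[OF *(2)] p[OF *(2)] s2] free_lift_gen[OF FD(1)[OF *(1)] p[OF *(1)] s] free_map_gen[OF R m s]
        FD(4)[OF g(1) *(1,2) g(3) *(3)] g free_gen_closed[OF R s]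
      by (simp add: compose_eq)
  qed (use R m p * FD in \<open>auto simp: free_module\<close>)
  from fun_cong[OF this, of m] *
  show "cover_map R F Y (fmor (cover R F) X Y f m) = fmor F X Y f (cover_map R F X m)"
    by (simp add: cover_map_def cover_def compose_eq)
qed

lemma cover_map_surj: assumes R: "cring R" and F: "is_functor R F" and Y: "Y \<in> fin_obj" "x \<in> carrier (fobj F Y)"
  shows "cover_map R F Y (free_gen R (cover_gens F Y) (Y, x, \<lambda>y\<in>Y. y)) = x"
    "free_gen R (cover_gens F Y) (Y, x, \<lambda>y\<in>Y. y) \<in> carrier (fobj (cover R F) Y)"
proof -
  note FD = is_functorD[OF F]
  have p: "(\<lambda>(X, x, f). fmor F X Y f x) \<in> cover_gens F Y \<rightarrow> carrier (fobj F Y)"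
    using Y mod_homD(2)[OF FD(2)] by (auto simp: cover_gens_def)
  have "(Y, x, \<lambda>y\<in>Y. y) \<in> cover_gens F Y" using Y fin_hom_id by (auto simp: cover_gens_def)
  thus "cover_map R F Y (free_gen R (cover_gens F Y) (Y, x, \<lambda>y\<in>Y. y)) = x"
    "free_gen R (cover_gens F Y) (Y, x, \<lambda>y\<in>Y. y) \<in> carrier (fobj (cover R F) Y)"
    using free_lift_gen[OF FD(1)[OF Y(1)] p] FD(3)[OF Y(1)] Y free_gen_closed[OF R]
    by (auto simp: cover_map_def cover_def)
qed

subsection \<open>Spans and quotients\<close>

lemma submod_span_submodule:
  assumes "module R M" "A \<subseteq> carrier M" shows "submodule (submod_span R M A) R M"
proof -
  interpret module R M by fact
  have c: "carrier M \<in> {H. submodule H R M \<and> A \<subseteq> H}" using assms carrier_is_submodule by auto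
  show ?thesis unfolding submod_span_def
  proof (rule submoduleI)
    show "\<Inter>{H. submodule H R M \<and> A \<subseteq> H} \<subseteq> carrier M" using c by blast
    show "\<zero>\<^bsub>M\<^esub> \<in> \<Inter>{H. submodule H R M \<and> A \<subseteq> H}"
      by (auto simp: submodule_def dest!: subgroup.one_closed)
  next
    show "\<ominus>\<^bsub>M\<^esub> a \<in> \<Inter>{H. submodule H R M \<and> A \<subseteq> H}" if "a \<in> \<Inter>{H. submodule H R M \<and> A \<subseteq> H}" for a
      using that by (simp add: submoduleE(3))
    show "a \<oplus>\<^bsub>M\<^esub> b \<in> \<Inter>{H. submodule H R M \<and> A \<subseteq> H}" if "a \<in> \<Inter>{H. submodule H R M \<and> A \<subseteq> H}" "b \<in> \<Inter>{H. submodule H R M \<and> A \<subseteq> H}" for a b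
      using that by (simp add: submoduleE(5))
    show "a \<odot>\<^bsub>M\<^esub> b \<in> \<Inter>{H. submodule H R M \<and> A \<subseteq> H}" if "a \<in> carrier R" "b \<in> \<Inter>{H. submodule H R M \<and> A \<subseteq> H}" for a b
      using that by (simp add: submoduleE(4))
  qed
qed

lemma submod_span_subset: "A \<subseteq> submod_span R M A" by (auto simp: submod_span_def)

lemma submod_span_least: "submodule H R M \<Longrightarrow> A \<subseteq> H \<Longrightarrow> submod_span R M A \<subseteq> H" by (auto simp: submod_span_def)

locale quot = module R M + sub: submodule N R M for R M N
begin

lemma asub: "abelian_subgroup N M"
  by (rule abelian_subgroupI3) (simp_all add: additive_subgroup_def sub.subgroup_axioms M.abelian_group_axioms)

sublocale q: abelian_subgroup N M by (rule asub)

lemma N_carrier: "n \<in> N \<Longrightarrow> n \<in> carrier M" using q.a_subset by auto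

lemma q_simps: "carrier (quot_mod M N) = a_rcosets\<^bsub>M\<^esub> N" "zero (quot_mod M N) = N" "add (quot_mod M N) C D = C <+>\<^bsub>M\<^esub> D"
  "smult (quot_mod M N) r C = N <+>\<^bsub>M\<^esub> ((\<lambda>x. r \<odot>\<^bsub>M\<^esub> x) ` C)"
  by (auto simp: quot_mod_def)

lemma q_carrier: "C \<in> carrier (quot_mod M N) \<longleftrightarrow> (\<exists>x\<in>carrier M. C = N +>\<^bsub>M\<^esub> x)"
  by (auto simp: q_simps A_RCOSETS_def')

lemma coset_add_image:
  assumes "x \<in> carrier M" "f x \<in> carrier P" "submodule N' R P" "module R P" "\<And>n. n \<in> N \<Longrightarrow> f (n \<oplus>\<^bsub>M\<^esub> x) \<in> N' +>\<^bsub>P\<^esub> f x"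
  shows "N' <+>\<^bsub>P\<^esub> (f ` (N +>\<^bsub>M\<^esub> x)) = N' +>\<^bsub>P\<^esub> f x"
proof -
  interpret P: module R P by fact
  interpret S: submodule N' R P by fact
  have fx: "f x \<in> f ` (N +>\<^bsub>M\<^esub> x)" using assms(1) q.a_rcos_self by blast
  have sc: "a \<in> N' \<Longrightarrow> a \<in> carrier P" for a using S.subset by auto
  have cl: "a \<in> N' \<Longrightarrow> b \<in> N' \<Longrightarrow> a \<oplus>\<^bsub>P\<^esub> b \<in> N'" for a b using S.m_closed by simp
  show ?thesis
  proof
    show "N' +>\<^bsub>P\<^esub> f x \<subseteq> N' <+>\<^bsub>P\<^esub> (f ` (N +>\<^bsub>M\<^esub> x))"
      using fx unfolding set_add_def' a_r_coset_def'[of P] by blast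
    show "N' <+>\<^bsub>P\<^esub> (f ` (N +>\<^bsub>M\<^esub> x)) \<subseteq> N' +>\<^bsub>P\<^esub> f x"
    proof
      fix z assume "z \<in> N' <+>\<^bsub>P\<^esub> (f ` (N +>\<^bsub>M\<^esub> x))"
      then obtain a n where "a \<in> N'" "n \<in> N" "z = a \<oplus>\<^bsub>P\<^esub> f (n \<oplus>\<^bsub>M\<^esub> x)"
        by (auto simp: set_add_def' a_r_coset_def')
      moreover then obtain b where "b \<in> N'" "f (n \<oplus>\<^bsub>M\<^esub> x) = b \<oplus>\<^bsub>P\<^esub> f x" using assms(5)[of n] by (auto simp: a_r_coset_def')
      ultimately have "z = (a \<oplus>\<^bsub>P\<^esub> b) \<oplus>\<^bsub>P\<^esub> f x" "a \<oplus>\<^bsub>P\<^esub> b \<in> N'"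
        using assms(2) sc cl by (auto simp: P.M.a_assoc)
      thus "z \<in> N' +>\<^bsub>P\<^esub> f x" by (auto simp: a_r_coset_def')
    qed
  qed
qed

lemma q_smult: assumes "r \<in> carrier R" "x \<in> carrier M"
  shows "r \<odot>\<^bsub>quot_mod M N\<^esub> (N +>\<^bsub>M\<^esub> x) = N +>\<^bsub>M\<^esub> (r \<odot>\<^bsub>M\<^esub> x)"
  unfolding q_simps
  by (rule coset_add_image)
    (use assms in \<open>auto simp: smult_r_distr N_carrier sub.submodule_axioms module_axioms a_r_coset_def' sub.smult_closed\<close>)

lemma q_add: assumes "y \<in> carrier M" "x \<in> carrier M"
  shows "(N +>\<^bsub>M\<^esub> x) \<oplus>\<^bsub>quot_mod M N\<^esub> (N +>\<^bsub>M\<^esub> y) = N +>\<^bsub>M\<^esub> (x \<oplus>\<^bsub>M\<^esub> y)"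
  unfolding q_simps using assms by (rule_tac q.a_rcos_sum)

lemma q_zero: "\<zero>\<^bsub>quot_mod M N\<^esub> = N +>\<^bsub>M\<^esub> \<zero>\<^bsub>M\<^esub>"
  using q.a_subset by (simp add: q_simps)

lemma q_closed: "x \<in> carrier M \<Longrightarrow> N +>\<^bsub>M\<^esub> x \<in> carrier (quot_mod M N)" by (auto simp: q_carrier)

lemma quot_module: "module R (quot_mod M N)"
proof (rule moduleI)
  show "abelian_group (quot_mod M N)"
  proof (rule abelian_groupI)
    show "\<exists>y\<in>carrier (quot_mod M N). y \<oplus>\<^bsub>quot_mod M N\<^esub> x = \<zero>\<^bsub>quot_mod M N\<^esub>" if "x \<in> carrier (quot_mod M N)" for x
    proof -
      from that obtain m where m: "m \<in> carrier M" "x = N +>\<^bsub>M\<^esub> m" by (auto simp: q_carrier)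
      thus ?thesis by (intro bexI[of _ "N +>\<^bsub>M\<^esub> (\<ominus>\<^bsub>M\<^esub> m)"]) (auto simp: q_add q_zero q_closed M.l_neg)
    qed
  qed (auto simp: q_carrier q_add q_zero M.a_ac intro: M.a_assoc M.a_comm)
qed (auto simp: q_carrier q_add q_smult smult_l_distr smult_r_distr smult_assoc1 R.is_cring)

lemma quot_map:
  assumes "f \<in> mod_hom R M P" "submodule N' R P" "module R P" "f ` N \<subseteq> N'"
  defines "F \<equiv> (\<lambda>C\<in>carrier (quot_mod M N). N' <+>\<^bsub>P\<^esub> (f ` C))"
  shows "x \<in> carrier M \<Longrightarrow> F (N +>\<^bsub>M\<^esub> x) = N' +>\<^bsub>P\<^esub> f x" "F \<in> mod_hom R (quot_mod M N) (quot_mod P N')"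
proof -
  interpret P: quot R P N' using assms(2,3) by (simp add: quot_def)
  show *: "F (N +>\<^bsub>M\<^esub> x) = N' +>\<^bsub>P\<^esub> f x" if x: "x \<in> carrier M" for x
  proof -
    have "N' <+>\<^bsub>P\<^esub> (f ` (N +>\<^bsub>M\<^esub> x)) = N' +>\<^bsub>P\<^esub> f x"
    proof (rule coset_add_image)
      fix n assume "n \<in> N"
      thus "f (n \<oplus>\<^bsub>M\<^esub> x) \<in> N' +>\<^bsub>P\<^esub> f x" using x assms(4) N_carrier mod_homD(3)[OF assms(1)] by (auto simp: a_r_coset_def')
    qed (use x assms mod_homD in auto)
    thus ?thesis using q_closed x by (simp add: F_def)
  qed
  show "F \<in> mod_hom R (quot_mod M N) (quot_mod P N')"
  proof (rule mod_homI)
    show "F \<in> carrier (quot_mod M N) \<rightarrow>\<^sub>E carrier (quot_mod P N')"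
    proof (rule PiE_I)
      fix C assume "C \<in> carrier (quot_mod M N)"
      thus "F C \<in> carrier (quot_mod P N')" using * mod_homD(2)[OF assms(1)] by (auto simp: q_carrier P.q_carrier)
    qed (simp add: F_def)
  qed (auto simp: q_carrier q_add q_smult * P.q_add P.q_smult mod_homD[OF assms(1)])
qed

end

subsection \<open>Tensor powers\<close>

lemma rels_carrier: assumes "module R M"
  shows "multilin_rels R M a \<subseteq> carrier (free_mod R (tuples M a))"
proof -
  interpret M: module R M by fact
  interpret F: module R "free_mod R (tuples M a)" by (rule free_module) (rule M.R.is_cring)
  have t: "x \<in> tuples M a \<Longrightarrow> i < a \<Longrightarrow> u \<in> carrier M \<Longrightarrow> free_gen R (tuples M a) (x(i := u)) \<in> carrier (free_mod R (tuples M a))" for x i u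
    by (rule free_gen_closed) (auto simp: tuples_def M.R.is_cring PiE_iff extensional_def)
  show ?thesis
  proof
    fix z assume "z \<in> multilin_rels R M a"
    thus "z \<in> carrier (free_mod R (tuples M a))" unfolding multilin_rels_def Let_def
    proof (elim UnE CollectE exE conjE, goal_cases)
      case (1 x i u v)
      thus ?case using t[OF 1(2,3)] by (metis F.M.minus_closed F.M.a_closed M.M.a_closed)
    next
      case (2 x i r u)
      thus ?case using t[OF 2(2,3)] by (metis F.M.minus_closed F.smult_closed M.smult_closed)
    qed
  qed
qed

lemma span_sub: "module R M \<Longrightarrow> submodule (multilin_span R M a) R (free_mod R (tuples M a))"
  unfolding multilin_span_def
  by (rule submod_span_submodule[OF free_module[OF module.axioms(1)] rels_carrier])

lemma tensor_quot: "module R M \<Longrightarrow> quot R (free_mod R (tuples M a)) (multilin_span R M a)"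
  by (simp add: quot_def span_sub free_module module.axioms(1))

lemma tensor_pow_module: "module R M \<Longrightarrow> module R (tensor_pow R M a)"
  unfolding tensor_pow_def by (rule quot.quot_module[OF tensor_quot])

lemma mod_hom_minus: assumes "f \<in> mod_hom R M N" "module R M" "module R N" "x \<in> carrier M" "y \<in> carrier M"
  shows "f (x \<ominus>\<^bsub>M\<^esub> y) = f x \<ominus>\<^bsub>N\<^esub> f y"
proof -
  interpret M: module R M by fact
  interpret N: module R N by fact
  have "f (\<ominus>\<^bsub>M\<^esub> y) = \<ominus>\<^bsub>N\<^esub> f y"
    using mod_homD(3)[OF assms(1), of "\<ominus>\<^bsub>M\<^esub> y" y] assms mod_homD(2)[OF assms(1)] mod_hom_zero[OF assms(1-3)]
    by (metis M.M.a_inv_closed M.M.l_neg N.M.minus_equality)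
  thus ?thesis using assms mod_homD(3)[OF assms(1), of x "\<ominus>\<^bsub>M\<^esub> y"] by (simp add: a_minus_def)
qed

lemma tuple_map_tuples: "f \<in> mod_hom R M N \<Longrightarrow> tuple_map a f \<in> tuples M a \<rightarrow> tuples N a"
  using mod_homD(2) by (fastforce simp: tuple_map_def tuples_def)

lemma tuple_map_upd: "i < a \<Longrightarrow> tuple_map a f (x(i := u)) = (tuple_map a f x)(i := f u)"
  by (auto simp: tuple_map_def)

lemma tuple_map_span:
  assumes f: "f \<in> mod_hom R M N" and M: "module R M" and N: "module R N"
  shows "free_map R (tuples M a) (tuples N a) (tuple_map a f) ` multilin_span R M a \<subseteq> multilin_span R N a"
proof -
  interpret M: module R M by fact
  interpret N: module R N by fact
  let ?F = "free_mod R (tuples M a)" let ?G = "free_mod R (tuples N a)"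
  interpret F: module R ?F by (rule free_module) (rule M.R.is_cring)
  interpret G: module R ?G by (rule free_module) (rule M.R.is_cring)
  interpret S: submodule "multilin_span R N a" R ?G by (rule span_sub) fact
  note R = M.R.is_cring
  define \<phi> where "\<phi> = free_map R (tuples M a) (tuples N a) (tuple_map a f)"
  have \<phi>: "\<phi> \<in> mod_hom R ?F ?G" unfolding \<phi>_def by (rule free_map_hom[OF R tuple_map_tuples[OF f]])
  define H where "H = {v \<in> carrier ?F. \<phi> v \<in> multilin_span R N a}"
  have cl: "x \<in> multilin_span R N a \<Longrightarrow> y \<in> multilin_span R N a \<Longrightarrow> x \<oplus>\<^bsub>?G\<^esub> y \<in> multilin_span R N a" for x y using S.m_closed by simp
  have "submodule H R ?F"
  proof (rule F.submoduleI)
    show "\<zero>\<^bsub>?F\<^esub> \<in> H" using mod_hom_zero[OF \<phi> F.module_axioms G.module_axioms] S.one_closed by (simp add: H_def)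
    fix x assume x: "x \<in> H"
    have "\<phi> (\<zero>\<^bsub>?F\<^esub> \<ominus>\<^bsub>?F\<^esub> x) = \<zero>\<^bsub>?G\<^esub> \<ominus>\<^bsub>?G\<^esub> \<phi> x"
      using x mod_hom_minus[OF \<phi> F.module_axioms G.module_axioms, of "\<zero>\<^bsub>?F\<^esub>" x] mod_hom_zero[OF \<phi> F.module_axioms G.module_axioms]
      by (simp add: H_def)
    moreover have "\<ominus>\<^bsub>?G\<^esub> \<phi> x \<in> multilin_span R N a" using x G.submoduleE(3)[OF S.submodule_axioms] by (auto simp: H_def)
    ultimately show "\<ominus>\<^bsub>?F\<^esub> x \<in> H" using x mod_homD(2)[OF \<phi>] by (auto simp: H_def a_minus_def)
  qed (use cl in \<open>auto simp: H_def mod_homD[OF \<phi>] intro!: S.smult_closed\<close>)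
  moreover have "multilin_rels R M a \<subseteq> H"
  proof
    fix z assume z: "z \<in> multilin_rels R M a"
    have up: "x \<in> tuples M a \<Longrightarrow> i < a \<Longrightarrow> u \<in> carrier M \<Longrightarrow> x(i := u) \<in> tuples M a" for x i u
      by (auto simp: tuples_def PiE_iff extensional_def)
    have g: "x \<in> tuples M a \<Longrightarrow> \<phi> (free_gen R (tuples M a) x) = free_gen R (tuples N a) (tuple_map a f x)" for x
      unfolding \<phi>_def by (rule free_map_gen[OF R tuple_map_tuples[OF f]])
    have gc: "x \<in> tuples M a \<Longrightarrow> free_gen R (tuples M a) x \<in> carrier ?F" for x by (rule free_gen_closed[OF R])
    have tt: "x \<in> tuples M a \<Longrightarrow> tuple_map a f x \<in> tuples N a" for x using tuple_map_tuples[OF f] by auto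
    have "\<phi> z \<in> multilin_rels R N a"
      using z unfolding multilin_rels_def Let_def
    proof (elim UnE CollectE exE conjE, goal_cases)
      case (1 x i u v)
      hence "\<phi> z = free_gen R (tuples N a) ((tuple_map a f x)(i := f u \<oplus>\<^bsub>N\<^esub> f v)) \<ominus>\<^bsub>?G\<^esub> (free_gen R (tuples N a) ((tuple_map a f x)(i := f u)) \<oplus>\<^bsub>?G\<^esub> free_gen R (tuples N a) ((tuple_map a f x)(i := f v)))"
        by (simp add: mod_hom_minus[OF \<phi> F.module_axioms G.module_axioms] mod_homD(3)[OF \<phi>] gc g up tuple_map_upd mod_homD(3)[OF f])
      thus ?case using 1 tt mod_homD(2)[OF f] by blast
    next
      case (2 x i r u)
      hence "\<phi> z = free_gen R (tuples N a) ((tuple_map a f x)(i := r \<odot>\<^bsub>N\<^esub> f u)) \<ominus>\<^bsub>?G\<^esub> (r \<odot>\<^bsub>?G\<^esub> free_gen R (tuples N a) ((tuple_map a f x)(i := f u)))"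
        by (simp add: mod_hom_minus[OF \<phi> F.module_axioms G.module_axioms] mod_homD(4)[OF \<phi>] gc g up tuple_map_upd mod_homD(4)[OF f])
      thus ?case using 2 tt mod_homD(2)[OF f] by blast
    qed
    thus "z \<in> H" using z rels_carrier[OF M] by (auto simp: H_def multilin_span_def intro: submod_span_subset[THEN subsetD])
  qed
  ultimately have "multilin_span R M a \<subseteq> H" unfolding multilin_span_def by (rule submod_span_least)
  thus ?thesis by (auto simp: H_def \<phi>_def)
qed

lemma tensor_pow_map:
  assumes f: "f \<in> mod_hom R M N" and M: "module R M" and N: "module R N"
  shows "tensor_pow_map R M N a f \<in> mod_hom R (tensor_pow R M a) (tensor_pow R N a)"
    "v \<in> carrier (free_mod R (tuples M a)) \<Longrightarrow>
      tensor_pow_map R M N a f (multilin_span R M a +>\<^bsub>free_mod R (tuples M a)\<^esub> v)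
       = multilin_span R N a +>\<^bsub>free_mod R (tuples N a)\<^esub> free_map R (tuples M a) (tuples N a) (tuple_map a f) v"
proof -
  have R: "cring R" using M module.axioms by blast
  note q = quot.quot_map[OF tensor_quot[OF M] free_map_hom[OF R tuple_map_tuples[OF f]] span_sub[OF N] free_module[OF R] tuple_map_span[OF f M N]]
  show "tensor_pow_map R M N a f \<in> mod_hom R (tensor_pow R M a) (tensor_pow R N a)"
    using q(2) by (simp add: tensor_pow_map_def tensor_pow_def)
  show "v \<in> carrier (free_mod R (tuples M a)) \<Longrightarrow>
      tensor_pow_map R M N a f (multilin_span R M a +>\<^bsub>free_mod R (tuples M a)\<^esub> v)
       = multilin_span R N a +>\<^bsub>free_mod R (tuples N a)\<^esub> free_map R (tuples M a) (tuples N a) (tuple_map a f) v"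
    using q(1) by (simp add: tensor_pow_map_def tensor_pow_def)
qed

lemma tensor_functor_functor:
  assumes "is_functor R F" "cring R" shows "is_functor R (tensor_functor R F a)"
proof (rule is_functorI)
  note FD = is_functorD[OF assms(1)]
  show "module R (fobj (tensor_functor R F a) X)" if "X \<in> fin_obj" for X
    using tensor_pow_module[OF FD(1)] that by (simp add: tensor_functor_def)
  show "fmor (tensor_functor R F a) X Y f \<in> mod_hom R (fobj (tensor_functor R F a) X) (fobj (tensor_functor R F a) Y)"
    if "X \<in> fin_obj" "Y \<in> fin_obj" "f \<in> fin_hom X Y" for X Y f
    using tensor_pow_map(1)[OF FD(2) FD(1) FD(1)] that by (simp add: tensor_functor_def)
  have el: "\<exists>v\<in>carrier (free_mod R (tuples (fobj F X) a)). C = multilin_span R (fobj F X) a +>\<^bsub>free_mod R (tuples (fobj F X) a)\<^esub> v"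
    if "X \<in> fin_obj" "C \<in> carrier (tensor_pow R (fobj F X) a)" for X C
    using quot.q_carrier[OF tensor_quot[OF FD(1)]] that by (simp add: tensor_pow_def)
  show "fmor (tensor_functor R F a) X X (\<lambda>x\<in>X. x) = (\<lambda>m\<in>carrier (fobj (tensor_functor R F a) X). m)"
    if X: "X \<in> fin_obj" for X
  proof (rule PiE_ext)
    show "fmor (tensor_functor R F a) X X (\<lambda>x\<in>X. x) \<in> carrier (tensor_pow R (fobj F X) a) \<rightarrow>\<^sub>E carrier (tensor_pow R (fobj F X) a)"
      using mod_homD(1)[OF tensor_pow_map(1)[OF FD(2) FD(1) FD(1)]] X fin_hom_id by (auto simp add: tensor_functor_def)
    show "(\<lambda>m\<in>carrier (fobj (tensor_functor R F a) X). m) \<in> carrier (tensor_pow R (fobj F X) a) \<rightarrow>\<^sub>E carrier (tensor_pow R (fobj F X) a)"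
      by (auto simp: tensor_functor_def)
    fix C assume C: "C \<in> carrier (tensor_pow R (fobj F X) a)"
    then obtain v where v: "v\<in>carrier (free_mod R (tuples (fobj F X) a))" "C = multilin_span R (fobj F X) a +>\<^bsub>free_mod R (tuples (fobj F X) a)\<^esub> v"
      using el X by blast
    have "free_map R (tuples (fobj F X) a) (tuples (fobj F X) a) (tuple_map a (fmor F X X (\<lambda>x\<in>X. x))) = (\<lambda>v\<in>carrier (free_mod R (tuples (fobj F X) a)). v)"
    proof (rule free_map_id[OF assms(2)])
      fix s assume s: "s \<in> tuples (fobj F X) a"
      show "tuple_map a (fmor F X X (\<lambda>x\<in>X. x)) s = s"
      proof (rule extensionalityI[of _ "{..<a}"])
        show "tuple_map a (fmor F X X (\<lambda>x\<in>X. x)) s \<in> extensional {..<a}" by (simp add: tuple_map_def)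
        show "s \<in> extensional {..<a}" using s by (simp add: tuples_def PiE_def)
        fix i assume i: "i \<in> {..<a}"
        hence "s i \<in> carrier (fobj F X)" using s unfolding tuples_def by (rule_tac PiE_mem)
        thus "tuple_map a (fmor F X X (\<lambda>x\<in>X. x)) s i = s i" using i by (simp only: FD(3)[OF X] tuple_map_def restrict_apply if_True)
      qed
    qed
    thus "fmor (tensor_functor R F a) X X (\<lambda>x\<in>X. x) C = (\<lambda>m\<in>carrier (fobj (tensor_functor R F a) X). m) C"
      using v C tensor_pow_map(2)[OF FD(2) FD(1) FD(1) v(1)] X fin_hom_id by (auto simp add: tensor_functor_def)
  qed
  fix X Y Z f g
  assume h: "X\<in>fin_obj" "Y\<in>fin_obj" "Z\<in>fin_obj" "f\<in>fin_hom X Y" "g \<in> fin_hom Y Z"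
  have gf: "compose X g f \<in> fin_hom X Z" using h fin_hom_compose by blast
  note Tf = tensor_pow_map[OF FD(2)[OF h(1,2,4)] FD(1)[OF h(1)] FD(1)[OF h(2)]]
  note Tg = tensor_pow_map[OF FD(2)[OF h(2,3,5)] FD(1)[OF h(2)] FD(1)[OF h(3)]]
  note Tgf = tensor_pow_map[OF FD(2)[OF h(1,3) gf] FD(1)[OF h(1)] FD(1)[OF h(3)]]
  show "fmor (tensor_functor R F a) X Z (compose X g f) = compose (carrier (fobj (tensor_functor R F a) X)) (fmor (tensor_functor R F a) Y Z g) (fmor (tensor_functor R F a) X Y f)"
  proof (rule PiE_ext)
    show "fmor (tensor_functor R F a) X Z (compose X g f) \<in> carrier (tensor_pow R (fobj F X) a) \<rightarrow>\<^sub>E carrier (tensor_pow R (fobj F Z) a)"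
      using mod_homD(1)[OF Tgf(1)] by (simp add: tensor_functor_def)
    show "compose (carrier (fobj (tensor_functor R F a) X)) (fmor (tensor_functor R F a) Y Z g) (fmor (tensor_functor R F a) X Y f) \<in> carrier (tensor_pow R (fobj F X) a) \<rightarrow>\<^sub>E carrier (tensor_pow R (fobj F Z) a)"
      using mod_homD(1)[OF mod_hom_compose[OF Tf(1) Tg(1) tensor_pow_module[OF FD(1)[OF h(1)]]]] by (simp add: tensor_functor_def)
    fix C assume C: "C \<in> carrier (tensor_pow R (fobj F X) a)"
    then obtain v where v: "v\<in>carrier (free_mod R (tuples (fobj F X) a))" "C = multilin_span R (fobj F X) a +>\<^bsub>free_mod R (tuples (fobj F X) a)\<^esub> v"
      using el h by blast
    have "free_map R (tuples (fobj F X) a) (tuples (fobj F Z) a) (tuple_map a (fmor F X Z (compose X g f))) =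
       compose (carrier (free_mod R (tuples (fobj F X) a))) (free_map R (tuples (fobj F Y) a) (tuples (fobj F Z) a) (tuple_map a (fmor F Y Z g)))
        (free_map R (tuples (fobj F X) a) (tuples (fobj F Y) a) (tuple_map a (fmor F X Y f)))"
    proof (rule free_map_comp[OF assms(2) tuple_map_tuples[OF FD(2)[OF h(1,2,4)]] tuple_map_tuples[OF FD(2)[OF h(2,3,5)]]])
      fix s assume s: "s \<in> tuples (fobj F X) a"
      show "tuple_map a (fmor F X Z (compose X g f)) s = tuple_map a (fmor F Y Z g) (tuple_map a (fmor F X Y f) s)"
        unfolding tuple_map_def
      proof (rule restrict_ext)
        fix i assume i: "i \<in> {..<a}"
        hence "s i \<in> carrier (fobj F X)" using s unfolding tuples_def by (rule_tac PiE_mem)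
        thus "fmor F X Z (compose X g f) (s i) = fmor F Y Z g ((\<lambda>i\<in>{..<a}. fmor F X Y f (s i)) i)"
          using i by (simp only: FD(4)[OF h] compose_eq restrict_apply if_True)
      qed
    qed
    moreover have "free_map R (tuples (fobj F X) a) (tuples (fobj F Y) a) (tuple_map a (fmor F X Y f)) v \<in> carrier (free_mod R (tuples (fobj F Y) a))"
      by (rule mod_homD(2)[OF free_map_hom[OF assms(2) tuple_map_tuples[OF FD(2)[OF h(1,2,4)]]] v(1)])
    ultimately show "fmor (tensor_functor R F a) X Z (compose X g f) C = compose (carrier (fobj (tensor_functor R F a) X)) (fmor (tensor_functor R F a) Y Z g) (fmor (tensor_functor R F a) X Y f) C"
      using C v Tf(2)[OF v(1)] Tgf(2)[OF v(1)] by (simp add: tensor_functor_def compose_eq Tg(2))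
  qed
qed


subsection \<open>Modules of natural transformations\<close>

lemma Hom_simps:
  "carrier (Hom_mod R F G) = nat_trans R F G"
  "\<zero>\<^bsub>Hom_mod R F G\<^esub> = (\<lambda>X\<in>fin_obj. \<lambda>m\<in>carrier (fobj F X). \<zero>\<^bsub>fobj G X\<^esub>)"
  "\<eta> \<oplus>\<^bsub>Hom_mod R F G\<^esub> \<theta> = (\<lambda>X\<in>fin_obj. \<lambda>m\<in>carrier (fobj F X). \<eta> X m \<oplus>\<^bsub>fobj G X\<^esub> \<theta> X m)"
  "r \<odot>\<^bsub>Hom_mod R F G\<^esub> \<eta> = (\<lambda>X\<in>fin_obj. \<lambda>m\<in>carrier (fobj F X). r \<odot>\<^bsub>fobj G X\<^esub> \<eta> X m)"
  by (auto simp: Hom_mod_def)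

lemma nt_eqI: "\<eta> \<in> nat_trans R F G \<Longrightarrow> \<theta> \<in> nat_trans R F G \<Longrightarrow> (\<And>X m. X \<in> fin_obj \<Longrightarrow> m \<in> carrier (fobj F X) \<Longrightarrow> \<eta> X m = \<theta> X m) \<Longrightarrow> \<eta> = \<theta>"
proof (rule extensionalityI)
  assume a: "\<eta> \<in> nat_trans R F G" "\<theta> \<in> nat_trans R F G" "\<And>X m. X \<in> fin_obj \<Longrightarrow> m \<in> carrier (fobj F X) \<Longrightarrow> \<eta> X m = \<theta> X m"
  show "\<eta> \<in> extensional fin_obj" "\<theta> \<in> extensional fin_obj" using a nat_transD by blast+
  fix X assume X: "X \<in> fin_obj"
  show "\<eta> X = \<theta> X" by (rule PiE_ext[OF mod_homD(1) mod_homD(1)], rule nat_transD(1)[OF a(1) X], rule nat_transD(1)[OF a(2) X]) (use a X in auto)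
qed

lemma Hom_closed:
  assumes F: "is_functor R F" and G: "is_functor R G"
  shows "\<zero>\<^bsub>Hom_mod R F G\<^esub> \<in> nat_trans R F G"
    "\<eta> \<in> nat_trans R F G \<Longrightarrow> \<theta> \<in> nat_trans R F G \<Longrightarrow> \<eta> \<oplus>\<^bsub>Hom_mod R F G\<^esub> \<theta> \<in> nat_trans R F G"
    "r \<in> carrier R \<Longrightarrow> \<eta> \<in> nat_trans R F G \<Longrightarrow> r \<odot>\<^bsub>Hom_mod R F G\<^esub> \<eta> \<in> nat_trans R F G"
proof -
  note FD = is_functorD[OF F] note GD = is_functorD[OF G]
  show "\<zero>\<^bsub>Hom_mod R F G\<^esub> \<in> nat_trans R F G"
  proof (rule nat_transI)
    show "\<zero>\<^bsub>Hom_mod R F G\<^esub> X \<in> mod_hom R (fobj F X) (fobj G X)" if "X \<in> fin_obj" for X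
    proof -
      interpret A: module R "fobj F X" using FD that by blast
      interpret B: module R "fobj G X" using GD that by blast
      show ?thesis using that by (auto simp: Hom_simps intro!: mod_homI)
    qed
  qed (auto simp: Hom_simps mod_homD(2)[OF FD(2)] mod_hom_zero[OF GD(2) GD(1) GD(1)])
  {
    assume e: "\<eta> \<in> nat_trans R F G" "\<theta> \<in> nat_trans R F G"
    show "\<eta> \<oplus>\<^bsub>Hom_mod R F G\<^esub> \<theta> \<in> nat_trans R F G"
    proof (rule nat_transI)
      show "(\<eta> \<oplus>\<^bsub>Hom_mod R F G\<^esub> \<theta>) X \<in> mod_hom R (fobj F X) (fobj G X)" if "X \<in> fin_obj" for X
      proof -
        interpret A: module R "fobj F X" using FD that by blast
        interpret B: module R "fobj G X" using GD that by blast
        note d = mod_homD[OF nat_transD(1)[OF e(1) that]] mod_homD[OF nat_transD(1)[OF e(2) that]]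
        show ?thesis using that by (auto simp: Hom_simps d B.M.a_ac B.smult_r_distr intro!: mod_homI)
      qed
      fix X Y f m assume h: "X \<in> fin_obj" "Y \<in> fin_obj" "f \<in> fin_hom X Y" "m \<in> carrier (fobj F X)"
      note d = mod_homD(2)[OF nat_transD(1)[OF e(1) h(1)] h(4)] mod_homD(2)[OF nat_transD(1)[OF e(2) h(1)] h(4)]
      show "(\<eta> \<oplus>\<^bsub>Hom_mod R F G\<^esub> \<theta>) Y (fmor F X Y f m) = fmor G X Y f ((\<eta> \<oplus>\<^bsub>Hom_mod R F G\<^esub> \<theta>) X m)"
        using h mod_homD(2)[OF FD(2)[OF h(1-3)] h(4)]
        by (simp add: Hom_simps nat_transD(3)[OF e(1) h] nat_transD(3)[OF e(2) h] mod_homD(3)[OF GD(2)[OF h(1-3)] d])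
    qed (auto simp: Hom_simps)
  }
  assume r: "r \<in> carrier R" and e: "\<eta> \<in> nat_trans R F G"
  show "r \<odot>\<^bsub>Hom_mod R F G\<^esub> \<eta> \<in> nat_trans R F G"
  proof (rule nat_transI)
    show "(r \<odot>\<^bsub>Hom_mod R F G\<^esub> \<eta>) X \<in> mod_hom R (fobj F X) (fobj G X)" if "X \<in> fin_obj" for X
    proof -
      interpret A: module R "fobj F X" using FD that by blast
      interpret B: module R "fobj G X" using GD that by blast
      note d = mod_homD[OF nat_transD(1)[OF e that]]
      have "r \<odot>\<^bsub>fobj G X\<^esub> (s \<odot>\<^bsub>fobj G X\<^esub> y) = s \<odot>\<^bsub>fobj G X\<^esub> (r \<odot>\<^bsub>fobj G X\<^esub> y)" if "s \<in> carrier R" "y \<in> carrier (fobj G X)" for s y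
        using r that by (metis A.R.m_comm B.smult_assoc1)
      thus ?thesis using that r by (auto simp: Hom_simps d B.smult_r_distr intro!: mod_homI)
    qed
    fix X Y f m assume h: "X \<in> fin_obj" "Y \<in> fin_obj" "f \<in> fin_hom X Y" "m \<in> carrier (fobj F X)"
    note d = mod_homD(2)[OF nat_transD(1)[OF e(1) h(1)] h(4)]
    show "(r \<odot>\<^bsub>Hom_mod R F G\<^esub> \<eta>) Y (fmor F X Y f m) = fmor G X Y f ((r \<odot>\<^bsub>Hom_mod R F G\<^esub> \<eta>) X m)"
      using h mod_homD(2)[OF FD(2)[OF h(1-3)] h(4)]
      by (simp add: Hom_simps nat_transD(3)[OF e(1) h] mod_homD(4)[OF GD(2)[OF h(1-3)] r d])
  qed (auto simp: Hom_simps)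
qed

lemma Hom_app:
  assumes "X \<in> fin_obj" "m \<in> carrier (fobj F X)"
  shows  "\<zero>\<^bsub>Hom_mod R F G\<^esub> X m = \<zero>\<^bsub>fobj G X\<^esub>"
  "(\<eta> \<oplus>\<^bsub>Hom_mod R F G\<^esub> \<theta>) X m = \<eta> X m \<oplus>\<^bsub>fobj G X\<^esub> \<theta> X m"
  "(r \<odot>\<^bsub>Hom_mod R F G\<^esub> \<eta>) X m = r \<odot>\<^bsub>fobj G X\<^esub> \<eta> X m"
  using assms by (auto simp: Hom_simps)

lemma Hom_module:
  assumes F: "is_functor R F" and G: "is_functor R G" and R: "cring R"
  shows "module R (Hom_mod R F G)"
proof -
  interpret R: cring R by fact
  note FD = is_functorD[OF F] note GD = is_functorD[OF G]
  note cl = Hom_closed[OF F G]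
  note ev = mod_homD(2)[OF nat_transD(1)]
  show ?thesis
  proof (rule moduleI, fact, rule abelian_groupI, unfold Hom_simps(1), goal_cases)
    case (1 x y) thus ?case using cl by simp
  next case 2 thus ?case using cl by simp
  next case (3 x y z)
    show ?case
    proof (rule nt_eqI[of _ R F G])
      fix X m assume Xm: "X \<in> fin_obj" "m \<in> carrier (fobj F X)"
      then interpret B: module R "fobj G X" using GD by blast
      show "(x \<oplus>\<^bsub>Hom_mod R F G\<^esub> y \<oplus>\<^bsub>Hom_mod R F G\<^esub> z) X m = (x \<oplus>\<^bsub>Hom_mod R F G\<^esub> (y \<oplus>\<^bsub>Hom_mod R F G\<^esub> z)) X m"
        using Xm 3 ev[of x R F G X m] ev[of y R F G X m] ev[of z R F G X m] by (simp add: Hom_app B.M.a_assoc)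
    qed (use 3 cl in auto)
  next case (4 x y)
    show ?case
    proof (rule nt_eqI[of _ R F G])
      fix X m assume Xm: "X \<in> fin_obj" "m \<in> carrier (fobj F X)"
      then interpret B: module R "fobj G X" using GD by blast
      show "(x \<oplus>\<^bsub>Hom_mod R F G\<^esub> y) X m = (y \<oplus>\<^bsub>Hom_mod R F G\<^esub> x) X m"
        using Xm 4 ev[of x R F G X m] ev[of y R F G X m] by (simp add: Hom_app B.M.a_comm)
    qed (use 4 cl in auto)
  next case (5 x)
    show ?case
    proof (rule nt_eqI[of _ R F G])
      fix X m assume Xm: "X \<in> fin_obj" "m \<in> carrier (fobj F X)"
      then interpret B: module R "fobj G X" using GD by blast
      show "(\<zero>\<^bsub>Hom_mod R F G\<^esub> \<oplus>\<^bsub>Hom_mod R F G\<^esub> x) X m = x X m"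
        using Xm 5 ev[of x R F G X m] by (simp add: Hom_app)
    qed (use 5 cl in auto)
  next case (6 x)
    have "(\<ominus>\<^bsub>R\<^esub> \<one>\<^bsub>R\<^esub>) \<odot>\<^bsub>Hom_mod R F G\<^esub> x \<oplus>\<^bsub>Hom_mod R F G\<^esub> x = \<zero>\<^bsub>Hom_mod R F G\<^esub>"
    proof (rule nt_eqI[of _ R F G])
      fix X m assume Xm: "X \<in> fin_obj" "m \<in> carrier (fobj F X)"
      then interpret B: module R "fobj G X" using GD by blast
      show "((\<ominus>\<^bsub>R\<^esub> \<one>\<^bsub>R\<^esub>) \<odot>\<^bsub>Hom_mod R F G\<^esub> x \<oplus>\<^bsub>Hom_mod R F G\<^esub> x) X m = \<zero>\<^bsub>Hom_mod R F G\<^esub> X m"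
        using Xm 6 ev[of x R F G X m] by (simp add: Hom_app B.smult_l_minus B.M.l_neg)
    qed (use 6 cl in auto)
    thus ?case using cl(3)[of "\<ominus>\<^bsub>R\<^esub> \<one>\<^bsub>R\<^esub>"] 6 by auto
  next case (7 r x) thus ?case using cl by simp
  next case (8 r s x)
    show ?case
    proof (rule nt_eqI[of _ R F G])
      fix X m assume Xm: "X \<in> fin_obj" "m \<in> carrier (fobj F X)"
      then interpret B: module R "fobj G X" using GD by blast
      show "((r \<oplus>\<^bsub>R\<^esub> s) \<odot>\<^bsub>Hom_mod R F G\<^esub> x) X m = (r \<odot>\<^bsub>Hom_mod R F G\<^esub> x \<oplus>\<^bsub>Hom_mod R F G\<^esub> s \<odot>\<^bsub>Hom_mod R F G\<^esub> x) X m"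
        using Xm 8 ev[of x R F G X m] by (simp add: Hom_app B.smult_l_distr)
    qed (use 8 cl in auto)
  next case (9 r x y)
    show ?case
    proof (rule nt_eqI[of _ R F G])
      fix X m assume Xm: "X \<in> fin_obj" "m \<in> carrier (fobj F X)"
      then interpret B: module R "fobj G X" using GD by blast
      show "(r \<odot>\<^bsub>Hom_mod R F G\<^esub> (x \<oplus>\<^bsub>Hom_mod R F G\<^esub> y)) X m = (r \<odot>\<^bsub>Hom_mod R F G\<^esub> x \<oplus>\<^bsub>Hom_mod R F G\<^esub> r \<odot>\<^bsub>Hom_mod R F G\<^esub> y) X m"
        using Xm 9 ev[of x R F G X m] ev[of y R F G X m] by (simp add: Hom_app B.smult_r_distr)
    qed (use 9 cl in auto)
  next case (10 r s x)
    show ?case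
    proof (rule nt_eqI[of _ R F G])
      fix X m assume Xm: "X \<in> fin_obj" "m \<in> carrier (fobj F X)"
      then interpret B: module R "fobj G X" using GD by blast
      show "(r \<otimes>\<^bsub>R\<^esub> s \<odot>\<^bsub>Hom_mod R F G\<^esub> x) X m = (r \<odot>\<^bsub>Hom_mod R F G\<^esub> (s \<odot>\<^bsub>Hom_mod R F G\<^esub> x)) X m"
        using Xm 10 ev[of x R F G X m] by (simp add: Hom_app B.smult_assoc1)
    qed (use 10 cl in auto)
  next case (11 x)
    show ?case
    proof (rule nt_eqI[of _ R F G])
      fix X m assume Xm: "X \<in> fin_obj" "m \<in> carrier (fobj F X)"
      then interpret B: module R "fobj G X" using GD by blast
      show "(\<one>\<^bsub>R\<^esub> \<odot>\<^bsub>Hom_mod R F G\<^esub> x) X m = x X m"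
        using Xm 11 ev[of x R F G X m] by (simp add: Hom_app)
    qed (use 11 cl in auto)
  qed
qed

lemma nt_comp_nat:
  assumes "\<eta> \<in> nat_trans R F G" "\<theta> \<in> nat_trans R G H" "is_functor R F"
  shows "nt_comp F \<theta> \<eta> \<in> nat_trans R F H"
proof (rule nat_transI)
  note FD = is_functorD[OF assms(3)]
  show "nt_comp F \<theta> \<eta> X \<in> mod_hom R (fobj F X) (fobj H X)" if "X \<in> fin_obj" for X
    using mod_hom_compose[OF nat_transD(1)[OF assms(1) that] nat_transD(1)[OF assms(2) that] FD(1)[OF that]] that by (simp add: nt_comp_def)
  show "nt_comp F \<theta> \<eta> \<in> extensional fin_obj" by (simp add: nt_comp_def)
  fix X Y f m assume h: "X \<in> fin_obj" "Y \<in> fin_obj" "f \<in> fin_hom X Y" "m \<in> carrier (fobj F X)"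
  show "nt_comp F \<theta> \<eta> Y (fmor F X Y f m) = fmor H X Y f (nt_comp F \<theta> \<eta> X m)"
    using h mod_homD(2)[OF FD(2)[OF h(1-3)] h(4)] nat_transD(3)[OF assms(1) h]
      nat_transD(3)[OF assms(2) h(1-3)] mod_homD(2)[OF nat_transD(1)[OF assms(1) h(1)] h(4)]
    by (simp add: nt_comp_def compose_eq)
qed

subsection \<open>The resolution is projective and exact\<close>

lemma ker_incl: "\<theta> \<in> nat_trans R F (ker_functor G H \<eta>) \<Longrightarrow> is_functor R F \<Longrightarrow> \<theta> \<in> nat_trans R F G"
  and ker_zero: "\<theta> \<in> nat_trans R F (ker_functor G H \<eta>) \<Longrightarrow> X \<in> fin_obj \<Longrightarrow> m \<in> carrier (fobj F X) \<Longrightarrow> \<eta> X (\<theta> X m) = \<zero>\<^bsub>fobj H X\<^esub>"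
proof -
  assume t: "\<theta> \<in> nat_trans R F (ker_functor G H \<eta>)"
  show "X \<in> fin_obj \<Longrightarrow> m \<in> carrier (fobj F X) \<Longrightarrow> \<eta> X (\<theta> X m) = \<zero>\<^bsub>fobj H X\<^esub>"
    using mod_homD(2)[OF nat_transD(1)[OF t, of X], of m] by (auto simp: ker_functor_def Let_def)
  assume "is_functor R F"
  show "\<theta> \<in> nat_trans R F G"
  proof (rule nat_transI)
    show "\<theta> X \<in> mod_hom R (fobj F X) (fobj G X)" if "X \<in> fin_obj" for X
      using nat_transD(1)[OF t that] by (auto simp: mod_hom_def ker_functor_def Let_def)
    fix X Y f m assume h: "X \<in> fin_obj" "Y \<in> fin_obj" "f \<in> fin_hom X Y" "m \<in> carrier (fobj F X)"
    show "\<theta> Y (fmor F X Y f m) = fmor G X Y f (\<theta> X m)"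
      using nat_transD(3)[OF t h] mod_homD(2)[OF nat_transD(1)[OF t h(1)] h(4)]
      by (auto simp: ker_functor_def Let_def)
  qed (use nat_transD[OF t] in auto)
qed

lemma syz1_functor: "cring R \<Longrightarrow> is_functor R F \<Longrightarrow> is_functor R (syz1 R F)"
  unfolding syz1_def by (intro ker_functor_functor cover_functor cover_map_nat)

lemma res_functor: assumes "cring R" "is_functor R F" shows
   "is_functor R (res0 R F)" "is_functor R (res1 R F)" "is_functor R (res2 R F)"
  "diff1 R F \<in> nat_trans R (res1 R F) (res0 R F)" "diff2 R F \<in> nat_trans R (res2 R F) (res1 R F)"
  using assms
  by (simp_all add: res0_def res1_def res2_def diff1_def diff2_def syz2_def cover_functor)
    (rule ker_incl[of _ R _ _ F "cover_map R F"] ker_incl[of _ R _ _ "syz1 R F" "cover_map R (syz1 R F)"];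
     simp add: cover_functor syz1_functor cover_map_nat flip: syz1_def)+

lemma exact0:
  assumes "cring R" "is_functor R F" "X \<in> fin_obj"
  shows "{m \<in> carrier (fobj (res0 R F) X). cover_map R F X m = \<zero>\<^bsub>fobj F X\<^esub>} = diff1 R F X ` carrier (fobj (res1 R F) X)"
proof -
  have "carrier (fobj (syz1 R F) X) = cover_map R (syz1 R F) X ` carrier (fobj (cover R (syz1 R F)) X)" (is "?A = ?B")
  proof
    show "?B \<subseteq> ?A" using mod_homD(2)[OF nat_transD(1)[OF cover_map_nat[OF assms(1) syz1_functor[OF assms(1,2)]] assms(3)]] by auto
    show "?A \<subseteq> ?B" using cover_map_surj[OF assms(1) syz1_functor[OF assms(1,2)] assms(3)] by (metis image_eqI subsetI)
  qed
  thus ?thesis by (simp add: res0_def res1_def diff1_def) (simp add: syz1_def ker_functor_def Let_def)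
qed

lemma exact1:
  assumes "cring R" "is_functor R F" "X \<in> fin_obj"
  shows "{m \<in> carrier (fobj (res1 R F) X). diff1 R F X m = \<zero>\<^bsub>fobj (res0 R F) X\<^esub>} = diff2 R F X ` carrier (fobj (res2 R F) X)"
proof -
  have "\<zero>\<^bsub>fobj (syz1 R F) X\<^esub> = \<zero>\<^bsub>fobj (res0 R F) X\<^esub>" by (simp add: syz1_def ker_functor_def res0_def Let_def)
  thus ?thesis using exact0[OF assms(1) syz1_functor[OF assms(1,2)] assms(3)]
    by (simp add: res0_def[of R "syz1 R F"] res1_def diff1_def diff2_def res2_def syz2_def)
qed

lemma cover_projective:
  assumes R: "cring R" and F: "is_functor R F" and A: "is_functor R A" and B: "is_functor R B"
    and p: "p \<in> nat_trans R A B" and surj: "\<And>X. X \<in> fin_obj \<Longrightarrow> p X ` carrier (fobj A X) = carrier (fobj B X)"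
    and \<phi>: "\<phi> \<in> nat_trans R (cover R F) B"
  shows "\<exists>\<psi>\<in>nat_trans R (cover R F) A. nt_comp (cover R F) p \<psi> = \<phi>"
proof -
  note FD = is_functorD[OF F] note AD = is_functorD[OF A] note BD = is_functorD[OF B] note CD = is_functorD[OF cover_functor[OF R]]
  define e where "e = (\<lambda>X x. free_gen R (cover_gens F X) (X, x, \<lambda>y\<in>X. y))"
  have gi: "(X, x, \<lambda>y\<in>X. y) \<in> cover_gens F X" if "X \<in> fin_obj" "x \<in> carrier (fobj F X)" for X x
    using that fin_hom_id by (auto simp: cover_gens_def)
  have ec: "e X x \<in> carrier (fobj (cover R F) X)" if "X \<in> fin_obj" "x \<in> carrier (fobj F X)" for X x
    unfolding e_def cover_def using free_gen_closed[OF R gi[OF that]] by simp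
  define l where "l = (\<lambda>X x. SOME y. y \<in> carrier (fobj A X) \<and> p X y = \<phi> X (e X x))"
  have l: "l X x \<in> carrier (fobj A X) \<and> p X (l X x) = \<phi> X (e X x)" if "X \<in> fin_obj" "x \<in> carrier (fobj F X)" for X x
  proof -
    have "\<phi> X (e X x) \<in> p X ` carrier (fobj A X)" using surj[OF that(1)] mod_homD(2)[OF nat_transD(1)[OF \<phi> that(1)] ec[OF that]] by simp
    hence "\<exists>y. y \<in> carrier (fobj A X) \<and> p X y = \<phi> X (e X x)" by force
    thus ?thesis unfolding l_def by (rule someI_ex)
  qed
  define \<psi> where "\<psi> = (\<lambda>Y\<in>fin_obj. free_lift R (cover_gens F Y) (fobj A Y) (\<lambda>(X, x, f). fmor A X Y f (l X x)))"
  have q: "(\<lambda>(X, x, f). fmor A X Y f (l X x)) \<in> cover_gens F Y \<rightarrow> carrier (fobj A Y)" if "Y \<in> fin_obj" for Y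
    using that l mod_homD(2)[OF AD(2)] by (auto simp: cover_gens_def)
  have m: "(\<lambda>(X, x, g). (X, x, compose X f g)) \<in> cover_gens F X \<rightarrow> cover_gens F Y" if "f \<in> fin_hom X Y" for X Y f
    using that by (auto simp: cover_gens_def fin_hom_compose)
  have \<psi>g: "\<psi> Y (free_gen R (cover_gens F Y) (X, x, f)) = fmor A X Y f (l X x)" if "Y \<in> fin_obj" "(X, x, f) \<in> cover_gens F Y" for X Y x f
    using free_lift_gen[OF AD(1) q, of Y] that by (auto simp: \<psi>_def)
  have Cf: "fmor (cover R F) X Y f (free_gen R (cover_gens F X) (Z, x, g)) = free_gen R (cover_gens F Y) (Z, x, compose Z f g)"
    if "f \<in> fin_hom X Y" "(Z, x, g) \<in> cover_gens F X" for X Y Z x f g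
    using free_map_gen[OF R m[OF that(1)] that(2)] by (simp add: cover_def)
  have \<psi>: "\<psi> \<in> nat_trans R (cover R F) A"
  proof (rule nat_transI)
    show h\<psi>: "\<psi> X \<in> mod_hom R (fobj (cover R F) X) (fobj A X)" if "X \<in> fin_obj" for X
      using free_lift_hom[OF AD(1)[OF that] q[OF that]] that by (simp add: \<psi>_def cover_def)
    show "\<psi> \<in> extensional fin_obj" by (simp add: \<psi>_def)
    fix X Y f v assume h: "X \<in> fin_obj" "Y \<in> fin_obj" "f \<in> fin_hom X Y" "v \<in> carrier (fobj (cover R F) X)"
    have "compose (carrier (fobj (cover R F) X)) (\<psi> Y) (fmor (cover R F) X Y f) = compose (carrier (fobj (cover R F) X)) (fmor A X Y f) (\<psi> X)"
    proof (rule free_hom_eqI[OF AD(1)[OF h(2)], where S="cover_gens F X"])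
      have *: "free_mod R (cover_gens F X) = fobj (cover R F) X" by (simp add: cover_def)
      show "compose (carrier (fobj (cover R F) X)) (\<psi> Y) (fmor (cover R F) X Y f) \<in> mod_hom R (free_mod R (cover_gens F X)) (fobj A Y)"
        unfolding * by (rule mod_hom_compose[OF CD(2)[OF h(1-3)] h\<psi>[OF h(2)] CD(1)[OF h(1)]])
      show "compose (carrier (fobj (cover R F) X)) (fmor A X Y f) (\<psi> X) \<in> mod_hom R (free_mod R (cover_gens F X)) (fobj A Y)"
        unfolding * by (rule mod_hom_compose[OF h\<psi>[OF h(1)] AD(2)[OF h(1-3)] CD(1)[OF h(1)]])
      fix s assume s: "s \<in> cover_gens F X"
      obtain Z x g where [simp]: "s = (Z, x, g)" by (cases s)
      have g: "Z \<in> fin_obj" "x \<in> carrier (fobj F Z)" "g \<in> fin_hom Z X" using s by (auto simp: cover_gens_def)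
      have s2: "(Z, x, compose Z f g) \<in> cover_gens F Y" using funcset_mem[OF m[OF h(3)] s] by simp
      have sc: "free_gen R (cover_gens F X) (Z, x, g) \<in> carrier (fobj (cover R F) X)" using free_gen_closed[OF R s] by (simp add: cover_def)
      show "compose (carrier (fobj (cover R F) X)) (\<psi> Y) (fmor (cover R F) X Y f) (free_gen R (cover_gens F X) s) = compose (carrier (fobj (cover R F) X)) (fmor A X Y f) (\<psi> X) (free_gen R (cover_gens F X) s)"
        using s s2 sc l[OF g(1,2)] AD(4)[OF g(1) h(1,2) g(3) h(3)] by (simp add: compose_eq Cf[OF h(3)] \<psi>g h)
    qed
    from fun_cong[OF this, of v] h show "\<psi> Y (fmor (cover R F) X Y f v) = fmor A X Y f (\<psi> X v)" by (simp add: compose_eq)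
  qed
  have "nt_comp (cover R F) p \<psi> = \<phi>"
  proof (rule nt_eqI[OF nt_comp_nat[OF \<psi> p cover_functor[OF R]] \<phi>])
    fix Y v assume Y: "Y \<in> fin_obj" and v: "v \<in> carrier (fobj (cover R F) Y)"
    have *: "free_mod R (cover_gens F Y) = fobj (cover R F) Y" by (simp add: cover_def)
    have "nt_comp (cover R F) p \<psi> Y = \<phi> Y"
    proof (rule free_hom_eqI[OF BD(1)[OF Y], where S="cover_gens F Y"])
      show "nt_comp (cover R F) p \<psi> Y \<in> mod_hom R (free_mod R (cover_gens F Y)) (fobj B Y)"
        unfolding * by (rule nat_transD(1)[OF nt_comp_nat[OF \<psi> p cover_functor[OF R]] Y])
      show "\<phi> Y \<in> mod_hom R (free_mod R (cover_gens F Y)) (fobj B Y)" unfolding * by (rule nat_transD(1)[OF \<phi> Y])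
      fix s assume s: "s \<in> cover_gens F Y"
      obtain Z x g where [simp]: "s = (Z, x, g)" by (cases s)
      have g: "Z \<in> fin_obj" "x \<in> carrier (fobj F Z)" "g \<in> fin_hom Z Y" using s by (auto simp: cover_gens_def)
      have sc: "free_gen R (cover_gens F Y) (Z, x, g) \<in> carrier (fobj (cover R F) Y)" using free_gen_closed[OF R s] by (simp add: cover_def)
      have "compose Z g (\<lambda>y\<in>Z. y) = g" using g by (auto simp: fin_hom_def compose_def PiE_iff extensional_def)
      hence "free_gen R (cover_gens F Y) (Z, x, g) = fmor (cover R F) Z Y g (e Z x)"
        using Cf[OF g(3) gi[OF g(1,2)]] by (simp add: e_def)
      hence "\<phi> Y (free_gen R (cover_gens F Y) (Z, x, g)) = fmor B Z Y g (\<phi> Z (e Z x))"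
        using nat_transD(3)[OF \<phi> g(1) Y g(3) ec[OF g(1,2)]] by simp
      also have "\<dots> = p Y (fmor A Z Y g (l Z x))" using l[OF g(1,2)] nat_transD(3)[OF p g(1) Y g(3), of "l Z x"] by simp
      finally show "nt_comp (cover R F) p \<psi> Y (free_gen R (cover_gens F Y) s) = \<phi> Y (free_gen R (cover_gens F Y) s)"
        using s sc Y by (simp add: nt_comp_def compose_eq \<psi>g)
    qed
    thus "nt_comp (cover R F) p \<psi> Y v = \<phi> Y v" by simp
  qed
  thus ?thesis using \<psi> by blast
qed

subsection \<open>The first extension group is a module\<close>

lemma nt_comp_app: "X \<in> fin_obj \<Longrightarrow> m \<in> carrier (fobj F X) \<Longrightarrow> nt_comp F \<theta> \<eta> X m = \<theta> X (\<eta> X m)"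
  by (simp add: nt_comp_def compose_eq)

lemma precomp_hom:
  assumes R: "cring R" and F: "is_functor R F" and F': "is_functor R F'" and G: "is_functor R G"
    and d: "d \<in> nat_trans R F' F"
  shows "(\<lambda>\<phi>\<in>nat_trans R F G. nt_comp F' \<phi> d) \<in> mod_hom R (Hom_mod R F G) (Hom_mod R F' G)"
proof (rule mod_homI)
  note cl = Hom_closed[OF F G] and cl' = Hom_closed[OF F' G]
  have n: "\<phi> \<in> nat_trans R F G \<Longrightarrow> nt_comp F' \<phi> d \<in> nat_trans R F' G" for \<phi>
    by (rule nt_comp_nat[OF d _ F'])
  have dc: "X \<in> fin_obj \<Longrightarrow> m \<in> carrier (fobj F' X) \<Longrightarrow> d X m \<in> carrier (fobj F X)" for X m
    by (rule mod_homD(2)[OF nat_transD(1)[OF d]])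
  show "(\<lambda>\<phi>\<in>nat_trans R F G. nt_comp F' \<phi> d) \<in> carrier (Hom_mod R F G) \<rightarrow>\<^sub>E carrier (Hom_mod R F' G)"
    using n by (auto simp: Hom_simps(1))
  fix x assume x: "x \<in> carrier (Hom_mod R F G)"
  hence x': "x \<in> nat_trans R F G" by (simp add: Hom_simps(1))
  {
    fix y assume "y \<in> carrier (Hom_mod R F G)"
    hence y': "y \<in> nat_trans R F G" by (simp add: Hom_simps(1))
    have "nt_comp F' (x \<oplus>\<^bsub>Hom_mod R F G\<^esub> y) d = nt_comp F' x d \<oplus>\<^bsub>Hom_mod R F' G\<^esub> nt_comp F' y d"
      by (rule nt_eqI[OF n[OF cl(2)[OF x' y']] cl'(2)[OF n[OF x'] n[OF y']]]) (simp add: nt_comp_app Hom_app dc)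
    thus "(\<lambda>\<phi>\<in>nat_trans R F G. nt_comp F' \<phi> d) (x \<oplus>\<^bsub>Hom_mod R F G\<^esub> y) = (\<lambda>\<phi>\<in>nat_trans R F G. nt_comp F' \<phi> d) x \<oplus>\<^bsub>Hom_mod R F' G\<^esub> (\<lambda>\<phi>\<in>nat_trans R F G. nt_comp F' \<phi> d) y"
      using x' y' cl by simp
  }
  fix r assume r: "r \<in> carrier R"
  have "nt_comp F' (r \<odot>\<^bsub>Hom_mod R F G\<^esub> x) d = r \<odot>\<^bsub>Hom_mod R F' G\<^esub> nt_comp F' x d"
    by (rule nt_eqI[OF n[OF cl(3)[OF r x']] cl'(3)[OF r n[OF x']]]) (simp add: nt_comp_app Hom_app dc)
  thus "(\<lambda>\<phi>\<in>nat_trans R F G. nt_comp F' \<phi> d) (r \<odot>\<^bsub>Hom_mod R F G\<^esub> x) = r \<odot>\<^bsub>Hom_mod R F' G\<^esub> (\<lambda>\<phi>\<in>nat_trans R F G. nt_comp F' \<phi> d) x"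
    using x' r cl by simp
qed

lemma image_submodule:
  assumes "module R M" "module R N" "f \<in> mod_hom R M N"
  shows "submodule (f ` carrier M) R N"
proof -
  interpret M: module R M by fact
  interpret N: module R N by fact
  note D = mod_homD[OF assms(3)]
  show ?thesis
  proof (rule N.submoduleI)
    show "\<zero>\<^bsub>N\<^esub> \<in> f ` carrier M" using mod_hom_zero[OF assms(3,1,2)] by (metis M.M.zero_closed image_eqI)
    fix a assume "a \<in> f ` carrier M"
    then obtain x where x: "x \<in> carrier M" "a = f x" by auto
    have "f (\<zero>\<^bsub>M\<^esub> \<ominus>\<^bsub>M\<^esub> x) = \<ominus>\<^bsub>N\<^esub> a"
      using x D(2) mod_hom_minus[OF assms(3,1,2), of "\<zero>\<^bsub>M\<^esub>" x] mod_hom_zero[OF assms(3,1,2)] by (simp add: a_minus_def)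
    thus "\<ominus>\<^bsub>N\<^esub> a \<in> f ` carrier M" using x by (metis M.M.minus_closed M.M.zero_closed image_eqI)
  next
    fix a b assume "a \<in> f ` carrier M" "b \<in> f ` carrier M"
    then obtain x y where "x \<in> carrier M" "a = f x" "y \<in> carrier M" "b = f y" by auto
    thus "a \<oplus>\<^bsub>N\<^esub> b \<in> f ` carrier M" using D(3)[of x y] by (metis M.M.a_closed image_eqI)
  next
    fix r a assume "r \<in> carrier R" "a \<in> f ` carrier M"
    then obtain x where "x \<in> carrier M" "a = f x" "r \<in> carrier R" by auto
    thus "r \<odot>\<^bsub>N\<^esub> a \<in> f ` carrier M" using D(4)[of r x] by (metis M.smult_closed image_eqI)
  qed (use D in auto)
qed

lemma submodule_restrict:
  assumes "module R M" "submodule H R M" "submodule K R M" "K \<subseteq> H"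
  shows "submodule K R (M\<lparr>carrier := H\<rparr>)"
proof -
  interpret N: module R "M\<lparr>carrier := H\<rparr>" by (rule submodule.submodule_is_module[OF assms(2,1)])
  have "module R (M\<lparr>carrier := K\<rparr>)" by (rule submodule.submodule_is_module[OF assms(3,1)])
  thus ?thesis by (intro N.module_incl_imp_submodule) (use assms in auto)
qed

lemma ext1_submodules:
  assumes R: "cring R" and F: "is_functor R F" and G: "is_functor R G"
  shows "submodule (ext1_cocycles R F G) R (Hom_mod R (res1 R F) G)"
    and "submodule (ext1_coboundaries R F G) R (Hom_mod R (res1 R F) G)"
    and "ext1_coboundaries R F G \<subseteq> ext1_cocycles R F G"
proof -
  note r = res_functor[OF R F]
  note H = Hom_module[OF r(1) G R] Hom_module[OF r(2) G R] Hom_module[OF r(3) G R]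
  note c1 = precomp_hom[OF R r(1,2) G r(4)] and c2 = precomp_hom[OF R r(2,3) G r(5)]
  have "ext1_cocycles R F G = {\<phi> \<in> carrier (Hom_mod R (res1 R F) G).
      (\<lambda>\<phi>\<in>nat_trans R (res1 R F) G. nt_comp (res2 R F) \<phi> (diff2 R F)) \<phi> = \<zero>\<^bsub>Hom_mod R (res2 R F) G\<^esub>}"
    by (auto simp: ext1_cocycles_def Hom_simps(1))
  thus "submodule (ext1_cocycles R F G) R (Hom_mod R (res1 R F) G)"
    using ker_submodule[OF H(2,3) c2] by simp
  have "ext1_coboundaries R F G =
      (\<lambda>\<psi>\<in>nat_trans R (res0 R F) G. nt_comp (res1 R F) \<psi> (diff1 R F)) ` carrier (Hom_mod R (res0 R F) G)"
    by (auto simp: ext1_coboundaries_def Hom_simps(1))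
  thus "submodule (ext1_coboundaries R F G) R (Hom_mod R (res1 R F) G)"
    using image_submodule[OF H(1,2) c1] by simp
  show "ext1_coboundaries R F G \<subseteq> ext1_cocycles R F G"
  proof
    fix \<phi> assume "\<phi> \<in> ext1_coboundaries R F G"
    then obtain \<psi> where \<psi>: "\<psi> \<in> nat_trans R (res0 R F) G" and \<phi>: "\<phi> = nt_comp (res1 R F) \<psi> (diff1 R F)"
      by (auto simp: ext1_coboundaries_def)
    have n1: "\<phi> \<in> nat_trans R (res1 R F) G" unfolding \<phi> by (rule nt_comp_nat[OF r(4) \<psi> r(2)])
    have "nt_comp (res2 R F) \<phi> (diff2 R F) = \<zero>\<^bsub>Hom_mod R (res2 R F) G\<^esub>"
    proof (rule nt_eqI[OF nt_comp_nat[OF r(5) n1 r(3)] Hom_closed(1)[OF r(3) G]])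
      fix X m assume X: "X \<in> fin_obj" and m: "m \<in> carrier (fobj (res2 R F) X)"
      have "diff2 R F X m \<in> {m \<in> carrier (fobj (res1 R F) X). diff1 R F X m = \<zero>\<^bsub>fobj (res0 R F) X\<^esub>}"
        unfolding exact1[OF R F X] using m by blast
      moreover have "\<psi> X \<zero>\<^bsub>fobj (res0 R F) X\<^esub> = \<zero>\<^bsub>fobj G X\<^esub>"
        by (rule mod_hom_zero[OF nat_transD(1)[OF \<psi> X] is_functorD(1)[OF r(1) X] is_functorD(1)[OF G X]])
      ultimately show "nt_comp (res2 R F) \<phi> (diff2 R F) X m = \<zero>\<^bsub>Hom_mod R (res2 R F) G\<^esub> X m"
        using X m by (simp add: nt_comp_app Hom_app \<phi>)
    qed
    thus "\<phi> \<in> ext1_cocycles R F G" using n1 by (simp add: ext1_cocycles_def)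
  qed
qed

lemma Ext1_module:
  assumes R: "cring R" and F: "is_functor R F" and G: "is_functor R G"
  shows "module R (Ext1_mod R F G)"
proof -
  note s = ext1_submodules[OF assms]
  note H = Hom_module[OF res_functor(2)[OF R F] G R]
  show ?thesis unfolding Ext1_mod_def
    by (rule quot.quot_module) (simp add: quot_def submodule.submodule_is_module[OF s(1) H] submodule_restrict[OF H s])
qed

end

theory Submission
  imports Defs "HOL-Combinatorics.Permutations"
begin

text \<open>
  Write \<open>T a\<close> for the \<open>a\<close>-th tensor power of the reduced functor, and \<open>rep n\<close> for the functor
  \<open>X \<mapsto> k[X\<^sup>n]\<close>, which for \<open>n > 0\<close> is represented by the set \<open>{0, \<dots>, n - 1}\<close>.

  \<^emph>\<open>Extensions.\<close> Tensoring \<open>0 \<rightarrow> T 1 \<rightarrow> rep 1 \<rightarrow> k \<rightarrow> 0\<close> with \<open>T a\<close> gives an exact sequence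
  \<open>0 \<rightarrow> T (a + 1) \<rightarrow> rep 1 \<otimes> T a \<rightarrow> T a \<rightarrow> 0\<close> whose middle term is a direct summand of \<open>rep (a + 1)\<close>, and
  so is projective. Hence \<open>Ext\<^sup>1(T a, G)\<close> is the quotient of \<open>Hom(T (a + 1), G)\<close> by the morphisms that
  extend to \<open>rep (a + 1)\<close>; by the Yoneda lemma these are given by the elements of \<open>G {0, \<dots>, a}\<close>. This
  is \<open>Ext1_via_obstruction\<close>. It is proved for the resolution by covers directly: \<open>to_cover\<close> and
  \<open>of_cover\<close> compare the cover of \<open>T a\<close> with \<open>rep (a + 1)\<close>.

  \<^emph>\<open>Morphisms.\<close> The functor \<open>T a\<close> is generated by one tensor, the universal chain
  \<open>([0] - [1]) \<otimes> \<dots> \<otimes> ([a - 1] - [a])\<close> (\<open>chain_formula\<close>), so that a morphism \<open>T a \<rightarrow> T b\<close> is determined by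
  an element of \<open>T b {0, \<dots>, a}\<close>. In the basis of tensors of successive differences the coordinates of
  this element are a function on the maps from a set of \<open>b\<close> elements to a set of \<open>a\<close> elements. It
  vanishes off the surjections, since the universal chain dies when two neighbouring points are
  merged; and it is a cocycle, since the alternating sum of the faces of the universal chain is zero.
  The differential of a function \<open>c\<close> on surjections is the alternating sum of the values of \<open>c\<close> at the
  surjections in which two neighbouring values are merged (\<open>differential\<close>), and the functions that
  are differentials come from the morphisms that extend to \<open>rep a\<close>.

  \<^emph>\<open>Exactness.\<close> The complex of functions on ordered set partitions of a set with \<open>b\<close> elements has
  cohomology in the top degree only, of rank one. For this the partitions into \<open>a\<close> blocks, apart from
  the finest one that is in order, are divided into sources and targets, and merging a distinguished
  singleton of a target with the block before it is a bijection from the targets in degree \<open>a + 1\<close> to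
  the sources in degree \<open>a\<close>. With respect to this bijection the differential from functions on the
  sources to functions on the targets is triangular with units on the diagonal, over any ring
  (\<open>coboundary_solve\<close>, \<open>coboundary_unique\<close>). Hence for \<open>0 < a < b\<close> a morphism is given by arbitrary
  coordinates at the targets, and every morphism \<open>T (a + 1) \<rightarrow> T b\<close> extends if \<open>a + 1 < b\<close>. The number
  of targets satisfies the recursion of \<open>Rk\<close> (\<open>card_targets\<close>). In the top degree, \<open>a = b\<close>, all
  permutations occur, and the one coordinate without a partner accounts for \<open>Ext\<^sup>1(T (b - 1), T b)\<close>,
  which is detected by the alternating sum of the coordinates.
\<close>

section \<open>Linear algebra over a commutative ring\<close>

lemma submodule_of_closed:
  assumes "module R M" "H \<subseteq> carrier M" "\<zero>\<^bsub>M\<^esub> \<in> H"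
    and "\<And>a b. a \<in> H \<Longrightarrow> b \<in> H \<Longrightarrow> a \<oplus>\<^bsub>M\<^esub> b \<in> H"
    and smult: "\<And>r a. r \<in> carrier R \<Longrightarrow> a \<in> H \<Longrightarrow> r \<odot>\<^bsub>M\<^esub> a \<in> H"
  shows "submodule H R M"
proof -
  interpret module R M by fact
  show ?thesis
  proof (rule submoduleI)
    fix a assume "a \<in> H"
    then show "\<ominus>\<^bsub>M\<^esub> a \<in> H"
      using smult[of "\<ominus>\<^bsub>R\<^esub> \<one>\<^bsub>R\<^esub>" a] assms(2) by (auto simp: smult_l_minus)
  qed (use assms in auto)
qed

lemma submoduleD:
  assumes "submodule H R M" "module R M"
  shows "H \<subseteq> carrier M" "\<zero>\<^bsub>M\<^esub> \<in> H" "a \<in> H \<Longrightarrow> b \<in> H \<Longrightarrow> a \<oplus>\<^bsub>M\<^esub> b \<in> H"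
    "r \<in> carrier R \<Longrightarrow> a \<in> H \<Longrightarrow> r \<odot>\<^bsub>M\<^esub> a \<in> H"
proof -
  interpret module R M by fact
  interpret submodule H R M by fact
  show "H \<subseteq> carrier M" "a \<in> H \<Longrightarrow> b \<in> H \<Longrightarrow> a \<oplus>\<^bsub>M\<^esub> b \<in> H"
    "r \<in> carrier R \<Longrightarrow> a \<in> H \<Longrightarrow> r \<odot>\<^bsub>M\<^esub> a \<in> H"
    using submoduleE[OF assms(1)] by auto
  show "\<zero>\<^bsub>M\<^esub> \<in> H" using one_closed by simp
qed

lemma equalizer_submodule:
  assumes "module R M" "module R N" "f \<in> mod_hom R M N" "g \<in> mod_hom R M N"
  shows "submodule {v \<in> carrier M. f v = g v} R M"
proof -
  interpret module R M by fact
  show ?thesis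
    by (rule submodule_of_closed)
      (use assms mod_hom_zero[OF assms(3,1,2)] mod_hom_zero[OF assms(4,1,2)] in
        \<open>auto simp: mod_homD[OF assms(3)] mod_homD[OF assms(4)]\<close>)
qed

lemma preimage_submodule:
  assumes "module R M" "module R N" "f \<in> mod_hom R M N" "submodule H R N"
  shows "submodule {v \<in> carrier M. f v \<in> H} R M"
proof -
  interpret module R M by fact
  show ?thesis
    by (rule submodule_of_closed)
      (use assms mod_hom_zero[OF assms(3,1,2)] submoduleD[OF assms(4,2)] in
        \<open>auto simp: mod_homD[OF assms(3)]\<close>)
qed

text \<open>
  The span is described by its elimination rule, which turns a statement about all elements into the
  claim that the elements with a given property form a submodule.
\<close>

definition spans :: "('k, 'r) ring_scheme \<Rightarrow> ('k, 'm, 'x) module_scheme \<Rightarrow> 'm set \<Rightarrow> bool"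
  where "spans R M B \<longleftrightarrow> B \<subseteq> carrier M \<and> (\<forall>H. submodule H R M \<longrightarrow> B \<subseteq> H \<longrightarrow> carrier M \<subseteq> H)"

lemma spansI:
  assumes "B \<subseteq> carrier M" "\<And>H. submodule H R M \<Longrightarrow> B \<subseteq> H \<Longrightarrow> carrier M \<subseteq> H"
  shows "spans R M B"
  using assms by (auto simp: spans_def)

lemma spansD: "spans R M B \<Longrightarrow> submodule H R M \<Longrightarrow> B \<subseteq> H \<Longrightarrow> carrier M \<subseteq> H"
  by (auto simp: spans_def)

lemma spans_hom_eq:
  assumes "module R M" "module R N" "f \<in> mod_hom R M N" "g \<in> mod_hom R M N" "spans R M B"
    and "\<And>v. v \<in> B \<Longrightarrow> f v = g v" "v \<in> carrier M"
  shows "f v = g v"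
proof -
  have "B \<subseteq> {v \<in> carrier M. f v = g v}" using assms by (auto simp: spans_def)
  from spansD[OF assms(5) equalizer_submodule[OF assms(1-4)] this] assms(7) show ?thesis by auto
qed

lemma free_spans:
  assumes "cring R"
  shows "spans R (free_mod R S) (free_gen R S ` S)"
proof (rule spansI)
  show "free_gen R S ` S \<subseteq> carrier (free_mod R S)" by (intro image_subsetI free_gen_closed[OF assms])
  fix H assume H: "submodule H R (free_mod R S)" "free_gen R S ` S \<subseteq> H"
  note D = submoduleD[OF H(1) free_module[OF assms]]
  show "carrier (free_mod R S) \<subseteq> H"
  proof
    fix v assume "v \<in> carrier (free_mod R S)"
    then show "v \<in> H"
      by (rule free_induct[OF assms, where P = "\<lambda>v. v \<in> H"]) (use D H(2) in auto)
  qed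
qed

lemma spans_surj_image:
  assumes "module R M" "module R N" "f \<in> mod_hom R M N" "spans R M B" "f ` B \<subseteq> C"
    and "f ` carrier M = carrier N" "C \<subseteq> carrier N"
  shows "spans R N C"
proof (rule spansI[OF assms(7)])
  fix H assume H: "submodule H R N" "C \<subseteq> H"
  have "B \<subseteq> {v \<in> carrier M. f v \<in> H}" using assms H by (auto simp: spans_def)
  from spansD[OF assms(4) preimage_submodule[OF assms(1-3) H(1)] this]
  show "carrier N \<subseteq> H" unfolding assms(6)[symmetric] by (auto simp only:)
qed

lemma ring_mod_simps:
  "carrier (ring_mod R) = carrier R" "\<zero>\<^bsub>ring_mod R\<^esub> = \<zero>\<^bsub>R\<^esub>"
  "x \<oplus>\<^bsub>ring_mod R\<^esub> y = x \<oplus>\<^bsub>R\<^esub> y" "r \<odot>\<^bsub>ring_mod R\<^esub> x = r \<otimes>\<^bsub>R\<^esub> x"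
  by (auto simp: ring_mod_def)

text \<open>
  Homomorphisms are extensional, and compositions of them need not be syntactically so. The predicate
  speaks of the values on the carrier only, so that it is preserved by substitution.
\<close>

definition lin :: "('k, 'r) ring_scheme \<Rightarrow> ('k, 'm, 'x) module_scheme \<Rightarrow> ('k, 'n, 'y) module_scheme \<Rightarrow> ('m \<Rightarrow> 'n) \<Rightarrow> bool"
  where "lin R M N f \<longleftrightarrow> restrict f (carrier M) \<in> mod_hom R M N"

lemma lin_of_hom: "f \<in> mod_hom R M N \<Longrightarrow> lin R M N f"
  unfolding lin_def by (frule mod_homD(1)) (metis PiE_restrict)

lemma linD:
  assumes "lin R M N f" "module R M"
  shows "x \<in> carrier M \<Longrightarrow> f x \<in> carrier N"
    "x \<in> carrier M \<Longrightarrow> y \<in> carrier M \<Longrightarrow> f (x \<oplus>\<^bsub>M\<^esub> y) = f x \<oplus>\<^bsub>N\<^esub> f y"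
    "r \<in> carrier R \<Longrightarrow> x \<in> carrier M \<Longrightarrow> f (r \<odot>\<^bsub>M\<^esub> x) = r \<odot>\<^bsub>N\<^esub> f x"
proof -
  interpret module R M by fact
  show "x \<in> carrier M \<Longrightarrow> f x \<in> carrier N"
    "x \<in> carrier M \<Longrightarrow> y \<in> carrier M \<Longrightarrow> f (x \<oplus>\<^bsub>M\<^esub> y) = f x \<oplus>\<^bsub>N\<^esub> f y"
    "r \<in> carrier R \<Longrightarrow> x \<in> carrier M \<Longrightarrow> f (r \<odot>\<^bsub>M\<^esub> x) = r \<odot>\<^bsub>N\<^esub> f x"
    using mod_homD(2-4)[OF assms(1)[unfolded lin_def]] by simp_all
qed

lemma linI:
  assumes "module R M"
    "\<And>x. x \<in> carrier M \<Longrightarrow> f x \<in> carrier N"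
    "\<And>x y. x \<in> carrier M \<Longrightarrow> y \<in> carrier M \<Longrightarrow> f (x \<oplus>\<^bsub>M\<^esub> y) = f x \<oplus>\<^bsub>N\<^esub> f y"
    "\<And>r x. r \<in> carrier R \<Longrightarrow> x \<in> carrier M \<Longrightarrow> f (r \<odot>\<^bsub>M\<^esub> x) = r \<odot>\<^bsub>N\<^esub> f x"
  shows "lin R M N f"
proof -
  interpret module R M by fact
  show ?thesis unfolding lin_def by (rule mod_homI) (use assms in auto)
qed

lemma lin_comp:
  assumes "lin R M N g" "lin R N P f" "module R M" "module R N"
  shows "lin R M P (\<lambda>v. f (g v))"
  by (rule linI[OF assms(3)]) (simp_all add: linD[OF assms(1,3)] linD[OF assms(2,4)])

lemma lin_id: "module R M \<Longrightarrow> lin R M M (\<lambda>v. v)"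
  using lin_of_hom[OF mod_hom_id] by (simp add: lin_def)

lemma lin_add:
  assumes "lin R M N f" "lin R M N g" "module R M" "module R N"
  shows "lin R M N (\<lambda>v. f v \<oplus>\<^bsub>N\<^esub> g v)"
proof -
  interpret N: module R N by fact
  show ?thesis
    by (rule linI[OF assms(3)])
      (simp_all add: linD[OF assms(1,3)] linD[OF assms(2,3)] N.M.a_ac N.smult_r_distr)
qed

lemma lin_scal:
  assumes "lin R M (ring_mod R) l" "module R M" "module R N" "m \<in> carrier N"
  shows "lin R M N (\<lambda>v. l v \<odot>\<^bsub>N\<^esub> m)"
proof -
  interpret N: module R N by fact
  note l = linD[OF assms(1,2), unfolded ring_mod_simps]
  show ?thesis
    by (rule linI[OF assms(2)]) (simp_all add: l assms(4) N.smult_l_distr N.smult_assoc1)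
qed

lemma lin_smult:
  assumes "lin R M N f" "r \<in> carrier R" "module R M" "module R N"
  shows "lin R M N (\<lambda>v. r \<odot>\<^bsub>N\<^esub> f v)"
proof -
  interpret N: module R N by fact
  note l = linD[OF assms(1,3)]
  have "r \<odot>\<^bsub>N\<^esub> (s \<odot>\<^bsub>N\<^esub> v) = s \<odot>\<^bsub>N\<^esub> (r \<odot>\<^bsub>N\<^esub> v)" if "s \<in> carrier R" "v \<in> carrier N" for s v
    using that assms(2) by (metis N.R.m_comm N.smult_assoc1)
  then show ?thesis
    by (intro linI[OF assms(3)]) (simp_all add: l assms(2) N.smult_r_distr)
qed

lemma lin_eq_on_spanning:
  assumes "lin R M N f" "lin R M N g" "spans R M B" "module R M" "module R N"
    "\<And>s. s \<in> B \<Longrightarrow> f s = g s" "v \<in> carrier M"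
  shows "f v = g v"
proof -
  have "restrict f (carrier M) v = restrict g (carrier M) v"
    by (rule spans_hom_eq[OF assms(4,5) assms(1,2)[unfolded lin_def] assms(3) _ assms(7)]) (use assms(3,6) in \<open>auto simp: spans_def\<close>)
  then show ?thesis using assms(7) by simp
qed

lemma lin_cong: "lin R M N f \<Longrightarrow> (\<And>v. v \<in> carrier M \<Longrightarrow> f v = g v) \<Longrightarrow> lin R M N g"
  unfolding lin_def using restrict_cong[of "carrier M" "carrier M" g f] by simp

lemma module_minus_zero:
  assumes "module R M" "x \<in> carrier M" "y \<in> carrier M" "x \<ominus>\<^bsub>M\<^esub> y = \<zero>\<^bsub>M\<^esub>"
  shows "x = y"
proof -
  interpret module R M by fact
  show ?thesis using assms(2-4) by (metis M.minus_eq M.minus_equality M.minus_minus M.a_inv_closed)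
qed

lemma mod_iso_of_ker:
  assumes f: "f \<in> mod_hom R M N" and M: "module R M" and N: "module R N"
    and surj: "carrier N \<subseteq> f ` carrier M" and ker: "\<And>x. x \<in> carrier M \<Longrightarrow> f x = \<zero>\<^bsub>N\<^esub> \<Longrightarrow> x = \<zero>\<^bsub>M\<^esub>"
  shows "inj_on f (carrier M)" "mod_iso R M N"
proof -
  interpret M: module R M by fact
  interpret N: module R N by fact
  note D = mod_homD[OF f]
  show inj: "inj_on f (carrier M)"
  proof (rule inj_onI)
    fix x y assume x: "x \<in> carrier M" and y: "y \<in> carrier M" and e: "f x = f y"
    have "f (x \<ominus>\<^bsub>M\<^esub> y) = \<zero>\<^bsub>N\<^esub>"
      using mod_hom_minus[OF f M N x y] e D(2)[OF y] by (simp add: N.M.minus_eq N.M.r_neg)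
    then have "x \<ominus>\<^bsub>M\<^esub> y = \<zero>\<^bsub>M\<^esub>" using ker x y by simp
    then show "x = y" by (rule module_minus_zero[OF M x y])
  qed
  have "bij_betw f (carrier M) (carrier N)" using inj surj D(2) by (auto simp: bij_betw_def)
  then show "mod_iso R M N" using f by (auto simp: mod_iso_def)
qed

lemma mod_iso_trans:
  assumes "mod_iso R M N" "mod_iso R N P" "module R M"
  shows "mod_iso R M P"
proof -
  obtain f g where f: "f \<in> mod_hom R M N" "bij_betw f (carrier M) (carrier N)"
    and g: "g \<in> mod_hom R N P" "bij_betw g (carrier N) (carrier P)"
    using assms by (auto simp: mod_iso_def)
  have "bij_betw (compose (carrier M) g f) (carrier M) (carrier P)"
    using bij_betw_trans[OF f(2) g(2)] by (subst bij_betw_cong[of _ _ "g \<circ> f"]) (auto simp: compose_eq)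
  then show ?thesis using mod_hom_compose[OF f(1) g(1) assms(3)] by (auto simp: mod_iso_def)
qed

lemma free_mod_iso:
  assumes R: "cring R" and S: "finite S"
  shows "mod_iso R (free_mod R S) (free_mod R {..<card S})"
proof -
  obtain h where h: "bij_betw h S {..<card S}" using ex_bij_betw_finite_nat[OF S] by (auto simp: atLeast0LessThan)
  let ?g = "inv_into S h"
  have hS: "h \<in> S \<rightarrow> {..<card S}" using h by (auto simp: bij_betw_def)
  have gT: "?g \<in> {..<card S} \<rightarrow> S" using bij_betw_inv_into[OF h] by (auto simp: bij_betw_def)
  let ?f = "free_map R S {..<card S} h" and ?k = "free_map R {..<card S} S ?g"
  note fh = free_map_hom[OF R hS] and kh = free_map_hom[OF R gT]
  have 1: "?k (?f v) = v" if v: "v \<in> carrier (free_mod R S)" for v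
    using fun_cong[OF free_map_comp[OF R hS gT, of id], of v] fun_cong[OF free_map_id[OF R, of S id], of v] v
      bij_betw_inv_into_left[OF h] by (simp add: compose_eq)
  have 2: "?f (?k v) = v" if v: "v \<in> carrier (free_mod R {..<card S})" for v
    using fun_cong[OF free_map_comp[OF R gT hS, of id], of v] fun_cong[OF free_map_id[OF R, of "{..<card S}" id], of v] v
      bij_betw_inv_into_right[OF h] by (simp add: compose_eq)
  have "bij_betw ?f (carrier (free_mod R S)) (carrier (free_mod R {..<card S}))"
    by (rule bij_betwI[where g = ?k]) (use 1 2 mod_homD(2)[OF fh] mod_homD(2)[OF kh] in auto)
  then show ?thesis using fh by (auto simp: mod_iso_def)
qed

section \<open>Multilinear maps and pure tensors\<close>

text \<open>
  Linearity in each entry is expressed through homomorphisms, so that facts about kernels, equalizers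
  and preimages apply to each entry.
\<close>

definition multilinear ::
    "('k, 'r) ring_scheme \<Rightarrow> ('k, 'm) module \<Rightarrow> nat \<Rightarrow> ('k, 'n) module \<Rightarrow> ((nat \<Rightarrow> 'm) \<Rightarrow> 'n) \<Rightarrow> bool"
  where "multilinear R M a N \<Phi> \<longleftrightarrow>
     (\<forall>x\<in>tuples M a. \<Phi> x \<in> carrier N \<and>
       (\<forall>i<a. (\<lambda>v\<in>carrier M. \<Phi> (x(i := v))) \<in> mod_hom R M N))"

lemma tuples_upd: "x \<in> tuples M a \<Longrightarrow> i < a \<Longrightarrow> u \<in> carrier M \<Longrightarrow> x(i := u) \<in> tuples M a"
  by (auto simp: tuples_def PiE_iff extensional_def)

lemma multilinearD:
  assumes "multilinear R M a N \<Phi>" "x \<in> tuples M a"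
  shows "\<Phi> x \<in> carrier N" "i < a \<Longrightarrow> (\<lambda>v\<in>carrier M. \<Phi> (x(i := v))) \<in> mod_hom R M N"
  using assms by (auto simp: multilinear_def)

lemma multilinearI:
  assumes "module R M"
    and "\<And>x. x \<in> tuples M a \<Longrightarrow> \<Phi> x \<in> carrier N"
    and "\<And>x i u v. x \<in> tuples M a \<Longrightarrow> i < a \<Longrightarrow> u \<in> carrier M \<Longrightarrow> v \<in> carrier M \<Longrightarrow>
      \<Phi> (x(i := u \<oplus>\<^bsub>M\<^esub> v)) = \<Phi> (x(i := u)) \<oplus>\<^bsub>N\<^esub> \<Phi> (x(i := v))"
    and "\<And>x i r u. x \<in> tuples M a \<Longrightarrow> i < a \<Longrightarrow> r \<in> carrier R \<Longrightarrow> u \<in> carrier M \<Longrightarrow>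
      \<Phi> (x(i := r \<odot>\<^bsub>M\<^esub> u)) = r \<odot>\<^bsub>N\<^esub> \<Phi> (x(i := u))"
  shows "multilinear R M a N \<Phi>"
proof -
  interpret module R M by fact
  show ?thesis unfolding multilinear_def
  proof (intro ballI conjI allI impI)
    fix x i assume x: "x \<in> tuples M a" "i < a"
    show "(\<lambda>v\<in>carrier M. \<Phi> (x(i := v))) \<in> mod_hom R M N"
      by (rule mod_homI) (use x assms(2)[OF tuples_upd] assms(3,4) in auto)
  qed (use assms(2) in auto)
qed

lemma multilinear_add:
  assumes "multilinear R M a N \<Phi>" "x \<in> tuples M a" "i < a" "u \<in> carrier M" "v \<in> carrier M" "module R M"
  shows "\<Phi> (x(i := u \<oplus>\<^bsub>M\<^esub> v)) = \<Phi> (x(i := u)) \<oplus>\<^bsub>N\<^esub> \<Phi> (x(i := v))"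
proof -
  interpret module R M by fact
  show ?thesis using mod_homD(3)[OF multilinearD(2)[OF assms(1-3)] assms(4,5)] assms(4,5) by simp
qed

lemma multilinear_smult:
  assumes "multilinear R M a N \<Phi>" "x \<in> tuples M a" "i < a" "r \<in> carrier R" "u \<in> carrier M" "module R M"
  shows "\<Phi> (x(i := r \<odot>\<^bsub>M\<^esub> u)) = r \<odot>\<^bsub>N\<^esub> \<Phi> (x(i := u))"
proof -
  interpret module R M by fact
  show ?thesis using mod_homD(4)[OF multilinearD(2)[OF assms(1-3)] assms(4,5)] assms(4,5) by simp
qed

lemma multilinear_compose_hom:
  assumes "multilinear R M a N \<Phi>" "g \<in> mod_hom R N P" "module R M"
  shows "multilinear R M a P (\<lambda>x. g (\<Phi> x))"
  using multilinearD(1)[OF assms(1)] mod_homD(2-4)[OF assms(2)]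
  by (intro multilinearI[OF assms(3)])
    (simp_all add: multilinear_add[OF assms(1) _ _ _ _ assms(3)] multilinear_smult[OF assms(1) _ _ _ _ assms(3)] tuples_upd)

lemma multilinear_tuple_map:
  assumes "multilinear R N a P \<Phi>" "f \<in> mod_hom R M N" "module R M" "module R N"
  shows "multilinear R M a P (\<lambda>x. \<Phi> (tuple_map a f x))"
proof -
  have t: "x \<in> tuples M a \<Longrightarrow> tuple_map a f x \<in> tuples N a" for x
    using tuple_map_tuples[OF assms(2)] by blast
  show ?thesis
    using multilinearD(1)[OF assms(1) t] mod_homD(2-4)[OF assms(2)] t
    by (intro multilinearI[OF assms(3)])
      (simp_all add: multilinear_add[OF assms(1) _ _ _ _ assms(4)] multilinear_smult[OF assms(1) _ _ _ _ assms(4)] tuple_map_upd)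
qed

text \<open>
  A property of tuples that is linear in each entry need only be checked on tuples of generators:
  the entries are replaced one at a time.
\<close>

lemma tuples_span_induct:
  assumes B: "spans R M B" and x: "x \<in> tuples M a"
    and lin: "\<And>x i. x \<in> tuples M a \<Longrightarrow> i < a \<Longrightarrow> submodule {v \<in> carrier M. P (x(i := v))} R M"
    and gen: "\<And>x. x \<in> {..<a} \<rightarrow>\<^sub>E B \<Longrightarrow> P x"
  shows "P x"
proof -
  have BM: "B \<subseteq> carrier M" using B by (simp add: spans_def)
  have "n \<le> a \<Longrightarrow> x \<in> tuples M a \<Longrightarrow> (\<And>i. n \<le> i \<Longrightarrow> i < a \<Longrightarrow> x i \<in> B) \<Longrightarrow> P x" for n x
  proof (induction n arbitrary: x)
    case 0
    then show ?case by (intro gen) (auto simp: tuples_def PiE_iff)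
  next
    case (Suc n)
    have n: "n < a" using Suc by simp
    have "B \<subseteq> {v \<in> carrier M. P (x(n := v))}"
      using Suc BM tuples_upd[OF Suc.prems(2) n] by (auto intro!: Suc.IH)
    from spansD[OF B lin[OF Suc.prems(2) n] this]
    have "P (x(n := x n))" using Suc n by (auto simp: tuples_def PiE_iff)
    then show ?case by simp
  qed
  from this[of a x] x show ?thesis by auto
qed

lemma multilinear_eq_on_spanning:
  assumes "module R M" "module R N" "multilinear R M a N \<Phi>" "multilinear R M a N \<Psi>" "spans R M B"
    and "\<And>x. x \<in> {..<a} \<rightarrow>\<^sub>E B \<Longrightarrow> \<Phi> x = \<Psi> x" "x \<in> tuples M a"
  shows "\<Phi> x = \<Psi> x"
  using assms(5,7)
proof (rule tuples_span_induct)
  fix x i assume x: "x \<in> tuples M a" "i < a"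
  have "{v \<in> carrier M. \<Phi> (x(i := v)) = \<Psi> (x(i := v))} = {v \<in> carrier M. (\<lambda>v\<in>carrier M. \<Phi> (x(i := v))) v = (\<lambda>v\<in>carrier M. \<Psi> (x(i := v))) v}" by auto
  then show "submodule {v \<in> carrier M. \<Phi> (x(i := v)) = \<Psi> (x(i := v))} R M"
    using equalizer_submodule[OF assms(1,2) multilinearD(2)[OF assms(3) x] multilinearD(2)[OF assms(4) x]] by simp
qed (rule assms(6))

definition tpure ::
    "('k, 'r) ring_scheme \<Rightarrow> ('k, 'm) module \<Rightarrow> nat \<Rightarrow> (nat \<Rightarrow> 'm) \<Rightarrow> ((nat \<Rightarrow> 'm) \<Rightarrow> 'k) set"
  where "tpure R M a x =
    multilin_span R M a +>\<^bsub>free_mod R (tuples M a)\<^esub> free_gen R (tuples M a) x"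

lemma (in quot) coset_hom: "(\<lambda>x\<in>carrier M. N +>\<^bsub>M\<^esub> x) \<in> mod_hom R M (quot_mod M N)"
  by (rule mod_homI) (auto simp: q_closed q_add q_smult)

lemma (in quot) coset_eqI:
  assumes "x \<in> carrier M" "y \<in> carrier M" "x \<ominus>\<^bsub>M\<^esub> y \<in> N"
  shows "N +>\<^bsub>M\<^esub> x = N +>\<^bsub>M\<^esub> y"
  using q.a_rcos_module[OF assms(2,1)] assms(2,3) q.a_repr_independence'
  by (simp add: a_minus_def)

lemma (in quot) quot_lift:
  assumes f: "f \<in> mod_hom R M P" and P: "module R P" and z: "\<And>n. n \<in> N \<Longrightarrow> f n = \<zero>\<^bsub>P\<^esub>"
  defines "F \<equiv> (\<lambda>C\<in>carrier (quot_mod M N). the_elem (f ` C))"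
  shows "x \<in> carrier M \<Longrightarrow> F (N +>\<^bsub>M\<^esub> x) = f x" "F \<in> mod_hom R (quot_mod M N) P"
proof -
  interpret P: module R P by fact
  show *: "F (N +>\<^bsub>M\<^esub> x) = f x" if x: "x \<in> carrier M" for x
  proof -
    have "f y = f x" if "y \<in> N +>\<^bsub>M\<^esub> x" for y
      using that x z N_carrier mod_homD(2,3)[OF f] by (auto simp: a_r_coset_def')
    moreover have "x \<in> N +>\<^bsub>M\<^esub> x" using x q.a_rcos_self by blast
    ultimately have "f ` (N +>\<^bsub>M\<^esub> x) = {f x}" by blast
    then show ?thesis using q_closed x by (simp add: F_def)
  qed
  show "F \<in> mod_hom R (quot_mod M N) P"
  proof (rule mod_homI)
    show "F \<in> carrier (quot_mod M N) \<rightarrow>\<^sub>E carrier P"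
    proof (rule PiE_I)
      fix C assume "C \<in> carrier (quot_mod M N)"
      then show "F C \<in> carrier P" using * mod_homD(2)[OF f] by (auto simp: q_carrier)
    qed (simp add: F_def)
  qed (auto simp: q_carrier q_add q_smult * mod_homD[OF f])
qed

lemma quot_iso:
  assumes q: "quot R M N" and f: "f \<in> mod_hom R M P" and P: "module R P"
    and surj: "f ` carrier M = carrier P" and ker: "\<And>x. x \<in> carrier M \<Longrightarrow> f x = \<zero>\<^bsub>P\<^esub> \<longleftrightarrow> x \<in> N"
  shows "mod_iso R (quot_mod M N) P"
proof -
  interpret quot R M N by fact
  interpret P: module R P by fact
  have z: "n \<in> N \<Longrightarrow> f n = \<zero>\<^bsub>P\<^esub>" for n using ker N_carrier by blast
  define F where "F = (\<lambda>C\<in>carrier (quot_mod M N). the_elem (f ` C))"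
  note l = quot_lift[OF f P z, folded F_def]
  have "bij_betw F (carrier (quot_mod M N)) (carrier P)"
    unfolding bij_betw_def
  proof
    show "inj_on F (carrier (quot_mod M N))"
    proof (rule inj_onI)
      fix C D assume "C \<in> carrier (quot_mod M N)" "D \<in> carrier (quot_mod M N)" and eq: "F C = F D"
      then obtain x y where x: "x \<in> carrier M" "C = N +>\<^bsub>M\<^esub> x" and y: "y \<in> carrier M" "D = N +>\<^bsub>M\<^esub> y"
        by (auto simp: q_carrier)
      have "f (x \<ominus>\<^bsub>M\<^esub> y) = f x \<ominus>\<^bsub>P\<^esub> f y" by (rule mod_hom_minus[OF f module_axioms P x(1) y(1)])
      also have "\<dots> = \<zero>\<^bsub>P\<^esub>" using eq l(1) x y mod_homD(2)[OF f] by (simp add: P.M.minus_eq P.M.r_neg)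
      finally have "x \<ominus>\<^bsub>M\<^esub> y \<in> N" using ker x y by simp
      then show "C = D" using coset_eqI x y by simp
    qed
    show "F ` carrier (quot_mod M N) = carrier P"
    proof
      show "F ` carrier (quot_mod M N) \<subseteq> carrier P" using mod_homD(2)[OF l(2)] by blast
      show "carrier P \<subseteq> F ` carrier (quot_mod M N)"
      proof
        fix p assume "p \<in> carrier P"
        then obtain x where "x \<in> carrier M" "p = f x" using surj by blast
        then show "p \<in> F ` carrier (quot_mod M N)" using l(1) q_closed by (metis image_eqI)
      qed
    qed
  qed
  then show ?thesis using l(2) by (auto simp: mod_iso_def)
qed

lemma tpure_multilinear:
  assumes M: "module R M"
  shows "multilinear R M a (tensor_pow R M a) (tpure R M a)"
proof -
  interpret M: module R M by fact
  interpret q: quot R "free_mod R (tuples M a)" "multilin_span R M a" by (rule tensor_quot) fact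
  note R = M.R.cring_axioms
  have g: "x \<in> tuples M a \<Longrightarrow> free_gen R (tuples M a) x \<in> carrier (free_mod R (tuples M a))" for x
    by (rule free_gen_closed[OF R])
  have rel: "multilin_rels R M a \<subseteq> multilin_span R M a"
    unfolding multilin_span_def by (rule submod_span_subset)
  show ?thesis
  proof (rule multilinearI[OF M])
    fix x assume "x \<in> tuples M a"
    then show "tpure R M a x \<in> carrier (tensor_pow R M a)"
      using q.q_closed g by (simp add: tpure_def tensor_pow_def)
  next
    fix x i u v assume x: "x \<in> tuples M a" "i < a" "u \<in> carrier M" "v \<in> carrier M"
    note t = tuples_upd[OF x(1,2)]
    have "multilin_span R M a +>\<^bsub>free_mod R (tuples M a)\<^esub> free_gen R (tuples M a) (x(i := u \<oplus>\<^bsub>M\<^esub> v)) =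
       multilin_span R M a +>\<^bsub>free_mod R (tuples M a)\<^esub> (free_gen R (tuples M a) (x(i := u)) \<oplus>\<^bsub>free_mod R (tuples M a)\<^esub> free_gen R (tuples M a) (x(i := v)))"
    proof (rule q.coset_eqI)
      show "free_gen R (tuples M a) (x(i := u \<oplus>\<^bsub>M\<^esub> v)) \<ominus>\<^bsub>free_mod R (tuples M a)\<^esub> (free_gen R (tuples M a) (x(i := u)) \<oplus>\<^bsub>free_mod R (tuples M a)\<^esub> free_gen R (tuples M a) (x(i := v))) \<in> multilin_span R M a"
        using x by (intro subsetD[OF rel]) (auto simp: multilin_rels_def Let_def)
    qed (use x t g in auto)
    then show "tpure R M a (x(i := u \<oplus>\<^bsub>M\<^esub> v)) = tpure R M a (x(i := u)) \<oplus>\<^bsub>tensor_pow R M a\<^esub> tpure R M a (x(i := v))"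
      using x t g by (simp add: tpure_def tensor_pow_def q.q_add)
  next
    fix x i r u assume x: "x \<in> tuples M a" "i < a" "r \<in> carrier R" "u \<in> carrier M"
    note t = tuples_upd[OF x(1,2)]
    have "multilin_span R M a +>\<^bsub>free_mod R (tuples M a)\<^esub> free_gen R (tuples M a) (x(i := r \<odot>\<^bsub>M\<^esub> u)) =
       multilin_span R M a +>\<^bsub>free_mod R (tuples M a)\<^esub> (r \<odot>\<^bsub>free_mod R (tuples M a)\<^esub> free_gen R (tuples M a) (x(i := u)))"
    proof (rule q.coset_eqI)
      show "free_gen R (tuples M a) (x(i := r \<odot>\<^bsub>M\<^esub> u)) \<ominus>\<^bsub>free_mod R (tuples M a)\<^esub> (r \<odot>\<^bsub>free_mod R (tuples M a)\<^esub> free_gen R (tuples M a) (x(i := u))) \<in> multilin_span R M a"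
        using x by (intro subsetD[OF rel]) (auto simp: multilin_rels_def Let_def)
    qed (use x t g in auto)
    then show "tpure R M a (x(i := r \<odot>\<^bsub>M\<^esub> u)) = r \<odot>\<^bsub>tensor_pow R M a\<^esub> tpure R M a (x(i := u))"
      using x t g by (simp add: tpure_def tensor_pow_def q.q_smult)
  qed
qed

lemma tpure_closed: "module R M \<Longrightarrow> x \<in> tuples M a \<Longrightarrow> tpure R M a x \<in> carrier (tensor_pow R M a)"
  using multilinearD(1)[OF tpure_multilinear] .

text \<open>
  Tensor powers enter the argument only through this lemma and the universal property below: they are
  spanned by the pure tensors of generators, and linear maps out of them are multilinear maps.
\<close>

lemma tensor_pow_spans:
  assumes M: "module R M" and B: "spans R M B"
  shows "spans R (tensor_pow R M a) (tpure R M a ` ({..<a} \<rightarrow>\<^sub>E B))"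
proof (rule spansI)
  interpret M: module R M by fact
  interpret q: quot R "free_mod R (tuples M a)" "multilin_span R M a" by (rule tensor_quot) fact
  note R = M.R.cring_axioms
  note T = tensor_pow_module[OF M, of a]
  have g: "x \<in> tuples M a \<Longrightarrow> free_gen R (tuples M a) x \<in> carrier (free_mod R (tuples M a))" for x
    by (rule free_gen_closed[OF R])
  have BT: "{..<a} \<rightarrow>\<^sub>E B \<subseteq> tuples M a" using B by (auto simp: tuples_def spans_def)
  then show "tpure R M a ` ({..<a} \<rightarrow>\<^sub>E B) \<subseteq> carrier (tensor_pow R M a)"
    using tpure_closed[OF M] by blast
  fix H assume H: "submodule H R (tensor_pow R M a)" "tpure R M a ` ({..<a} \<rightarrow>\<^sub>E B) \<subseteq> H"
  have pure: "tpure R M a x \<in> H" if "x \<in> tuples M a" for x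
    using B that
  proof (rule tuples_span_induct)
    fix x i assume x: "x \<in> tuples M a" "i < a"
    have "{v \<in> carrier M. tpure R M a (x(i := v)) \<in> H} = {v \<in> carrier M. (\<lambda>v\<in>carrier M. tpure R M a (x(i := v))) v \<in> H}" by auto
    then show "submodule {v \<in> carrier M. tpure R M a (x(i := v)) \<in> H} R M"
      using preimage_submodule[OF M T multilinearD(2)[OF tpure_multilinear[OF M] x] H(1)] by simp
  qed (use H in auto)
  have "spans R (tensor_pow R M a) (tpure R M a ` tuples M a)"
  proof (rule spans_surj_image[OF q.module_axioms _ _ free_spans[OF R]])
    show "module R (tensor_pow R M a)" by (rule T)
    show "(\<lambda>x\<in>carrier (free_mod R (tuples M a)). multilin_span R M a +>\<^bsub>free_mod R (tuples M a)\<^esub> x) \<in> mod_hom R (free_mod R (tuples M a)) (tensor_pow R M a)"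
      using q.coset_hom by (simp add: tensor_pow_def)
    show "(\<lambda>x\<in>carrier (free_mod R (tuples M a)). multilin_span R M a +>\<^bsub>free_mod R (tuples M a)\<^esub> x) ` free_gen R (tuples M a) ` tuples M a \<subseteq> tpure R M a ` tuples M a"
      using g by (auto simp: tpure_def)
    show "(\<lambda>x\<in>carrier (free_mod R (tuples M a)). multilin_span R M a +>\<^bsub>free_mod R (tuples M a)\<^esub> x) ` carrier (free_mod R (tuples M a)) = carrier (tensor_pow R M a)"
      by (auto simp: tensor_pow_def q.q_carrier)
  qed (use tpure_closed[OF M] in auto)
  then show "carrier (tensor_pow R M a) \<subseteq> H" using pure H(1) by (auto simp: spans_def)
qed

lemma spans_carrier: "spans R M (carrier M)" by (auto simp: spans_def)

lemma tpure_zero: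
  assumes M: "module R M" and x: "x \<in> tuples M a" "i < a" "x i = \<zero>\<^bsub>M\<^esub>"
  shows "tpure R M a x = \<zero>\<^bsub>tensor_pow R M a\<^esub>"
proof -
  interpret M: module R M by fact
  have "tpure R M a (x(i := \<zero>\<^bsub>M\<^esub>)) = \<zero>\<^bsub>tensor_pow R M a\<^esub>"
    using mod_hom_zero[OF multilinearD(2)[OF tpure_multilinear[OF M] x(1,2)] M tensor_pow_module[OF M]] by simp
  then show ?thesis using x(3) by (metis fun_upd_triv)
qed

lemma tensor_pow_hom_eqI:
  assumes "module R M" "module R N" "f \<in> mod_hom R (tensor_pow R M a) N" "g \<in> mod_hom R (tensor_pow R M a) N"
    and "\<And>x. x \<in> tuples M a \<Longrightarrow> f (tpure R M a x) = g (tpure R M a x)" "v \<in> carrier (tensor_pow R M a)"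
  shows "f v = g v"
  using tensor_pow_module[OF assms(1)] assms(2-4) tensor_pow_spans[OF assms(1) spans_carrier] _ assms(6)
  by (rule spans_hom_eq) (use assms(5) in \<open>auto simp: tuples_def\<close>)

definition tensor_lift ::
    "('k, 'r) ring_scheme \<Rightarrow> ('k, 'm) module \<Rightarrow> nat \<Rightarrow> ('k, 'n) module \<Rightarrow> ((nat \<Rightarrow> 'm) \<Rightarrow> 'n)
      \<Rightarrow> ((nat \<Rightarrow> 'm) \<Rightarrow> 'k) set \<Rightarrow> 'n"
  where "tensor_lift R M a N \<Phi> =
    (\<lambda>C\<in>carrier (tensor_pow R M a). the_elem (free_lift R (tuples M a) N \<Phi> ` C))"

lemma tensor_lift:
  assumes M: "module R M" and N: "module R N" and \<Phi>: "multilinear R M a N \<Phi>"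
  shows "tensor_lift R M a N \<Phi> \<in> mod_hom R (tensor_pow R M a) N"
    and "x \<in> tuples M a \<Longrightarrow> tensor_lift R M a N \<Phi> (tpure R M a x) = \<Phi> x"
proof -
  interpret M: module R M by fact
  interpret N: module R N by fact
  interpret q: quot R "free_mod R (tuples M a)" "multilin_span R M a" by (rule tensor_quot) fact
  note R = M.R.cring_axioms
  have \<Phi>c: "\<Phi> \<in> tuples M a \<rightarrow> carrier N" using multilinearD(1)[OF \<Phi>] by blast
  define f where "f = free_lift R (tuples M a) N \<Phi>"
  have f: "f \<in> mod_hom R (free_mod R (tuples M a)) N" unfolding f_def by (rule free_lift_hom[OF N \<Phi>c])
  have fg: "x \<in> tuples M a \<Longrightarrow> f (free_gen R (tuples M a) x) = \<Phi> x" for x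
    unfolding f_def by (rule free_lift_gen[OF N \<Phi>c])
  have g: "x \<in> tuples M a \<Longrightarrow> free_gen R (tuples M a) x \<in> carrier (free_mod R (tuples M a))" for x
    by (rule free_gen_closed[OF R])
  note minus = mod_hom_minus[OF f q.module_axioms N]
  have "multilin_rels R M a \<subseteq> {v \<in> carrier (free_mod R (tuples M a)). f v = \<zero>\<^bsub>N\<^esub>}"
  proof
    fix z assume z: "z \<in> multilin_rels R M a"
    then have "f z = \<zero>\<^bsub>N\<^esub>" unfolding multilin_rels_def Let_def
    proof (elim UnE CollectE exE conjE, goal_cases)
      case (1 x i u v)
      note t = tuples_upd[OF 1(2,3)]
      have "\<Phi> (x(i := u \<oplus>\<^bsub>M\<^esub> v)) = \<Phi> (x(i := u)) \<oplus>\<^bsub>N\<^esub> \<Phi> (x(i := v))"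
        using mod_homD(3)[OF multilinearD(2)[OF \<Phi> 1(2,3)] 1(4,5)] 1 by simp
      moreover have "\<Phi> (x(i := u)) \<in> carrier N" "\<Phi> (x(i := v)) \<in> carrier N" using \<Phi>c t 1 by auto
      ultimately show ?case using 1 t by (simp add: minus g fg mod_homD(3)[OF f] N.M.r_neg N.M.minus_eq)
    next
      case (2 x i r u)
      note t = tuples_upd[OF 2(2,3)]
      have "\<Phi> (x(i := r \<odot>\<^bsub>M\<^esub> u)) = r \<odot>\<^bsub>N\<^esub> \<Phi> (x(i := u))"
        using mod_homD(4)[OF multilinearD(2)[OF \<Phi> 2(2,3)] 2(4,5)] 2 by simp
      moreover have "\<Phi> (x(i := u)) \<in> carrier N" using \<Phi>c t 2 by auto
      ultimately show ?case using 2 t by (simp add: minus g fg mod_homD(4)[OF f] N.M.r_neg N.M.minus_eq)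
    qed
    then show "z \<in> {v \<in> carrier (free_mod R (tuples M a)). f v = \<zero>\<^bsub>N\<^esub>}" using z rels_carrier[OF M] by auto
  qed
  then have "multilin_span R M a \<subseteq> {v \<in> carrier (free_mod R (tuples M a)). f v = \<zero>\<^bsub>N\<^esub>}"
    unfolding multilin_span_def by (rule submod_span_least[OF ker_submodule[OF q.module_axioms N f]])
  then have z: "n \<in> multilin_span R M a \<Longrightarrow> f n = \<zero>\<^bsub>N\<^esub>" for n by blast
  note l = q.quot_lift[OF f N z]
  show "tensor_lift R M a N \<Phi> \<in> mod_hom R (tensor_pow R M a) N"
    using l(2) by (simp add: tensor_lift_def tensor_pow_def f_def)
  show "tensor_lift R M a N \<Phi> (tpure R M a x) = \<Phi> x" if "x \<in> tuples M a"
    using l(1)[OF _ g[OF that]] that fg by (simp add: tensor_lift_def tensor_pow_def f_def tpure_def)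
qed

lemma tensor_pow_map_tpure:
  assumes f: "f \<in> mod_hom R M N" and M: "module R M" and N: "module R N" and x: "x \<in> tuples M a"
  shows "tensor_pow_map R M N a f (tpure R M a x) = tpure R N a (tuple_map a f x)"
proof -
  have R: "cring R" using M module.axioms by blast
  show ?thesis
    using tensor_pow_map(2)[OF f M N free_gen_closed[OF R x]] free_map_gen[OF R tuple_map_tuples[OF f] x]
    by (simp add: tpure_def)
qed


section \<open>Functions on tuples of points\<close>

abbreviation tup :: "nat \<Rightarrow> nat set \<Rightarrow> (nat \<Rightarrow> nat) set"
  where "tup n X \<equiv> fin_hom {..<n} X"

text \<open>
  For \<open>n > 0\<close> this is the projective functor represented by \<open>{..<n}\<close>. Its elements are written as
  functions on tuples, so that tensors become functions of several variables.
\<close>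

definition rep :: "('k, 'r) ring_scheme \<Rightarrow> nat \<Rightarrow> ('k, (nat \<Rightarrow> nat) \<Rightarrow> 'k) fin_functor"
  where "rep R n = \<lparr>fobj = (\<lambda>X. free_mod R (tup n X)),
    fmor = (\<lambda>X Y f. free_map R (tup n X) (tup n Y) (compose {..<n} f))\<rparr>"

definition coord :: "('k, 'r) ring_scheme \<Rightarrow> nat \<Rightarrow> nat set \<Rightarrow> (nat \<Rightarrow> nat \<Rightarrow> 'k) \<Rightarrow> (nat \<Rightarrow> nat) \<Rightarrow> 'k"
  where "coord R a X x = (\<lambda>y\<in>tup a X. finprod R (\<lambda>i. x i (y i)) {..<a})"

definition pairing :: "('k, 'r) ring_scheme \<Rightarrow> 's set \<Rightarrow> ('s \<Rightarrow> 'k) \<Rightarrow> ('s \<Rightarrow> 'k) \<Rightarrow> 'k"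
  where "pairing R S p = free_lift R S (ring_mod R) p"

definition tens :: "('k, 'r) ring_scheme \<Rightarrow> nat \<Rightarrow> nat set \<Rightarrow> ((nat \<Rightarrow> nat) \<Rightarrow> 'k) \<Rightarrow> (nat \<Rightarrow> 'k) \<Rightarrow> (nat \<Rightarrow> nat) \<Rightarrow> 'k"
  where "tens R a X w v = (\<lambda>z\<in>tup (Suc a) X. w (restrict z {..<a}) \<otimes>\<^bsub>R\<^esub> v (z a))"

definition diff :: "('k, 'r) ring_scheme \<Rightarrow> nat set \<Rightarrow> nat \<Rightarrow> nat \<Rightarrow> nat \<Rightarrow> 'k"
  where "diff R X x y = free_gen R X x \<ominus>\<^bsub>free_mod R X\<^esub> free_gen R X y"

lemma PiE_image_obtain:
  assumes "x \<in> I \<rightarrow>\<^sub>E f ` X"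
  obtains y where "y \<in> I \<rightarrow>\<^sub>E X" "x = (\<lambda>i\<in>I. f (y i))"
proof
  show "(\<lambda>i\<in>I. SOME u. u \<in> X \<and> f u = x i) \<in> I \<rightarrow>\<^sub>E X"
    "x = (\<lambda>i\<in>I. f ((\<lambda>i\<in>I. SOME u. u \<in> X \<and> f u = x i) i))"
  proof -
    have *: "(SOME u. u \<in> X \<and> f u = x i) \<in> X \<and> f (SOME u. u \<in> X \<and> f u = x i) = x i" if "i \<in> I" for i
      by (rule someI_ex) (use assms that in \<open>force simp: PiE_iff\<close>)
    then show "(\<lambda>i\<in>I. SOME u. u \<in> X \<and> f u = x i) \<in> I \<rightarrow>\<^sub>E X" by auto
    show "x = (\<lambda>i\<in>I. f ((\<lambda>i\<in>I. SOME u. u \<in> X \<and> f u = x i) i))"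
      using assms * by (intro extensionalityI[of x I]) (auto simp: PiE_iff)
  qed
qed

lemma tup_finite: "finite X \<Longrightarrow> finite (tup n X)"
  by (auto simp: fin_hom_def intro: finite_PiE)

lemma tup_upd: "u \<in> tup a X \<Longrightarrow> y \<in> X \<Longrightarrow> u(a := y) \<in> tup (Suc a) X"
  by (auto simp: fin_hom_def PiE_iff extensional_def)

lemma tup_restrict: "z \<in> tup (Suc a) X \<Longrightarrow> restrict z {..<a} \<in> tup a X"
  by (auto simp: fin_hom_def PiE_iff)

lemma tup_app: "z \<in> tup a X \<Longrightarrow> i < a \<Longrightarrow> z i \<in> X"
  by (auto simp: fin_hom_def PiE_iff)

lemma tup_compose: "z \<in> tup a X \<Longrightarrow> f \<in> fin_hom X Y \<Longrightarrow> compose {..<a} f z \<in> tup a Y"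
  by (rule fin_hom_compose)

lemma tup_fin_obj: "{..<Suc n} \<in> fin_obj"
  by (auto simp: fin_obj_def)

lemma free_add_app: "s \<in> S \<Longrightarrow> (u \<oplus>\<^bsub>free_mod R S\<^esub> v) s = u s \<oplus>\<^bsub>R\<^esub> v s"
  by (simp add: free_simps)

lemma free_smult_app: "s \<in> S \<Longrightarrow> (r \<odot>\<^bsub>free_mod R S\<^esub> v) s = r \<otimes>\<^bsub>R\<^esub> v s"
  by (simp add: free_simps)

text \<open>
  Multilinear maps on the free module of a set are used on the reduced submodule as well.
\<close>

lemma multilinear_submodule:
  assumes "multilinear R M a N \<Phi>" "module R M" "H \<subseteq> carrier M" "module R (M\<lparr>carrier := H\<rparr>)"
  shows "multilinear R (M\<lparr>carrier := H\<rparr>) a N \<Phi>"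
proof (rule multilinearI[OF assms(4)])
  have t: "x \<in> tuples (M\<lparr>carrier := H\<rparr>) a \<Longrightarrow> x \<in> tuples M a" for x
    using assms(3) by (auto simp: tuples_def PiE_iff)
  show "x \<in> tuples (M\<lparr>carrier := H\<rparr>) a \<Longrightarrow> \<Phi> x \<in> carrier N" for x
    using multilinearD(1)[OF assms(1) t] .
  show "\<Phi> (x(i := u \<oplus>\<^bsub>M\<lparr>carrier := H\<rparr>\<^esub> v)) = \<Phi> (x(i := u)) \<oplus>\<^bsub>N\<^esub> \<Phi> (x(i := v))"
    if "x \<in> tuples (M\<lparr>carrier := H\<rparr>) a" "i < a" "u \<in> carrier (M\<lparr>carrier := H\<rparr>)" "v \<in> carrier (M\<lparr>carrier := H\<rparr>)" for x i u v
    using multilinear_add[OF assms(1) t[OF that(1)] that(2), of u v] that assms(2,3) by auto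
  show "\<Phi> (x(i := r \<odot>\<^bsub>M\<lparr>carrier := H\<rparr>\<^esub> u)) = r \<odot>\<^bsub>N\<^esub> \<Phi> (x(i := u))"
    if "x \<in> tuples (M\<lparr>carrier := H\<rparr>) a" "i < a" "r \<in> carrier R" "u \<in> carrier (M\<lparr>carrier := H\<rparr>)" for x i r u
    using multilinear_smult[OF assms(1) t[OF that(1)] that(2,3), of u] that assms(2,3) by auto
qed

context cring
begin

lemma free_mod_module: "module R (free_mod R S)"
  by (rule free_module[OF cring_axioms])

lemma rep_functor: "is_functor R (rep R n)"
proof (rule is_functorI)
  show "fmor (rep R n) X Y f \<in> mod_hom R (fobj (rep R n) X) (fobj (rep R n) Y)" if "f \<in> fin_hom X Y" for X Y f
    using that by (auto simp: rep_def intro!: free_map_hom[OF cring_axioms] tup_compose)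
  show "fmor (rep R n) X X (\<lambda>x\<in>X. x) = (\<lambda>m\<in>carrier (fobj (rep R n) X). m)" for X
    unfolding rep_def fin_functor.simps
    by (rule free_map_id[OF cring_axioms]) (auto simp: fin_hom_def Id_compose PiE_def)
  show "fmor (rep R n) X Z (compose X g f) = compose (carrier (fobj (rep R n) X)) (fmor (rep R n) Y Z g) (fmor (rep R n) X Y f)"
    if "f \<in> fin_hom X Y" "g \<in> fin_hom Y Z" for X Y Z f g
    unfolding rep_def fin_functor.simps
  proof (rule free_map_comp[OF cring_axioms])
    show "compose {..<n} f \<in> tup n X \<rightarrow> tup n Y" "compose {..<n} g \<in> tup n Y \<rightarrow> tup n Z"
      using tup_compose that by blast+
    show "compose {..<n} (compose X g f) s = compose {..<n} g (compose {..<n} f s)" if "s \<in> tup n X" for s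
      using that by (intro compose_assoc[symmetric]) (auto simp: fin_hom_def)
  qed
qed (simp add: rep_def free_mod_module)

lemma free_mod_finite: "finite S \<Longrightarrow> carrier (free_mod R S) = S \<rightarrow>\<^sub>E carrier R"
  by (auto simp: free_simps supp_def)

lemma free_gen_in: "s \<in> S \<Longrightarrow> free_gen R S s \<in> carrier (free_mod R S)"
  by (rule free_gen_closed[OF cring_axioms])

lemma pairing_hom:
  assumes "p \<in> S \<rightarrow> carrier R"
  shows "pairing R S p \<in> mod_hom R (free_mod R S) (ring_mod R)"
  unfolding pairing_def
  by (rule free_lift_hom) (use assms in \<open>auto simp: ring_mod_module[OF cring_axioms] ring_mod_simps\<close>)

lemma pairing_gen:
  assumes "p \<in> S \<rightarrow> carrier R" "s \<in> S"
  shows "pairing R S p (free_gen R S s) = p s"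
  unfolding pairing_def
  by (rule free_lift_gen) (use assms in \<open>auto simp: ring_mod_module[OF cring_axioms] ring_mod_simps\<close>)

lemma eval_hom:
  assumes "s \<in> S"
  shows "(\<lambda>v\<in>carrier (free_mod R S). v s) \<in> mod_hom R (free_mod R S) (ring_mod R)"
proof -
  interpret module R "free_mod R S" by (rule free_mod_module)
  have m: "v \<in> carrier (free_mod R S) \<Longrightarrow> v s \<in> carrier R" for v
    using assms by (auto simp: free_simps PiE_iff)
  show ?thesis
  proof (rule mod_homI)
    fix u v assume "u \<in> carrier (free_mod R S)" "v \<in> carrier (free_mod R S)"
    then show "(\<lambda>v\<in>carrier (free_mod R S). v s) (u \<oplus>\<^bsub>free_mod R S\<^esub> v) = (\<lambda>v\<in>carrier (free_mod R S). v s) u \<oplus>\<^bsub>ring_mod R\<^esub> (\<lambda>v\<in>carrier (free_mod R S). v s) v"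
      using M.a_closed[of u v] assms by (simp add: ring_mod_simps) (simp add: free_simps)
  next
    fix r v assume "r \<in> carrier R" "v \<in> carrier (free_mod R S)"
    then show "(\<lambda>v\<in>carrier (free_mod R S). v s) (r \<odot>\<^bsub>free_mod R S\<^esub> v) = r \<odot>\<^bsub>ring_mod R\<^esub> (\<lambda>v\<in>carrier (free_mod R S). v s) v"
      using smult_closed[of r v] assms by (simp add: ring_mod_simps) (simp add: free_simps)
  qed (use m in \<open>auto simp: ring_mod_simps\<close>)
qed

lemma finprod_zero_factor:
  assumes "finite A" "i \<in> A" "f \<in> A \<rightarrow> carrier R" "f i = \<zero>"
  shows "finprod R f A = \<zero>"
proof -
  have "finprod R f A = finprod R f (insert i (A - {i}))" using assms by (simp add: insert_absorb)
  also have "\<dots> = f i \<otimes> finprod R f (A - {i})" by (rule finprod_insert) (use assms in auto)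
  also have "\<dots> = \<zero>" using assms by (auto intro!: l_null finprod_closed)
  finally show ?thesis .
qed

text \<open>An entry enters one factor only, and the other factors are scalars.\<close>

lemma prod_multilinear:
  assumes M: "module R M" and l: "\<And>i. i < a \<Longrightarrow> l i \<in> mod_hom R M (ring_mod R)"
  shows "multilinear R M a (ring_mod R) (\<lambda>x. finprod R (\<lambda>i. l i (x i)) {..<a})"
proof -
  interpret M: module R M by fact
  have lc: "x \<in> tuples M a \<Longrightarrow> i < a \<Longrightarrow> l i (x i) \<in> carrier R" for x i
    using mod_homD(2)[OF l, of i "x i"] by (auto simp: tuples_def PiE_iff ring_mod_simps)
  have split: "finprod R (\<lambda>j. l j ((x(i := u)) j)) {..<a} = l i u \<otimes> finprod R (\<lambda>j. l j (x j)) ({..<a} - {i})"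
    if x: "x \<in> tuples M a" "i < a" "u \<in> carrier M" for x i u
  proof -
    note c = lc[OF tuples_upd[OF x]]
    have "finprod R (\<lambda>j. l j ((x(i := u)) j)) {..<a} = finprod R (\<lambda>j. l j ((x(i := u)) j)) (insert i ({..<a} - {i}))"
      using x by (simp add: insert_absorb)
    also have "\<dots> = l i ((x(i := u)) i) \<otimes> finprod R (\<lambda>j. l j ((x(i := u)) j)) ({..<a} - {i})"
      by (rule finprod_insert) (use c c[OF x(2)] x in auto)
    also have "finprod R (\<lambda>j. l j ((x(i := u)) j)) ({..<a} - {i}) = finprod R (\<lambda>j. l j (x j)) ({..<a} - {i})"
      by (rule finprod_cong') (use lc[OF x(1)] in auto)
    finally show ?thesis by simp
  qed
  have rest: "finprod R (\<lambda>j. l j (x j)) ({..<a} - {i}) \<in> carrier R" if "x \<in> tuples M a" for x i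
    using lc[OF that] by (intro finprod_closed) auto
  show ?thesis
  proof (rule multilinearI[OF M])
    fix x assume "x \<in> tuples M a"
    then show "finprod R (\<lambda>i. l i (x i)) {..<a} \<in> carrier (ring_mod R)"
      using lc by (auto simp: ring_mod_simps intro!: finprod_closed)
  next
    fix x i u v assume x: "x \<in> tuples M a" "i < a" "u \<in> carrier M" "v \<in> carrier M"
    then show "finprod R (\<lambda>j. l j ((x(i := u \<oplus>\<^bsub>M\<^esub> v)) j)) {..<a} =
      finprod R (\<lambda>j. l j ((x(i := u)) j)) {..<a} \<oplus>\<^bsub>ring_mod R\<^esub> finprod R (\<lambda>j. l j ((x(i := v)) j)) {..<a}"
      using mod_homD(2)[OF l[OF x(2)]] rest[OF x(1)]
      by (simp only: split M.a_closed mod_homD(3)[OF l[OF x(2)] x(3,4)] ring_mod_simps l_distr)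
  next
    fix x i r u assume x: "x \<in> tuples M a" "i < a" "r \<in> carrier R" "u \<in> carrier M"
    then show "finprod R (\<lambda>j. l j ((x(i := r \<odot>\<^bsub>M\<^esub> u)) j)) {..<a} =
      r \<odot>\<^bsub>ring_mod R\<^esub> finprod R (\<lambda>j. l j ((x(i := u)) j)) {..<a}"
      using mod_homD(2)[OF l[OF x(2)]] rest[OF x(1)]
      by (simp only: split M.smult_closed mod_homD(4)[OF l[OF x(2)] x(3,4)] ring_mod_simps m_assoc)
  qed
qed

lemma coord_closed:
  assumes "finite X" "x \<in> tuples (free_mod R X) a"
  shows "coord R a X x \<in> carrier (free_mod R (tup a X))"
proof -
  have "x i (y i) \<in> carrier R" if "i < a" "y \<in> tup a X" for i y
    using assms that tup_app[OF that(2,1)] by (auto simp: tuples_def PiE_iff free_simps)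
  then show ?thesis using assms tup_finite[OF assms(1), of a]
    by (auto simp: free_mod_finite coord_def intro!: finprod_closed)
qed

lemma coord_multilinear:
  assumes X: "finite X"
  shows "multilinear R (free_mod R X) a (free_mod R (tup a X)) (coord R a X)"
proof -
  note M = free_mod_module[of X]
  interpret M: module R "free_mod R X" by (rule M)
  interpret N: module R "free_mod R (tup a X)" by (rule free_mod_module)
  have ev: "coord R a X x y = finprod R (\<lambda>i. (\<lambda>v\<in>carrier (free_mod R X). v (y i)) (x i)) {..<a}"
    if "x \<in> tuples (free_mod R X) a" "y \<in> tup a X" for x y
    using that tup_app[OF that(2)] unfolding coord_def
    by (auto simp: tuples_def PiE_iff free_simps intro!: finprod_cong')
  have ml: "multilinear R (free_mod R X) a (ring_mod R) (\<lambda>x. finprod R (\<lambda>i. (\<lambda>v\<in>carrier (free_mod R X). v (y i)) (x i)) {..<a})"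
    if "y \<in> tup a X" for y
    by (rule prod_multilinear[OF M eval_hom]) (use that tup_app in auto)
  show ?thesis
  proof (rule multilinearI[OF M])
    fix x i u v assume x: "x \<in> tuples (free_mod R X) a" "i < a" "u \<in> carrier (free_mod R X)" "v \<in> carrier (free_mod R X)"
    note t = tuples_upd[OF x(1,2)]
    show "coord R a X (x(i := u \<oplus>\<^bsub>free_mod R X\<^esub> v)) = coord R a X (x(i := u)) \<oplus>\<^bsub>free_mod R (tup a X)\<^esub> coord R a X (x(i := v))"
    proof (rule free_eqI)
      fix y assume y: "y \<in> tup a X"
      show "coord R a X (x(i := u \<oplus>\<^bsub>free_mod R X\<^esub> v)) y = (coord R a X (x(i := u)) \<oplus>\<^bsub>free_mod R (tup a X)\<^esub> coord R a X (x(i := v))) y"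
        using multilinear_add[OF ml[OF y] x M] y x t
        by (simp add: free_add_app ring_mod_simps ev del: fun_upd_apply restrict_apply)
    qed (use coord_closed[OF X] t x in auto)
  next
    fix x i r u assume x: "x \<in> tuples (free_mod R X) a" "i < a" "r \<in> carrier R" "u \<in> carrier (free_mod R X)"
    note t = tuples_upd[OF x(1,2)]
    show "coord R a X (x(i := r \<odot>\<^bsub>free_mod R X\<^esub> u)) = r \<odot>\<^bsub>free_mod R (tup a X)\<^esub> coord R a X (x(i := u))"
    proof (rule free_eqI)
      fix y assume y: "y \<in> tup a X"
      show "coord R a X (x(i := r \<odot>\<^bsub>free_mod R X\<^esub> u)) y = (r \<odot>\<^bsub>free_mod R (tup a X)\<^esub> coord R a X (x(i := u))) y"
        using multilinear_smult[OF ml[OF y] x M] y x t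
        by (simp add: free_smult_app ring_mod_simps ev del: fun_upd_apply restrict_apply)
    qed (use coord_closed[OF X] t x in auto)
  qed (rule coord_closed[OF X])
qed

lemma finprod_indicator:
  assumes "y \<in> tup a X" "z \<in> tup a X"
  shows "finprod R (\<lambda>i. if z i = y i then \<one> else \<zero>) {..<a} = (if z = y then \<one> else \<zero>)"
proof (cases "z = y")
  case True then show ?thesis by (auto intro!: finprod_one_eqI)
next
  case False
  then obtain i where "i < a" "z i \<noteq> y i"
    using PiE_ext[of z "{..<a}" "\<lambda>_. X" y] assms by (auto simp: fin_hom_def)
  then show ?thesis using False by (auto intro!: finprod_zero_factor[of _ i])
qed

lemma coord_gen:
  assumes "y \<in> tup a X"
  shows "coord R a X (\<lambda>i\<in>{..<a}. free_gen R X (y i)) = free_gen R (tup a X) y"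
  unfolding coord_def free_gen_def
proof (rule restrict_ext)
  fix z assume z: "z \<in> tup a X"
  have "finprod R (\<lambda>i. (\<lambda>i\<in>{..<a}. \<lambda>t\<in>X. if t = y i then \<one> else \<zero>) i (z i)) {..<a} = finprod R (\<lambda>i. if z i = y i then \<one> else \<zero>) {..<a}"
    by (rule finprod_cong') (use tup_app[OF z] in auto)
  then show "finprod R (\<lambda>i. (\<lambda>i\<in>{..<a}. \<lambda>t\<in>X. if t = y i then \<one> else \<zero>) i (z i)) {..<a} = (if z = y then \<one> else \<zero>)"
    using finprod_indicator[OF assms z] by simp
qed

text \<open>
  Linear forms and the maps induced by maps of sets are computed factor by factor: both sides are
  multilinear, and generators are mapped to generators.
\<close>

lemma pairing_coord:
  assumes X: "finite X" and p: "\<And>j. j < b \<Longrightarrow> p j \<in> X \<rightarrow> carrier R" and x: "x \<in> tuples (free_mod R X) b"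
  shows "pairing R (tup b X) (\<lambda>y. finprod R (\<lambda>j. p j (y j)) {..<b}) (coord R b X x) =
    finprod R (\<lambda>j. pairing R X (p j) (x j)) {..<b}"
proof (rule multilinear_eq_on_spanning[OF free_mod_module ring_mod_module[OF cring_axioms] _ _ free_spans[OF cring_axioms] _ x])
  have P: "(\<lambda>y. finprod R (\<lambda>j. p j (y j)) {..<b}) \<in> tup b X \<rightarrow> carrier R"
    using p tup_app by (fastforce intro!: finprod_closed)
  show "multilinear R (free_mod R X) b (ring_mod R) (\<lambda>x. pairing R (tup b X) (\<lambda>y. finprod R (\<lambda>j. p j (y j)) {..<b}) (coord R b X x))"
    by (rule multilinear_compose_hom[OF coord_multilinear[OF X] pairing_hom[OF P] free_mod_module])
  show "multilinear R (free_mod R X) b (ring_mod R) (\<lambda>x. finprod R (\<lambda>j. pairing R X (p j) (x j)) {..<b})"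
    by (rule prod_multilinear[OF free_mod_module pairing_hom[OF p]])
  fix x assume "x \<in> {..<b} \<rightarrow>\<^sub>E free_gen R X ` X"
  then obtain y where y: "y \<in> tup b X" "x = (\<lambda>i\<in>{..<b}. free_gen R X (y i))"
    unfolding fin_hom_def by (rule PiE_image_obtain)
  have "finprod R (\<lambda>j. pairing R X (p j) (x j)) {..<b} = finprod R (\<lambda>j. p j (y j)) {..<b}"
  proof (rule finprod_cong')
    fix j assume "j \<in> {..<b}"
    then show "pairing R X (p j) (x j) = p j (y j)" using y pairing_gen[OF p tup_app[OF y(1)]] by simp
  qed (use p tup_app[OF y(1)] in fastforce)+
  then show "pairing R (tup b X) (\<lambda>y. finprod R (\<lambda>j. p j (y j)) {..<b}) (coord R b X x) = finprod R (\<lambda>j. pairing R X (p j) (x j)) {..<b}"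
    using y by (simp add: coord_gen pairing_gen[OF P])
qed

lemma coord_natural:
  assumes "finite X" "finite Y" "f \<in> fin_hom X Y" "x \<in> tuples (free_mod R X) a"
  shows "coord R a Y (tuple_map a (free_map R X Y f) x) =
    free_map R (tup a X) (tup a Y) (compose {..<a} f) (coord R a X x)"
proof (rule multilinear_eq_on_spanning[OF free_mod_module free_mod_module _ _ free_spans[OF cring_axioms] _ assms(4)])
  have f: "f \<in> X \<rightarrow> Y" using assms(3) by (auto simp: fin_hom_def)
  have cf: "compose {..<a} f \<in> tup a X \<rightarrow> tup a Y" using tup_compose[OF _ assms(3)] by auto
  show "multilinear R (free_mod R X) a (free_mod R (tup a Y)) (\<lambda>x. coord R a Y (tuple_map a (free_map R X Y f) x))"
    by (rule multilinear_tuple_map[OF coord_multilinear free_map_hom[OF cring_axioms f]])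
      (use assms free_mod_module in auto)
  show "multilinear R (free_mod R X) a (free_mod R (tup a Y)) (\<lambda>x. free_map R (tup a X) (tup a Y) (compose {..<a} f) (coord R a X x))"
    by (rule multilinear_compose_hom[OF coord_multilinear free_map_hom[OF cring_axioms cf]])
      (use assms free_mod_module in auto)
  fix x assume "x \<in> {..<a} \<rightarrow>\<^sub>E free_gen R X ` X"
  then obtain y where y: "y \<in> tup a X" "x = (\<lambda>i\<in>{..<a}. free_gen R X (y i))"
    unfolding fin_hom_def by (rule PiE_image_obtain)
  have "tuple_map a (free_map R X Y f) x = (\<lambda>i\<in>{..<a}. free_gen R Y (compose {..<a} f y i))"
    using y tup_app[OF y(1)] by (auto simp: tuple_map_def free_map_gen[OF cring_axioms f] compose_eq intro!: restrict_ext)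
  then show "coord R a Y (tuple_map a (free_map R X Y f) x) = free_map R (tup a X) (tup a Y) (compose {..<a} f) (coord R a X x)"
    using y tup_compose[OF y(1) assms(3)] by (simp add: coord_gen free_map_gen[OF cring_axioms cf])
qed

subsection \<open>Adding a last entry\<close>

lemma tens_closed:
  assumes "finite X" "w \<in> carrier (free_mod R (tup a X))" "v \<in> carrier (free_mod R X)"
  shows "tens R a X w v \<in> carrier (free_mod R (tup (Suc a) X))"
  using assms(1) tup_restrict[of _ a X] tup_app[of _ "Suc a" X a] free_app[OF assms(2)] free_app[OF assms(3)]
  by (auto simp: free_mod_finite tup_finite tens_def intro!: m_closed)

lemma tens_hom_left:
  assumes X: "finite X" and v: "v \<in> carrier (free_mod R X)"
  shows "(\<lambda>w\<in>carrier (free_mod R (tup a X)). tens R a X w v) \<in> mod_hom R (free_mod R (tup a X)) (free_mod R (tup (Suc a) X))"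
proof -
  interpret module R "free_mod R (tup a X)" by (rule free_mod_module)
  have vc: "z \<in> tup (Suc a) X \<Longrightarrow> v (z a) \<in> carrier R" for z using v tup_app[of z "Suc a" X a] by (auto simp: free_simps)
  have wc: "w \<in> carrier (free_mod R (tup a X)) \<Longrightarrow> z \<in> tup (Suc a) X \<Longrightarrow> w (restrict z {..<a}) \<in> carrier R" for w z
    using tup_restrict[of z a X] by (auto simp: free_simps)
  have "tens R a X (x \<oplus>\<^bsub>free_mod R (tup a X)\<^esub> y) v = tens R a X x v \<oplus>\<^bsub>free_mod R (tup (Suc a) X)\<^esub> tens R a X y v"
    if "x \<in> carrier (free_mod R (tup a X))" "y \<in> carrier (free_mod R (tup a X))" for x y
    using that by (auto simp: tens_def free_simps(3) vc wc tup_restrict l_distr intro!: restrict_ext)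
  moreover have "tens R a X (r \<odot>\<^bsub>free_mod R (tup a X)\<^esub> x) v = r \<odot>\<^bsub>free_mod R (tup (Suc a) X)\<^esub> tens R a X x v"
    if "r \<in> carrier R" "x \<in> carrier (free_mod R (tup a X))" for r x
    using that by (auto simp: tens_def free_simps(4) vc wc tup_restrict m_assoc intro!: restrict_ext)
  ultimately show ?thesis
    by (intro mod_homI) (use tens_closed[OF X _ v] in simp_all)
qed

lemma tens_hom_right:
  assumes X: "finite X" and w: "w \<in> carrier (free_mod R (tup a X))"
  shows "(\<lambda>v\<in>carrier (free_mod R X). tens R a X w v) \<in> mod_hom R (free_mod R X) (free_mod R (tup (Suc a) X))"
proof -
  interpret module R "free_mod R X" by (rule free_mod_module)
  have vc: "v \<in> carrier (free_mod R X) \<Longrightarrow> z \<in> tup (Suc a) X \<Longrightarrow> v (z a) \<in> carrier R" for z v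
    using tup_app[of z "Suc a" X a] by (auto simp: free_simps)
  have za: "z \<in> tup (Suc a) X \<Longrightarrow> z a \<in> X" for z by (rule tup_app) auto
  have wc: "z \<in> tup (Suc a) X \<Longrightarrow> w (restrict z {..<a}) \<in> carrier R" for z
    using w tup_restrict[of z a X] by (auto simp: free_simps)
  have "tens R a X w (x \<oplus>\<^bsub>free_mod R X\<^esub> y) = tens R a X w x \<oplus>\<^bsub>free_mod R (tup (Suc a) X)\<^esub> tens R a X w y"
    if "x \<in> carrier (free_mod R X)" "y \<in> carrier (free_mod R X)" for x y
    using that by (auto simp: tens_def free_simps(3) vc wc za r_distr intro!: restrict_ext)
  moreover have "tens R a X w (r \<odot>\<^bsub>free_mod R X\<^esub> x) = r \<odot>\<^bsub>free_mod R (tup (Suc a) X)\<^esub> tens R a X w x"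
    if "r \<in> carrier R" "x \<in> carrier (free_mod R X)" for r x
    using that by (auto simp: tens_def free_simps(4) vc wc za m_lcomm intro!: restrict_ext)
  ultimately show ?thesis
    by (intro mod_homI) (use tens_closed[OF X w] in simp_all)
qed

lemma tens_gen:
  assumes "u \<in> tup a X" "y \<in> X"
  shows "tens R a X (free_gen R (tup a X) u) (free_gen R X y) = free_gen R (tup (Suc a) X) (u(a := y))"
  unfolding tens_def
proof (subst (2) free_gen_def, rule restrict_ext)
  fix z assume z: "z \<in> tup (Suc a) X"
  have "z = u(a := y) \<longleftrightarrow> restrict z {..<a} = u \<and> z a = y"
  proof
    assume "z = u(a := y)"
    then show "restrict z {..<a} = u \<and> z a = y" using assms by (auto simp: fin_hom_def PiE_iff extensional_def restrict_def fun_eq_iff)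
  next
    assume h: "restrict z {..<a} = u \<and> z a = y"
    show "z = u(a := y)"
    proof
      fix i show "z i = (u(a := y)) i"
        using h z by (cases "i < a"; cases "i = a") (auto simp: fin_hom_def PiE_iff extensional_def restrict_def)
    qed
  qed
  then show "free_gen R (tup a X) u (restrict z {..<a}) \<otimes> free_gen R X y (z a) = (if z = u(a := y) then \<one> else \<zero>)"
    using tup_restrict[OF z] tup_app[OF z, of a] by (auto simp: free_gen_def)
qed

lemma coord_Suc:
  assumes x: "x \<in> tuples (free_mod R X) (Suc a)"
  shows "coord R (Suc a) X x = tens R a X (coord R a X (restrict x {..<a})) (x a)"
  unfolding tens_def
proof (subst coord_def, rule restrict_ext)
  fix z assume z: "z \<in> tup (Suc a) X"
  have c: "x i (z i) \<in> carrier R" if "i < Suc a" for i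
    using x that tup_app[OF z that] by (auto simp: tuples_def PiE_iff free_simps)
  have "finprod R (\<lambda>i. x i (z i)) {..<Suc a} = finprod R (\<lambda>i. x i (z i)) (insert a {..<a})"
    by (simp add: lessThan_Suc)
  also have "\<dots> = x a (z a) \<otimes> finprod R (\<lambda>i. x i (z i)) {..<a}"
    by (rule finprod_insert) (use c in auto)
  also have "finprod R (\<lambda>i. x i (z i)) {..<a} = coord R a X (restrict x {..<a}) (restrict z {..<a})"
    using tup_restrict[OF z] c by (auto simp: coord_def intro!: finprod_cong')
  also have "x a (z a) \<otimes> \<dots> = \<dots> \<otimes> x a (z a)"
  proof (rule m_comm)
    have "coord R a X (restrict x {..<a}) (restrict z {..<a}) = finprod R (\<lambda>i. x i (z i)) {..<a}"
      using tup_restrict[OF z] c by (auto simp: coord_def intro!: finprod_cong')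
    also have "\<dots> \<in> carrier R" using c by (auto intro!: finprod_closed)
    finally show "coord R a X (restrict x {..<a}) (restrict z {..<a}) \<in> carrier R" .
  qed (use c in auto)
  finally show "finprod R (\<lambda>i. x i (z i)) {..<Suc a} = coord R a X (restrict x {..<a}) (restrict z {..<a}) \<otimes> x a (z a)" .
qed

end


section \<open>Coordinates on tensor powers of the reduced functor\<close>

abbreviation red :: "('k, 'r) ring_scheme \<Rightarrow> nat set \<Rightarrow> ('k, nat \<Rightarrow> 'k) module"
  where "red R X \<equiv> fobj (red_functor R) X"

abbreviation T :: "('k, 'r) ring_scheme \<Rightarrow> nat \<Rightarrow> ('k, ((nat \<Rightarrow> nat \<Rightarrow> 'k) \<Rightarrow> 'k) set) fin_functor"
  where "T R a \<equiv> tensor_functor R (red_functor R) a"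

text \<open>
  The embedding of \<open>T a\<close> into functions on tuples, under which a pure tensor becomes the product of
  its factors. It makes tensors concrete: equality is tested on functions, and the image is stable
  under the operations that are needed.
\<close>

definition coef :: "('k, 'r) ring_scheme \<Rightarrow> nat \<Rightarrow> nat set \<Rightarrow> ((nat \<Rightarrow> nat \<Rightarrow> 'k) \<Rightarrow> 'k) set \<Rightarrow> (nat \<Rightarrow> nat) \<Rightarrow> 'k"
  where "coef R a = (\<lambda>X\<in>fin_obj. tensor_lift R (red R X) a (free_mod R (tup a X)) (coord R a X))"

lemma T_obj: "fobj (T R a) X = tensor_pow R (red R X) a"
  by (simp add: tensor_functor_def)

lemma red_simps:
  assumes "X \<in> fin_obj"
  shows "carrier (red R X) = {v \<in> carrier (free_mod R X). pairing R X (\<lambda>_. \<one>\<^bsub>R\<^esub>) v = \<zero>\<^bsub>R\<^esub>}"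
    and "red R X = (free_mod R X)\<lparr>carrier := {v \<in> carrier (free_mod R X). pairing R X (\<lambda>_. \<one>\<^bsub>R\<^esub>) v = \<zero>\<^bsub>R\<^esub>}\<rparr>"
    and "fmor (red_functor R) X Y f = restrict (free_map R X Y f) (carrier (red R X))"
  using assms by (auto simp: red_functor_def ker_functor_def Let_def lin_functor_def const_functor_def
      augmentation_def pairing_def ring_mod_simps)

lemma fin_objD: "X \<in> fin_obj \<Longrightarrow> finite X" "X \<in> fin_obj \<Longrightarrow> X \<noteq> {}"
  by (auto simp: fin_obj_def)

context cring
begin

lemma red_module: "X \<in> fin_obj \<Longrightarrow> module R (red R X)"
  using is_functorD(1)[OF red_functor_functor[OF cring_axioms]] .

lemma T_functor: "is_functor R (T R a)"
  by (rule tensor_functor_functor[OF red_functor_functor[OF cring_axioms] cring_axioms])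

lemma red_carrier: "X \<in> fin_obj \<Longrightarrow> v \<in> carrier (red R X) \<Longrightarrow> v \<in> carrier (free_mod R X)"
  by (simp add: red_simps)

lemma red_tuples: "X \<in> fin_obj \<Longrightarrow> x \<in> tuples (red R X) a \<Longrightarrow> x \<in> tuples (free_mod R X) a"
  using red_carrier by (auto simp: tuples_def PiE_iff)

lemma const_one: "(\<lambda>_. \<one>) \<in> X \<rightarrow> carrier R" by simp

lemma multilinear_red:
  assumes "X \<in> fin_obj" "multilinear R (free_mod R X) a N \<Phi>"
  shows "multilinear R (red R X) a N \<Phi>"
proof -
  note e = red_simps(2)[OF assms(1), of R]
  show ?thesis
    by (subst e, rule multilinear_submodule[OF assms(2) free_mod_module _ red_module[OF assms(1), unfolded e]]) auto
qed

subsection \<open>The coordinate embedding\<close>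

lemma coef_hom:
  assumes X: "X \<in> fin_obj"
  shows "coef R a X \<in> mod_hom R (tensor_pow R (red R X) a) (free_mod R (tup a X))"
    and "x \<in> tuples (red R X) a \<Longrightarrow> coef R a X (tpure R (red R X) a x) = coord R a X x"
  using tensor_lift[OF red_module[OF X] free_mod_module multilinear_red[OF X coord_multilinear[OF fin_objD(1)[OF X]]]] X
  by (simp_all add: coef_def)

lemma T_map_tpure:
  assumes "X \<in> fin_obj" "Y \<in> fin_obj" "f \<in> fin_hom X Y" "x \<in> tuples (red R X) a"
  shows "fmor (T R a) X Y f (tpure R (red R X) a x) = tpure R (red R Y) a (tuple_map a (free_map R X Y f) x)"
proof -
  note f = is_functorD(2)[OF red_functor_functor[OF cring_axioms] assms(1-3)]
  have "tuple_map a (fmor (red_functor R) X Y f) x = tuple_map a (free_map R X Y f) x"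
    using assms(1,4) by (auto simp: tuple_map_def red_simps(3) tuples_def PiE_iff intro!: restrict_ext)
  then show ?thesis
    using tensor_pow_map_tpure[OF f red_module[OF assms(1)] red_module[OF assms(2)] assms(4)]
    by (simp add: tensor_functor_def)
qed

lemma red_tuple_map:
  assumes "X \<in> fin_obj" "Y \<in> fin_obj" "f \<in> fin_hom X Y" "x \<in> tuples (red R X) a"
  shows "tuple_map a (free_map R X Y f) x \<in> tuples (red R Y) a"
proof -
  note f = is_functorD(2)[OF red_functor_functor[OF cring_axioms] assms(1-3)]
  have "tuple_map a (fmor (red_functor R) X Y f) x = tuple_map a (free_map R X Y f) x"
    using assms(1,4) by (auto simp: tuple_map_def red_simps(3) tuples_def PiE_iff intro!: restrict_ext)
  then show ?thesis using funcset_mem[OF tuple_map_tuples[OF f] assms(4)] by simp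
qed

lemma coef_nat: "coef R a \<in> nat_trans R (T R a) (rep R a)"
proof (rule nat_transI)
  fix X Y f m assume h: "X \<in> fin_obj" "Y \<in> fin_obj" "f \<in> fin_hom X Y" "m \<in> carrier (fobj (T R a) X)"
  note F = is_functorD(2)[OF T_functor h(1-3)] and P = is_functorD(2)[OF rep_functor h(1-3)]
  note c = coef_hom(1)[folded T_obj]
  have "compose (carrier (fobj (T R a) X)) (coef R a Y) (fmor (T R a) X Y f) m =
    compose (carrier (fobj (T R a) X)) (fmor (rep R a) X Y f) (coef R a X) m"
  proof (rule tensor_pow_hom_eqI[OF red_module[OF h(1)]])
    show "module R (free_mod R (tup a Y))" by (rule free_mod_module)
    show "compose (carrier (fobj (T R a) X)) (coef R a Y) (fmor (T R a) X Y f) \<in> mod_hom R (tensor_pow R (red R X) a) (free_mod R (tup a Y))"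
      using mod_hom_compose[OF F c[OF h(2)] is_functorD(1)[OF T_functor h(1)]] by (simp add: T_obj)
    show "compose (carrier (fobj (T R a) X)) (fmor (rep R a) X Y f) (coef R a X) \<in> mod_hom R (tensor_pow R (red R X) a) (free_mod R (tup a Y))"
      using mod_hom_compose[OF c[OF h(1)] P[unfolded rep_def fin_functor.simps] is_functorD(1)[OF T_functor h(1)]] by (simp add: T_obj rep_def)
    fix x assume x: "x \<in> tuples (red R X) a"
    show "compose (carrier (fobj (T R a) X)) (coef R a Y) (fmor (T R a) X Y f) (tpure R (red R X) a x) =
      compose (carrier (fobj (T R a) X)) (fmor (rep R a) X Y f) (coef R a X) (tpure R (red R X) a x)"
      using tpure_closed[OF red_module[OF h(1)] x] red_tuple_map[OF h(1-3) x] x h(1,2)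
        coord_natural[OF _ _ h(3) red_tuples[OF h(1) x]] fin_objD
      by (simp add: compose_eq T_obj T_map_tpure[OF h(1-3) x] coef_hom(2) rep_def)
  qed (use h(4) in \<open>simp add: T_obj\<close>)
  then show "coef R a Y (fmor (T R a) X Y f m) = fmor (rep R a) X Y f (coef R a X m)"
    using h(4) by (simp add: compose_eq)
qed (use coef_hom(1) in \<open>auto simp: rep_def T_obj coef_def\<close>)

text \<open>
  A spanning family \<open>e\<close> of the reduced module with a dual family \<open>p\<close> of functions is a basis, and
  then the pure tensors of members of \<open>e\<close> form a basis of the tensor power: the products of dual
  functions separate them.
\<close>

definition dual_family :: "nat set \<Rightarrow> nat set \<Rightarrow> (nat \<Rightarrow> nat \<Rightarrow> 'a) \<Rightarrow> (nat \<Rightarrow> nat \<Rightarrow> 'a) \<Rightarrow> bool"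
  where "dual_family X I e p \<longleftrightarrow> spans R (red R X) (e ` I) \<and> (\<forall>i\<in>I. p i \<in> X \<rightarrow> carrier R) \<and>
    (\<forall>i\<in>I. \<forall>j\<in>I. pairing R X (p i) (e j) = (if i = j then \<one> else \<zero>))"

definition dual_form :: "(nat \<Rightarrow> nat \<Rightarrow> 'a) \<Rightarrow> nat \<Rightarrow> nat set \<Rightarrow> (nat \<Rightarrow> nat) \<Rightarrow> ((nat \<Rightarrow> nat \<Rightarrow> 'a) \<Rightarrow> 'a) set \<Rightarrow> 'a"
  where "dual_form p b X f = compose (carrier (fobj (T R b) X))
    (pairing R (tup b X) (\<lambda>y. finprod R (\<lambda>j. p (f j) (y j)) {..<b})) (coef R b X)"

definition basis_tensor :: "(nat \<Rightarrow> nat \<Rightarrow> 'a) \<Rightarrow> nat \<Rightarrow> nat set \<Rightarrow> (nat \<Rightarrow> nat) \<Rightarrow> ((nat \<Rightarrow> nat \<Rightarrow> 'a) \<Rightarrow> 'a) set"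
  where "basis_tensor e b X g = tpure R (red R X) b (\<lambda>i\<in>{..<b}. e (g i))"

lemma dual_form_hom:
  assumes X: "X \<in> fin_obj" and p: "\<And>j. j < b \<Longrightarrow> p (f j) \<in> X \<rightarrow> carrier R"
  shows "dual_form p b X f \<in> mod_hom R (fobj (T R b) X) (ring_mod R)"
    and "x \<in> tuples (red R X) b \<Longrightarrow> dual_form p b X f (tpure R (red R X) b x) = finprod R (\<lambda>j. pairing R X (p (f j)) (x j)) {..<b}"
proof -
  have P: "(\<lambda>y. finprod R (\<lambda>j. p (f j) (y j)) {..<b}) \<in> tup b X \<rightarrow> carrier R"
    using p tup_app by (fastforce intro!: finprod_closed)
  show "dual_form p b X f \<in> mod_hom R (fobj (T R b) X) (ring_mod R)"
    unfolding dual_form_def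
    by (rule mod_hom_compose[OF _ pairing_hom[OF P] is_functorD(1)[OF T_functor X]]) (simp add: T_obj coef_hom(1)[OF X])
  show "dual_form p b X f (tpure R (red R X) b x) = finprod R (\<lambda>j. pairing R X (p (f j)) (x j)) {..<b}" if x: "x \<in> tuples (red R X) b"
    using tpure_closed[OF red_module[OF X] x] pairing_coord[OF fin_objD(1)[OF X] p red_tuples[OF X x]]
    by (simp add: dual_form_def compose_eq T_obj coef_hom(2)[OF X x])
qed

lemma dual_family_tuples:
  assumes "dual_family X I e p" "g \<in> tup b I"
  shows "(\<lambda>i\<in>{..<b}. e (g i)) \<in> tuples (red R X) b"
  using assms tup_app[OF assms(2)] by (auto simp: dual_family_def spans_def tuples_def)

lemma basis_tensor_closed:
  assumes "dual_family X I e p" "X \<in> fin_obj" "g \<in> tup b I"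
  shows "basis_tensor e b X g \<in> carrier (fobj (T R b) X)"
  unfolding basis_tensor_def T_obj by (rule tpure_closed[OF red_module[OF assms(2)] dual_family_tuples[OF assms(1,3)]])

lemma dual_form_dual:
  assumes d: "dual_family X I e p" "X \<in> fin_obj" and f: "f \<in> tup b I" and g: "g \<in> tup b I"
  shows "dual_form p b X f (basis_tensor e b X g) = (if f = g then \<one> else \<zero>)"
proof -
  have "dual_form p b X f (basis_tensor e b X g) = finprod R (\<lambda>j. pairing R X (p (f j)) ((\<lambda>i\<in>{..<b}. e (g i)) j)) {..<b}"
    unfolding basis_tensor_def
    by (rule dual_form_hom(2)[OF d(2) _ dual_family_tuples[OF d(1) g]]) (use d f tup_app in \<open>auto simp: dual_family_def\<close>)
  also have "\<dots> = finprod R (\<lambda>j. if f j = g j then \<one> else \<zero>) {..<b}"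
    by (rule finprod_cong') (use d tup_app[OF f] tup_app[OF g] in \<open>auto simp: dual_family_def\<close>)
  also have "\<dots> = (if f = g then \<one> else \<zero>)" by (rule finprod_indicator[OF g f])
  finally show ?thesis .
qed

lemma basis_tensor_span:
  assumes d: "dual_family X I e p" "X \<in> fin_obj"
  shows "spans R (fobj (T R b) X) (basis_tensor e b X ` tup b I)"
proof -
  have s: "spans R (red R X) (e ` I)" using d by (simp add: dual_family_def)
  have "tpure R (red R X) b ` ({..<b} \<rightarrow>\<^sub>E e ` I) \<subseteq> basis_tensor e b X ` tup b I"
  proof (rule image_subsetI)
    fix x assume "x \<in> {..<b} \<rightarrow>\<^sub>E e ` I"
    then obtain y where "y \<in> {..<b} \<rightarrow>\<^sub>E I" "x = (\<lambda>i\<in>{..<b}. e (y i))" by (rule PiE_image_obtain)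
    then show "tpure R (red R X) b x \<in> basis_tensor e b X ` tup b I" by (auto simp: basis_tensor_def fin_hom_def)
  qed
  moreover have "basis_tensor e b X ` tup b I \<subseteq> carrier (tensor_pow R (red R X) b)"
    using basis_tensor_closed[OF d] by (auto simp: T_obj)
  ultimately show ?thesis
    using spansD[OF tensor_pow_spans[OF red_module[OF d(2)] s, of b]] unfolding T_obj
    by (intro spansI) (auto dest: subset_trans)
qed

lemma basis_tensor_lift:
  assumes d: "dual_family X I e p" "X \<in> fin_obj" and S: "S \<subseteq> tup b I"
  shows "free_lift R S (fobj (T R b) X) (basis_tensor e b X) \<in> mod_hom R (free_mod R S) (fobj (T R b) X)"
    and "c \<in> carrier (free_mod R S) \<Longrightarrow> f \<in> tup b I \<Longrightarrow>
      dual_form p b X f (free_lift R S (fobj (T R b) X) (basis_tensor e b X) c) = (if f \<in> S then c f else \<zero>)"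
proof -
  note M = is_functorD(1)[OF T_functor d(2), of b]
  have cl: "basis_tensor e b X \<in> S \<rightarrow> carrier (fobj (T R b) X)" using basis_tensor_closed[OF d] S by auto
  show h: "free_lift R S (fobj (T R b) X) (basis_tensor e b X) \<in> mod_hom R (free_mod R S) (fobj (T R b) X)"
    by (rule free_lift_hom[OF M cl])
  show "dual_form p b X f (free_lift R S (fobj (T R b) X) (basis_tensor e b X) c) = (if f \<in> S then c f else \<zero>)"
    if c: "c \<in> carrier (free_mod R S)" and f: "f \<in> tup b I"
  proof -
    let ?ev = "\<lambda>v\<in>carrier (free_mod R S). if f \<in> S then v f else \<zero>"
    have ev: "?ev \<in> mod_hom R (free_mod R S) (ring_mod R)"
    proof (cases "f \<in> S")
      case True then show ?thesis using eval_hom[OF True] by simp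
    next
      case False
      interpret module R "free_mod R S" by (rule free_mod_module)
      show ?thesis using False by (auto intro!: mod_homI simp: ring_mod_simps)
    qed
    have fh: "dual_form p b X f \<in> mod_hom R (fobj (T R b) X) (ring_mod R)"
      by (rule dual_form_hom(1)[OF d(2)]) (use d f tup_app in \<open>auto simp: dual_family_def\<close>)
    have "compose (carrier (free_mod R S)) (dual_form p b X f) (free_lift R S (fobj (T R b) X) (basis_tensor e b X)) = ?ev"
    proof (rule free_hom_eqI[OF ring_mod_module[OF cring_axioms] mod_hom_compose[OF h fh free_mod_module] ev])
      fix s assume s: "s \<in> S"
      show "compose (carrier (free_mod R S)) (dual_form p b X f) (free_lift R S (fobj (T R b) X) (basis_tensor e b X)) (free_gen R S s) = ?ev (free_gen R S s)"
        using s S f free_gen_in[OF s]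
        by (simp add: compose_eq free_lift_gen[OF M cl s] dual_form_dual[OF d] subset_iff) (auto simp: free_gen_def)
    qed
    from fun_cong[OF this, of c] c show ?thesis by (simp add: compose_eq)
  qed
qed

lemma forms_separate:
  assumes d: "dual_family X I e p" "X \<in> fin_obj"
    and v: "v \<in> carrier (fobj (T R b) X)" and z: "\<And>f. f \<in> tup b I \<Longrightarrow> dual_form p b X f v = \<zero>"
  shows "v = \<zero>\<^bsub>fobj (T R b) X\<^esub>"
proof -
  let ?S = "tup b I" and ?L = "free_lift R (tup b I) (fobj (T R b) X) (basis_tensor e b X)"
  note M = is_functorD(1)[OF T_functor d(2), of b]
  note L = basis_tensor_lift[OF d subset_refl, where b = b]
  have cl: "basis_tensor e b X \<in> ?S \<rightarrow> carrier (fobj (T R b) X)" using basis_tensor_closed[OF d] by auto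
  have "submodule (?L ` carrier (free_mod R ?S)) R (fobj (T R b) X)"
    by (rule image_submodule[OF free_mod_module M L(1)])
  moreover have "basis_tensor e b X ` ?S \<subseteq> ?L ` carrier (free_mod R ?S)"
    using free_lift_gen[OF M cl] free_gen_in by (metis image_eqI image_subsetI)
  ultimately obtain c where c: "c \<in> carrier (free_mod R ?S)" "v = ?L c"
    using spansD[OF basis_tensor_span[OF d]] v by blast
  have "c = \<zero>\<^bsub>free_mod R ?S\<^esub>"
  proof (rule free_eqI[OF c(1)])
    show "\<zero>\<^bsub>free_mod R ?S\<^esub> \<in> carrier (free_mod R ?S)"
      using free_zero_closed[OF cring_axioms] by (simp add: free_simps(2))
    show "c f = \<zero>\<^bsub>free_mod R ?S\<^esub> f" if "f \<in> ?S" for f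
      using z[OF that] L(2)[OF c(1) that] c(2) that by (simp add: free_simps(2))
  qed
  then show ?thesis using c(2) mod_hom_zero[OF L(1) free_mod_module M] by simp
qed

subsection \<open>Two bases\<close>

lemma diff_closed:
  assumes X: "X \<in> fin_obj" and x: "x \<in> X" "y \<in> X"
  shows "diff R X x y \<in> carrier (red R X)"
    and "p \<in> X \<rightarrow> carrier R \<Longrightarrow> pairing R X p (diff R X x y) = p x \<ominus> p y"
proof -
  interpret F: module R "free_mod R X" by (rule free_mod_module)
  interpret K: module R "ring_mod R" by (rule ring_mod_module[OF cring_axioms])
  have pr: "pairing R X p (diff R X x y) = p x \<ominus> p y" if p: "p \<in> X \<rightarrow> carrier R" for p
  proof -
    have "pairing R X p (diff R X x y) = p x \<ominus>\<^bsub>ring_mod R\<^esub> p y"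
      unfolding diff_def
      using mod_hom_minus[OF pairing_hom[OF p] F.module_axioms K.module_axioms free_gen_in[OF x(1)] free_gen_in[OF x(2)]]
      by (simp add: pairing_gen[OF p] x)
    also have "\<ominus>\<^bsub>ring_mod R\<^esub> p y = \<ominus> p y"
      by (rule K.M.minus_equality) (use p x l_neg[of "p y"] in \<open>auto simp: ring_mod_simps\<close>)
    then have "p x \<ominus>\<^bsub>ring_mod R\<^esub> p y = p x \<ominus> p y" by (simp add: a_minus_def ring_mod_simps)
    finally show ?thesis .
  qed
  show "diff R X x y \<in> carrier (red R X)"
    using pr[OF const_one] x by (simp add: red_simps[OF X] diff_def free_gen_in r_neg minus_eq)
  show "p \<in> X \<rightarrow> carrier R \<Longrightarrow> pairing R X p (diff R X x y) = p x \<ominus> p y" by (rule pr)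
qed

lemma diff_map:
  assumes "f \<in> fin_hom X Y" "x \<in> X" "y \<in> X"
  shows "free_map R X Y f (diff R X x y) = diff R Y (f x) (f y)"
proof -
  have f: "f \<in> X \<rightarrow> Y" using assms by (auto simp: fin_hom_def)
  show ?thesis unfolding diff_def
    using mod_hom_minus[OF free_map_hom[OF cring_axioms f] free_mod_module free_mod_module free_gen_in free_gen_in, OF assms(2,3)] assms
    by (simp add: free_map_gen[OF cring_axioms f])
qed

lemma diff_refl: "x \<in> X \<Longrightarrow> diff R X x x = \<zero>\<^bsub>free_mod R X\<^esub>"
proof -
  assume x: "x \<in> X"
  interpret F: module R "free_mod R X" by (rule free_mod_module)
  show ?thesis using free_gen_in[OF x] by (simp add: diff_def F.M.r_neg F.M.minus_eq)
qed

lemma diff_add: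
  assumes "x \<in> X" "y \<in> X" "z \<in> X"
  shows "diff R X x y \<oplus>\<^bsub>free_mod R X\<^esub> diff R X y z = diff R X x z"
proof -
  interpret F: module R "free_mod R X" by (rule free_mod_module)
  note g = free_gen_in[OF assms(1)] free_gen_in[OF assms(2)] free_gen_in[OF assms(3)]
  show ?thesis using g by (simp add: diff_def F.M.minus_eq F.M.a_assoc F.M.r_neg1)
qed

text \<open>A reduced vector is \<open>\<Sum>v(y)([y] - [y\<^sub>0])\<close>, as the sum of its coefficients vanishes.\<close>

lemma diff_span_base:
  assumes X: "X \<in> fin_obj" and y0: "y0 \<in> X"
  shows "spans R (red R X) ((\<lambda>y. diff R X y y0) ` X)"
proof -
  interpret F: module R "free_mod R X" by (rule free_mod_module)
  interpret M: module R "red R X" by (rule red_module[OF X])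
  let ?\<rho> = "free_lift R X (red R X) (\<lambda>y. diff R X y y0)"
  have dc: "(\<lambda>y. diff R X y y0) \<in> X \<rightarrow> carrier (red R X)" using diff_closed[OF X] y0 by auto
  note \<rho> = free_lift_hom[OF M.module_axioms dc]
  note g0 = free_gen_in[OF y0]
  let ?f = "\<lambda>v\<in>carrier (free_mod R X). ?\<rho> v \<oplus>\<^bsub>free_mod R X\<^esub> pairing R X (\<lambda>_. \<one>) v \<odot>\<^bsub>free_mod R X\<^esub> free_gen R X y0"
  have \<rho>c: "v \<in> carrier (free_mod R X) \<Longrightarrow> ?\<rho> v \<in> carrier (free_mod R X)" for v
    using mod_homD(2)[OF \<rho>] red_carrier[OF X] by blast
  have pc: "v \<in> carrier (free_mod R X) \<Longrightarrow> pairing R X (\<lambda>_. \<one>) v \<in> carrier R" for v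
    using mod_homD(2)[OF pairing_hom[OF const_one]] by (simp add: ring_mod_simps)
  have \<rho>a: "?\<rho> (u \<oplus>\<^bsub>free_mod R X\<^esub> v) = ?\<rho> u \<oplus>\<^bsub>free_mod R X\<^esub> ?\<rho> v"
    if "u \<in> carrier (free_mod R X)" "v \<in> carrier (free_mod R X)" for u v
    using mod_homD(3)[OF \<rho> that] by (simp add: red_simps[OF X])
  have \<rho>s: "?\<rho> (r \<odot>\<^bsub>free_mod R X\<^esub> v) = r \<odot>\<^bsub>free_mod R X\<^esub> ?\<rho> v"
    if "r \<in> carrier R" "v \<in> carrier (free_mod R X)" for r v
    using mod_homD(4)[OF \<rho> that] by (simp add: red_simps[OF X])
  have pa: "pairing R X (\<lambda>_. \<one>) (u \<oplus>\<^bsub>free_mod R X\<^esub> v) = pairing R X (\<lambda>_. \<one>) u \<oplus> pairing R X (\<lambda>_. \<one>) v"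
    if "u \<in> carrier (free_mod R X)" "v \<in> carrier (free_mod R X)" for u v
    using mod_homD(3)[OF pairing_hom[OF const_one] that] by (simp add: ring_mod_simps)
  have ps: "pairing R X (\<lambda>_. \<one>) (r \<odot>\<^bsub>free_mod R X\<^esub> v) = r \<otimes> pairing R X (\<lambda>_. \<one>) v"
    if "r \<in> carrier R" "v \<in> carrier (free_mod R X)" for r v
    using mod_homD(4)[OF pairing_hom[OF const_one] that] by (simp add: ring_mod_simps)
  have fh: "?f \<in> mod_hom R (free_mod R X) (free_mod R X)"
  proof (rule mod_homI)
    fix u v assume "u \<in> carrier (free_mod R X)" "v \<in> carrier (free_mod R X)"
    then show "?f (u \<oplus>\<^bsub>free_mod R X\<^esub> v) = ?f u \<oplus>\<^bsub>free_mod R X\<^esub> ?f v"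
      by (simp add: \<rho>a pa \<rho>c pc g0 F.smult_l_distr F.M.a_ac)
  next
    fix r v assume "r \<in> carrier R" "v \<in> carrier (free_mod R X)"
    then show "?f (r \<odot>\<^bsub>free_mod R X\<^esub> v) = r \<odot>\<^bsub>free_mod R X\<^esub> ?f v"
      by (simp add: \<rho>s ps \<rho>c pc g0 F.smult_r_distr F.smult_assoc1)
  qed (use \<rho>c pc g0 in auto)
  have id: "?f = (\<lambda>v\<in>carrier (free_mod R X). v)"
  proof (rule free_hom_eqI[OF F.module_axioms fh mod_hom_id[OF F.module_axioms]])
    fix s assume s: "s \<in> X"
    show "?f (free_gen R X s) = (\<lambda>v\<in>carrier (free_mod R X). v) (free_gen R X s)"
      using s free_gen_in[OF s] g0
      by (simp add: free_lift_gen[OF M.module_axioms dc s] pairing_gen[OF const_one]) (simp add: diff_def F.M.minus_eq F.M.a_assoc F.M.l_neg)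
  qed
  have \<rho>id: "?\<rho> v = v" if v: "v \<in> carrier (red R X)" for v
  proof -
    have "pairing R X (\<lambda>_. \<one>) v = \<zero>" "v \<in> carrier (free_mod R X)" using v by (auto simp: red_simps[OF X])
    then show ?thesis using fun_cong[OF id, of v] \<rho>c g0 by simp
  qed
  show ?thesis
  proof (rule spans_surj_image[OF F.module_axioms M.module_axioms \<rho> free_spans[OF cring_axioms]])
    show "?\<rho> ` free_gen R X ` X \<subseteq> (\<lambda>y. diff R X y y0) ` X"
      using free_lift_gen[OF M.module_axioms dc] by auto
    show "?\<rho> ` carrier (free_mod R X) = carrier (red R X)"
      using mod_homD(2)[OF \<rho>] \<rho>id red_carrier[OF X] by (force simp: image_iff)
  qed (use dc in auto)
qed

text \<open>
  This basis exists for every set; it is used to see that the embedding \<open>coef\<close> is injective.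
\<close>

lemma dual_family_base:
  assumes X: "X \<in> fin_obj" and y0: "y0 \<in> X"
  shows "dual_family X (X - {y0}) (\<lambda>y. diff R X y y0) (\<lambda>i y. if y = i then \<one> else \<zero>)"
proof -
  interpret M: module R "red R X" by (rule red_module[OF X])
  have "spans R (red R X) ((\<lambda>y. diff R X y y0) ` (X - {y0}))"
  proof (rule spansI)
    fix H assume H: "submodule H R (red R X)" "(\<lambda>y. diff R X y y0) ` (X - {y0}) \<subseteq> H"
    have "\<zero>\<^bsub>red R X\<^esub> = \<zero>\<^bsub>free_mod R X\<^esub>" by (simp add: red_simps(2)[OF X])
    then have "diff R X y0 y0 \<in> H" using diff_refl[OF y0] submoduleD(2)[OF H(1) M.module_axioms] by simp
    then have "(\<lambda>y. diff R X y y0) ` X \<subseteq> H" using H(2) by blast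
    then show "carrier (red R X) \<subseteq> H" by (rule spansD[OF diff_span_base[OF X y0] H(1)])
  qed (use diff_closed[OF X] y0 in auto)
  then show ?thesis
    using diff_closed(2)[OF X _ y0] by (auto simp: dual_family_def minus_eq)
qed

abbreviation step :: "nat \<Rightarrow> nat \<Rightarrow> nat \<Rightarrow> 'a"
  where "step a i \<equiv> diff R {..<Suc a} i (Suc i)"

text \<open>The functions dual to the successive differences are the indicators of initial segments.\<close>

definition below :: "nat \<Rightarrow> nat \<Rightarrow> 'a" where "below i y = (if y \<le> i then \<one> else \<zero>)"

lemma below_closed: "below i \<in> X \<rightarrow> carrier R" "below i y \<in> carrier R"
  by (auto simp: below_def)

lemma dual_family_step: "dual_family {..<Suc a} {..<a} (step a) below"
proof -
  let ?X = "{..<Suc a}"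
  note X = tup_fin_obj[of a]
  interpret M: module R "red R ?X" by (rule red_module[OF X])
  have "spans R (red R ?X) (step a ` {..<a})"
  proof (rule spansI)
    fix H assume H: "submodule H R (red R ?X)" "step a ` {..<a} \<subseteq> H"
    note HD = submoduleD[OF H(1) M.module_axioms]
    have z: "\<zero>\<^bsub>red R ?X\<^esub> = \<zero>\<^bsub>free_mod R ?X\<^esub>" "u \<oplus>\<^bsub>red R ?X\<^esub> v = u \<oplus>\<^bsub>free_mod R ?X\<^esub> v" for u v by (simp_all add: red_simps(2)[OF X])
    have "k \<le> a \<Longrightarrow> diff R ?X (a - k) a \<in> H" for k
    proof (induction k)
      case 0 then show ?case using HD(2) by (simp add: z diff_refl)
    next
      case (Suc k)
      have "step a (a - Suc k) \<in> H" using H(2) Suc.prems by auto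
      moreover have "Suc (a - Suc k) = a - k" using Suc.prems by simp
      ultimately have "diff R ?X (a - Suc k) (a - k) \<oplus>\<^bsub>red R ?X\<^esub> diff R ?X (a - k) a \<in> H" using Suc HD(3) by simp
      then show ?case using diff_add[of "a - Suc k" ?X "a - k" a] by (simp add: z)
    qed
    from this[of "a - y" for y] have "y \<le> a \<Longrightarrow> diff R ?X y a \<in> H" for y by (metis diff_diff_cancel diff_le_self)
    then have "(\<lambda>y. diff R ?X y a) ` ?X \<subseteq> H" by auto
    then show "carrier (red R ?X) \<subseteq> H" by (rule spansD[OF diff_span_base[OF X, of a] H(1), rotated]) simp
  qed (use diff_closed[OF X] in auto)
  moreover have "pairing R ?X (below i) (step a j) = (if i = j then \<one> else \<zero>)" if "i < a" "j < a" for i j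
    using that diff_closed(2)[OF X, of j "Suc j" "below i"] by (auto simp: below_closed below_def minus_eq r_neg)
  ultimately show ?thesis by (auto simp: dual_family_def below_closed)
qed

text \<open>
  The dual forms of a basis factor through the embedding.
\<close>

lemma coef_inj:
  assumes X: "X \<in> fin_obj" and v: "v \<in> carrier (fobj (T R a) X)" "w \<in> carrier (fobj (T R a) X)"
    and eq: "coef R a X v = coef R a X w"
  shows "v = w"
proof -
  obtain y0 where y0: "y0 \<in> X" using fin_objD(2)[OF X] by blast
  note d = dual_family_base[OF X y0]
  interpret M: module R "fobj (T R a) X" by (rule is_functorD(1)[OF T_functor X])
  have "v \<ominus>\<^bsub>fobj (T R a) X\<^esub> w = \<zero>\<^bsub>fobj (T R a) X\<^esub>"
  proof (rule forms_separate[OF d X])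
    fix f assume f: "f \<in> tup a (X - {y0})"
    let ?p = "\<lambda>i y. if y = i then \<one> else \<zero>"
    note K = ring_mod_module[OF cring_axioms]
    interpret K: module R "ring_mod R" by (rule K)
    have fh: "dual_form ?p a X f \<in> mod_hom R (fobj (T R a) X) (ring_mod R)" by (rule dual_form_hom(1)[OF X]) auto
    have "dual_form ?p a X f v = dual_form ?p a X f w" using eq v by (simp add: dual_form_def compose_eq)
    then have "dual_form ?p a X f (v \<ominus>\<^bsub>fobj (T R a) X\<^esub> w) = dual_form ?p a X f w \<ominus>\<^bsub>ring_mod R\<^esub> dual_form ?p a X f w"
      using mod_hom_minus[OF fh M.module_axioms K v] by simp
    also have "\<dots> = \<zero>" using mod_homD(2)[OF fh v(2)] by (simp add: K.M.minus_eq K.M.r_neg) (simp add: ring_mod_simps)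
    finally show "dual_form ?p a X f (v \<ominus>\<^bsub>fobj (T R a) X\<^esub> w) = \<zero>" .
  qed (use v in auto)
  then show ?thesis using v by (metis M.M.minus_eq M.M.minus_equality M.M.minus_minus M.M.a_inv_closed)
qed

end


section \<open>The chain formula\<close>

definition aug :: "('k, 'r) ring_scheme \<Rightarrow> nat set \<Rightarrow> (nat \<Rightarrow> 'k) \<Rightarrow> 'k"
  where "aug R X = pairing R X (\<lambda>_. \<one>\<^bsub>R\<^esub>)"

definition chain :: "('k, 'r) ring_scheme \<Rightarrow> nat \<Rightarrow> nat set \<Rightarrow> (nat \<Rightarrow> nat) \<Rightarrow> nat \<Rightarrow> nat \<Rightarrow> 'k"
  where "chain R a X x = (\<lambda>i\<in>{..<a}. diff R X (x i) (x (Suc i)))"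

text \<open>
  The tensor of successive differences along a path \<open>x\<close> is linear in \<open>[x]\<close>. The based version keeps
  the last point of the path, which makes it an endomorphism of \<open>rep (a + 1)\<close>; it is the projection
  onto the tensors that are reduced in all entries but the last.
\<close>

definition chain_map :: "('k, 'r) ring_scheme \<Rightarrow> nat \<Rightarrow> nat set \<Rightarrow> ((nat \<Rightarrow> nat) \<Rightarrow> 'k) \<Rightarrow> (nat \<Rightarrow> nat) \<Rightarrow> 'k"
  where "chain_map R a X = free_lift R (tup (Suc a) X) (free_mod R (tup a X)) (\<lambda>x. coord R a X (chain R a X x))"

definition based_chain_map :: "('k, 'r) ring_scheme \<Rightarrow> nat \<Rightarrow> nat set \<Rightarrow> ((nat \<Rightarrow> nat) \<Rightarrow> 'k) \<Rightarrow> (nat \<Rightarrow> nat) \<Rightarrow> 'k"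
  where "based_chain_map R a X = free_lift R (tup (Suc a) X) (free_mod R (tup (Suc a) X))
    (\<lambda>x. tens R a X (coord R a X (chain R a X x)) (free_gen R X (x a)))"

text \<open>
  The chain of the path through all points of \<open>{0, \<dots>, a}\<close>, of which every chain is an image.
\<close>

definition univ_chain :: "('k, 'r) ring_scheme \<Rightarrow> nat \<Rightarrow> ((nat \<Rightarrow> nat \<Rightarrow> 'k) \<Rightarrow> 'k) set"
  where "univ_chain R a = tpure R (red R {..<Suc a}) a (chain R a {..<Suc a} (\<lambda>i. i))"

definition yoneda :: "('k, 'r) ring_scheme \<Rightarrow> ('k, 'n) fin_functor \<Rightarrow> nat \<Rightarrow> 'n \<Rightarrow> nat set \<Rightarrow> ((nat \<Rightarrow> nat) \<Rightarrow> 'k) \<Rightarrow> 'n"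
  where "yoneda R G n h = (\<lambda>X\<in>fin_obj. free_lift R (tup n X) (fobj G X) (\<lambda>x. fmor G {..<n} X x h))"

text \<open>
  The transformation out of \<open>T n\<close> that extends to \<open>rep n\<close>, with the value \<open>h\<close> at the identity tuple.
\<close>

definition ext_by :: "('k, 'r) ring_scheme \<Rightarrow> ('k, 'n) fin_functor \<Rightarrow> nat \<Rightarrow> 'n \<Rightarrow> nat set \<Rightarrow> ((nat \<Rightarrow> nat \<Rightarrow> 'k) \<Rightarrow> 'k) set \<Rightarrow> 'n"
  where "ext_by R G n h = nt_comp (T R n) (yoneda R G n h) (coef R n)"

context cring
begin

lemma chain_closed:
  assumes "X \<in> fin_obj" "x \<in> tup (Suc a) X"
  shows "chain R a X x \<in> tuples (red R X) a"
  using assms tup_app[OF assms(2)] diff_closed(1)[OF assms(1)] by (auto simp: chain_def tuples_def)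

lemma coord_chain_closed:
  assumes "X \<in> fin_obj" "x \<in> tup (Suc a) X"
  shows "coord R a X (chain R a X x) \<in> carrier (free_mod R (tup a X))"
  by (rule coord_closed[OF fin_objD(1) red_tuples]) (use assms chain_closed in auto)

lemma chain_map_hom:
  assumes "X \<in> fin_obj"
  shows "chain_map R a X \<in> mod_hom R (free_mod R (tup (Suc a) X)) (free_mod R (tup a X))"
    and "x \<in> tup (Suc a) X \<Longrightarrow> chain_map R a X (free_gen R (tup (Suc a) X) x) = coord R a X (chain R a X x)"
proof -
  have c: "(\<lambda>x. coord R a X (chain R a X x)) \<in> tup (Suc a) X \<rightarrow> carrier (free_mod R (tup a X))"
    using coord_chain_closed[OF assms] by auto
  show "chain_map R a X \<in> mod_hom R (free_mod R (tup (Suc a) X)) (free_mod R (tup a X))"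
    unfolding chain_map_def by (rule free_lift_hom[OF free_mod_module c])
  show "x \<in> tup (Suc a) X \<Longrightarrow> chain_map R a X (free_gen R (tup (Suc a) X) x) = coord R a X (chain R a X x)"
    unfolding chain_map_def by (rule free_lift_gen[OF free_mod_module c])
qed

lemma based_chain_map_hom:
  assumes "X \<in> fin_obj"
  shows "based_chain_map R a X \<in> mod_hom R (free_mod R (tup (Suc a) X)) (free_mod R (tup (Suc a) X))"
    and "x \<in> tup (Suc a) X \<Longrightarrow> based_chain_map R a X (free_gen R (tup (Suc a) X) x) =
      tens R a X (coord R a X (chain R a X x)) (free_gen R X (x a))"
proof -
  have c: "(\<lambda>x. tens R a X (coord R a X (chain R a X x)) (free_gen R X (x a))) \<in> tup (Suc a) X \<rightarrow> carrier (free_mod R (tup (Suc a) X))"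
    using coord_chain_closed[OF assms] tup_app[of _ "Suc a" X a] by (auto intro!: tens_closed fin_objD(1)[OF assms] free_gen_in)
  show "based_chain_map R a X \<in> mod_hom R (free_mod R (tup (Suc a) X)) (free_mod R (tup (Suc a) X))"
    unfolding based_chain_map_def by (rule free_lift_hom[OF free_mod_module c])
  show "x \<in> tup (Suc a) X \<Longrightarrow> based_chain_map R a X (free_gen R (tup (Suc a) X) x) =
      tens R a X (coord R a X (chain R a X x)) (free_gen R X (x a))"
    unfolding based_chain_map_def by (rule free_lift_gen[OF free_mod_module c])
qed

lemma aug_lin: "lin R (free_mod R X) (ring_mod R) (aug R X)"
  unfolding aug_def by (rule lin_of_hom[OF pairing_hom[OF const_one]])

lemma aug_gen: "x \<in> X \<Longrightarrow> aug R X (free_gen R X x) = \<one>"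
  unfolding aug_def by (rule pairing_gen[OF const_one])

lemma red_aug: "X \<in> fin_obj \<Longrightarrow> v \<in> carrier (red R X) \<Longrightarrow> aug R X v = \<zero>"
  by (simp add: red_simps aug_def)

lemma free_lin_eq:
  assumes "lin R (free_mod R S) N f" "lin R (free_mod R S) N g" "module R N"
    "\<And>s. s \<in> S \<Longrightarrow> f (free_gen R S s) = g (free_gen R S s)" "v \<in> carrier (free_mod R S)"
  shows "f v = g v"
  by (rule lin_eq_on_spanning[OF assms(1,2) free_spans[OF cring_axioms] free_mod_module assms(3) _ assms(5)])
    (use assms(4) in auto)

lemma tens_lin_left: "finite X \<Longrightarrow> v \<in> carrier (free_mod R X) \<Longrightarrow>
    lin R (free_mod R (tup a X)) (free_mod R (tup (Suc a) X)) (\<lambda>w. tens R a X w v)"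
  unfolding lin_def by (rule tens_hom_left)

lemma tens_lin_right: "finite X \<Longrightarrow> w \<in> carrier (free_mod R (tup a X)) \<Longrightarrow>
    lin R (free_mod R X) (free_mod R (tup (Suc a) X)) (tens R a X w)"
  unfolding lin_def using tens_hom_right by simp

lemma lin_tens_left: "lin R M (free_mod R (tup a X)) g \<Longrightarrow> module R M \<Longrightarrow> finite X \<Longrightarrow> v \<in> carrier (free_mod R X) \<Longrightarrow>
    lin R M (free_mod R (tup (Suc a) X)) (\<lambda>w. tens R a X (g w) v)"
  by (rule lin_comp[OF _ tens_lin_left _ free_mod_module])

lemma lin_tens_right: "lin R M (free_mod R X) g \<Longrightarrow> module R M \<Longrightarrow> finite X \<Longrightarrow> w \<in> carrier (free_mod R (tup a X)) \<Longrightarrow>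
    lin R M (free_mod R (tup (Suc a) X)) (\<lambda>v. tens R a X w (g v))"
  by (rule lin_comp[OF _ tens_lin_right _ free_mod_module])

lemma lin_chain_map: "lin R M (free_mod R (tup (Suc a) X)) g \<Longrightarrow> module R M \<Longrightarrow> X \<in> fin_obj \<Longrightarrow>
    lin R M (free_mod R (tup a X)) (\<lambda>v. chain_map R a X (g v))"
  by (rule lin_comp[OF _ lin_of_hom[OF chain_map_hom(1)] _ free_mod_module])

lemma lin_based_chain_map: "lin R M (free_mod R (tup (Suc a) X)) g \<Longrightarrow> module R M \<Longrightarrow> X \<in> fin_obj \<Longrightarrow>
    lin R M (free_mod R (tup (Suc a) X)) (\<lambda>v. based_chain_map R a X (g v))"
  by (rule lin_comp[OF _ lin_of_hom[OF based_chain_map_hom(1)] _ free_mod_module])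

lemma lin_aug: "lin R M (free_mod R X) g \<Longrightarrow> module R M \<Longrightarrow> lin R M (ring_mod R) (\<lambda>v. aug R X (g v))"
  by (rule lin_comp[OF _ aug_lin _ free_mod_module])

lemma coef_lin: "X \<in> fin_obj \<Longrightarrow> lin R (fobj (T R a) X) (free_mod R (tup a X)) (coef R a X)"
  unfolding T_obj by (rule lin_of_hom[OF coef_hom(1)])

lemma lin_coef: "lin R M (fobj (T R a) X) g \<Longrightarrow> module R M \<Longrightarrow> X \<in> fin_obj \<Longrightarrow>
    lin R M (free_mod R (tup a X)) (\<lambda>v. coef R a X (g v))"
  by (rule lin_comp[OF _ coef_lin _ is_functorD(1)[OF T_functor]])

text \<open>
  The last edge of a path splits off as a factor once the last two points are fixed.
\<close>

lemma chain_map_step: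
  assumes X: "X \<in> fin_obj" and z: "z \<in> X" and y: "y \<in> X" and w: "w \<in> carrier (free_mod R (tup a X))"
  shows "chain_map R (Suc a) X (tens R (Suc a) X (tens R a X w (free_gen R X z)) (free_gen R X y)) =
    tens R a X (chain_map R a X (tens R a X w (free_gen R X z))) (diff R X z y)"
proof -
  note fX = fin_objD(1)[OF X] and m = free_mod_module
  note dc = red_carrier[OF X diff_closed(1)[OF X z y]]
  show ?thesis
  proof (rule free_lin_eq[OF _ _ m _ w])
    show "lin R (free_mod R (tup a X)) (free_mod R (tup (Suc a) X))
      (\<lambda>w. chain_map R (Suc a) X (tens R (Suc a) X (tens R a X w (free_gen R X z)) (free_gen R X y)))"
      by (intro lin_id lin_chain_map lin_tens_left
          lin_tens_left m X fX free_gen_in y z)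
    show "lin R (free_mod R (tup a X)) (free_mod R (tup (Suc a) X))
      (\<lambda>w. tens R a X (chain_map R a X (tens R a X w (free_gen R X z))) (diff R X z y))"
      by (intro lin_id lin_tens_left lin_chain_map
          lin_tens_left m X fX free_gen_in dc z)
    fix u assume u: "u \<in> tup a X"
    note u1 = tup_upd[OF u z] note u2 = tup_upd[OF u1 y]
    have c: "chain R (Suc a) X (u(a := z, Suc a := y)) \<in> tuples (free_mod R X) (Suc a)"
      by (rule red_tuples[OF X chain_closed[OF X u2]])
    have "restrict (chain R (Suc a) X (u(a := z, Suc a := y))) {..<a} = chain R a X (u(a := z))"
      by (auto simp: chain_def restrict_def)
    then show "chain_map R (Suc a) X (tens R (Suc a) X (tens R a X (free_gen R (tup a X) u) (free_gen R X z)) (free_gen R X y)) =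
      tens R a X (chain_map R a X (tens R a X (free_gen R (tup a X) u) (free_gen R X z))) (diff R X z y)"
      by (simp add: tens_gen[OF u z] tens_gen[OF u1 y] chain_map_hom(2)[OF X u1] chain_map_hom(2)[OF X u2] coord_Suc[OF c])
        (simp add: chain_def)
  qed
qed

text \<open>
  Expanding \<open>\<Prod>([x\<^sub>i] - [x\<^sub>i\<^sub>+\<^sub>1])\<close>, a term that takes \<open>[x\<^sub>i\<^sub>+\<^sub>1]\<close> in some factor misses \<open>x\<^sub>i\<close> for the least
  such \<open>i\<close>, and vanishes when summed against a vector that is reduced in that entry. Thus a reduced
  tensor is recovered from its chains, whatever the last point is. The recursion on the last entry
  avoids the expansion.
\<close>

lemma chain_map_tens:
  assumes X: "X \<in> fin_obj"
  shows "x \<in> tuples (red R X) a \<Longrightarrow> v \<in> carrier (free_mod R X) \<Longrightarrow>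
    chain_map R a X (tens R a X (coord R a X x) v) = aug R X v \<odot>\<^bsub>free_mod R (tup a X)\<^esub> coord R a X x"
proof (induction a arbitrary: x v)
  case 0
  note fX = fin_objD(1)[OF X] and m = free_mod_module
  interpret N: module R "free_mod R (tup 0 X)" by (rule m)
  let ?e = "coord R 0 X x" and ?u = "\<lambda>_::nat. undefined :: nat"
  have u: "?u \<in> tup 0 X" by (simp add: fin_hom_def)
  have e: "coord R 0 X x' = free_gen R (tup 0 X) ?u" for x'
    by (auto simp: coord_def free_gen_def fin_hom_def intro!: restrict_ext)
  have ec: "?e \<in> carrier (free_mod R (tup 0 X))" using e free_gen_in[OF u] by simp
  show ?case
  proof (rule free_lin_eq[OF _ _ m _ 0(2)])
    show "lin R (free_mod R X) (free_mod R (tup 0 X)) (\<lambda>v. chain_map R 0 X (tens R 0 X ?e v))"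
      by (intro lin_id lin_chain_map lin_tens_right m X fX ec)
    show "lin R (free_mod R X) (free_mod R (tup 0 X)) (\<lambda>v. aug R X v \<odot>\<^bsub>free_mod R (tup 0 X)\<^esub> ?e)"
      by (intro lin_id lin_scal lin_aug m ec)
    fix y assume y: "y \<in> X"
    note t = tup_upd[OF u y]
    show "chain_map R 0 X (tens R 0 X ?e (free_gen R X y)) = aug R X (free_gen R X y) \<odot>\<^bsub>free_mod R (tup 0 X)\<^esub> ?e"
      unfolding e tens_gen[OF u y] chain_map_hom(2)[OF X t] aug_gen[OF y]
      by (rule N.smult_one[OF free_gen_in[OF u], symmetric])
  qed
next
  case (Suc a)
  note fX = fin_objD(1)[OF X] and m = free_mod_module
  interpret N: module R "free_mod R (tup (Suc a) X)" by (rule m)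
  interpret N1: module R "free_mod R (tup a X)" by (rule m)
  define w where "w = coord R a X (restrict x {..<a})"
  have r: "restrict x {..<a} \<in> tuples (red R X) a" and xa: "x a \<in> carrier (red R X)"
    using Suc.prems(1) by (auto simp: tuples_def PiE_iff)
  have w: "w \<in> carrier (free_mod R (tup a X))" unfolding w_def by (rule coord_closed[OF fX red_tuples[OF X r]])
  note xa' = red_carrier[OF X xa]
  have cx: "coord R (Suc a) X x = tens R a X w (x a)"
    unfolding w_def by (rule coord_Suc[OF red_tuples[OF X Suc.prems(1)]])
  note tw = tens_closed[OF fX w]
  have IH: "chain_map R a X (tens R a X w v) = aug R X v \<odot>\<^bsub>free_mod R (tup a X)\<^esub> w" if "v \<in> carrier (free_mod R X)" for v
    unfolding w_def by (rule Suc.IH[OF r that])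
  \<comment> \<open>If the last entry is not reduced, its augmentation measures the failure. Both sides are linear in \<open>v'\<close>.\<close>
  have base: "chain_map R (Suc a) X (tens R (Suc a) X (tens R a X w v') (free_gen R X y))
      \<oplus>\<^bsub>free_mod R (tup (Suc a) X)\<^esub> aug R X v' \<odot>\<^bsub>free_mod R (tup (Suc a) X)\<^esub> tens R a X w (free_gen R X y) = tens R a X w v'"
    if y: "y \<in> X" and v': "v' \<in> carrier (free_mod R X)" for y v'
  proof (rule free_lin_eq[OF _ _ m _ v'])
    show "lin R (free_mod R X) (free_mod R (tup (Suc a) X)) (\<lambda>v'. chain_map R (Suc a) X (tens R (Suc a) X (tens R a X w v') (free_gen R X y))
      \<oplus>\<^bsub>free_mod R (tup (Suc a) X)\<^esub> aug R X v' \<odot>\<^bsub>free_mod R (tup (Suc a) X)\<^esub> tens R a X w (free_gen R X y))"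
      by (intro lin_id lin_add lin_scal lin_chain_map lin_tens_left
          lin_tens_left lin_tens_right lin_aug m X fX w tw free_gen_in y)
    show "lin R (free_mod R X) (free_mod R (tup (Suc a) X)) (tens R a X w)" by (rule tens_lin_right[OF fX w])
    fix z assume z: "z \<in> X"
    interpret F: module R "free_mod R X" by (rule m)
    note gz = free_gen_in[OF z] and gy = free_gen_in[OF y]
    note dc = red_carrier[OF X diff_closed(1)[OF X z y]]
    have "chain_map R (Suc a) X (tens R (Suc a) X (tens R a X w (free_gen R X z)) (free_gen R X y)) = tens R a X w (diff R X z y)"
      unfolding chain_map_step[OF X z y w] IH[OF gz] aug_gen[OF z] using w by simp
    moreover have "tens R a X w (diff R X z y \<oplus>\<^bsub>free_mod R X\<^esub> free_gen R X y) =
      tens R a X w (diff R X z y) \<oplus>\<^bsub>free_mod R (tup (Suc a) X)\<^esub> tens R a X w (free_gen R X y)"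
      by (rule linD(2)[OF tens_lin_right[OF fX w] m dc gy])
    moreover have "diff R X z y \<oplus>\<^bsub>free_mod R X\<^esub> free_gen R X y = free_gen R X z"
      using gz gy by (simp add: diff_def F.M.minus_eq F.M.a_assoc F.M.l_neg)
    ultimately show "chain_map R (Suc a) X (tens R (Suc a) X (tens R a X w (free_gen R X z)) (free_gen R X y))
      \<oplus>\<^bsub>free_mod R (tup (Suc a) X)\<^esub> aug R X (free_gen R X z) \<odot>\<^bsub>free_mod R (tup (Suc a) X)\<^esub> tens R a X w (free_gen R X y) = tens R a X w (free_gen R X z)"
      using tw[OF gy] aug_gen[OF z] by simp
  qed
  show ?case
  proof (rule free_lin_eq[OF _ _ m _ Suc.prems(2)])
    show "lin R (free_mod R X) (free_mod R (tup (Suc a) X)) (\<lambda>v. chain_map R (Suc a) X (tens R (Suc a) X (coord R (Suc a) X x) v))"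
      unfolding cx by (intro lin_id lin_chain_map lin_tens_right m X fX tw xa')
    show "lin R (free_mod R X) (free_mod R (tup (Suc a) X)) (\<lambda>v. aug R X v \<odot>\<^bsub>free_mod R (tup (Suc a) X)\<^esub> coord R (Suc a) X x)"
      unfolding cx by (intro lin_id lin_scal lin_aug m tw xa')
    fix y assume y: "y \<in> X"
    have "tens R (Suc a) X (tens R a X w (x a)) (free_gen R X y) \<in> carrier (free_mod R (tup (Suc (Suc a)) X))"
      by (intro tens_closed fX tw xa' free_gen_in y)
    then have "chain_map R (Suc a) X (tens R (Suc a) X (tens R a X w (x a)) (free_gen R X y)) \<in> carrier (free_mod R (tup (Suc a) X))"
      by (rule mod_homD(2)[OF chain_map_hom(1)[OF X]])
    then show "chain_map R (Suc a) X (tens R (Suc a) X (coord R (Suc a) X x) (free_gen R X y)) =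
      aug R X (free_gen R X y) \<odot>\<^bsub>free_mod R (tup (Suc a) X)\<^esub> coord R (Suc a) X x"
      using base[OF y xa'] red_aug[OF X xa] aug_gen[OF y] tw xa' free_gen_in[OF y] by (simp add: cx)
  qed
qed

text \<open>
  In the based version the last factor is left untouched, so the augmentation does not intervene.
\<close>

lemma based_chain_map_tens:
  assumes X: "X \<in> fin_obj" and x: "x \<in> tuples (red R X) a" and v: "v \<in> carrier (free_mod R X)"
  shows "based_chain_map R a X (tens R a X (coord R a X x) v) = tens R a X (coord R a X x) v"
proof -
  note fX = fin_objD(1)[OF X] and m = free_mod_module
  have w: "coord R a X x \<in> carrier (free_mod R (tup a X))" by (rule coord_closed[OF fX red_tuples[OF X x]])
  show ?thesis
  proof (rule free_lin_eq[OF _ tens_lin_right[OF fX w] m _ v])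
    show "lin R (free_mod R X) (free_mod R (tup (Suc a) X)) (\<lambda>v. based_chain_map R a X (tens R a X (coord R a X x) v))"
      by (intro lin_id lin_based_chain_map lin_tens_right m X fX w)
    fix y assume y: "y \<in> X"
    note gy = free_gen_in[OF y]
    have "based_chain_map R a X (tens R a X w' (free_gen R X y)) = tens R a X (chain_map R a X (tens R a X w' (free_gen R X y))) (free_gen R X y)"
      if w': "w' \<in> carrier (free_mod R (tup a X))" for w'
    proof (rule free_lin_eq[OF _ _ m _ w'])
      show "lin R (free_mod R (tup a X)) (free_mod R (tup (Suc a) X)) (\<lambda>w. based_chain_map R a X (tens R a X w (free_gen R X y)))"
        by (intro lin_id lin_based_chain_map lin_tens_left m X fX gy)
      show "lin R (free_mod R (tup a X)) (free_mod R (tup (Suc a) X)) (\<lambda>w. tens R a X (chain_map R a X (tens R a X w (free_gen R X y))) (free_gen R X y))"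
        by (intro lin_id lin_tens_left lin_chain_map
            lin_tens_left m X fX gy)
      fix u assume u: "u \<in> tup a X"
      note t = tup_upd[OF u y]
      show "based_chain_map R a X (tens R a X (free_gen R (tup a X) u) (free_gen R X y)) =
        tens R a X (chain_map R a X (tens R a X (free_gen R (tup a X) u) (free_gen R X y))) (free_gen R X y)"
        by (simp add: tens_gen[OF u y] based_chain_map_hom(2)[OF X t] chain_map_hom(2)[OF X t])
    qed
    from this[OF w] show "based_chain_map R a X (tens R a X (coord R a X x) (free_gen R X y)) = tens R a X (coord R a X x) (free_gen R X y)"
      using w chain_map_tens[OF X x gy] aug_gen[OF y] module.smult_one[OF m w] by simp
  qed
qed

subsection \<open>The universal chain\<close>

lemma univ_chain_closed: "univ_chain R a \<in> carrier (fobj (T R a) {..<Suc a})"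
  unfolding univ_chain_def T_obj
  by (rule tpure_closed[OF red_module[OF tup_fin_obj]])
    (auto simp: chain_def tuples_def intro!: diff_closed(1)[OF tup_fin_obj])

lemma univ_chain_map:
  assumes X: "X \<in> fin_obj" and x: "x \<in> tup (Suc a) X"
  shows "fmor (T R a) {..<Suc a} X x (univ_chain R a) = tpure R (red R X) a (chain R a X x)"
proof -
  have c: "chain R a {..<Suc a} (\<lambda>i. i) \<in> tuples (red R {..<Suc a}) a"
    by (auto simp: chain_def tuples_def intro!: diff_closed(1)[OF tup_fin_obj])
  have "tuple_map a (free_map R {..<Suc a} X x) (chain R a {..<Suc a} (\<lambda>i. i)) = chain R a X x"
    by (auto simp: tuple_map_def chain_def diff_map[OF x] intro!: restrict_ext)
  then show ?thesis unfolding univ_chain_def using T_map_tpure[OF tup_fin_obj X x c] by simp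
qed

lemma yoneda_gen:
  assumes G: "is_functor R G" and n: "{..<n} \<in> fin_obj" and h: "h \<in> carrier (fobj G {..<n})" and X: "X \<in> fin_obj"
  shows "yoneda R G n h X \<in> mod_hom R (free_mod R (tup n X)) (fobj G X)"
    and "x \<in> tup n X \<Longrightarrow> yoneda R G n h X (free_gen R (tup n X) x) = fmor G {..<n} X x h"
proof -
  note GD = is_functorD[OF G]
  have c: "(\<lambda>x. fmor G {..<n} X x h) \<in> tup n X \<rightarrow> carrier (fobj G X)"
    using mod_homD(2)[OF GD(2)[OF n X] h] by auto
  show "yoneda R G n h X \<in> mod_hom R (free_mod R (tup n X)) (fobj G X)"
    unfolding yoneda_def using free_lift_hom[OF GD(1)[OF X] c] X by simp
  show "x \<in> tup n X \<Longrightarrow> yoneda R G n h X (free_gen R (tup n X) x) = fmor G {..<n} X x h"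
    unfolding yoneda_def using free_lift_gen[OF GD(1)[OF X] c] X by simp
qed

lemma yoneda_nat:
  assumes G: "is_functor R G" and n: "{..<n} \<in> fin_obj" and h: "h \<in> carrier (fobj G {..<n})"
  shows "yoneda R G n h \<in> nat_trans R (rep R n) G"
proof (rule nat_transI)
  note GD = is_functorD[OF G] and y = yoneda_gen[OF G n h]
  show "yoneda R G n h X \<in> mod_hom R (fobj (rep R n) X) (fobj G X)" if "X \<in> fin_obj" for X
    using y(1)[OF that] by (simp add: rep_def)
  fix X Y f m assume a: "X \<in> fin_obj" "Y \<in> fin_obj" "f \<in> fin_hom X Y" "m \<in> carrier (fobj (rep R n) X)"
  have cf: "compose {..<n} f \<in> tup n X \<rightarrow> tup n Y" using tup_compose[OF _ a(3)] by auto
  have "yoneda R G n h Y (free_map R (tup n X) (tup n Y) (compose {..<n} f) m) = fmor G X Y f (yoneda R G n h X m)"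
  proof (rule free_lin_eq[where S = "tup n X" and N = "fobj G Y"])
    show "lin R (free_mod R (tup n X)) (fobj G Y) (\<lambda>m. yoneda R G n h Y (free_map R (tup n X) (tup n Y) (compose {..<n} f) m))"
      by (rule lin_comp[OF lin_of_hom[OF free_map_hom[OF cring_axioms cf]] lin_of_hom[OF y(1)[OF a(2)]] free_mod_module free_mod_module])
    show "lin R (free_mod R (tup n X)) (fobj G Y) (\<lambda>m. fmor G X Y f (yoneda R G n h X m))"
      by (rule lin_comp[OF lin_of_hom[OF y(1)[OF a(1)]] lin_of_hom[OF GD(2)[OF a(1-3)]] free_mod_module GD(1)[OF a(1)]])
    fix s assume s: "s \<in> tup n X"
    have "compose (carrier (fobj G {..<n})) (fmor G X Y f) (fmor G {..<n} X s) h = fmor G X Y f (fmor G {..<n} X s h)"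
      using h by (simp add: compose_eq)
    then show "yoneda R G n h Y (free_map R (tup n X) (tup n Y) (compose {..<n} f) (free_gen R (tup n X) s)) = fmor G X Y f (yoneda R G n h X (free_gen R (tup n X) s))"
      using y(2)[OF a(1) s] y(2)[OF a(2) funcset_mem[OF cf s]] GD(4)[OF n a(1,2) s a(3)]
      by (simp add: free_map_gen[OF cring_axioms cf s])
  qed (use a GD(1) in \<open>auto simp: rep_def\<close>)
  then show "yoneda R G n h Y (fmor (rep R n) X Y f m) = fmor G X Y f (yoneda R G n h X m)" by (simp add: rep_def)
qed (simp add: yoneda_def)

lemma ext_by_nat:
  assumes "is_functor R G" "{..<n} \<in> fin_obj" "h \<in> carrier (fobj G {..<n})"
  shows "ext_by R G n h \<in> nat_trans R (T R n) G"
  unfolding ext_by_def by (rule nt_comp_nat[OF coef_nat yoneda_nat[OF assms] T_functor])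

lemma ext_by_app: "X \<in> fin_obj \<Longrightarrow> v \<in> carrier (fobj (T R n) X) \<Longrightarrow> ext_by R G n h X v = yoneda R G n h X (coef R n X v)"
  by (simp add: ext_by_def nt_comp_app)

lemma yoneda_comp:
  assumes F: "is_functor R F" and G: "is_functor R G" and \<eta>: "\<eta> \<in> nat_trans R F G" and n: "{..<n} \<in> fin_obj"
    and h: "h \<in> carrier (fobj F {..<n})" and X: "X \<in> fin_obj" and w: "w \<in> carrier (free_mod R (tup n X))"
  shows "\<eta> X (yoneda R F n h X w) = yoneda R G n (\<eta> {..<n} h) X w"
proof -
  have h': "\<eta> {..<n} h \<in> carrier (fobj G {..<n})" by (rule mod_homD(2)[OF nat_transD(1)[OF \<eta> n] h])
  note y = yoneda_gen[OF F n h X] yoneda_gen[OF G n h' X]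
  show ?thesis
  proof (rule free_lin_eq[OF _ lin_of_hom[OF y(3)] _ _ w])
    show "lin R (free_mod R (tup n X)) (fobj G X) (\<lambda>w. \<eta> X (yoneda R F n h X w))"
      by (rule lin_comp[OF lin_of_hom[OF y(1)] lin_of_hom[OF nat_transD(1)[OF \<eta> X]] free_mod_module is_functorD(1)[OF F X]])
  qed (use y nat_transD(3)[OF \<eta> n X _ h] is_functorD(1)[OF G X] in auto)
qed

lemma coef_closed: "X \<in> fin_obj \<Longrightarrow> v \<in> carrier (fobj (T R a) X) \<Longrightarrow> coef R a X v \<in> carrier (free_mod R (tup a X))"
  using mod_homD(2)[OF coef_hom(1)] by (simp add: T_obj)

lemma coef_yoneda_univ_chain:
  assumes X: "X \<in> fin_obj" and w: "w \<in> carrier (free_mod R (tup (Suc a) X))"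
  shows "coef R a X (yoneda R (T R a) (Suc a) (univ_chain R a) X w) = chain_map R a X w"
proof -
  note y = yoneda_gen[OF T_functor tup_fin_obj univ_chain_closed X]
  show ?thesis
  proof (rule free_lin_eq[OF _ lin_of_hom[OF chain_map_hom(1)[OF X]] free_mod_module _ w])
    show "lin R (free_mod R (tup (Suc a) X)) (free_mod R (tup a X)) (\<lambda>w. coef R a X (yoneda R (T R a) (Suc a) (univ_chain R a) X w))"
      by (rule lin_comp[OF lin_of_hom[OF y(1)] coef_lin[OF X] free_mod_module is_functorD(1)[OF T_functor X]])
    show "coef R a X (yoneda R (T R a) (Suc a) (univ_chain R a) X (free_gen R (tup (Suc a) X) s)) = chain_map R a X (free_gen R (tup (Suc a) X) s)"
      if s: "s \<in> tup (Suc a) X" for s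
      by (simp add: y(2)[OF s] univ_chain_map[OF X s] coef_hom(2)[OF X chain_closed[OF X s]] chain_map_hom(2)[OF X s])
  qed
qed

lemma T_lin_eq:
  assumes X: "X \<in> fin_obj" and "lin R (fobj (T R a) X) N f" "lin R (fobj (T R a) X) N g" "module R N"
    and "\<And>x. x \<in> tuples (red R X) a \<Longrightarrow> f (tpure R (red R X) a x) = g (tpure R (red R X) a x)"
    and "v \<in> carrier (fobj (T R a) X)"
  shows "f v = g v"
  using assms(2,3) tensor_pow_spans[OF red_module[OF X] spans_carrier, of a, folded T_obj] is_functorD(1)[OF T_functor X] assms(4) _ assms(6)
  by (rule lin_eq_on_spanning) (use assms(5) in \<open>auto simp: tuples_def\<close>)

text \<open>
  Every tensor is an explicit combination of chains that end at any given point \<open>y\<close>. As chains are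
  images of the universal chain, \<open>T a\<close> is generated by a single element.
\<close>

theorem chain_formula:
  assumes X: "X \<in> fin_obj" and y: "y \<in> X" and v: "v \<in> carrier (fobj (T R a) X)"
  shows "yoneda R (T R a) (Suc a) (univ_chain R a) X (tens R a X (coef R a X v) (free_gen R X y)) = v"
proof (rule coef_inj[OF X _ v])
  note fX = fin_objD(1)[OF X] and gy = free_gen_in[OF y] and m = free_mod_module
  have t: "tens R a X (coef R a X v) (free_gen R X y) \<in> carrier (free_mod R (tup (Suc a) X))"
    by (rule tens_closed[OF fX coef_closed[OF X v] gy])
  show "yoneda R (T R a) (Suc a) (univ_chain R a) X (tens R a X (coef R a X v) (free_gen R X y)) \<in> carrier (fobj (T R a) X)"
    by (rule mod_homD(2)[OF yoneda_gen(1)[OF T_functor tup_fin_obj univ_chain_closed X] t])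
  have "chain_map R a X (tens R a X (coef R a X v) (free_gen R X y)) = coef R a X v"
  proof (rule T_lin_eq[OF X _ coef_lin[OF X] m _ v])
    show "lin R (fobj (T R a) X) (free_mod R (tup a X)) (\<lambda>v. chain_map R a X (tens R a X (coef R a X v) (free_gen R X y)))"
      by (intro lin_id lin_chain_map lin_tens_left
        lin_tens_left lin_coef m is_functorD(1)[OF T_functor] X fX gy)
    fix x assume x: "x \<in> tuples (red R X) a"
    interpret N: module R "free_mod R (tup a X)" by (rule m)
    show "chain_map R a X (tens R a X (coef R a X (tpure R (red R X) a x)) (free_gen R X y)) = coef R a X (tpure R (red R X) a x)"
      using coord_closed[OF fX red_tuples[OF X x]] by (simp add: coef_hom(2)[OF X x] chain_map_tens[OF X x gy] aug_gen[OF y])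
  qed
  then show "coef R a X (yoneda R (T R a) (Suc a) (univ_chain R a) X (tens R a X (coef R a X v) (free_gen R X y))) = coef R a X v"
    by (simp add: coef_yoneda_univ_chain[OF X t])
qed

lemma nat_trans_eqI_univ_chain:
  assumes G: "is_functor R G" and \<eta>: "\<eta> \<in> nat_trans R (T R a) G" and \<theta>: "\<theta> \<in> nat_trans R (T R a) G"
    and eq: "\<eta> {..<Suc a} (univ_chain R a) = \<theta> {..<Suc a} (univ_chain R a)"
  shows "\<eta> = \<theta>"
proof (rule nt_eqI[OF \<eta> \<theta>])
  fix X v assume X: "X \<in> fin_obj" and v: "v \<in> carrier (fobj (T R a) X)"
  obtain y where y: "y \<in> X" using fin_objD(2)[OF X] by blast
  have t: "tens R a X (coef R a X v) (free_gen R X y) \<in> carrier (free_mod R (tup (Suc a) X))"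
    by (rule tens_closed[OF fin_objD(1)[OF X] coef_closed[OF X v] free_gen_in[OF y]])
  show "\<eta> X v = \<theta> X v"
    using yoneda_comp[OF T_functor G \<eta> tup_fin_obj univ_chain_closed X t] yoneda_comp[OF T_functor G \<theta> tup_fin_obj univ_chain_closed X t] eq
    by (simp add: chain_formula[OF X y v])
qed

text \<open>
  On tensors that are reduced in the last entry too, the chain map vanishes: it multiplies by the
  augmentation of the last factor. These two facts say that \<open>T (a + 1)\<close> is the kernel of the map
  from \<open>rep 1 \<otimes> T a\<close> to \<open>T a\<close>.
\<close>

lemma coef_Suc_tens:
  assumes X: "X \<in> fin_obj" and v: "v \<in> carrier (fobj (T R (Suc a)) X)"
  shows "chain_map R a X (coef R (Suc a) X v) = \<zero>\<^bsub>free_mod R (tup a X)\<^esub>"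
    and "based_chain_map R a X (coef R (Suc a) X v) = coef R (Suc a) X v"
proof -
  note fX = fin_objD(1)[OF X] and m = free_mod_module
  interpret N: module R "free_mod R (tup a X)" by (rule m)
  have sp: "coef R (Suc a) X (tpure R (red R X) (Suc a) x) = tens R a X (coord R a X (restrict x {..<a})) (x a)"
    "restrict x {..<a} \<in> tuples (red R X) a" "x a \<in> carrier (red R X)" "x a \<in> carrier (free_mod R X)"
    if x: "x \<in> tuples (red R X) (Suc a)" for x
    using coord_Suc[OF red_tuples[OF X x]] x red_carrier[OF X, of "x a"]
    by (auto simp: coef_hom(2)[OF X x] tuples_def PiE_iff)
  have z: "lin R M (free_mod R (tup a X)) (\<lambda>_. \<zero>\<^bsub>free_mod R (tup a X)\<^esub>)" if "module R M" for M :: "('a, 'm) module"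
    by (rule linI[OF that]) auto
  show "chain_map R a X (coef R (Suc a) X v) = \<zero>\<^bsub>free_mod R (tup a X)\<^esub>"
  proof (rule T_lin_eq[OF X _ z[OF is_functorD(1)[OF T_functor X]] m _ v])
    show "lin R (fobj (T R (Suc a)) X) (free_mod R (tup a X)) (\<lambda>v. chain_map R a X (coef R (Suc a) X v))"
      by (intro lin_id lin_chain_map lin_coef m is_functorD(1)[OF T_functor] X)
    show "chain_map R a X (coef R (Suc a) X (tpure R (red R X) (Suc a) x)) = \<zero>\<^bsub>free_mod R (tup a X)\<^esub>"
      if x: "x \<in> tuples (red R X) (Suc a)" for x
      using coord_closed[OF fX red_tuples[OF X sp(2)[OF x]]]
      by (simp add: sp(1)[OF x] chain_map_tens[OF X sp(2)[OF x] sp(4)[OF x]] red_aug[OF X sp(3)[OF x]])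
  qed
  show "based_chain_map R a X (coef R (Suc a) X v) = coef R (Suc a) X v"
  proof (rule T_lin_eq[OF X _ coef_lin[OF X] m _ v])
    show "lin R (fobj (T R (Suc a)) X) (free_mod R (tup (Suc a) X)) (\<lambda>v. based_chain_map R a X (coef R (Suc a) X v))"
      by (intro lin_id lin_based_chain_map lin_coef m is_functorD(1)[OF T_functor] X)
    show "based_chain_map R a X (coef R (Suc a) X (tpure R (red R X) (Suc a) x)) = coef R (Suc a) X (tpure R (red R X) (Suc a) x)"
      if x: "x \<in> tuples (red R X) (Suc a)" for x
      by (simp add: sp(1)[OF x] based_chain_map_tens[OF X sp(2)[OF x] sp(4)[OF x]])
  qed
qed

end


section \<open>First extensions as morphisms modulo extendable ones\<close>

definition inclusion :: "('k, 'm) fin_functor \<Rightarrow> nat set \<Rightarrow> 'm \<Rightarrow> 'm"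
  where "inclusion F = (\<lambda>X\<in>fin_obj. \<lambda>v\<in>carrier (fobj F X). v)"

lemma ker_functor_simps:
  "carrier (fobj (ker_functor F G \<eta>) X) = {m \<in> carrier (fobj F X). \<eta> X m = \<zero>\<^bsub>fobj G X\<^esub>}"
  "add (fobj (ker_functor F G \<eta>) X) = add (fobj F X)"
  "smult (fobj (ker_functor F G \<eta>) X) = smult (fobj F X)"
  "fmor (ker_functor F G \<eta>) X Y f = restrict (fmor F X Y f) (carrier (fobj (ker_functor F G \<eta>) X))"
  by (auto simp: ker_functor_def Let_def)

lemma nat_trans_lin: "\<eta> \<in> nat_trans R F G \<Longrightarrow> X \<in> fin_obj \<Longrightarrow> lin R (fobj F X) (fobj G X) (\<eta> X)"
  by (rule lin_of_hom[OF nat_transD(1)])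

lemma nat_trans_closed: "\<eta> \<in> nat_trans R F G \<Longrightarrow> X \<in> fin_obj \<Longrightarrow> v \<in> carrier (fobj F X) \<Longrightarrow> \<eta> X v \<in> carrier (fobj G X)"
  by (rule mod_homD(2)[OF nat_transD(1)])

lemma nat_transI_lin:
  assumes "\<And>X. X \<in> fin_obj \<Longrightarrow> lin R (fobj F X) (fobj G X) (\<eta> X)"
    "\<And>X Y f m. X\<in>fin_obj \<Longrightarrow> Y\<in>fin_obj \<Longrightarrow> f\<in>fin_hom X Y \<Longrightarrow> m\<in>carrier (fobj F X) \<Longrightarrow>
       \<eta> Y (fmor F X Y f m) = fmor G X Y f (\<eta> X m)"
    and F: "is_functor R F"
  shows "(\<lambda>X\<in>fin_obj. restrict (\<eta> X) (carrier (fobj F X))) \<in> nat_trans R F G"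
proof (rule nat_transI)
  fix X Y f m assume h: "X \<in> fin_obj" "Y \<in> fin_obj" "f \<in> fin_hom X Y" "m \<in> carrier (fobj F X)"
  then show "(\<lambda>X\<in>fin_obj. restrict (\<eta> X) (carrier (fobj F X))) Y (fmor F X Y f m) =
      fmor G X Y f ((\<lambda>X\<in>fin_obj. restrict (\<eta> X) (carrier (fobj F X))) X m)"
    using mod_homD(2)[OF is_functorD(2)[OF F h(1-3)] h(4)] assms(2) by simp
qed (use assms(1) in \<open>auto simp: lin_def\<close>)

definition section_gen :: "('k, 'r) ring_scheme \<Rightarrow> ('k, 'm) fin_functor \<Rightarrow> nat set \<Rightarrow> 'm \<Rightarrow> (nat set \<times> 'm \<times> (nat \<Rightarrow> nat) \<Rightarrow> 'k)"
  where "section_gen R S X v = free_gen R (cover_gens S X) (X, v, \<lambda>y\<in>X. y)"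

context cring
begin

lemma inclusion_nat:
  assumes F: "is_functor R F" and G: "is_functor R G" and \<eta>: "\<eta> \<in> nat_trans R F G"
  shows "inclusion (ker_functor F G \<eta>) \<in> nat_trans R (ker_functor F G \<eta>) F"
  unfolding inclusion_def
proof (rule nat_transI_lin[OF _ _ ker_functor_functor[OF F G \<eta>]])
  fix X assume "X \<in> fin_obj"
  show "lin R (fobj (ker_functor F G \<eta>) X) (fobj F X) (\<lambda>v. v)"
    by (rule linI[OF is_functorD(1)[OF ker_functor_functor[OF F G \<eta>]]])
      (use \<open>X \<in> fin_obj\<close> in \<open>auto simp: ker_functor_simps\<close>)
qed (simp add: ker_functor_simps(4))

lemma nat_trans_into_ker:
  assumes F: "is_functor R F" and G: "is_functor R G" and \<eta>: "\<eta> \<in> nat_trans R F G"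
    and S: "is_functor R S" and m: "m \<in> nat_trans R S F"
    and z: "\<And>X v. X \<in> fin_obj \<Longrightarrow> v \<in> carrier (fobj S X) \<Longrightarrow> \<eta> X (m X v) = \<zero>\<^bsub>fobj G X\<^esub>"
  shows "m \<in> nat_trans R S (ker_functor F G \<eta>)"
proof (rule nat_transI)
  fix X assume X: "X \<in> fin_obj"
  note D = mod_homD[OF nat_transD(1)[OF m X]]
  show "m X \<in> mod_hom R (fobj S X) (fobj (ker_functor F G \<eta>) X)"
    by (rule mod_homI) (use D z[OF X] in \<open>auto simp: ker_functor_simps PiE_iff\<close>)
next
  fix X Y f v assume h: "X \<in> fin_obj" "Y \<in> fin_obj" "f \<in> fin_hom X Y" "v \<in> carrier (fobj S X)"
  have "m X v \<in> carrier (fobj (ker_functor F G \<eta>) X)"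
    using z[OF h(1,4)] nat_trans_closed[OF m h(1,4)] by (simp add: ker_functor_simps)
  then show "m Y (fmor S X Y f v) = fmor (ker_functor F G \<eta>) X Y f (m X v)"
    using nat_transD(3)[OF m h] by (simp add: ker_functor_simps(4))
qed (use nat_transD(2)[OF m] in auto)

text \<open>
  The lift is a choice of preimages; injectivity makes it linear and natural.
\<close>

lemma lift_through_injection:
  assumes S: "is_functor R S" and T': "is_functor R T'" and P: "is_functor R P"
    and m: "m \<in> nat_trans R S P" and c: "c \<in> nat_trans R T' P"
    and inj: "\<And>X u v. X \<in> fin_obj \<Longrightarrow> u \<in> carrier (fobj T' X) \<Longrightarrow> v \<in> carrier (fobj T' X) \<Longrightarrow> c X u = c X v \<Longrightarrow> u = v"
    and im: "\<And>X v. X \<in> fin_obj \<Longrightarrow> v \<in> carrier (fobj S X) \<Longrightarrow> m X v \<in> c X ` carrier (fobj T' X)"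
  obtains s where "s \<in> nat_trans R S T'" "\<And>X v. X \<in> fin_obj \<Longrightarrow> v \<in> carrier (fobj S X) \<Longrightarrow> c X (s X v) = m X v"
proof -
  define s where "s X v = (SOME u. u \<in> carrier (fobj T' X) \<and> c X u = m X v)" for X v
  have s: "s X v \<in> carrier (fobj T' X)" "c X (s X v) = m X v" if "X \<in> fin_obj" "v \<in> carrier (fobj S X)" for X v
  proof -
    have "\<exists>u. u \<in> carrier (fobj T' X) \<and> c X u = m X v" using im[OF that] by force
    then have "s X v \<in> carrier (fobj T' X) \<and> c X (s X v) = m X v" unfolding s_def by (rule someI_ex)
    then show "s X v \<in> carrier (fobj T' X)" "c X (s X v) = m X v" by auto
  qed
  have "(\<lambda>X\<in>fin_obj. restrict (s X) (carrier (fobj S X))) \<in> nat_trans R S T'"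
  proof (rule nat_transI_lin[OF _ _ S])
    fix X assume X: "X \<in> fin_obj"
    interpret S: module R "fobj S X" by (rule is_functorD(1)[OF S X])
    interpret T: module R "fobj T' X" by (rule is_functorD(1)[OF T' X])
    note mD = mod_homD[OF nat_transD(1)[OF m X]] and cD = mod_homD[OF nat_transD(1)[OF c X]]
    show "lin R (fobj S X) (fobj T' X) (s X)"
    proof (rule linI[OF S.module_axioms])
      fix x y assume xy: "x \<in> carrier (fobj S X)" "y \<in> carrier (fobj S X)"
      show "s X (x \<oplus>\<^bsub>fobj S X\<^esub> y) = s X x \<oplus>\<^bsub>fobj T' X\<^esub> s X y"
        by (rule inj[OF X]) (use xy s[OF X] in \<open>auto simp: mD(3) cD(3)\<close>)
    next
      fix r x assume xy: "r \<in> carrier R" "x \<in> carrier (fobj S X)"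
      show "s X (r \<odot>\<^bsub>fobj S X\<^esub> x) = r \<odot>\<^bsub>fobj T' X\<^esub> s X x"
        by (rule inj[OF X]) (use xy s[OF X] in \<open>auto simp: mD(4) cD(4)\<close>)
    qed (use s X in auto)
  next
    fix X Y f v assume h: "X \<in> fin_obj" "Y \<in> fin_obj" "f \<in> fin_hom X Y" "v \<in> carrier (fobj S X)"
    have fv: "fmor S X Y f v \<in> carrier (fobj S Y)" by (rule mod_homD(2)[OF is_functorD(2)[OF S h(1-3)] h(4)])
    show "s Y (fmor S X Y f v) = fmor T' X Y f (s X v)"
      by (rule inj[OF h(2)])
        (use s h fv mod_homD(2)[OF is_functorD(2)[OF T' h(1-3)] s(1)[OF h(1,4)]] in
          \<open>auto simp: nat_transD(3)[OF m h] nat_transD(3)[OF c h(1-3)]\<close>)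
  qed
  then show ?thesis by (rule that) (use s in auto)
qed

lemma cover_map_gen:
  assumes F: "is_functor R F" and Y: "Y \<in> fin_obj" and s: "(X, x, f) \<in> cover_gens F Y"
  shows "cover_map R F Y (free_gen R (cover_gens F Y) (X, x, f)) = fmor F X Y f x"
proof -
  note FD = is_functorD[OF F]
  have p: "(\<lambda>(X, x, f). fmor F X Y f x) \<in> cover_gens F Y \<rightarrow> carrier (fobj F Y)"
    using Y mod_homD(2)[OF FD(2)] by (auto simp: cover_gens_def)
  show ?thesis using free_lift_gen[OF FD(1)[OF Y] p s] Y by (simp add: cover_map_def)
qed

lemma cover_fmor_gen:
  assumes "f \<in> fin_hom X Y" "(Z, x, g) \<in> cover_gens F X"
  shows "fmor (cover R F) X Y f (free_gen R (cover_gens F X) (Z, x, g)) = free_gen R (cover_gens F Y) (Z, x, compose Z f g)"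
proof -
  have m: "(\<lambda>(X, x, g). (X, x, compose X f g)) \<in> cover_gens F X \<rightarrow> cover_gens F Y"
    using assms by (auto simp: cover_gens_def fin_hom_compose)
  show ?thesis using free_map_gen[OF cring_axioms m assms(2)] by (simp add: cover_def)
qed

lemma section_gen:
  assumes S: "is_functor R S" and X: "X \<in> fin_obj" and v: "v \<in> carrier (fobj S X)"
  shows "section_gen R S X v \<in> carrier (fobj (cover R S) X)" "cover_map R S X (section_gen R S X v) = v"
  using cover_map_surj[OF cring_axioms S X v] by (auto simp: section_gen_def)

text \<open>
  A natural transformation out of \<open>cover S\<close> that vanishes on the kernel of the covering map factors
  through \<open>S\<close>. The factor is computed on the canonical preimages \<open>section_gen\<close>, which are not linear in
  \<open>v\<close>; the failure of linearity lies in the kernel.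
\<close>

lemma descend:
  assumes S: "is_functor R S" and G: "is_functor R G" and \<phi>: "\<phi> \<in> nat_trans R (cover R S) G"
    and z: "\<And>X v. X \<in> fin_obj \<Longrightarrow> v \<in> carrier (fobj (cover R S) X) \<Longrightarrow> cover_map R S X v = \<zero>\<^bsub>fobj S X\<^esub> \<Longrightarrow> \<phi> X v = \<zero>\<^bsub>fobj G X\<^esub>"
  obtains \<psi> where "\<psi> \<in> nat_trans R S G" "\<phi> = nt_comp (cover R S) \<psi> (cover_map R S)"
    "\<And>X v. X \<in> fin_obj \<Longrightarrow> v \<in> carrier (fobj S X) \<Longrightarrow> \<psi> X v = \<phi> X (section_gen R S X v)"
proof -
  note C = cover_functor[OF cring_axioms, of S] and p = cover_map_nat[OF cring_axioms S]
  have eq: "\<phi> X u = \<phi> X v"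
    if X: "X \<in> fin_obj" and u: "u \<in> carrier (fobj (cover R S) X)" and v: "v \<in> carrier (fobj (cover R S) X)"
      and e: "cover_map R S X u = cover_map R S X v" for X u v
  proof -
    interpret C: module R "fobj (cover R S) X" by (rule is_functorD(1)[OF C X])
    interpret S: module R "fobj S X" by (rule is_functorD(1)[OF S X])
    interpret G: module R "fobj G X" by (rule is_functorD(1)[OF G X])
    note pc = nat_trans_closed[OF p X] and \<phi>c = nat_trans_closed[OF \<phi> X]
    have "cover_map R S X (u \<ominus>\<^bsub>fobj (cover R S) X\<^esub> v) = \<zero>\<^bsub>fobj S X\<^esub>"
      using mod_hom_minus[OF nat_transD(1)[OF p X] C.module_axioms S.module_axioms u v] e pc[OF v] by (simp add: S.M.minus_eq S.M.r_neg)
    then have "\<phi> X (u \<ominus>\<^bsub>fobj (cover R S) X\<^esub> v) = \<zero>\<^bsub>fobj G X\<^esub>" using z[OF X] u v by simp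
    then have "\<phi> X u \<ominus>\<^bsub>fobj G X\<^esub> \<phi> X v = \<zero>\<^bsub>fobj G X\<^esub>"
      using mod_hom_minus[OF nat_transD(1)[OF \<phi> X] C.module_axioms G.module_axioms u v] by simp
    then show ?thesis using \<phi>c[OF u] \<phi>c[OF v] by (rule_tac module_minus_zero[OF G.module_axioms])
  qed
  define \<psi> where "\<psi> = (\<lambda>X\<in>fin_obj. restrict (\<lambda>v. \<phi> X (section_gen R S X v)) (carrier (fobj S X)))"
  have \<psi>: "\<psi> \<in> nat_trans R S G" unfolding \<psi>_def
  proof (rule nat_transI_lin[OF _ _ S])
    fix X assume X: "X \<in> fin_obj"
    interpret C: module R "fobj (cover R S) X" by (rule is_functorD(1)[OF C X])
    interpret S: module R "fobj S X" by (rule is_functorD(1)[OF S X])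
    note g = section_gen[OF S X] and \<phi>D = mod_homD[OF nat_transD(1)[OF \<phi> X]] and pD = mod_homD[OF nat_transD(1)[OF p X]]
    show "lin R (fobj S X) (fobj G X) (\<lambda>v. \<phi> X (section_gen R S X v))"
    proof (rule linI[OF S.module_axioms])
      fix u v assume uv: "u \<in> carrier (fobj S X)" "v \<in> carrier (fobj S X)"
      have "\<phi> X (section_gen R S X (u \<oplus>\<^bsub>fobj S X\<^esub> v)) = \<phi> X (section_gen R S X u \<oplus>\<^bsub>fobj (cover R S) X\<^esub> section_gen R S X v)"
        by (rule eq[OF X]) (use g uv in \<open>auto simp: pD(3)\<close>)
      then show "\<phi> X (section_gen R S X (u \<oplus>\<^bsub>fobj S X\<^esub> v)) = \<phi> X (section_gen R S X u) \<oplus>\<^bsub>fobj G X\<^esub> \<phi> X (section_gen R S X v)"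
        using g uv by (simp add: \<phi>D(3))
    next
      fix r v assume uv: "r \<in> carrier R" "v \<in> carrier (fobj S X)"
      have "\<phi> X (section_gen R S X (r \<odot>\<^bsub>fobj S X\<^esub> v)) = \<phi> X (r \<odot>\<^bsub>fobj (cover R S) X\<^esub> section_gen R S X v)"
        by (rule eq[OF X]) (use g uv in \<open>auto simp: pD(4)\<close>)
      then show "\<phi> X (section_gen R S X (r \<odot>\<^bsub>fobj S X\<^esub> v)) = r \<odot>\<^bsub>fobj G X\<^esub> \<phi> X (section_gen R S X v)"
        using g uv by (simp add: \<phi>D(4))
    qed (use g \<phi>D(2) in auto)
  next
    fix X Y f v assume h: "X \<in> fin_obj" "Y \<in> fin_obj" "f \<in> fin_hom X Y" "v \<in> carrier (fobj S X)"
    note g = section_gen[OF S h(1,4)]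
    have fv: "fmor S X Y f v \<in> carrier (fobj S Y)" by (rule mod_homD(2)[OF is_functorD(2)[OF S h(1-3)] h(4)])
    have "\<phi> Y (section_gen R S Y (fmor S X Y f v)) = \<phi> Y (fmor (cover R S) X Y f (section_gen R S X v))"
      by (rule eq[OF h(2)])
        (use section_gen[OF S h(2) fv] mod_homD(2)[OF is_functorD(2)[OF C h(1-3)] g(1)] nat_transD(3)[OF p h(1-3) g(1)] g(2) in auto)
    then show "\<phi> Y (section_gen R S Y (fmor S X Y f v)) = fmor G X Y f (\<phi> X (section_gen R S X v))"
      using nat_transD(3)[OF \<phi> h(1-3) g(1)] by simp
  qed
  have "\<phi> = nt_comp (cover R S) \<psi> (cover_map R S)"
  proof (rule nt_eqI[OF \<phi> nt_comp_nat[OF p \<psi> C]])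
    fix X v assume X: "X \<in> fin_obj" and v: "v \<in> carrier (fobj (cover R S) X)"
    note pv = nat_trans_closed[OF p X v]
    have "\<phi> X v = \<phi> X (section_gen R S X (cover_map R S X v))"
      by (rule eq[OF X v]) (use section_gen[OF S X pv] in auto)
    then show "\<phi> X v = nt_comp (cover R S) \<psi> (cover_map R S) X v"
      using X v pv by (simp add: nt_comp_app \<psi>_def)
  qed
  then show ?thesis using that[OF \<psi>] by (simp add: \<psi>_def)
qed

text \<open>
  By exactness of the resolution, the cocycles are the morphisms out of the first syzygy.
\<close>

lemma cocycle_descends:
  assumes F: "is_functor R F" and G: "is_functor R G" and \<phi>: "\<phi> \<in> ext1_cocycles R F G"
  obtains \<psi> where "\<psi> \<in> nat_trans R (syz1 R F) G" "\<phi> = nt_comp (res1 R F) \<psi> (diff1 R F)"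
    "\<And>X v. X \<in> fin_obj \<Longrightarrow> v \<in> carrier (fobj (syz1 R F) X) \<Longrightarrow> \<psi> X v = \<phi> X (section_gen R (syz1 R F) X v)"
proof -
  note r = res_functor[OF cring_axioms F]
  have S: "is_functor R (syz1 R F)"
    unfolding syz1_def by (rule ker_functor_functor[OF cover_functor[OF cring_axioms] F cover_map_nat[OF cring_axioms F]])
  have \<phi>n: "\<phi> \<in> nat_trans R (cover R (syz1 R F)) G" and
    c: "nt_comp (res2 R F) \<phi> (diff2 R F) = \<zero>\<^bsub>Hom_mod R (res2 R F) G\<^esub>"
    using \<phi> by (auto simp: ext1_cocycles_def res1_def)
  have z: "\<phi> X v = \<zero>\<^bsub>fobj G X\<^esub>"
    if X: "X \<in> fin_obj" and v: "v \<in> carrier (fobj (cover R (syz1 R F)) X)" and k: "cover_map R (syz1 R F) X v = \<zero>\<^bsub>fobj (syz1 R F) X\<^esub>" for X v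
  proof -
    have "\<zero>\<^bsub>fobj (syz1 R F) X\<^esub> = \<zero>\<^bsub>fobj (res0 R F) X\<^esub>" by (simp add: syz1_def ker_functor_def Let_def res0_def)
    then have "v \<in> {m \<in> carrier (fobj (res1 R F) X). diff1 R F X m = \<zero>\<^bsub>fobj (res0 R F) X\<^esub>}"
      using v k by (simp add: res1_def diff1_def)
    then obtain u where u: "u \<in> carrier (fobj (res2 R F) X)" "v = diff2 R F X u"
      unfolding exact1[OF cring_axioms F X] by blast
    then show ?thesis using fun_cong[OF fun_cong[OF c, of X], of u] X by (simp add: nt_comp_app Hom_app)
  qed
  show ?thesis
  proof (rule descend[OF S G \<phi>n])
    show "\<phi> X v = \<zero>\<^bsub>fobj G X\<^esub>"
      if "X \<in> fin_obj" "v \<in> carrier (fobj (cover R (syz1 R F)) X)" "cover_map R (syz1 R F) X v = \<zero>\<^bsub>fobj (syz1 R F) X\<^esub>" for X v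
      using that by (rule z)
  qed (rule that[unfolded res1_def diff1_def])
qed

end


text \<open>
  A path in \<open>X\<close> goes to the generator of the cover of \<open>T a\<close> that stands for its chain. Conversely, the
  generator \<open>(X, x, f)\<close> stands for the element \<open>f x\<close> and is lifted to \<open>f x \<otimes> [f (Max X)]\<close>. Any choice of
  a point of \<open>X\<close> in place of \<open>Max X\<close> would give a natural lift; as \<open>Max {0, \<dots>, a} = a\<close>, this one keeps the
  last point of a path, so that the composition on \<open>rep (a + 1)\<close> is \<open>based_chain_map\<close>.
\<close>

definition to_cover :: "('k, 'r) ring_scheme \<Rightarrow> nat \<Rightarrow> nat set \<Rightarrow> ((nat \<Rightarrow> nat) \<Rightarrow> 'k) \<Rightarrow> _"
  where "to_cover R a = (\<lambda>X\<in>fin_obj. free_map R (tup (Suc a) X) (cover_gens (T R a) X) (\<lambda>x. ({..<Suc a}, univ_chain R a, x)))"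

definition of_cover :: "('k, 'r) ring_scheme \<Rightarrow> nat \<Rightarrow> nat set \<Rightarrow> _ \<Rightarrow> ((nat \<Rightarrow> nat) \<Rightarrow> 'k)"
  where "of_cover R a = (\<lambda>Y\<in>fin_obj. free_lift R (cover_gens (T R a) Y) (free_mod R (tup (Suc a) Y))
    (\<lambda>(X, x, f). tens R a Y (coef R a Y (fmor (T R a) X Y f x)) (free_gen R Y (f (Max X)))))"

context cring
begin

lemma to_cover_gen:
  assumes X: "X \<in> fin_obj"
  shows "to_cover R a X \<in> mod_hom R (free_mod R (tup (Suc a) X)) (fobj (cover R (T R a)) X)"
    and "x \<in> tup (Suc a) X \<Longrightarrow> to_cover R a X (free_gen R (tup (Suc a) X) x) =
      free_gen R (cover_gens (T R a) X) ({..<Suc a}, univ_chain R a, x)"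
    and "x \<in> tup (Suc a) X \<Longrightarrow> ({..<Suc a}, univ_chain R a, x) \<in> cover_gens (T R a) X"
proof -
  have g: "(\<lambda>x. ({..<Suc a}, univ_chain R a, x)) \<in> tup (Suc a) X \<rightarrow> cover_gens (T R a) X"
    using tup_fin_obj univ_chain_closed by (auto simp: cover_gens_def)
  show "to_cover R a X \<in> mod_hom R (free_mod R (tup (Suc a) X)) (fobj (cover R (T R a)) X)"
    unfolding to_cover_def using free_map_hom[OF cring_axioms g] X by (simp add: cover_def)
  show "x \<in> tup (Suc a) X \<Longrightarrow> to_cover R a X (free_gen R (tup (Suc a) X) x) =
      free_gen R (cover_gens (T R a) X) ({..<Suc a}, univ_chain R a, x)"
    unfolding to_cover_def using free_map_gen[OF cring_axioms g] X by simp
  show "x \<in> tup (Suc a) X \<Longrightarrow> ({..<Suc a}, univ_chain R a, x) \<in> cover_gens (T R a) X" using g by blast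
qed

lemma to_cover_nat: "to_cover R a \<in> nat_trans R (rep R (Suc a)) (cover R (T R a))"
proof (rule nat_transI)
  show "to_cover R a X \<in> mod_hom R (fobj (rep R (Suc a)) X) (fobj (cover R (T R a)) X)" if "X \<in> fin_obj" for X
    using to_cover_gen(1)[OF that] by (simp add: rep_def)
  fix X Y f m assume h: "X \<in> fin_obj" "Y \<in> fin_obj" "f \<in> fin_hom X Y" "m \<in> carrier (fobj (rep R (Suc a)) X)"
  note C = is_functorD[OF cover_functor[OF cring_axioms]]
  have cf: "compose {..<Suc a} f \<in> tup (Suc a) X \<rightarrow> tup (Suc a) Y" using tup_compose[OF _ h(3)] by blast
  note m = free_mod_module
  have "to_cover R a Y (free_map R (tup (Suc a) X) (tup (Suc a) Y) (compose {..<Suc a} f) m) = fmor (cover R (T R a)) X Y f (to_cover R a X m)"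
  proof (rule free_lin_eq[where S = "tup (Suc a) X"])
    show "lin R (free_mod R (tup (Suc a) X)) (fobj (cover R (T R a)) Y)
      (\<lambda>m. to_cover R a Y (free_map R (tup (Suc a) X) (tup (Suc a) Y) (compose {..<Suc a} f) m))"
      by (rule lin_comp[OF lin_of_hom[OF free_map_hom[OF cring_axioms cf]] lin_of_hom[OF to_cover_gen(1)[OF h(2)]] m m])
    show "lin R (free_mod R (tup (Suc a) X)) (fobj (cover R (T R a)) Y) (\<lambda>m. fmor (cover R (T R a)) X Y f (to_cover R a X m))"
      by (rule lin_comp[OF lin_of_hom[OF to_cover_gen(1)[OF h(1)]] lin_of_hom[OF C(2)[OF h(1-3)]] m C(1)[OF h(1)]])
    fix x assume x: "x \<in> tup (Suc a) X"
    show "to_cover R a Y (free_map R (tup (Suc a) X) (tup (Suc a) Y) (compose {..<Suc a} f) (free_gen R (tup (Suc a) X) x)) =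
      fmor (cover R (T R a)) X Y f (to_cover R a X (free_gen R (tup (Suc a) X) x))"
      using funcset_mem[OF cf x]
      by (simp add: free_map_gen[OF cring_axioms cf x] to_cover_gen(2)[OF h(1) x] to_cover_gen(2)[OF h(2)]
          cover_fmor_gen[OF h(3) to_cover_gen(3)[OF h(1) x]])
  qed (use C(1)[OF h(2)] h in \<open>auto simp: rep_def\<close>)
  then show "to_cover R a Y (fmor (rep R (Suc a)) X Y f m) = fmor (cover R (T R a)) X Y f (to_cover R a X m)"
    by (simp add: rep_def)
qed (simp add: to_cover_def)

lemma of_cover_gen:
  assumes Y: "Y \<in> fin_obj"
  shows "of_cover R a Y \<in> mod_hom R (fobj (cover R (T R a)) Y) (free_mod R (tup (Suc a) Y))"
    and "(X, x, f) \<in> cover_gens (T R a) Y \<Longrightarrow> of_cover R a Y (free_gen R (cover_gens (T R a) Y) (X, x, f)) =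
      tens R a Y (coef R a Y (fmor (T R a) X Y f x)) (free_gen R Y (f (Max X)))"
    and "(X, x, f) \<in> cover_gens (T R a) Y \<Longrightarrow> fmor (T R a) X Y f x \<in> carrier (fobj (T R a) Y)"
    and "(X, x, f) \<in> cover_gens (T R a) Y \<Longrightarrow> f (Max X) \<in> Y"
proof -
  have c: "fmor (T R a) X Y f x \<in> carrier (fobj (T R a) Y)" "f (Max X) \<in> Y" if "(X, x, f) \<in> cover_gens (T R a) Y" for X x f
    using that mod_homD(2)[OF is_functorD(2)[OF T_functor _ Y]] Max_in[of X]
    by (auto simp: cover_gens_def fin_obj_def fin_hom_def PiE_iff)
  then show "(X, x, f) \<in> cover_gens (T R a) Y \<Longrightarrow> fmor (T R a) X Y f x \<in> carrier (fobj (T R a) Y)"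
    "(X, x, f) \<in> cover_gens (T R a) Y \<Longrightarrow> f (Max X) \<in> Y" by auto
  have g: "(\<lambda>(X, x, f). tens R a Y (coef R a Y (fmor (T R a) X Y f x)) (free_gen R Y (f (Max X))))
    \<in> cover_gens (T R a) Y \<rightarrow> carrier (free_mod R (tup (Suc a) Y))"
    using c by (auto intro!: tens_closed fin_objD(1)[OF Y] coef_closed[OF Y] free_gen_in)
  show "of_cover R a Y \<in> mod_hom R (fobj (cover R (T R a)) Y) (free_mod R (tup (Suc a) Y))"
    unfolding of_cover_def using free_lift_hom[OF free_mod_module g] Y by (simp add: cover_def)
  show "(X, x, f) \<in> cover_gens (T R a) Y \<Longrightarrow> of_cover R a Y (free_gen R (cover_gens (T R a) Y) (X, x, f)) =
      tens R a Y (coef R a Y (fmor (T R a) X Y f x)) (free_gen R Y (f (Max X)))"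
    unfolding of_cover_def using free_lift_gen[OF free_mod_module g] Y by simp
qed

lemma cover_lin_eq:
  assumes "lin R (fobj (cover R F) Y) N f" "lin R (fobj (cover R F) Y) N g" "module R N"
    and "\<And>X x h. (X, x, h) \<in> cover_gens F Y \<Longrightarrow> f (free_gen R (cover_gens F Y) (X, x, h)) = g (free_gen R (cover_gens F Y) (X, x, h))"
    and "v \<in> carrier (fobj (cover R F) Y)"
  shows "f v = g v"
  by (rule free_lin_eq[where S = "cover_gens F Y" and N = N]) (use assms in \<open>auto simp: cover_def\<close>)

lemma tens_natural:
  assumes h: "X \<in> fin_obj" "Y \<in> fin_obj" "f \<in> fin_hom X Y" and y: "y \<in> X" and w: "w \<in> carrier (free_mod R (tup a X))"
  shows "free_map R (tup (Suc a) X) (tup (Suc a) Y) (compose {..<Suc a} f) (tens R a X w (free_gen R X y)) =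
    tens R a Y (free_map R (tup a X) (tup a Y) (compose {..<a} f) w) (free_gen R Y (f y))"
proof (rule free_lin_eq[OF _ _ free_mod_module _ w])
  note m = free_mod_module and fX = fin_objD(1)[OF h(1)] and fY = fin_objD(1)[OF h(2)]
  have fy: "f y \<in> Y" using h(3) y by (auto simp: fin_hom_def)
  have c: "compose {..<n} f \<in> tup n X \<rightarrow> tup n Y" for n using tup_compose[OF _ h(3)] by blast
  note fh = lin_of_hom[OF free_map_hom[OF cring_axioms c]]
  show "lin R (free_mod R (tup a X)) (free_mod R (tup (Suc a) Y))
    (\<lambda>w. free_map R (tup (Suc a) X) (tup (Suc a) Y) (compose {..<Suc a} f) (tens R a X w (free_gen R X y)))"
    by (rule lin_comp[OF tens_lin_left[OF fX free_gen_in[OF y]] fh m m])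
  show "lin R (free_mod R (tup a X)) (free_mod R (tup (Suc a) Y))
    (\<lambda>w. tens R a Y (free_map R (tup a X) (tup a Y) (compose {..<a} f) w) (free_gen R Y (f y)))"
    by (rule lin_tens_left[OF fh m fY free_gen_in[OF fy]])
  fix u assume u: "u \<in> tup a X"
  have "compose {..<Suc a} f (u(a := y)) = (compose {..<a} f u)(a := f y)"
    by (auto simp: compose_def fun_eq_iff)
  then show "free_map R (tup (Suc a) X) (tup (Suc a) Y) (compose {..<Suc a} f) (tens R a X (free_gen R (tup a X) u) (free_gen R X y)) =
    tens R a Y (free_map R (tup a X) (tup a Y) (compose {..<a} f) (free_gen R (tup a X) u)) (free_gen R Y (f y))"
    using funcset_mem[OF c u]
    by (simp add: tens_gen[OF u y] free_map_gen[OF cring_axioms c tup_upd[OF u y]] free_map_gen[OF cring_axioms c u] tens_gen fy)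
qed

lemma of_cover_nat: "of_cover R a \<in> nat_trans R (cover R (T R a)) (rep R (Suc a))"
proof (rule nat_transI)
  show "of_cover R a X \<in> mod_hom R (fobj (cover R (T R a)) X) (fobj (rep R (Suc a)) X)" if "X \<in> fin_obj" for X
    using of_cover_gen(1)[OF that] by (simp add: rep_def)
  fix X Y f m assume h: "X \<in> fin_obj" "Y \<in> fin_obj" "f \<in> fin_hom X Y" "m \<in> carrier (fobj (cover R (T R a)) X)"
  note C = is_functorD[OF cover_functor[OF cring_axioms]] and P = is_functorD[OF rep_functor]
  show "of_cover R a Y (fmor (cover R (T R a)) X Y f m) = fmor (rep R (Suc a)) X Y f (of_cover R a X m)"
  proof (rule cover_lin_eq[where N = "fobj (rep R (Suc a)) Y"])
    show "lin R (fobj (cover R (T R a)) X) (fobj (rep R (Suc a)) Y) (\<lambda>m. of_cover R a Y (fmor (cover R (T R a)) X Y f m))"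
      using lin_comp[OF lin_of_hom[OF C(2)[OF h(1-3)]] lin_of_hom[OF of_cover_gen(1)[OF h(2)]] C(1)[OF h(1)] C(1)[OF h(2)]] by (simp add: rep_def)
    show "lin R (fobj (cover R (T R a)) X) (fobj (rep R (Suc a)) Y) (\<lambda>m. fmor (rep R (Suc a)) X Y f (of_cover R a X m))"
      by (rule lin_comp[OF _ lin_of_hom[OF P(2)[OF h(1-3)]] C(1)[OF h(1)] P(1)[OF h(1)]])
        (use lin_of_hom[OF of_cover_gen(1)[OF h(1)]] in \<open>simp add: rep_def\<close>)
    fix Z x g assume s: "(Z, x, g) \<in> cover_gens (T R a) X"
    then have Z: "Z \<in> fin_obj" "x \<in> carrier (fobj (T R a) Z)" "g \<in> fin_hom Z X" by (auto simp: cover_gens_def)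
    have s2: "(Z, x, compose Z f g) \<in> cover_gens (T R a) Y" using Z h(3) by (auto simp: cover_gens_def fin_hom_compose)
    have "Max Z \<in> Z" using Z(1) by (auto simp: fin_obj_def)
    then have mx: "compose Z f g (Max Z) = f (g (Max Z))" by (simp add: compose_eq)
    note c = coef_closed[OF h(1) of_cover_gen(3)[OF h(1) s]]
    have "coef R a Y (fmor (T R a) Z Y (compose Z f g) x) = free_map R (tup a X) (tup a Y) (compose {..<a} f) (coef R a X (fmor (T R a) Z X g x))"
      using nat_transD(3)[OF coef_nat h(1-3) of_cover_gen(3)[OF h(1) s]] is_functorD(4)[OF T_functor Z(1) h(1,2) Z(3) h(3)] Z(2)
      by (simp add: rep_def compose_eq)
    then show "of_cover R a Y (fmor (cover R (T R a)) X Y f (free_gen R (cover_gens (T R a) X) (Z, x, g))) =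
      fmor (rep R (Suc a)) X Y f (of_cover R a X (free_gen R (cover_gens (T R a) X) (Z, x, g)))"
      by (simp add: cover_fmor_gen[OF h(3) s] of_cover_gen(2)[OF h(1) s] of_cover_gen(2)[OF h(2) s2] rep_def mx
          tens_natural[OF h(1-3) of_cover_gen(4)[OF h(1) s] c])
  qed (use P(1)[OF h(2)] h in auto)
qed (simp add: of_cover_def)

lemma cover_map_to_cover:
  assumes X: "X \<in> fin_obj" and w: "w \<in> carrier (free_mod R (tup (Suc a) X))"
  shows "cover_map R (T R a) X (to_cover R a X w) = yoneda R (T R a) (Suc a) (univ_chain R a) X w"
proof (rule free_lin_eq[OF _ _ is_functorD(1)[OF T_functor X] _ w])
  note y = yoneda_gen[OF T_functor tup_fin_obj univ_chain_closed X]
  note p = cover_map_nat[OF cring_axioms T_functor]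
  show "lin R (free_mod R (tup (Suc a) X)) (fobj (T R a) X) (\<lambda>w. cover_map R (T R a) X (to_cover R a X w))"
    by (rule lin_comp[OF lin_of_hom[OF to_cover_gen(1)[OF X]] nat_trans_lin[OF p X] free_mod_module
          is_functorD(1)[OF cover_functor[OF cring_axioms] X]])
  show "lin R (free_mod R (tup (Suc a) X)) (fobj (T R a) X) (yoneda R (T R a) (Suc a) (univ_chain R a) X)" by (rule lin_of_hom[OF y(1)])
  fix x assume x: "x \<in> tup (Suc a) X"
  show "cover_map R (T R a) X (to_cover R a X (free_gen R (tup (Suc a) X) x)) = yoneda R (T R a) (Suc a) (univ_chain R a) X (free_gen R (tup (Suc a) X) x)"
    by (simp add: to_cover_gen(2)[OF X x] y(2)[OF x] cover_map_gen[OF T_functor X to_cover_gen(3)[OF X x]])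
qed

text \<open>
  The lift is compatible with the projections to \<open>T a\<close>, by the chain formula.
\<close>

lemma cover_map_to_of:
  assumes X: "X \<in> fin_obj" and v: "v \<in> carrier (fobj (cover R (T R a)) X)"
  shows "cover_map R (T R a) X (to_cover R a X (of_cover R a X v)) = cover_map R (T R a) X v"
proof (rule cover_lin_eq[OF _ _ is_functorD(1)[OF T_functor X] _ v])
  note p = cover_map_nat[OF cring_axioms T_functor] and C = is_functorD(1)[OF cover_functor[OF cring_axioms] X]
  show "lin R (fobj (cover R (T R a)) X) (fobj (T R a) X) (\<lambda>v. cover_map R (T R a) X (to_cover R a X (of_cover R a X v)))"
    by (rule lin_comp[OF lin_comp[OF lin_of_hom[OF of_cover_gen(1)[OF X]] lin_of_hom[OF to_cover_gen(1)[OF X]] C free_mod_module]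
        nat_trans_lin[OF p X] C C])
  show "lin R (fobj (cover R (T R a)) X) (fobj (T R a) X) (cover_map R (T R a) X)" by (rule nat_trans_lin[OF p X])
  fix Z x g assume s: "(Z, x, g) \<in> cover_gens (T R a) X"
  note c = of_cover_gen(3)[OF X s] and y = of_cover_gen(4)[OF X s]
  have t: "tens R a X (coef R a X (fmor (T R a) Z X g x)) (free_gen R X (g (Max Z))) \<in> carrier (free_mod R (tup (Suc a) X))"
    by (intro tens_closed fin_objD(1)[OF X] coef_closed[OF X c] free_gen_in y)
  show "cover_map R (T R a) X (to_cover R a X (of_cover R a X (free_gen R (cover_gens (T R a) X) (Z, x, g)))) =
    cover_map R (T R a) X (free_gen R (cover_gens (T R a) X) (Z, x, g))"
    by (simp add: of_cover_gen(2)[OF X s] cover_map_to_cover[OF X t] chain_formula[OF X y c] cover_map_gen[OF T_functor X s])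
qed

lemma of_to_cover:
  assumes X: "X \<in> fin_obj" and w: "w \<in> carrier (free_mod R (tup (Suc a) X))"
  shows "of_cover R a X (to_cover R a X w) = based_chain_map R a X w"
proof (rule free_lin_eq[OF _ lin_of_hom[OF based_chain_map_hom(1)[OF X]] free_mod_module _ w])
  show "lin R (free_mod R (tup (Suc a) X)) (free_mod R (tup (Suc a) X)) (\<lambda>w. of_cover R a X (to_cover R a X w))"
    by (rule lin_comp[OF lin_of_hom[OF to_cover_gen(1)[OF X]] lin_of_hom[OF of_cover_gen(1)[OF X]] free_mod_module
          is_functorD(1)[OF cover_functor[OF cring_axioms] X]])
  fix x assume x: "x \<in> tup (Suc a) X"
  have "Max {..<Suc a} = a" by (rule Max_eqI) auto
  then show "of_cover R a X (to_cover R a X (free_gen R (tup (Suc a) X) x)) = based_chain_map R a X (free_gen R (tup (Suc a) X) x)"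
    by (simp add: to_cover_gen(2)[OF X x] of_cover_gen(2)[OF X to_cover_gen(3)[OF X x]] univ_chain_map[OF X x]
        coef_hom(2)[OF X chain_closed[OF X x]] based_chain_map_hom(2)[OF X x] del: lessThan_Suc)
qed

text \<open>
  Modulo the image of \<open>T R (Suc a)\<close> the base point of the lift may be moved to any fixed point, so that
  the lift of \<open>v\<close> depends on the image of \<open>v\<close> in \<open>T R a\<close> only.
\<close>

lemma of_cover_image:
  assumes Y: "Y \<in> fin_obj" and v: "v \<in> carrier (fobj (cover R (T R a)) Y)" and z: "cover_map R (T R a) Y v = \<zero>\<^bsub>fobj (T R a) Y\<^esub>"
  shows "of_cover R a Y v \<in> coef R (Suc a) Y ` carrier (fobj (T R (Suc a)) Y)"
proof -
  let ?H = "coef R (Suc a) Y ` carrier (fobj (T R (Suc a)) Y)" and ?N = "free_mod R (tup (Suc a) Y)" and ?C = "fobj (cover R (T R a)) Y"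
  obtain y0 where y0: "y0 \<in> Y" using fin_objD(2)[OF Y] by blast
  note fY = fin_objD(1)[OF Y] and m = free_mod_module and p = cover_map_nat[OF cring_axioms T_functor]
  note C = is_functorD(1)[OF cover_functor[OF cring_axioms] Y] and TY = is_functorD(1)[OF T_functor Y]
  interpret N: module R ?N by (rule m)
  interpret Ta: module R "fobj (T R a) Y" by (rule TY)
  interpret F: module R "free_mod R Y" by (rule m)
  have H: "submodule ?H R ?N"
    by (rule image_submodule[OF TY m coef_hom(1)[OF Y, folded T_obj]])
  have tens_diff: "tens R a Y (coef R a Y u) (diff R Y y y0) \<in> ?H" if y: "y \<in> Y" and u: "u \<in> carrier (fobj (T R a) Y)" for y u
  proof -
    note dc = diff_closed(1)[OF Y y y0]
    let ?f = "restrict (\<lambda>u. tens R a Y (coef R a Y u) (diff R Y y y0)) (carrier (fobj (T R a) Y))"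
    have l: "?f \<in> mod_hom R (fobj (T R a) Y) ?N"
      using lin_tens_left[OF coef_lin[OF Y] TY fY red_carrier[OF Y dc]] by (simp add: lin_def)
    have "tpure R (red R Y) a ` ({..<a} \<rightarrow>\<^sub>E carrier (red R Y)) \<subseteq> {u \<in> carrier (fobj (T R a) Y). ?f u \<in> ?H}"
    proof (rule image_subsetI)
      fix x assume "x \<in> {..<a} \<rightarrow>\<^sub>E carrier (red R Y)"
      then have x: "x \<in> tuples (red R Y) a" by (simp add: tuples_def)
      have x2: "x(a := diff R Y y y0) \<in> tuples (red R Y) (Suc a)"
        using x dc by (auto simp: tuples_def PiE_iff extensional_def)
      have rx: "restrict (x(a := diff R Y y y0)) {..<a} = x"
        using x by (auto simp: tuples_def PiE_iff extensional_def restrict_def fun_eq_iff)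
      have "coef R (Suc a) Y (tpure R (red R Y) (Suc a) (x(a := diff R Y y y0))) = tens R a Y (coef R a Y (tpure R (red R Y) a x)) (diff R Y y y0)"
        by (simp add: coef_hom(2)[OF Y x2] coef_hom(2)[OF Y x] coord_Suc[OF red_tuples[OF Y x2]] rx)
      moreover have "tpure R (red R Y) (Suc a) (x(a := diff R Y y y0)) \<in> carrier (fobj (T R (Suc a)) Y)"
        unfolding T_obj by (rule tpure_closed[OF red_module[OF Y] x2])
      ultimately have "tens R a Y (coef R a Y (tpure R (red R Y) a x)) (diff R Y y y0) \<in> ?H" by (metis image_eqI)
      then show "tpure R (red R Y) a x \<in> {u \<in> carrier (fobj (T R a) Y). ?f u \<in> ?H}"
        using tpure_closed[OF red_module[OF Y] x] by (simp add: T_obj)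
    qed
    from spansD[OF tensor_pow_spans[OF red_module[OF Y] spans_carrier, folded T_obj] preimage_submodule[OF TY m l H] this] u
    show ?thesis by auto
  qed
  \<comment> \<open>The lift with base point \<open>y0\<close> is subtracted; it is zero for \<open>v\<close> in the kernel.\<close>
  let ?g = "\<lambda>v. of_cover R a Y v \<oplus>\<^bsub>?N\<^esub> (\<ominus> \<one>) \<odot>\<^bsub>?N\<^esub> tens R a Y (coef R a Y (cover_map R (T R a) Y v)) (free_gen R Y y0)"
  have g: "lin R ?C ?N ?g"
    by (intro lin_add lin_smult lin_tens_left lin_coef nat_trans_lin[OF p Y] lin_of_hom[OF of_cover_gen(1)[OF Y]] free_gen_in y0 Y fY C m) simp
  have "free_gen R (cover_gens (T R a) Y) ` cover_gens (T R a) Y \<subseteq> {v \<in> carrier ?C. restrict ?g (carrier ?C) v \<in> ?H}"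
  proof (rule image_subsetI)
    fix s assume s: "s \<in> cover_gens (T R a) Y"
    obtain X x f where [simp]: "s = (X, x, f)" by (cases s)
    note s' = s[simplified]
    note c = of_cover_gen(3)[OF Y s'] and y = of_cover_gen(4)[OF Y s']
    let ?u = "coef R a Y (fmor (T R a) X Y f x)"
    have u: "?u \<in> carrier (free_mod R (tup a Y))" by (rule coef_closed[OF Y c])
    note tl = tens_lin_right[OF fY u]
    have "tens R a Y ?u (diff R Y (f (Max X)) y0) = tens R a Y ?u (free_gen R Y (f (Max X))) \<oplus>\<^bsub>?N\<^esub> tens R a Y ?u ((\<ominus> \<one>) \<odot>\<^bsub>free_mod R Y\<^esub> free_gen R Y y0)"
      using linD(2)[OF tl m free_gen_in[OF y], of "(\<ominus> \<one>) \<odot>\<^bsub>free_mod R Y\<^esub> free_gen R Y y0"] free_gen_in[OF y0]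
      by (simp add: diff_def F.M.minus_eq F.smult_l_minus)
    also have "tens R a Y ?u ((\<ominus> \<one>) \<odot>\<^bsub>free_mod R Y\<^esub> free_gen R Y y0) = (\<ominus> \<one>) \<odot>\<^bsub>?N\<^esub> tens R a Y ?u (free_gen R Y y0)"
      by (rule linD(3)[OF tl m _ free_gen_in[OF y0]]) simp
    finally have "?g (free_gen R (cover_gens (T R a) Y) s) \<in> ?H"
      using tens_diff[OF y c] by (simp add: of_cover_gen(2)[OF Y s'] cover_map_gen[OF T_functor Y s'])
    then show "free_gen R (cover_gens (T R a) Y) s \<in> {v \<in> carrier ?C. restrict ?g (carrier ?C) v \<in> ?H}"
      using free_gen_in[OF s] by (simp add: cover_def)
  qed
  from spansD[OF free_spans[OF cring_axioms] preimage_submodule[OF C m g[unfolded lin_def] H, unfolded cover_def fin_functor.simps]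
      this[unfolded cover_def fin_functor.simps]] v
  have "?g v \<in> ?H" by (auto simp: cover_def)
  moreover have "?g v = of_cover R a Y v"
  proof -
    have "coef R a Y \<zero>\<^bsub>fobj (T R a) Y\<^esub> = \<zero>\<^bsub>free_mod R (tup a Y)\<^esub>"
      by (rule mod_hom_zero[OF coef_hom(1)[OF Y, folded T_obj] TY m])
    moreover have "tens R a Y \<zero>\<^bsub>free_mod R (tup a Y)\<^esub> (free_gen R Y y0) = \<zero>\<^bsub>?N\<^esub>"
    proof -
      interpret N0: module R "free_mod R (tup a Y)" by (rule m)
      show ?thesis using mod_hom_zero[OF tens_hom_left[OF fY free_gen_in[OF y0], of a] m m] by simp
    qed
    moreover have "of_cover R a Y v \<in> carrier ?N" by (rule mod_homD(2)[OF of_cover_gen(1)[OF Y] v])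
    ultimately show ?thesis by (simp add: z)
  qed
  ultimately show ?thesis by simp
qed

lemma syz1_functor': "is_functor R (syz1 R (T R a))"
  unfolding syz1_def
  by (rule ker_functor_functor[OF cover_functor[OF cring_axioms] T_functor cover_map_nat[OF cring_axioms T_functor]])

lemma syz1_carrier: "carrier (fobj (syz1 R F) X) = {v \<in> carrier (fobj (cover R F) X). cover_map R F X v = \<zero>\<^bsub>fobj F X\<^esub>}"
  by (simp add: syz1_def ker_functor_simps)

end


text \<open>
  A cocycle is a morphism out of the syzygy, and is pulled back along the comparison \<open>to_cover\<close> to
  \<open>T (a + 1)\<close>. The canonical preimages convert it from a map on the next term of the resolution.
\<close>

definition obstruction :: "('k, 'r) ring_scheme \<Rightarrow> nat \<Rightarrow> _ \<Rightarrow> nat set \<Rightarrow> ((nat \<Rightarrow> nat \<Rightarrow> 'k) \<Rightarrow> 'k) set \<Rightarrow> 'n"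
  where "obstruction R a \<phi> = (\<lambda>X\<in>fin_obj. \<lambda>v\<in>carrier (fobj (T R (Suc a)) X).
    \<phi> X (section_gen R (syz1 R (T R a)) X (to_cover R a X (coef R (Suc a) X v))))"

context cring
begin

lemma to_syz1:
  shows "nt_comp (T R (Suc a)) (to_cover R a) (coef R (Suc a)) \<in> nat_trans R (T R (Suc a)) (syz1 R (T R a))"
    and "X \<in> fin_obj \<Longrightarrow> v \<in> carrier (fobj (T R (Suc a)) X) \<Longrightarrow> to_cover R a X (coef R (Suc a) X v) \<in> carrier (fobj (syz1 R (T R a)) X)"
proof -
  have n: "nt_comp (T R (Suc a)) (to_cover R a) (coef R (Suc a)) \<in> nat_trans R (T R (Suc a)) (cover R (T R a))"
    by (rule nt_comp_nat[OF coef_nat to_cover_nat T_functor])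
  have z: "cover_map R (T R a) X (to_cover R a X (coef R (Suc a) X v)) = \<zero>\<^bsub>fobj (T R a) X\<^esub>"
    if X: "X \<in> fin_obj" and v: "v \<in> carrier (fobj (T R (Suc a)) X)" for X v
  proof -
    note w = coef_closed[OF X v]
    interpret Ta: module R "fobj (T R a) X" by (rule is_functorD(1)[OF T_functor X])
    show ?thesis unfolding cover_map_to_cover[OF X w]
    proof (rule coef_inj[OF X mod_homD(2)[OF yoneda_gen(1)[OF T_functor tup_fin_obj univ_chain_closed X] w] Ta.M.zero_closed])
      show "coef R a X (yoneda R (T R a) (Suc a) (univ_chain R a) X (coef R (Suc a) X v)) = coef R a X \<zero>\<^bsub>fobj (T R a) X\<^esub>"
        unfolding coef_yoneda_univ_chain[OF X w] coef_Suc_tens(1)[OF X v]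
        by (rule mod_hom_zero[OF coef_hom(1)[OF X, folded T_obj] Ta.module_axioms free_mod_module, symmetric])
    qed
  qed
  show "nt_comp (T R (Suc a)) (to_cover R a) (coef R (Suc a)) \<in> nat_trans R (T R (Suc a)) (syz1 R (T R a))"
    unfolding syz1_def
    by (rule nat_trans_into_ker[OF cover_functor[OF cring_axioms] T_functor cover_map_nat[OF cring_axioms T_functor] T_functor n])
      (simp add: nt_comp_app z)
  show "to_cover R a X (coef R (Suc a) X v) \<in> carrier (fobj (syz1 R (T R a)) X)"
    if "X \<in> fin_obj" "v \<in> carrier (fobj (T R (Suc a)) X)"
    using z[OF that] nat_trans_closed[OF n that(1,2)] that by (simp add: syz1_carrier nt_comp_app)
qed

text \<open>
  The other comparison, from the syzygy to \<open>T (a + 1)\<close>: a lift of zero in \<open>T a\<close> is a tensor that is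
  reduced in the last entry too.
\<close>

lemma from_syz1:
  obtains s where "s \<in> nat_trans R (syz1 R (T R a)) (T R (Suc a))"
    "\<And>X v. X \<in> fin_obj \<Longrightarrow> v \<in> carrier (fobj (syz1 R (T R a)) X) \<Longrightarrow> coef R (Suc a) X (s X v) = of_cover R a X v"
proof -
  let ?S = "syz1 R (T R a)"
  have i: "inclusion ?S \<in> nat_trans R ?S (cover R (T R a))"
    unfolding syz1_def by (rule inclusion_nat[OF cover_functor[OF cring_axioms] T_functor cover_map_nat[OF cring_axioms T_functor]])
  note n = nt_comp_nat[OF i of_cover_nat syz1_functor']
  have app: "nt_comp ?S (of_cover R a) (inclusion ?S) X v = of_cover R a X v"
    if "X \<in> fin_obj" "v \<in> carrier (fobj ?S X)" for X v
    using that by (simp add: nt_comp_app inclusion_def)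
  show ?thesis
  proof (rule lift_through_injection[OF syz1_functor' T_functor rep_functor n coef_nat coef_inj])
    show "nt_comp ?S (of_cover R a) (inclusion ?S) X v \<in> coef R (Suc a) X ` carrier (fobj (T R (Suc a)) X)"
      if "X \<in> fin_obj" "v \<in> carrier (fobj ?S X)" for X v
      unfolding app[OF that] by (rule of_cover_image) (use that in \<open>auto simp: syz1_carrier\<close>)
  qed (use that app in auto)
qed

lemma obstruction_eq:
  assumes G: "is_functor R G" and \<psi>: "\<psi> \<in> nat_trans R (syz1 R (T R a)) G"
    and eq: "\<And>X v. X \<in> fin_obj \<Longrightarrow> v \<in> carrier (fobj (syz1 R (T R a)) X) \<Longrightarrow> \<phi> X (section_gen R (syz1 R (T R a)) X v) = \<psi> X v"
  shows "obstruction R a \<phi> \<in> nat_trans R (T R (Suc a)) G"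
    and "X \<in> fin_obj \<Longrightarrow> v \<in> carrier (fobj (T R (Suc a)) X) \<Longrightarrow> obstruction R a \<phi> X v = \<psi> X (to_cover R a X (coef R (Suc a) X v))"
proof -
  show app: "obstruction R a \<phi> X v = \<psi> X (to_cover R a X (coef R (Suc a) X v))"
    if "X \<in> fin_obj" "v \<in> carrier (fobj (T R (Suc a)) X)" for X v
    using that eq to_syz1(2)[OF that] by (simp add: obstruction_def)
  have "obstruction R a \<phi> = nt_comp (T R (Suc a)) \<psi> (nt_comp (T R (Suc a)) (to_cover R a) (coef R (Suc a)))"
    by (intro ext) (auto simp: obstruction_def nt_comp_def compose_def eq to_syz1(2))
  then show "obstruction R a \<phi> \<in> nat_trans R (T R (Suc a)) G"
    using nt_comp_nat[OF to_syz1(1) \<psi> T_functor] by simp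
qed

lemma obstruction_nat:
  assumes G: "is_functor R G" and \<phi>: "\<phi> \<in> ext1_cocycles R (T R a) G"
  shows "obstruction R a \<phi> \<in> nat_trans R (T R (Suc a)) G"
proof -
  obtain \<psi> where "\<psi> \<in> nat_trans R (syz1 R (T R a)) G"
    "\<And>X v. X \<in> fin_obj \<Longrightarrow> v \<in> carrier (fobj (syz1 R (T R a)) X) \<Longrightarrow> \<psi> X v = \<phi> X (section_gen R (syz1 R (T R a)) X v)"
    by (rule cocycle_descends[OF T_functor G \<phi>]) blast
  then show ?thesis using obstruction_eq(1)[OF G] by metis
qed

lemma obstruction_hom:
  assumes G: "is_functor R G"
  shows "(\<lambda>\<phi>\<in>ext1_cocycles R (T R a) G. obstruction R a \<phi>) \<in>
    mod_hom R ((Hom_mod R (res1 R (T R a)) G)\<lparr>carrier := ext1_cocycles R (T R a) G\<rparr>) (Hom_mod R (T R (Suc a)) G)"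
proof -
  let ?Z = "ext1_cocycles R (T R a) G" and ?H = "Hom_mod R (res1 R (T R a)) G"
  note sub = ext1_submodules(1)[OF cring_axioms T_functor[of a] G]
  note H = Hom_module[OF res_functor(2)[OF cring_axioms T_functor[of a]] G cring_axioms]
  note zD = submoduleD[OF sub H]
  note sg = section_gen[OF syz1_functor'[of a]]
  have sg': "X \<in> fin_obj \<Longrightarrow> v \<in> carrier (fobj (T R (Suc a)) X) \<Longrightarrow>
    section_gen R (syz1 R (T R a)) X (to_cover R a X (coef R (Suc a) X v)) \<in> carrier (fobj (res1 R (T R a)) X)" for X v
    using sg(1)[OF _ to_syz1(2)] by (simp add: res1_def)
  have "obstruction R a (\<phi> \<oplus>\<^bsub>?H\<^esub> \<psi>) = obstruction R a \<phi> \<oplus>\<^bsub>Hom_mod R (T R (Suc a)) G\<^esub> obstruction R a \<psi>"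
    if "\<phi> \<in> ?Z" "\<psi> \<in> ?Z" for \<phi> \<psi>
    by (intro ext) (auto simp: obstruction_def Hom_simps(3) sg')
  moreover have "obstruction R a (r \<odot>\<^bsub>?H\<^esub> \<phi>) = r \<odot>\<^bsub>Hom_mod R (T R (Suc a)) G\<^esub> obstruction R a \<phi>"
    if "r \<in> carrier R" "\<phi> \<in> ?Z" for r \<phi>
    by (intro ext) (auto simp: obstruction_def Hom_simps(4) sg')
  ultimately show ?thesis
    by (intro mod_homI) (use obstruction_nat[OF G] zD(3,4) in \<open>simp_all add: Hom_simps(1)\<close>)
qed

text \<open>
  The comparison from the syzygy is a left inverse of the comparison to it.
\<close>

lemma obstruction_surj:
  assumes G: "is_functor R G" and \<eta>: "\<eta> \<in> nat_trans R (T R (Suc a)) G"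
  obtains \<phi> where "\<phi> \<in> ext1_cocycles R (T R a) G" "obstruction R a \<phi> = \<eta>"
proof -
  let ?S = "syz1 R (T R a)"
  obtain s where s: "s \<in> nat_trans R ?S (T R (Suc a))"
    "\<And>X v. X \<in> fin_obj \<Longrightarrow> v \<in> carrier (fobj ?S X) \<Longrightarrow> coef R (Suc a) X (s X v) = of_cover R a X v"
    by (rule from_syz1) blast
  define \<psi> where "\<psi> = nt_comp ?S \<eta> s"
  define \<phi> where "\<phi> = nt_comp (res1 R (T R a)) \<psi> (diff1 R (T R a))"
  note r = res_functor[OF cring_axioms T_functor[of a]]
  have \<psi>: "\<psi> \<in> nat_trans R ?S G" unfolding \<psi>_def by (rule nt_comp_nat[OF s(1) \<eta> syz1_functor'])
  have d: "diff1 R (T R a) \<in> nat_trans R (res1 R (T R a)) ?S"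
    unfolding res1_def diff1_def by (rule cover_map_nat[OF cring_axioms syz1_functor'])
  have \<phi>n: "\<phi> \<in> nat_trans R (res1 R (T R a)) G" unfolding \<phi>_def by (rule nt_comp_nat[OF d \<psi> r(2)])
  have \<phi>: "\<phi> \<in> ext1_cocycles R (T R a) G"
    unfolding ext1_cocycles_def
  proof (rule CollectI, rule conjI[OF \<phi>n])
    show "nt_comp (res2 R (T R a)) \<phi> (diff2 R (T R a)) = \<zero>\<^bsub>Hom_mod R (res2 R (T R a)) G\<^esub>"
    proof (rule nt_eqI[OF nt_comp_nat[OF r(5) \<phi>n r(3)] Hom_closed(1)[OF r(3) G]])
      fix X m assume X: "X \<in> fin_obj" and m: "m \<in> carrier (fobj (res2 R (T R a)) X)"
      have "diff2 R (T R a) X m \<in> {m \<in> carrier (fobj (res1 R (T R a)) X). diff1 R (T R a) X m = \<zero>\<^bsub>fobj (res0 R (T R a)) X\<^esub>}"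
        unfolding exact1[OF cring_axioms T_functor X] using m by blast
      moreover have "\<psi> X \<zero>\<^bsub>fobj (res0 R (T R a)) X\<^esub> = \<zero>\<^bsub>fobj G X\<^esub>"
        using mod_hom_zero[OF nat_transD(1)[OF \<psi> X] is_functorD(1)[OF syz1_functor' X] is_functorD(1)[OF G X]]
        by (simp add: syz1_def ker_functor_def Let_def res0_def)
      ultimately show "nt_comp (res2 R (T R a)) \<phi> (diff2 R (T R a)) X m = \<zero>\<^bsub>Hom_mod R (res2 R (T R a)) G\<^esub> X m"
        using X m by (simp add: nt_comp_app Hom_app \<phi>_def)
    qed
  qed
  have eq: "\<phi> X (section_gen R ?S X v) = \<psi> X v" if "X \<in> fin_obj" "v \<in> carrier (fobj ?S X)" for X v
    using that section_gen[OF syz1_functor' that] by (simp add: \<phi>_def nt_comp_app res1_def diff1_def)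
  have "obstruction R a \<phi> = \<eta>"
  proof (rule nt_eqI[OF obstruction_nat[OF G \<phi>] \<eta>])
    fix X v assume X: "X \<in> fin_obj" and v: "v \<in> carrier (fobj (T R (Suc a)) X)"
    note t = to_syz1(2)[OF X v]
    have "s X (to_cover R a X (coef R (Suc a) X v)) = v"
      by (rule coef_inj[OF X nat_trans_closed[OF s(1) X t] v])
        (simp add: s(2)[OF X t] of_to_cover[OF X coef_closed[OF X v]] coef_Suc_tens(2)[OF X v])
    then show "obstruction R a \<phi> X v = \<eta> X v"
      using obstruction_eq(2)[OF G \<psi> eq X v] X t by (simp add: \<psi>_def nt_comp_app)
  qed
  then show ?thesis using that \<phi> by blast
qed

text \<open>
  The class of a cocycle is determined by its obstruction modulo the transformations that extend to
  \<open>rep (a + 1)\<close>: the comparison maps are inverse to each other up to a map that factors through the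
  cover, and the extension provided by \<open>h\<close> takes care of the rest.
\<close>

lemma obstruction_coboundary:
  assumes G: "is_functor R G" and \<phi>: "\<phi> \<in> ext1_cocycles R (T R a) G"
  shows "\<phi> \<in> ext1_coboundaries R (T R a) G \<longleftrightarrow>
    (\<exists>h\<in>carrier (fobj G {..<Suc a}). obstruction R a \<phi> = ext_by R G (Suc a) h)"
proof
  let ?F = "T R a" and ?S = "syz1 R (T R a)"
  note r = res_functor[OF cring_axioms T_functor[of a]]
  note C = cover_functor[OF cring_axioms, of ?F]
  have SC: "v \<in> carrier (fobj ?S X) \<Longrightarrow> v \<in> carrier (fobj (cover R ?F) X)" for X v by (simp add: syz1_carrier)
  {
    assume "\<phi> \<in> ext1_coboundaries R ?F G"
    then obtain \<Psi> where \<Psi>: "\<Psi> \<in> nat_trans R (cover R ?F) G" and e: "\<phi> = nt_comp (res1 R ?F) \<Psi> (diff1 R ?F)"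
      by (auto simp: ext1_coboundaries_def res0_def)
    let ?n = "{..<Suc a}"
    \<comment> \<open>By the Yoneda lemma, \<open>\<Psi>\<close> after \<open>to_cover\<close> is determined by its value at the identity tuple.\<close>
    define g where "g = free_gen R (cover_gens ?F ?n) (?n, univ_chain R a, \<lambda>y\<in>?n. y)"
    have gi: "(?n, univ_chain R a, \<lambda>y\<in>?n. y) \<in> cover_gens ?F ?n"
      using tup_fin_obj univ_chain_closed fin_hom_id by (auto simp: cover_gens_def)
    have gc: "g \<in> carrier (fobj (cover R ?F) ?n)" unfolding g_def using free_gen_in[OF gi] by (simp add: cover_def)
    define h where "h = \<Psi> ?n g"
    have h: "h \<in> carrier (fobj G ?n)" unfolding h_def by (rule nat_trans_closed[OF \<Psi> tup_fin_obj gc])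
    have yo: "\<Psi> X (to_cover R a X w) = yoneda R G (Suc a) h X w"
      if X: "X \<in> fin_obj" and w: "w \<in> carrier (free_mod R (tup (Suc a) X))" for X w
    proof (rule free_lin_eq[OF _ lin_of_hom[OF yoneda_gen(1)[OF G tup_fin_obj h X]] is_functorD(1)[OF G X] _ w])
      show "lin R (free_mod R (tup (Suc a) X)) (fobj G X) (\<lambda>w. \<Psi> X (to_cover R a X w))"
        by (rule lin_comp[OF lin_of_hom[OF to_cover_gen(1)[OF X]] nat_trans_lin[OF \<Psi> X] free_mod_module is_functorD(1)[OF C X]])
      fix x assume x: "x \<in> tup (Suc a) X"
      have "compose ?n x (\<lambda>y\<in>?n. y) = x" using x by (auto simp: fin_hom_def compose_def PiE_iff extensional_def)
      then have "to_cover R a X (free_gen R (tup (Suc a) X) x) = fmor (cover R ?F) ?n X x g"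
        by (simp only: to_cover_gen(2)[OF X x] g_def cover_fmor_gen[OF x gi])
      then show "\<Psi> X (to_cover R a X (free_gen R (tup (Suc a) X) x)) = yoneda R G (Suc a) h X (free_gen R (tup (Suc a) X) x)"
        unfolding yoneda_gen(2)[OF G tup_fin_obj h X x] using nat_transD(3)[OF \<Psi> tup_fin_obj X x gc] by (simp only: h_def)
    qed
    have "obstruction R a \<phi> = ext_by R G (Suc a) h"
    proof (rule nt_eqI[OF obstruction_nat[OF G \<phi>] ext_by_nat[OF G tup_fin_obj h]])
      fix X v assume X: "X \<in> fin_obj" and v: "v \<in> carrier (fobj (T R (Suc a)) X)"
      note t = to_syz1(2)[OF X v]
      show "obstruction R a \<phi> X v = ext_by R G (Suc a) h X v"
        using X v section_gen[OF syz1_functor' X t] yo[OF X coef_closed[OF X v]]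
        by (simp add: obstruction_def e nt_comp_app res1_def diff1_def ext_by_app)
    qed
    then show "\<exists>h\<in>carrier (fobj G ?n). obstruction R a \<phi> = ext_by R G (Suc a) h" using h by blast
  }
  assume "\<exists>h\<in>carrier (fobj G {..<Suc a}). obstruction R a \<phi> = ext_by R G (Suc a) h"
  then obtain h where h: "h \<in> carrier (fobj G {..<Suc a})" and e: "obstruction R a \<phi> = ext_by R G (Suc a) h" by blast
  obtain \<psi> where \<psi>: "\<psi> \<in> nat_trans R ?S G" "\<phi> = nt_comp (res1 R ?F) \<psi> (diff1 R ?F)"
    "\<And>X v. X \<in> fin_obj \<Longrightarrow> v \<in> carrier (fobj ?S X) \<Longrightarrow> \<psi> X v = \<phi> X (section_gen R ?S X v)"
    by (rule cocycle_descends[OF T_functor G \<phi>]) blast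
  obtain s where s: "s \<in> nat_trans R ?S (T R (Suc a))"
    "\<And>X v. X \<in> fin_obj \<Longrightarrow> v \<in> carrier (fobj ?S X) \<Longrightarrow> coef R (Suc a) X (s X v) = of_cover R a X v"
    by (rule from_syz1) blast
  \<comment> \<open>On the syzygy, \<open>c\<close> differs from the identity by \<open>to_cover\<close> after \<open>of_cover\<close>; the extension that \<open>h\<close> provides
     makes up for it.\<close>
  define c where "c X v = v \<oplus>\<^bsub>fobj (cover R ?F) X\<^esub> (\<ominus> \<one>) \<odot>\<^bsub>fobj (cover R ?F) X\<^esub> to_cover R a X (of_cover R a X v)" for X v
  define \<Psi> where "\<Psi> X v = yoneda R G (Suc a) h X (of_cover R a X v) \<oplus>\<^bsub>fobj G X\<^esub> \<psi> X (c X v)" for X v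
  note oc = of_cover_nat[of a] and tc = to_cover_nat[of a] and yo = yoneda_nat[OF G tup_fin_obj h]
  note p = cover_map_nat[OF cring_axioms T_functor[of a]]
  have ocl: "v \<in> carrier (fobj (cover R ?F) X) \<Longrightarrow> X \<in> fin_obj \<Longrightarrow> of_cover R a X v \<in> carrier (fobj (rep R (Suc a)) X)" for X v
    using nat_trans_closed[OF oc] by blast
  have tcl: "v \<in> carrier (fobj (cover R ?F) X) \<Longrightarrow> X \<in> fin_obj \<Longrightarrow> to_cover R a X (of_cover R a X v) \<in> carrier (fobj (cover R ?F) X)" for X v
    using nat_trans_closed[OF tc _ ocl] by blast
  have c_syz: "c X v \<in> carrier (fobj ?S X)" if X: "X \<in> fin_obj" and v: "v \<in> carrier (fobj (cover R ?F) X)" for X v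
  proof -
    interpret C: module R "fobj (cover R ?F) X" by (rule is_functorD(1)[OF C X])
    interpret Ta: module R "fobj ?F X" by (rule is_functorD(1)[OF T_functor X])
    note pD = mod_homD[OF nat_transD(1)[OF p X]]
    show ?thesis using v tcl[OF v X] cover_map_to_of[OF X v] pD(2)[OF v]
      by (simp add: syz1_carrier c_def pD(3,4) Ta.smult_l_minus Ta.M.r_neg)
  qed
  have "(\<lambda>X\<in>fin_obj. restrict (\<Psi> X) (carrier (fobj (cover R ?F) X))) \<in> nat_trans R (cover R ?F) G"
  proof (rule nat_transI_lin[OF _ _ C])
    fix X assume X: "X \<in> fin_obj"
    note CX = is_functorD(1)[OF C X] and GX = is_functorD(1)[OF G X]
    have lc: "lin R (fobj (cover R ?F) X) (fobj (cover R ?F) X) (c X)"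
      unfolding c_def
      by (intro lin_add lin_id lin_smult lin_comp[OF nat_trans_lin[OF oc X] nat_trans_lin[OF tc X]] CX is_functorD(1)[OF rep_functor X]) simp
    have lc': "lin R (fobj (cover R ?F) X) (fobj ?S X) (c X)"
    proof (rule linI[OF CX c_syz[OF X]])
      fix x y assume "x \<in> carrier (fobj (cover R ?F) X)" "y \<in> carrier (fobj (cover R ?F) X)"
      then show "c X (x \<oplus>\<^bsub>fobj (cover R ?F) X\<^esub> y) = c X x \<oplus>\<^bsub>fobj ?S X\<^esub> c X y"
        using linD(2)[OF lc CX] by (simp add: syz1_def ker_functor_simps)
    next
      fix r x assume "r \<in> carrier R" "x \<in> carrier (fobj (cover R ?F) X)"
      then show "c X (r \<odot>\<^bsub>fobj (cover R ?F) X\<^esub> x) = r \<odot>\<^bsub>fobj ?S X\<^esub> c X x"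
        using linD(3)[OF lc CX] by (simp add: syz1_def ker_functor_simps)
    qed
    show "lin R (fobj (cover R ?F) X) (fobj G X) (\<Psi> X)"
      unfolding \<Psi>_def
      by (intro lin_add lin_comp[OF nat_trans_lin[OF oc X] nat_trans_lin[OF yo X]] lin_comp[OF lc' nat_trans_lin[OF \<psi>(1) X]]
          CX GX is_functorD(1)[OF rep_functor X] is_functorD(1)[OF syz1_functor' X])
  next
    fix X Y f v assume h': "X \<in> fin_obj" "Y \<in> fin_obj" "f \<in> fin_hom X Y" "v \<in> carrier (fobj (cover R ?F) X)"
    note CD = mod_homD[OF is_functorD(2)[OF C h'(1-3)]] and GD = mod_homD[OF is_functorD(2)[OF G h'(1-3)]]
    interpret CX: module R "fobj (cover R ?F) X" by (rule is_functorD(1)[OF C h'(1)])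
    note on = nat_transD(3)[OF oc h'] and ov = ocl[OF h'(4,1)] and tv = tcl[OF h'(4,1)]
    have cn: "c Y (fmor (cover R ?F) X Y f v) = fmor (cover R ?F) X Y f (c X v)"
      using nat_transD(3)[OF tc h'(1-3) ov] h'(4) tv by (simp add: c_def on CD(3,4))
    also have "\<dots> = fmor ?S X Y f (c X v)" using c_syz[OF h'(1,4)] by (simp add: syz1_def ker_functor_simps(4))
    finally show "\<Psi> Y (fmor (cover R ?F) X Y f v) = fmor G X Y f (\<Psi> X v)"
      using nat_transD(3)[OF \<psi>(1) h'(1-3) c_syz[OF h'(1,4)]] nat_transD(3)[OF yo h'(1-3) ov]
        nat_trans_closed[OF \<psi>(1) h'(1) c_syz[OF h'(1,4)]] nat_trans_closed[OF yo h'(1) ov]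
      by (simp add: \<Psi>_def on GD(3))
  qed
  moreover have "\<phi> = nt_comp (res1 R ?F) (\<lambda>X\<in>fin_obj. restrict (\<Psi> X) (carrier (fobj (cover R ?F) X))) (diff1 R ?F)"
  proof -
    have d: "diff1 R ?F \<in> nat_trans R (res1 R ?F) ?S"
      unfolding res1_def diff1_def by (rule cover_map_nat[OF cring_axioms syz1_functor'])
    have \<Psi>S: "\<Psi> X v = \<psi> X v" if X: "X \<in> fin_obj" and v: "v \<in> carrier (fobj ?S X)" for X v
    proof -
      interpret GX: module R "fobj G X" by (rule is_functorD(1)[OF G X])
      interpret SX: module R "fobj ?S X" by (rule is_functorD(1)[OF syz1_functor' X])
      note sv = nat_trans_closed[OF s(1) X v]
      let ?w = "to_cover R a X (of_cover R a X v)"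
      have w: "?w \<in> carrier (fobj ?S X)" using to_syz1(2)[OF X sv] s(2)[OF X v] by simp
      have "yoneda R G (Suc a) h X (of_cover R a X v) = \<psi> X ?w"
        using obstruction_eq(2)[OF G \<psi>(1) \<psi>(3)[symmetric] X sv] ext_by_app[OF X sv, of G h] unfolding e s(2)[OF X v] by metis
      moreover have "c X v = v \<oplus>\<^bsub>fobj ?S X\<^esub> (\<ominus> \<one>) \<odot>\<^bsub>fobj ?S X\<^esub> ?w"
        by (simp add: c_def syz1_def ker_functor_simps)
      moreover have "\<psi> X (v \<oplus>\<^bsub>fobj ?S X\<^esub> (\<ominus> \<one>) \<odot>\<^bsub>fobj ?S X\<^esub> ?w) = \<psi> X v \<oplus>\<^bsub>fobj G X\<^esub> (\<ominus> \<one>) \<odot>\<^bsub>fobj G X\<^esub> \<psi> X ?w"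
        using v w mod_homD(3,4)[OF nat_transD(1)[OF \<psi>(1) X]] by simp
      ultimately show ?thesis
        using nat_trans_closed[OF \<psi>(1) X v] nat_trans_closed[OF \<psi>(1) X w]
        by (simp add: \<Psi>_def GX.smult_l_minus GX.M.a_lcomm GX.M.r_neg)
    qed
    show ?thesis unfolding \<psi>(2)
      by (intro ext) (auto simp: nt_comp_def compose_def \<Psi>S nat_trans_closed[OF d] SC)
  qed
  ultimately show "\<phi> \<in> ext1_coboundaries R ?F G" by (auto simp: ext1_coboundaries_def res0_def)
qed

text \<open>
  The quotient of the morphisms out of \<open>T (a + 1)\<close> is presented by a homomorphism \<open>\<mu>\<close> with the right
  kernel, so that it need not be formed.
\<close>

theorem Ext1_via_obstruction:
  assumes G: "is_functor R G" and P: "module R P"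
    and \<mu>: "\<mu> \<in> mod_hom R (Hom_mod R (T R (Suc a)) G) P"
    and surj: "\<mu> ` nat_trans R (T R (Suc a)) G = carrier P"
    and ker: "\<And>\<eta>. \<eta> \<in> nat_trans R (T R (Suc a)) G \<Longrightarrow>
      \<mu> \<eta> = \<zero>\<^bsub>P\<^esub> \<longleftrightarrow> (\<exists>h\<in>carrier (fobj G {..<Suc a}). \<eta> = ext_by R G (Suc a) h)"
  shows "mod_iso R (Ext1_mod R (T R a) G) P"
proof -
  let ?F = "T R a" let ?Z = "(Hom_mod R (res1 R ?F) G)\<lparr>carrier := ext1_cocycles R ?F G\<rparr>"
  note s = ext1_submodules[OF cring_axioms T_functor[of a] G]
  note H = Hom_module[OF res_functor(2)[OF cring_axioms T_functor[of a]] G cring_axioms]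
  have Z: "module R ?Z" by (rule submodule.submodule_is_module[OF s(1) H])
  have q: "quot R ?Z (ext1_coboundaries R ?F G)" by (simp add: quot_def Z submodule_restrict[OF H s])
  let ?\<theta> = "\<lambda>\<phi>\<in>ext1_cocycles R ?F G. obstruction R a \<phi>"
  let ?f = "compose (carrier ?Z) \<mu> ?\<theta>"
  show ?thesis unfolding Ext1_mod_def
  proof (rule quot_iso[OF q mod_hom_compose[OF obstruction_hom[OF G] \<mu> Z] P])
    show "?f ` carrier ?Z = carrier P"
    proof
      show "?f ` carrier ?Z \<subseteq> carrier P"
        using mod_homD(2)[OF mod_hom_compose[OF obstruction_hom[OF G] \<mu> Z]] by blast
      show "carrier P \<subseteq> ?f ` carrier ?Z"
      proof
        fix y assume "y \<in> carrier P"
        then obtain \<eta> where \<eta>: "\<eta> \<in> nat_trans R (T R (Suc a)) G" "y = \<mu> \<eta>" using surj by blast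
        obtain \<phi> where "\<phi> \<in> ext1_cocycles R ?F G" "obstruction R a \<phi> = \<eta>" by (rule obstruction_surj[OF G \<eta>(1)])
        then show "y \<in> ?f ` carrier ?Z" using \<eta>(2) by (intro image_eqI[of _ _ \<phi>]) (auto simp: compose_eq)
      qed
    qed
    show "?f \<phi> = \<zero>\<^bsub>P\<^esub> \<longleftrightarrow> \<phi> \<in> ext1_coboundaries R ?F G" if "\<phi> \<in> carrier ?Z" for \<phi>
      using that ker[OF obstruction_nat[OF G]] obstruction_coboundary[OF G] by (simp add: compose_eq)
  qed
qed

end


section \<open>Matching surjections\<close>

definition surjs :: "nat \<Rightarrow> nat set \<Rightarrow> (nat \<Rightarrow> nat) set"
  where "surjs b A = {f \<in> tup b A. f ` {..<b} = A}"

text \<open>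
  The values \<open>m - 1\<close> and \<open>m\<close> become one. A surjection \<open>f\<close> onto \<open>{..<n}\<close> is an ordered partition into the
  blocks \<open>f -` {t}\<close>, and \<open>merges b m f\<close> joins the neighbouring blocks \<open>m - 1\<close> and \<open>m\<close>.
\<close>

definition merge :: "nat \<Rightarrow> nat \<Rightarrow> nat"
  where "merge m t = (if t < m then t else t - 1)"

abbreviation merges :: "nat \<Rightarrow> nat \<Rightarrow> (nat \<Rightarrow> nat) \<Rightarrow> nat \<Rightarrow> nat"
  where "merges b m f \<equiv> compose {..<b} (merge m) f"

text \<open>
  The matching looks for the first element \<open>i\<close> that is not the singleton block in position \<open>i\<close>. The
  elements before it occupy the first blocks in order. It is a target if this element, in its later
  position, is a singleton, and a source otherwise. Merging the singleton with the block before it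
  turns a target into a source, and splitting the element off to the right undoes this.
\<close>

definition settled :: "nat \<Rightarrow> (nat \<Rightarrow> nat) \<Rightarrow> nat \<Rightarrow> bool"
  where "settled b f i \<longleftrightarrow> i < b \<and> f i = i \<and> (\<forall>j<b. f j = i \<longrightarrow> j = i)"

definition depth :: "nat \<Rightarrow> (nat \<Rightarrow> nat) \<Rightarrow> nat"
  where "depth b f = (LEAST i. \<not> settled b f i)"

definition single :: "nat \<Rightarrow> (nat \<Rightarrow> nat) \<Rightarrow> bool"
  where "single b f \<longleftrightarrow> (\<forall>j<b. f j = f (depth b f) \<longrightarrow> j = depth b f)"

definition targets :: "nat \<Rightarrow> nat \<Rightarrow> (nat \<Rightarrow> nat) set"
  where "targets b n = {f \<in> surjs b {..<n}. depth b f < b \<and> single b f}"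

definition sources :: "nat \<Rightarrow> nat \<Rightarrow> (nat \<Rightarrow> nat) set"
  where "sources b n = {f \<in> surjs b {..<n}. depth b f < b \<and> \<not> single b f}"

definition match :: "nat \<Rightarrow> (nat \<Rightarrow> nat) \<Rightarrow> nat \<Rightarrow> nat"
  where "match b f = merges b (f (depth b f)) f"

text \<open>
  Lexicographic: small depth first, and for equal depth large position first; the position is less
  than \<open>Suc b\<close>.
\<close>

definition match_rank :: "nat \<Rightarrow> (nat \<Rightarrow> nat) \<Rightarrow> nat"
  where "match_rank b u = depth b u * Suc b + (b - u (depth b u))"

lemma surjs_bound: "f \<in> surjs b {..<n} \<Longrightarrow> j < b \<Longrightarrow> f j < n"
  by (auto simp: surjs_def)

lemma surjs_obtain:
  assumes "f \<in> surjs b {..<n}" "t < n"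
  obtains j where "j < b" "f j = t"
proof -
  have "t \<in> f ` {..<b}" using assms by (simp add: surjs_def)
  then show ?thesis using that by auto
qed

lemma surjsI:
  assumes "f \<in> extensional {..<b}" "\<And>j. j < b \<Longrightarrow> f j < n" "\<And>t. t < n \<Longrightarrow> \<exists>j<b. f j = t"
  shows "f \<in> surjs b {..<n}"
  using assms by (force simp: surjs_def fin_hom_def PiE_iff)

lemma surjs_ext: "f \<in> surjs b A \<Longrightarrow> f \<in> extensional {..<b}"
  by (auto simp: surjs_def fin_hom_def PiE_iff)

lemma finite_surjs: "finite A \<Longrightarrow> finite (surjs b A)"
  unfolding surjs_def using tup_finite[of A b] by auto

lemma surjs_le: "f \<in> surjs b {..<n} \<Longrightarrow> n \<le> b"
  unfolding surjs_def using card_image_le[of "{..<b}" f] by auto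

lemma settled_below: "i < depth b f \<Longrightarrow> settled b f i"
  unfolding depth_def using not_less_Least by blast

lemma not_settled_depth: "\<not> settled b f (depth b f)"
  unfolding depth_def by (rule LeastI[of _ b]) (simp add: settled_def)

lemma depth_le: "\<not> settled b f i \<Longrightarrow> depth b f \<le> i"
  unfolding depth_def by (rule Least_le)

lemma depth_eqI:
  assumes "\<And>i. i < r \<Longrightarrow> settled b f i" "\<not> settled b f r"
  shows "depth b f = r"
  using depth_le[OF assms(2)] assms(1) not_settled_depth[of b f] by (metis le_neq_implies_less)

lemma depth_bound: "depth b f \<le> j \<Longrightarrow> j < b \<Longrightarrow> depth b f \<le> f j"
proof (rule ccontr)
  assume h: "depth b f \<le> j" "j < b" and "\<not> depth b f \<le> f j"
  then have "settled b f (f j)" by (intro settled_below) simp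
  then have "j = f j" using h by (simp add: settled_def)
  then show False using h \<open>\<not> depth b f \<le> f j\<close> by linarith
qed

lemma targetD:
  assumes "f \<in> targets b n"
  shows "f \<in> surjs b {..<n}" "depth b f < b" "j < b \<Longrightarrow> f j = f (depth b f) \<Longrightarrow> j = depth b f"
    "depth b f < f (depth b f)" "f (depth b f) < n"
proof -
  show s: "f \<in> surjs b {..<n}" "depth b f < b" "j < b \<Longrightarrow> f j = f (depth b f) \<Longrightarrow> j = depth b f"
    using assms by (auto simp: targets_def single_def)
  show "f (depth b f) < n" by (rule surjs_bound[OF s(1,2)])
  have "f (depth b f) \<noteq> depth b f"
    using not_settled_depth[of b f] assms by (auto simp: settled_def targets_def single_def)
  then show "depth b f < f (depth b f)" using depth_bound[of b f "depth b f"] s(2) by simp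
qed

lemma merges_app: "j < b \<Longrightarrow> merges b m f j = merge m (f j)"
  by (simp add: compose_eq)

lemma merges_surj:
  assumes f: "f \<in> surjs b {..<Suc n}" and m: "1 \<le> m" "m < Suc n"
  shows "merges b m f \<in> surjs b {..<n}"
proof (rule surjsI)
  show "merges b m f \<in> extensional {..<b}" by simp
  show "merges b m f j < n" if "j < b" for j
    using surjs_bound[OF f that] m that by (auto simp: merges_app merge_def)
  show "\<exists>j<b. merges b m f j = t" if t: "t < n" for t
  proof (cases "t < m")
    case True
    obtain j where "j < b" "f j = t" by (rule surjs_obtain[OF f, of t]) (use t in auto)
    then show ?thesis using True by (intro exI[of _ j]) (simp add: merges_app merge_def)
  next
    case False
    obtain j where "j < b" "f j = Suc t" by (rule surjs_obtain[OF f, of "Suc t"]) (use t in auto)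
    then show ?thesis using False by (intro exI[of _ j]) (simp add: merges_app merge_def)
  qed
qed

lemma merges_settled:
  assumes "settled b f i" "Suc i < m"
  shows "settled b (merges b m f) i"
  using assms by (auto simp: settled_def merges_app merge_def split: if_splits)

text \<open>
  The depth is unchanged, because the distinguished singleton stands after position \<open>depth b f\<close> and
  the block before it is therefore not one of the settled ones.
\<close>

lemma match_depth:
  assumes f: "f \<in> targets b (Suc n)"
  shows "match b f \<in> sources b n" "depth b (match b f) = depth b f" "match b f (depth b f) = f (depth b f) - 1"
proof -
  note D = targetD[OF f]
  let ?r = "depth b f" let ?m = "f ?r" let ?u = "match b f"
  have ur: "?u ?r = ?m - 1" using D(2) by (simp add: match_def merges_app merge_def)
  then show "?u ?r = ?m - 1" .
  obtain j where j: "j < b" "f j = ?m - 1" by (rule surjs_obtain[OF D(1), of "?m - 1"]) (use D(5) in auto)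
  have uj: "?u j = ?m - 1" using j D(4) by (simp add: match_def merges_app merge_def)
  have ne: "j \<noteq> ?r" using j D(4) by auto
  show d: "depth b ?u = ?r"
  proof (rule depth_eqI)
    show "settled b ?u i" if "i < ?r" for i
      unfolding match_def by (rule merges_settled[OF settled_below[OF that]]) (use that D(4) in simp)
    show "\<not> settled b ?u ?r" using ur uj ne j(1) by (auto simp: settled_def)
  qed
  have "?u \<in> surjs b {..<n}" unfolding match_def by (rule merges_surj[OF D(1)]) (use D(4,5) in auto)
  moreover have "\<not> single b ?u" unfolding single_def d using ur uj ne j(1) by auto
  ultimately show "?u \<in> sources b n" using D(2) d by (simp add: sources_def)
qed

text \<open>
  The other terms of the differential at a target are no sources, or sources of smaller rank. A merge
  that involves a settled block unsettles it, and the depth decreases. A merge beyond the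
  distinguished singleton leaves it in place and unsettled, hence further to the right than in the
  partner. A merge strictly between leaves it a singleton.
\<close>

lemma merges_match_rank_less:
  assumes f: "f \<in> targets b (Suc n)" and m: "1 \<le> m" "m < Suc n" "m \<noteq> f (depth b f)"
    and w: "merges b m f \<in> sources b n"
  shows "match_rank b (merges b m f) < match_rank b (match b f)"
proof -
  note D = targetD[OF f]
  let ?r = "depth b f" let ?w = "merges b m f"
  note M = match_depth[OF f]
  have ws: "?w \<in> surjs b {..<n}" "\<not> single b ?w" "depth b ?w < b" using w by (auto simp: sources_def)
  show ?thesis
  proof (cases "m \<le> ?r")
    case True
    have "settled b f (m - 1)" by (rule settled_below) (use True m in auto)
    then have s: "f (m - 1) = m - 1" "m - 1 < b" by (auto simp: settled_def)
    obtain j where j: "j < b" "f j = m" by (rule surjs_obtain[OF D(1) m(2)])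
    have "\<not> settled b ?w (m - 1)"
    proof
      assume h: "settled b ?w (m - 1)"
      have "?w j = m - 1" using j by (simp add: merges_app merge_def)
      then have "j = m - 1" using h j(1) by (simp add: settled_def)
      then show False using s j m by simp
    qed
    then have "depth b ?w \<le> m - 1" by (rule depth_le)
    then have "Suc (depth b ?w) \<le> ?r" using True m by simp
    then have "Suc (depth b ?w) * Suc b \<le> ?r * Suc b" by (rule mult_le_mono1)
    then show ?thesis unfolding match_rank_def M(2) by simp
  next
    case False
    have se: "settled b ?w i" if "i < ?r" for i
      by (rule merges_settled[OF settled_below[OF that]]) (use that False in simp)
    have wr: "?w ?r = merge m (f ?r)" using D(2) by (simp add: merges_app)
    have d: "depth b ?w = ?r"
      by (rule depth_eqI[OF se]) (use wr False D(4) m in \<open>auto simp: settled_def merge_def split: if_splits\<close>)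
    have "f ?r < m"
    proof (rule ccontr)
      assume "\<not> f ?r < m"
      then have lt: "m < f ?r" using m by simp
      have "single b ?w" unfolding single_def d
      proof (intro allI impI)
        fix j assume j: "j < b" "?w j = ?w ?r"
        then have "merge m (f j) = f ?r - 1" using lt wr by (simp add: merges_app merge_def)
        then have "f j = f ?r" using lt m(1) by (auto simp: merge_def split: if_splits)
        then show "j = ?r" by (rule D(3)[OF j(1)])
      qed
      then show False using ws by simp
    qed
    then have "?w ?r = f ?r" using wr by (simp add: merge_def)
    moreover have "?w ?r < n" "n \<le> b" using surjs_bound[OF ws(1) D(2)] surjs_le[OF ws(1)] by auto
    ultimately show ?thesis unfolding match_rank_def M(2) M(3) d using D(4) by simp
  qed
qed

lemma match_bij: "bij_betw (match b) (targets b (Suc n)) (sources b n)"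
proof -
  \<comment> \<open>Splits the distinguished element off its block, to the right of the rest of the block.\<close>
  define split where "split u = (\<lambda>j\<in>{..<b}. if j = depth b u then Suc (u j) else if u j \<le> u (depth b u) then u j else Suc (u j))" for u
  have inv: "split u \<in> targets b (Suc n)" "match b (split u) = u" if u: "u \<in> sources b n" for u
  proof -
    let ?r = "depth b u" let ?f = "split u"
    have us: "u \<in> surjs b {..<n}" "?r < b" and ns: "\<not> single b u" using u by (auto simp: sources_def)
    have ge: "?r \<le> u ?r" by (rule depth_bound) (use us in auto)
    have un: "u ?r < n" by (rule surjs_bound[OF us])
    have fr: "?f ?r = Suc (u ?r)" using us by (simp add: split_def)
    have d: "depth b ?f = ?r"
    proof (rule depth_eqI)
      fix i assume i: "i < ?r"
      have s: "i < b" "u i = i" "\<And>j. j < b \<Longrightarrow> u j = i \<Longrightarrow> j = i" using settled_below[OF i] by (auto simp: settled_def)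
      show "settled b ?f i"
        using s i ge by (auto simp: settled_def split_def split: if_splits)
    qed (use fr ge in \<open>auto simp: settled_def\<close>)
    have fs: "?f \<in> surjs b {..<Suc n}"
    proof (rule surjsI)
      show "?f j < Suc n" if "j < b" for j using surjs_bound[OF us(1) that] that by (auto simp: split_def)
      fix t assume t: "t < Suc n"
      consider "t < u ?r" | "t = u ?r" | "t = Suc (u ?r)" | "Suc (u ?r) < t" by linarith
      then show "\<exists>j<b. ?f j = t"
      proof cases
        case 1
        obtain j where "j < b" "u j = t" by (rule surjs_obtain[OF us(1), of t]) (use 1 un in auto)
        then show ?thesis using 1 by (intro exI[of _ j]) (auto simp: split_def)
      next
        case 2
        obtain j where "j < b" "u j = u ?r" "j \<noteq> ?r" using ns by (auto simp: single_def)
        then show ?thesis using 2 by (intro exI[of _ j]) (auto simp: split_def)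
      next
        case 3
        then show ?thesis using fr us by blast
      next
        case 4
        obtain j where "j < b" "u j = t - 1" by (rule surjs_obtain[OF us(1), of "t - 1"]) (use 4 t in auto)
        then show ?thesis using 4 by (intro exI[of _ j]) (auto simp: split_def)
      qed
    qed (simp add: split_def)
    show "?f \<in> targets b (Suc n)"
    proof -
      have "\<forall>j<b. ?f j = Suc (u ?r) \<longrightarrow> j = ?r" by (auto simp: split_def split: if_splits)
      then show ?thesis using fs us(2) by (simp add: targets_def single_def d fr)
    qed
    show "match b ?f = u"
    proof
      fix j show "match b ?f j = u j"
      proof (cases "j < b")
        case True
        then have "match b ?f j = merge (Suc (u ?r)) (?f j)" unfolding match_def d fr by (simp add: merges_app)
        then show ?thesis using True by (auto simp: split_def merge_def)
      next
        case False
        then show ?thesis using surjs_ext[OF us(1)] by (simp add: match_def compose_def extensional_def)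
      qed
    qed
  qed
  show ?thesis
  proof (rule bij_betwI[where g = split])
    show "match b \<in> targets b (Suc n) \<rightarrow> sources b n" using match_depth(1) by blast
    show "split (match b f) = f" if f: "f \<in> targets b (Suc n)" for f
    proof
      fix j
      note D = targetD[OF f] and M = match_depth[OF f]
      show "split (match b f) j = f j"
      proof (cases "j < b")
        case True
        have m: "match b f j = merge (f (depth b f)) (f j)" using True by (simp add: match_def merges_app)
        have sp: "split (match b f) j = (if j = depth b f then Suc (f (depth b f) - 1)
            else if match b f j \<le> f (depth b f) - 1 then match b f j else Suc (match b f j))"
          using True by (simp add: split_def M(2) M(3))
        consider "j = depth b f" | "f j < f (depth b f)" "j \<noteq> depth b f" | "f j > f (depth b f)" "j \<noteq> depth b f"
          using D(3)[OF True] by (metis linorder_neqE_nat)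
        then show ?thesis
        proof cases
          case 1
          then show ?thesis using D(4) sp by simp
        next
          case 2
          then have "match b f j = f j" "f j \<le> f (depth b f) - 1" using m by (simp_all add: merge_def)
          then show ?thesis using 2(2) sp by simp
        next
          case 3
          then have "match b f j = f j - 1" "\<not> f j - 1 \<le> f (depth b f) - 1" "Suc (f j - 1) = f j"
            using m D(4) by (simp_all add: merge_def)
          then show ?thesis using 3(2) sp by simp
        qed
      next
        case False
        then show ?thesis using surjs_ext[OF D(1)] by (simp add: split_def extensional_def)
      qed
    qed
    show "split \<in> sources b n \<rightarrow> targets b (Suc n)" using inv(1) by blast
    show "match b (split u) = u" if "u \<in> sources b n" for u using inv(2)[OF that] .
  qed
qed

text \<open>
  A surjection all of whose elements are settled is the identity; it is the only one without a
  partner.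
\<close>

lemma depth_full_id:
  assumes "f \<in> surjs b {..<n}" "b \<le> depth b f"
  shows "f = (\<lambda>j\<in>{..<b}. j)" "n = b"
proof -
  have s: "f i = i" if "i < b" for i using settled_below[of i b f] that assms(2) by (auto simp: settled_def)
  then show f: "f = (\<lambda>j\<in>{..<b}. j)" using surjs_ext[OF assms(1)] by (auto simp: extensional_def)
  have "f ` {..<b} = {..<b}" using image_cong[of "{..<b}" "{..<b}" f "\<lambda>i. i"] s by simp
  moreover have "f ` {..<b} = {..<n}" using assms(1) by (simp add: surjs_def)
  ultimately show "n = b" by simp
qed

lemma surjs_split: "n < b \<Longrightarrow> surjs b {..<n} = sources b n \<union> targets b n"
  using depth_full_id(2)[of _ b n] by (fastforce simp: sources_def targets_def not_le[symmetric])

lemma sources_targets_disjoint: "sources b n \<inter> targets b n = {}"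
  by (auto simp: sources_def targets_def)

lemma surjs_inj: "f \<in> surjs b {..<b} \<Longrightarrow> inj_on f {..<b}"
  by (rule eq_card_imp_inj_on) (auto simp: surjs_def)

lemma id_surj: "(\<lambda>j\<in>{..<b}. j) \<in> surjs b {..<b}"
  by (rule surjsI) auto

lemma surjs_square: "surjs b {..<b} = insert (\<lambda>j\<in>{..<b}. j) (targets b b)" "(\<lambda>j\<in>{..<b}. j) \<notin> targets b b"
proof -
  have "f \<in> targets b b" if f: "f \<in> surjs b {..<b}" and n: "f \<noteq> (\<lambda>j\<in>{..<b}. j)" for f
  proof -
    have "depth b f < b" using depth_full_id(1)[OF f] n by (auto simp: not_le[symmetric])
    then show ?thesis using f surjs_inj[OF f] by (auto simp: targets_def single_def inj_on_def)
  qed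
  then show "surjs b {..<b} = insert (\<lambda>j\<in>{..<b}. j) (targets b b)"
    using id_surj by (auto simp: targets_def)
  show "(\<lambda>j\<in>{..<b}. j) \<notin> targets b b"
  proof
    assume "(\<lambda>j\<in>{..<b}. j) \<in> targets b b"
    note D = targetD[OF this]
    from D(2,4) show False by simp
  qed
qed

subsection \<open>Counting\<close>

text \<open>
  The recursion removes the last element of the domain, whose value is either taken elsewhere too or
  not.
\<close>

fun surj_num :: "nat \<Rightarrow> nat \<Rightarrow> nat" where
  "surj_num 0 n = (if n = 0 then 1 else 0)"
| "surj_num (Suc b) n = n * (surj_num b n + surj_num b (n - 1))"

lemma card_surjs: "finite A \<Longrightarrow> card (surjs b A) = surj_num b (card A)"
proof (induction b arbitrary: A)
  case 0
  have "surjs 0 A = (if A = {} then {\<lambda>_. undefined} else {})"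
    by (auto simp: surjs_def fin_hom_def)
  then show ?case using 0 by simp
next
  case (Suc b)
  \<comment> \<open>If \<open>b\<close> takes the value \<open>v\<close>, then the restriction to \<open>{..<b}\<close> is onto \<open>A\<close> or onto \<open>A - {v}\<close>.\<close>
  let ?S = "\<lambda>v. surjs b A \<union> surjs b (A - {v})"
  let ?up = "\<lambda>v f. f(b := v)"
  have inj: "inj_on (?up v) (?S v)" for v
  proof (rule inj_onI)
    fix f g assume "f \<in> ?S v" "g \<in> ?S v" and e: "f(b := v) = g(b := v)"
    then have "f \<in> extensional {..<b}" "g \<in> extensional {..<b}" using surjs_ext by auto
    then show "f = g" using e by (auto simp: extensional_def fun_eq_iff) (metis lessThan_iff less_irrefl)
  qed
  have eq: "surjs (Suc b) A = (\<Union>v\<in>A. ?up v ` ?S v)"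
  proof
    show "(\<Union>v\<in>A. ?up v ` ?S v) \<subseteq> surjs (Suc b) A"
    proof clarify
      fix v f assume v: "v \<in> A" and f: "f \<in> ?S v"
      have fA: "f \<in> tup b A" using f by (auto simp: surjs_def fin_hom_def PiE_iff)
      have "(f(b := v)) ` {..<Suc b} = insert v (f ` {..<b})" by (auto simp: lessThan_Suc)
      also have "\<dots> = A" using f v by (auto simp: surjs_def)
      finally show "f(b := v) \<in> surjs (Suc b) A" using tup_upd[OF fA v] by (simp add: surjs_def)
    qed
    show "surjs (Suc b) A \<subseteq> (\<Union>v\<in>A. ?up v ` ?S v)"
    proof
      fix f assume f: "f \<in> surjs (Suc b) A"
      let ?g = "restrict f {..<b}"
      have fA: "f \<in> tup (Suc b) A" and im: "f ` {..<Suc b} = A" using f by (auto simp: surjs_def)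
      have v: "f b \<in> A" by (rule tup_app[OF fA]) simp
      have g: "?g \<in> tup b A" by (rule tup_restrict[OF fA])
      have fg: "f = ?g(b := f b)"
        using fA by (auto simp: fin_hom_def PiE_iff extensional_def fun_eq_iff less_Suc_eq)
      have im2: "insert (f b) (?g ` {..<b}) = A" using im by (auto simp: lessThan_Suc)
      have "?g \<in> ?S (f b)"
      proof (cases "f b \<in> ?g ` {..<b}")
        case True
        then have "?g ` {..<b} = A" using im2 by (simp add: insert_absorb)
        then show ?thesis using g by (simp add: surjs_def)
      next
        case False
        then have "?g ` {..<b} = A - {f b}" using im2 by blast
        then show ?thesis by (auto simp: surjs_def fin_hom_def PiE_iff)
      qed
      then show "f \<in> (\<Union>v\<in>A. ?up v ` ?S v)" using fg v by blast
    qed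
  qed
  have card1: "card (?up v ` ?S v) = surj_num b (card A) + surj_num b (card A - 1)" if v: "v \<in> A" for v
  proof -
    have "card (?up v ` ?S v) = card (?S v)" by (rule card_image[OF inj])
    also have "\<dots> = card (surjs b A) + card (surjs b (A - {v}))"
      using finite_surjs Suc.prems v by (intro card_Un_disjoint) (auto simp: surjs_def)
    finally show ?thesis using Suc v by simp
  qed
  have "card (surjs (Suc b) A) = (\<Sum>v\<in>A. card (?up v ` ?S v))"
    unfolding eq
  proof (rule card_UN_disjoint[OF Suc.prems])
    show "\<forall>v\<in>A. finite (?up v ` ?S v)" using finite_surjs Suc.prems by auto
    show "\<forall>v\<in>A. \<forall>w\<in>A. v \<noteq> w \<longrightarrow> ?up v ` ?S v \<inter> ?up w ` ?S w = {}"
    proof (intro ballI impI equals0I)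
      fix v w x assume vw: "v \<noteq> w" and x: "x \<in> ?up v ` ?S v \<inter> ?up w ` ?S w"
      have "x b = v" using x by (elim IntE imageE) (simp del: Un_iff)
      moreover have "x b = w" using x by (elim IntE imageE) (simp del: Un_iff)
      ultimately show False using vw by simp
    qed
  qed
  then show ?case using card1 by simp
qed

lemma surj_num_lt: "b < n \<Longrightarrow> surj_num b n = 0"
  by (induction b arbitrary: n) auto

lemma surj_num_diag: "surj_num n n = fact n"
  by (induction n) (auto simp: surj_num_lt)

lemma surj_num_subdiag: "2 * surj_num (Suc n) n = n * fact (Suc n)"
proof (induction n)
  case (Suc n)
  have "2 * surj_num (Suc (Suc n)) (Suc n) = Suc n * (2 * surj_num (Suc n) (Suc n) + 2 * surj_num (Suc n) n)"
    using surj_num.simps(2)[of "Suc n" "Suc n"] by (simp del: surj_num.simps)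
  also have "\<dots> = Suc n * (2 * fact (Suc n) + n * fact (Suc n))" using Suc surj_num_diag[of "Suc n"] by (simp only:)
  also have "\<dots> = Suc n * fact (Suc (Suc n))" by (simp add: algebra_simps)
  finally show ?case .
qed simp

text \<open>
  This is the exactness of the complex on the level of ranks. The recursion of \<open>Rk\<close> is derived from
  that for surjections by induction; the subdiagonal, where \<open>Rk\<close> is given by a closed formula, is
  treated apart because the top degree is not exact.
\<close>

lemma Rk_add: "Suc n < b \<Longrightarrow> Rk b n + Rk b (Suc n) = surj_num b n"
proof (induction b arbitrary: n)
  case (Suc b)
  show ?case
  proof (cases n)
    case 0
    then show ?thesis using Suc.prems Rk_equations(2)[of "Suc b"] Rk_equations(5)[of "Suc b"] by simp
  next
    case n: (Suc n')
    have low: "Rk (Suc b) n = n * Rk b n' + n' * Rk b n"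
    proof (cases "n = 1")
      case True
      then show ?thesis using Suc.prems n Rk_equations(5)[of "Suc b"] Rk_equations(2)[of b] by simp
    next
      case False
      then show ?thesis using Suc.prems n Rk_equations(7)[where b = "Suc b" and a = n] by simp
    qed
    have IH: "Rk b n' + Rk b n = surj_num b n'" using Suc.IH[of n'] Suc.prems n by simp
    show ?thesis
    proof (cases "Suc (Suc n) = Suc b")
      case False
      then have lt: "Suc n < b" using Suc.prems by simp
      have "Rk (Suc b) (Suc n) = Suc n * Rk b n + n * Rk b (Suc n)"
        using lt n Rk_equations(7)[where b = "Suc b" and a = "Suc n"] by simp
      moreover have "surj_num (Suc b) n = n * ((Rk b n + Rk b (Suc n)) + (Rk b n' + Rk b n))"
        using IH Suc.IH[OF lt] n by simp
      ultimately show ?thesis unfolding low by (simp add: n algebra_simps)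
    next
      case True
      then have b: "b = Suc n" by simp
      \<comment> \<open>The division by \<open>2\<close> in the closed formula is exact; \<open>h\<close> removes it from the calculation.\<close>
      define h :: nat where "h = fact (Suc n) div 2"
      have even: "even (fact (Suc n) :: nat)" by (rule dvd_fact) (use n in auto)
      then have h: "fact (Suc n) = 2 * h" unfolding h_def by simp
      have h1: "h \<ge> 1" using h fact_gt_zero[of "Suc n", where ?'a = nat] by linarith
      have up: "Rk (Suc b) (Suc n) = (n - 1) * (Suc (Suc n) * h) + 1"
      proof -
        have "fact (Suc n + 1) = Suc (Suc n) * h * 2" using h by (simp del: fact_Suc add: fact_Suc[of "Suc n"])
        then have "fact (Suc n + 1) div 2 = Suc (Suc n) * h" by simp
        then show ?thesis using Rk_equations(6)[of "Suc n"] n by (simp add: b del: fact_Suc)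
      qed
      have "2 * surj_num b n = 2 * (n * h)" using surj_num_subdiag[of n] unfolding b h by (simp only: mult.left_commute)
      then have sn: "surj_num b n = n * h" by simp
      have "Rk b n = (if n = 1 then 0 else (n - 2) * h + 1)"
        using Rk_equations(5)[of b] Rk_equations(6)[of n] n h_def by (cases "n = 1") (simp_all add: b del: fact_Suc)
      moreover have "surj_num (Suc b) n = n * (n * h) + n * (Rk b n' + Rk b n)"
        using IH sn n by (simp add: algebra_simps)
      moreover have "Rk b n + (n * (n * h)) = (n - 1) * (Suc (Suc n) * h) + 1" if "Rk b n = (if n = 1 then 0 else (n - 2) * h + 1)"
      proof (cases "n = 1")
        case True
        then have "h = 1" by (simp add: h_def numeral_2_eq_2)
        then show ?thesis using True that by simp
      next
        case False
        then obtain k where "n = Suc (Suc k)" using n by (cases n') auto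
        then show ?thesis using that by (simp add: algebra_simps)
      qed
      ultimately have "surj_num (Suc b) n = n * (n * h) + n * (Rk b n' + Rk b n)" "Rk (Suc b) (Suc n) = Rk b n + n * (n * h)"
        using up by simp_all
      then show ?thesis unfolding low by (simp add: n algebra_simps)
    qed
  qed
qed simp

lemma card_targets:
  assumes "0 < n" "n < b"
  shows "card (targets b n) = Rk b n"
proof -
  have fin: "finite (sources b n)" "finite (targets b n)" for n
    using finite_surjs[of "{..<n}" b] by (auto simp: sources_def targets_def)
  have step: "card (targets b n) + card (targets b (Suc n)) = surj_num b n" if "n < b" for n
  proof -
    have "card (targets b (Suc n)) = card (sources b n)" by (rule bij_betw_same_card[OF match_bij])
    moreover have "card (surjs b {..<n}) = card (sources b n) + card (targets b n)"
      unfolding surjs_split[OF that] by (rule card_Un_disjoint[OF fin sources_targets_disjoint])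
    ultimately show ?thesis using card_surjs[of "{..<n}" b] by simp
  qed
  have "n < b \<Longrightarrow> card (targets b n) = Rk b n" for n
  proof (induction n)
    case 0
    have "targets b 0 = {}" using 0 by (auto simp: targets_def surjs_def)
    then show ?case using Rk_equations(2)[of b] 0 by simp
  next
    case (Suc n)
    then show ?case using step[of n] Rk_add[of n b] by simp
  qed
  then show ?thesis using assms by blast
qed


section \<open>The differential in coordinates\<close>

text \<open>
  The face maps of simplices: the increasing map from \<open>{..<n}\<close> to \<open>{..<Suc n}\<close> that omits the value \<open>k\<close>.
\<close>

definition shift :: "nat \<Rightarrow> nat \<Rightarrow> nat \<Rightarrow> nat"
  where "shift n k = (\<lambda>i\<in>{..<n}. if i < k then i else Suc i)"

lemma shift_tup: "shift n k \<in> tup n {..<Suc n}"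
  by (auto simp: shift_def fin_hom_def)

lemma shift_inj: "inj_on (shift n) {1..<n}"
proof (rule inj_onI)
  fix k l assume k: "k \<in> {1..<n}" "l \<in> {1..<n}" and e: "shift n k = shift n l"
  have "shift n k k = shift n l k" "shift n k l = shift n l l" using e by auto
  then show "k = l" using k by (auto simp: shift_def split: if_splits)
qed

lemma shift_merge:
  assumes "1 \<le> k" "k \<le> m" "s < m" "t < Suc m"
  shows "shift (Suc m) k s \<le> t \<and> t < shift (Suc m) k (Suc s) \<longleftrightarrow> s = merge k t"
  using assms by (auto simp: shift_def merge_def)

text \<open>
  A path \<open>x\<close> contributes to the differential only if it interlaces with \<open>f\<close> along \<open>u\<close>. As \<open>u\<close> is onto, \<open>x\<close>
  is strictly increasing; as \<open>f\<close> takes its extreme values, \<open>x\<close> begins with \<open>0\<close> and ends with \<open>Suc m\<close>.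
\<close>

lemma shift_of_interlaced:
  assumes x: "\<And>i. i < Suc m \<Longrightarrow> x i = i \<or> x i = Suc i" "x \<in> extensional {..<Suc m}"
    and u: "u \<in> surjs b {..<m}" and f: "f \<in> surjs b {..<Suc m}"
    and il: "\<And>j. j < b \<Longrightarrow> x (u j) \<le> f j \<and> f j < x (Suc (u j))"
  obtains k where "k \<in> {1..<Suc m}" "x = shift (Suc m) k"
proof -
  have incr: "x i < x (Suc i)" if i: "i < m" for i
  proof -
    obtain j where "j < b" "u j = i" by (rule surjs_obtain[OF u i])
    then show ?thesis using il[of j] by auto
  qed
  have ub: "j < b \<Longrightarrow> u j < m" for j using surjs_bound[OF u] .
  have x0: "x 0 = 0"
  proof -
    obtain j where j: "j < b" "f j = 0" by (rule surjs_obtain[OF f, of 0]) auto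
    then have "x (u j) = 0" using il[of j] by auto
    then show ?thesis using x(1)[of "u j"] ub[OF j(1)] by auto
  qed
  have xm: "x m = Suc m"
  proof -
    obtain j where j: "j < b" "f j = m" by (rule surjs_obtain[OF f, of m]) auto
    have "m < x (Suc (u j))" using il[OF j(1)] j(2) by simp
    then show ?thesis using x(1)[of "Suc (u j)"] x(1)[of m] ub[OF j(1)] by (cases "Suc (u j) = m") auto
  qed
  define k where "k = (LEAST i. x i = Suc i)"
  have xk: "x k = Suc k" unfolding k_def by (rule LeastI[of _ m]) (rule xm)
  have km: "k \<le> m" unfolding k_def by (rule Least_le) (rule xm)
  have below: "x i = i" if "i < k" for i
    using not_less_Least[of i "\<lambda>i. x i = Suc i"] x(1)[of i] that km unfolding k_def by auto
  have above: "k \<le> i \<Longrightarrow> i \<le> m \<Longrightarrow> x i = Suc i" for i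
  proof (induction i rule: dec_induct)
    case (step i)
    then have "x i = Suc i" "i < m" by auto
    then show ?case using incr[of i] x(1)[of "Suc i"] by auto
  qed (rule xk)
  have "x = shift (Suc m) k"
  proof
    fix i show "x i = shift (Suc m) k i"
      using below[of i] above[of i] x(2) by (cases "i < Suc m") (auto simp: shift_def extensional_def)
  qed
  moreover have "k \<noteq> 0" using xk x0 by (metis nat.distinct(1))
  ultimately show ?thesis using km by (intro that[of k]) auto
qed

context cring
begin

definition step_coord :: "nat \<Rightarrow> nat \<Rightarrow> (nat \<Rightarrow> nat) \<Rightarrow> ((nat \<Rightarrow> nat \<Rightarrow> 'a) \<Rightarrow> 'a) set \<Rightarrow> 'a"
  where "step_coord b n f = dual_form below b {..<Suc n} f"

lemma lin_finsum:
  assumes "finite S" "\<And>s. s \<in> S \<Longrightarrow> lin R M (ring_mod R) (l s)" "module R M"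
  shows "lin R M (ring_mod R) (\<lambda>v. finsum R (\<lambda>s. l s v) S)"
  using assms(1,2)
proof (induction S rule: finite_induct)
  case empty
  interpret K: module R "ring_mod R" by (rule ring_mod_module[OF cring_axioms])
  show ?case by (rule linI[OF assms(3)]) (simp_all add: ring_mod_simps)
next
  case (insert s S)
  have c: "t \<in> insert s S \<Longrightarrow> v \<in> carrier M \<Longrightarrow> l t v \<in> carrier R" for t v
    using linD(1)[OF insert.prems assms(3)] by (simp add: ring_mod_simps)
  have "lin R M (ring_mod R) (\<lambda>v. l s v \<oplus>\<^bsub>ring_mod R\<^esub> finsum R (\<lambda>s. l s v) S)"
    by (intro lin_add insert.IH insert.prems assms(3) ring_mod_module[OF cring_axioms]) auto
  then show ?case
    by (rule lin_cong) (use insert.hyps c in \<open>simp add: ring_mod_simps finsum_insert Pi_def\<close>)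
qed

text \<open>
  The sign \<open>(-1)\<^bsup>n - k\<^esup>\<close>, in the form in which it arises as a coefficient of the universal chain.
\<close>

definition sgn_shift :: "nat \<Rightarrow> nat \<Rightarrow> 'a"
  where "sgn_shift n k = finprod R (\<lambda>i. if i < k then \<one> else \<ominus> \<one>) {..<n}"

lemma sgn_shift: "sgn_shift n k \<in> carrier R" "sgn_shift n k \<otimes> sgn_shift n k = \<one>"
proof -
  have c: "(\<lambda>i. if i < k then \<one> else \<ominus> \<one>) \<in> {..<n} \<rightarrow> carrier R" by auto
  show "sgn_shift n k \<in> carrier R" unfolding sgn_shift_def by (rule finprod_closed[OF c])
  have "sgn_shift n k \<otimes> sgn_shift n k = finprod R (\<lambda>i. (if i < k then \<one> else \<ominus> \<one>) \<otimes> (if i < k then \<one> else \<ominus> \<one>)) {..<n}"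
    unfolding sgn_shift_def by (rule finprod_multf[OF c c, symmetric])
  also have "\<dots> = \<one>" by (rule finprod_one_eqI) (auto simp: l_minus r_minus)
  finally show "sgn_shift n k \<otimes> sgn_shift n k = \<one>" .
qed

lemma step_coord_hom: "step_coord b n f \<in> mod_hom R (fobj (T R b) {..<Suc n}) (ring_mod R)"
  unfolding step_coord_def by (rule dual_form_hom(1)[OF tup_fin_obj]) (rule below_closed)

lemma step_coord_lin: "lin R (fobj (T R b) {..<Suc n}) (ring_mod R) (step_coord b n f)"
  by (rule lin_of_hom[OF step_coord_hom])

lemma step_coord_closed: "v \<in> carrier (fobj (T R b) {..<Suc n}) \<Longrightarrow> step_coord b n f v \<in> carrier R"
  using mod_homD(2)[OF step_coord_hom] by (simp add: ring_mod_simps)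

lemma step_coord_tpure:
  "x \<in> tuples (red R {..<Suc n}) b \<Longrightarrow>
    step_coord b n f (tpure R (red R {..<Suc n}) b x) = finprod R (\<lambda>j. pairing R {..<Suc n} (below (f j)) (x j)) {..<b}"
  unfolding step_coord_def by (rule dual_form_hom(2)[OF tup_fin_obj]) (rule below_closed)

lemma step_coord_eqI:
  assumes v: "v \<in> carrier (fobj (T R b) {..<Suc n})" and w: "w \<in> carrier (fobj (T R b) {..<Suc n})"
    and eq: "\<And>f. f \<in> tup b {..<n} \<Longrightarrow> step_coord b n f v = step_coord b n f w"
  shows "v = w"
proof -
  let ?M = "fobj (T R b) {..<Suc n}"
  interpret M: module R ?M by (rule is_functorD(1)[OF T_functor tup_fin_obj])
  note K = ring_mod_module[OF cring_axioms]
  interpret K: module R "ring_mod R" by (rule K)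
  have "v \<ominus>\<^bsub>?M\<^esub> w = \<zero>\<^bsub>?M\<^esub>"
  proof (rule forms_separate[OF dual_family_step tup_fin_obj])
    fix f assume f: "f \<in> tup b {..<n}"
    have "step_coord b n f (v \<ominus>\<^bsub>?M\<^esub> w) = step_coord b n f w \<ominus>\<^bsub>ring_mod R\<^esub> step_coord b n f w"
      using mod_hom_minus[OF step_coord_hom M.module_axioms K v w] eq[OF f] by simp
    also have "\<dots> = \<zero>" using mod_homD(2)[OF step_coord_hom w] by (simp add: K.M.minus_eq K.M.r_neg) (simp add: ring_mod_simps)
    finally show "dual_form below b {..<Suc n} f (v \<ominus>\<^bsub>?M\<^esub> w) = \<zero>" by (simp add: step_coord_def)
  qed (use v w in auto)
  then show ?thesis by (rule module_minus_zero[OF M.module_axioms v w])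
qed

lemma pairing_finsum:
  assumes "finite S" "p \<in> S \<rightarrow> carrier R" "w \<in> carrier (free_mod R S)"
  shows "pairing R S p w = finsum R (\<lambda>s. w s \<otimes> p s) S"
proof -
  have s: "supp R S w \<subseteq> S" by (auto simp: supp_def)
  have "pairing R S p w = (\<Oplus>\<^bsub>ring_mod R\<^esub>s\<in>S. w s \<odot>\<^bsub>ring_mod R\<^esub> p s)"
    using finsum_supp[OF ring_mod_module[OF cring_axioms] assms(3) _ assms(1) s] assms
    by (simp add: pairing_def free_lift_def ring_mod_simps)
  also have "\<dots> = finsum R (\<lambda>s. w s \<otimes> p s) S"
    by (simp add: finsum_def finprod_def ring_mod_def)
  finally show ?thesis .
qed

lemma dual_form_yoneda:
  assumes G: "is_functor R G" and n: "{..<n} \<in> fin_obj" and h: "h \<in> carrier (fobj G {..<n})" and X: "X \<in> fin_obj"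
    and l: "lin R (fobj G X) (ring_mod R) l" and w: "w \<in> carrier (free_mod R (tup n X))"
  shows "l (yoneda R G n h X w) = finsum R (\<lambda>x. w x \<otimes> l (fmor G {..<n} X x h)) (tup n X)"
proof -
  note y = yoneda_gen[OF G n h X] and GX = is_functorD(1)[OF G X]
  have c: "(\<lambda>x. l (fmor G {..<n} X x h)) \<in> tup n X \<rightarrow> carrier R"
    using linD(1)[OF l GX mod_homD(2)[OF is_functorD(2)[OF G n X] h]] by (auto simp: ring_mod_simps)
  have "l (yoneda R G n h X w) = pairing R (tup n X) (\<lambda>x. l (fmor G {..<n} X x h)) w"
    by (rule free_lin_eq[OF lin_comp[OF lin_of_hom[OF y(1)] l free_mod_module GX] lin_of_hom[OF pairing_hom[OF c]]
          ring_mod_module[OF cring_axioms] _ w]) (simp add: y(2) pairing_gen[OF c])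
  then show ?thesis using pairing_finsum[OF tup_finite[OF fin_objD(1)[OF X]] c w] by simp
qed

lemma yoneda_lin:
  assumes G: "is_functor R G" and n: "{..<n} \<in> fin_obj" and X: "X \<in> fin_obj" and w: "w \<in> carrier (free_mod R (tup n X))"
  shows "lin R (fobj G {..<n}) (fobj G X) (\<lambda>h. yoneda R G n h X w)"
proof (rule free_induct[OF cring_axioms w])
  note y = yoneda_gen[OF G n _ X] and Gn = is_functorD(1)[OF G n]
  interpret N: module R "fobj G X" by (rule is_functorD(1)[OF G X])
  have "lin R (fobj G {..<n}) (fobj G X) (\<lambda>h. \<zero>\<^bsub>fobj G X\<^esub>)" by (rule linI[OF Gn]) auto
  then show "lin R (fobj G {..<n}) (fobj G X) (\<lambda>h. yoneda R G n h X \<zero>\<^bsub>free_mod R (tup n X)\<^esub>)"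
    by (rule lin_cong) (rule mod_hom_zero[OF y(1) free_mod_module N.module_axioms, symmetric])
  fix r s w assume r: "r \<in> carrier R" and s: "s \<in> tup n X" and w: "w \<in> carrier (free_mod R (tup n X))"
    and IH: "lin R (fobj G {..<n}) (fobj G X) (\<lambda>h. yoneda R G n h X w)"
  interpret P: module R "free_mod R (tup n X)" by (rule free_mod_module)
  have "lin R (fobj G {..<n}) (fobj G X) (\<lambda>h. r \<odot>\<^bsub>fobj G X\<^esub> fmor G {..<n} X s h \<oplus>\<^bsub>fobj G X\<^esub> yoneda R G n h X w)"
    by (intro lin_add lin_smult lin_of_hom[OF is_functorD(2)[OF G n X s]] IH r Gn N.module_axioms)
  then show "lin R (fobj G {..<n}) (fobj G X) (\<lambda>h. yoneda R G n h X (r \<odot>\<^bsub>free_mod R (tup n X)\<^esub> free_gen R (tup n X) s \<oplus>\<^bsub>free_mod R (tup n X)\<^esub> w))"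
    by (rule lin_cong) (use r s w free_gen_in[OF s] mod_homD(3,4)[OF y(1)] y(2) in simp)
qed

lemma ext_by_lin:
  assumes G: "is_functor R G" and n: "{..<n} \<in> fin_obj" and X: "X \<in> fin_obj" and v: "v \<in> carrier (fobj (T R n) X)"
  shows "lin R (fobj G {..<n}) (fobj G X) (\<lambda>h. ext_by R G n h X v)"
  using yoneda_lin[OF G n X coef_closed[OF X v]] by (rule lin_cong) (simp add: ext_by_app[OF X v])

text \<open>The coefficients of the universal chain: the point \<open>x\<close> contributes only if \<open>x i \<in> {i, i + 1}\<close>.\<close>

lemma coef_univ_chain:
  assumes x: "x \<in> tup n {..<Suc n}"
  shows "coef R n {..<Suc n} (univ_chain R n) x = finprod R (\<lambda>i. diff R {..<Suc n} i (Suc i) (x i)) {..<n}"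
proof -
  have c: "chain R n {..<Suc n} (\<lambda>i. i) \<in> tuples (red R {..<Suc n}) n"
    by (auto simp: chain_def tuples_def intro!: diff_closed(1)[OF tup_fin_obj])
  have d: "diff R {..<Suc n} i (Suc i) (x i) \<in> carrier R" if "i < n" for i
    using red_carrier[OF tup_fin_obj diff_closed(1)[OF tup_fin_obj, of i n "Suc i"]] that tup_app[OF x that]
    by (auto simp: free_simps)
  show ?thesis unfolding univ_chain_def coef_hom(2)[OF tup_fin_obj c]
    using x by (simp add: coord_def) (rule finprod_cong'; use d in \<open>auto simp: chain_def\<close>)
qed

lemma diff_app:
  assumes "z \<in> X" "x \<in> X" "y \<in> X"
  shows "diff R X x y z = (if z = x then \<one> else \<zero>) \<ominus> (if z = y then \<one> else \<zero>)"
proof -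
  interpret F: module R "free_mod R X" by (rule free_mod_module)
  have "\<ominus>\<^bsub>free_mod R X\<^esub> free_gen R X y = (\<ominus> \<one>) \<odot>\<^bsub>free_mod R X\<^esub> free_gen R X y"
    using free_gen_in[OF assms(3)] by (simp add: F.smult_l_minus)
  then show ?thesis unfolding diff_def F.M.minus_eq
    using assms by (simp add: free_add_app free_smult_app) (auto simp: free_gen_def minus_eq)
qed

lemma diff_app_closed: "z \<in> X \<Longrightarrow> x \<in> X \<Longrightarrow> y \<in> X \<Longrightarrow> diff R X x y z \<in> carrier R"
  by (simp add: diff_app)

lemma step_coord_image_basis_tensor:
  assumes x: "x \<in> tup (Suc m) {..<Suc (Suc m)}" and u: "u \<in> tup b {..<m}"
  shows "step_coord b (Suc m) f (fmor (T R b) {..<Suc m} {..<Suc (Suc m)} x (basis_tensor (step m) b {..<Suc m} u)) =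
    finprod R (\<lambda>j. below (f j) (x (u j)) \<ominus> below (f j) (x (Suc (u j)))) {..<b}"
proof -
  note X = tup_fin_obj[of m] and Y = tup_fin_obj[of "Suc m"]
  have ub: "j < b \<Longrightarrow> u j < m" for j using tup_app[OF u] by auto
  have e: "(\<lambda>i\<in>{..<b}. step m (u i)) \<in> tuples (red R {..<Suc m}) b"
    by (rule dual_family_tuples[OF dual_family_step u])
  have te: "tuple_map b (free_map R {..<Suc m} {..<Suc (Suc m)} x) (\<lambda>i\<in>{..<b}. step m (u i)) =
      (\<lambda>i\<in>{..<b}. diff R {..<Suc (Suc m)} (x (u i)) (x (Suc (u i))))"
    unfolding tuple_map_def
  proof (rule restrict_ext)
    fix i assume i: "i \<in> {..<b}"
    then show "free_map R {..<Suc m} {..<Suc (Suc m)} x ((\<lambda>i\<in>{..<b}. step m (u i)) i) = diff R {..<Suc (Suc m)} (x (u i)) (x (Suc (u i)))"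
      using diff_map[OF x, of "u i" "Suc (u i)"] ub[of i] by simp
  qed
  note t = red_tuple_map[OF X Y x e, unfolded te]
  have xb: "i < Suc m \<Longrightarrow> x i \<in> {..<Suc (Suc m)}" for i using tup_app[OF x] by auto
  show ?thesis
    unfolding basis_tensor_def T_map_tpure[OF X Y x e] te step_coord_tpure[OF t]
  proof (rule finprod_cong')
    fix j assume j: "j \<in> {..<b}"
    show "pairing R {..<Suc (Suc m)} (below (f j)) ((\<lambda>i\<in>{..<b}. diff R {..<Suc (Suc m)} (x (u i)) (x (Suc (u i)))) j) =
      below (f j) (x (u j)) \<ominus> below (f j) (x (Suc (u j)))"
      using diff_closed(2)[OF Y xb xb below_closed(1), of "u j" "Suc (u j)" "f j"] j ub[of j] by simp
  qed (auto simp: below_closed)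
qed

text \<open>
  For a surjection \<open>f\<close>, the points \<open>x\<close> at which both factors survive omit exactly one value, and
  the surviving tensors are those from which \<open>f\<close> arises by cutting a fibre in two.
\<close>

lemma differential_basis_tensor:
  assumes u: "u \<in> surjs b {..<m}" and f: "f \<in> surjs b {..<Suc m}"
  shows "step_coord b (Suc m) f (ext_by R (T R b) (Suc m) (basis_tensor (step m) b {..<Suc m} u) {..<Suc (Suc m)} (univ_chain R (Suc m))) =
    finsum R (\<lambda>k. sgn_shift (Suc m) k \<otimes> (if merges b k f = u then \<one> else \<zero>)) {1..<Suc m}"
proof -
  let ?n = "Suc m" let ?Y = "{..<Suc ?n}" let ?h = "basis_tensor (step m) b {..<?n} u" let ?w = "coef R ?n ?Y (univ_chain R ?n)"
  note X = tup_fin_obj[of m] and Y = tup_fin_obj[of ?n]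
  have ut: "u \<in> tup b {..<m}" using u by (simp add: surjs_def)
  have h: "?h \<in> carrier (fobj (T R b) {..<?n})" by (rule basis_tensor_closed[OF dual_family_step X ut])
  have w: "?w \<in> carrier (free_mod R (tup ?n ?Y))" by (rule coef_closed[OF Y univ_chain_closed])
  let ?t = "\<lambda>x. ?w x \<otimes> step_coord b ?n f (fmor (T R b) {..<?n} ?Y x ?h)"
  have tc: "x \<in> tup ?n ?Y \<Longrightarrow> ?t x \<in> carrier R" for x
    using free_app[OF w] step_coord_closed[OF mod_homD(2)[OF is_functorD(2)[OF T_functor X Y] h]] by auto
  have wx: "?w x = finprod R (\<lambda>i. diff R ?Y i (Suc i) (x i)) {..<?n}" if "x \<in> tup ?n ?Y" for x by (rule coef_univ_chain[OF that])
  have dc: "(\<lambda>i. diff R ?Y i (Suc i) (x i)) \<in> {..<?n} \<rightarrow> carrier R" if x: "x \<in> tup ?n ?Y" for x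
    using tup_app[OF x] by (auto intro!: diff_app_closed)
  \<comment> \<open>Otherwise a factor of the coefficient of the universal chain at \<open>x\<close> vanishes.\<close>
  have near: "x i = i \<or> x i = Suc i" if x: "x \<in> tup ?n ?Y" and nz: "?t x \<noteq> \<zero>" and i: "i < ?n" for x i
  proof (rule ccontr)
    assume "\<not> (x i = i \<or> x i = Suc i)"
    then have "diff R ?Y i (Suc i) (x i) = \<zero>" using tup_app[OF x i] i by (simp add: diff_app minus_eq)
    then have "?w x = \<zero>" unfolding wx[OF x] by (intro finprod_zero_factor[of _ i] dc[OF x]) (use i in auto)
    then show False using nz step_coord_closed[OF mod_homD(2)[OF is_functorD(2)[OF T_functor X Y x] h]] by simp
  qed
  \<comment> \<open>The difference is \<open>0\<close> or \<open>1\<close>, never \<open>-1\<close>, because \<open>x\<close> is weakly increasing.\<close>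
  have fac: "below (f j) (x (u j)) \<ominus> below (f j) (x (Suc (u j))) = (if x (u j) \<le> f j \<and> f j < x (Suc (u j)) then \<one> else \<zero>)"
    if "\<And>i. i < ?n \<Longrightarrow> x i = i \<or> x i = Suc i" "j < b" for x j
    using that(1)[of "u j"] that(1)[of "Suc (u j)"] surjs_bound[OF u that(2)]
    by (auto simp: below_def minus_eq r_neg)
  have cx: "step_coord b ?n f (fmor (T R b) {..<?n} ?Y x ?h) = (if \<forall>j<b. x (u j) \<le> f j \<and> f j < x (Suc (u j)) then \<one> else \<zero>)"
    if x: "x \<in> tup ?n ?Y" and n: "\<And>i. i < ?n \<Longrightarrow> x i = i \<or> x i = Suc i" for x
  proof -
    have "step_coord b ?n f (fmor (T R b) {..<?n} ?Y x ?h) =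
      finprod R (\<lambda>j. if x (u j) \<le> f j \<and> f j < x (Suc (u j)) then \<one> else \<zero>) {..<b}"
      unfolding step_coord_image_basis_tensor[OF x ut] by (rule finprod_cong') (use fac[OF n] in auto)
    also have "\<dots> = (if \<forall>j<b. x (u j) \<le> f j \<and> f j < x (Suc (u j)) then \<one> else \<zero>)"
    proof (cases "\<forall>j<b. x (u j) \<le> f j \<and> f j < x (Suc (u j))")
      case True then show ?thesis unfolding if_P[OF True] by (intro finprod_one_eqI) auto
    next
      case False
      then obtain j where "j < b" "\<not> (x (u j) \<le> f j \<and> f j < x (Suc (u j)))" by blast
      then have "finprod R (\<lambda>j. if x (u j) \<le> f j \<and> f j < x (Suc (u j)) then \<one> else \<zero>) {..<b} = \<zero>"
        by (intro finprod_zero_factor[of _ j]) auto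
      then show ?thesis using False by auto
    qed
    finally show ?thesis .
  qed
  have zero: "?t x = \<zero>" if x: "x \<in> tup ?n ?Y" "x \<notin> shift ?n ` {1..<?n}" for x
  proof (rule ccontr)
    assume nz: "?t x \<noteq> \<zero>"
    note n = near[OF x(1) nz]
    have "?w x \<in> carrier R" using free_app[OF w x(1)] .
    then have "\<forall>j<b. x (u j) \<le> f j \<and> f j < x (Suc (u j))"
      using nz cx[OF x(1) n] by (auto split: if_splits)
    moreover have "x \<in> extensional {..<?n}" using x(1) by (simp add: fin_hom_def PiE_iff)
    ultimately obtain k where "k \<in> {1..<?n}" "x = shift ?n k" using shift_of_interlaced[OF n _ u f] by metis
    then show False using x(2) by blast
  qed
  have val: "?t (shift ?n k) = sgn_shift ?n k \<otimes> (if merges b k f = u then \<one> else \<zero>)" if k: "k \<in> {1..<?n}" for k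
  proof -
    note s = shift_tup[of ?n k]
    have n: "shift ?n k i = i \<or> shift ?n k i = Suc i" if "i < ?n" for i using that by (simp add: shift_def)
    have "?w (shift ?n k) = sgn_shift ?n k"
      unfolding wx[OF s] sgn_shift_def
      by (rule finprod_cong') (auto simp: shift_def diff_app minus_eq)
    moreover have "(\<forall>j<b. shift ?n k (u j) \<le> f j \<and> f j < shift ?n k (Suc (u j))) \<longleftrightarrow> merges b k f = u"
    proof -
      have "(\<forall>j<b. shift ?n k (u j) \<le> f j \<and> f j < shift ?n k (Suc (u j))) \<longleftrightarrow> (\<forall>j<b. u j = merge k (f j))"
        using shift_merge[of k m] k surjs_bound[OF u] surjs_bound[OF f] by auto
      also have "\<dots> \<longleftrightarrow> merges b k f = u"
      proof
        assume "\<forall>j<b. u j = merge k (f j)"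
        then show "merges b k f = u"
          using surjs_ext[OF u] by (intro extensionalityI[of _ "{..<b}"]) (auto simp: compose_eq)
      qed (auto simp: compose_eq)
      finally show ?thesis .
    qed
    ultimately show ?thesis using cx[OF s n] by simp
  qed
  have "step_coord b ?n f (ext_by R (T R b) ?n ?h ?Y (univ_chain R ?n)) = finsum R ?t (tup ?n ?Y)"
    unfolding ext_by_app[OF Y univ_chain_closed] by (rule dual_form_yoneda[OF T_functor X h Y step_coord_lin w])
  also have "\<dots> = finsum R ?t (shift ?n ` {1..<?n})"
    unfolding finsum_def
    by (rule add.finprod_mono_neutral_cong_right[unfolded finsum_def])
      (use zero tc shift_tup tup_finite[of ?Y ?n] in auto)
  also have "\<dots> = finsum R (\<lambda>k. ?t (shift ?n k)) {1..<?n}"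
    by (rule add.finprod_reindex[OF _ shift_inj]) (use tc shift_tup in auto)
  also have "\<dots> = finsum R (\<lambda>k. sgn_shift ?n k \<otimes> (if merges b k f = u then \<one> else \<zero>)) {1..<?n}"
    by (rule finsum_cong') (use val sgn_shift(1) in auto)
  finally show ?thesis .
qed

text \<open>
  The differential of the complex of functions on surjections.
\<close>

definition coboundary :: "nat \<Rightarrow> nat \<Rightarrow> ((nat \<Rightarrow> nat) \<Rightarrow> 'a) \<Rightarrow> (nat \<Rightarrow> nat) \<Rightarrow> 'a"
  where "coboundary b m c f = finsum R (\<lambda>k. sgn_shift (Suc m) k \<otimes> c (merges b k f)) {1..<Suc m}"

lemma differential:
  assumes S: "S \<subseteq> surjs b {..<m}" and c: "c \<in> carrier (free_mod R S)" and f: "f \<in> surjs b {..<Suc m}"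
    and c': "\<And>u. u \<in> surjs b {..<m} \<Longrightarrow> c' u = (if u \<in> S then c u else \<zero>)"
  defines "h \<equiv> free_lift R S (fobj (T R b) {..<Suc m}) (basis_tensor (step m) b {..<Suc m}) c"
  shows "step_coord b (Suc m) f (ext_by R (T R b) (Suc m) h {..<Suc (Suc m)} (univ_chain R (Suc m))) = coboundary b m c' f"
proof -
  let ?ev = "\<lambda>k v. if merges b k f \<in> S then v (merges b k f) else \<zero>"
  note X = tup_fin_obj[of m] and Y = tup_fin_obj[of "Suc m"]
  have St: "S \<subseteq> tup b {..<m}" using S by (auto simp: surjs_def)
  have cl: "basis_tensor (step m) b {..<Suc m} \<in> S \<rightarrow> carrier (fobj (T R b) {..<Suc m})"
    using basis_tensor_closed[OF dual_family_step X] St by auto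
  note L = basis_tensor_lift(1)[OF dual_family_step X St]
  have evc: "v \<in> carrier (free_mod R S) \<Longrightarrow> ?ev k v \<in> carrier R" for v k using free_app[of v R S] by simp
  have "step_coord b (Suc m) f (ext_by R (T R b) (Suc m) h {..<Suc (Suc m)} (univ_chain R (Suc m))) =
    finsum R (\<lambda>k. sgn_shift (Suc m) k \<otimes> ?ev k c) {1..<Suc m}"
    unfolding h_def
  proof (rule free_lin_eq[OF _ _ ring_mod_module[OF cring_axioms] _ c])
    show "lin R (free_mod R S) (ring_mod R) (\<lambda>c. step_coord b (Suc m) f (ext_by R (T R b) (Suc m)
      (free_lift R S (fobj (T R b) {..<Suc m}) (basis_tensor (step m) b {..<Suc m}) c) {..<Suc (Suc m)} (univ_chain R (Suc m))))"
      by (rule lin_comp[OF lin_comp[OF lin_of_hom[OF L] ext_by_lin[OF T_functor X Y univ_chain_closed]] step_coord_lin])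
        (auto simp: free_mod_module is_functorD(1)[OF T_functor X] is_functorD(1)[OF T_functor Y])
    show "lin R (free_mod R S) (ring_mod R) (\<lambda>c. finsum R (\<lambda>k. sgn_shift (Suc m) k \<otimes> ?ev k c) {1..<Suc m})"
    proof (rule lin_finsum[OF _ _ free_mod_module])
      fix k
      show "lin R (free_mod R S) (ring_mod R) (\<lambda>c. sgn_shift (Suc m) k \<otimes> ?ev k c)"
      proof (rule linI[OF free_mod_module])
        interpret P: module R "free_mod R S" by (rule free_mod_module)
        fix r v w assume v: "v \<in> carrier (free_mod R S)"
        show "sgn_shift (Suc m) k \<otimes> ?ev k v \<in> carrier (ring_mod R)"
          unfolding ring_mod_simps using evc[OF v, of k] sgn_shift(1) by blast
        show "sgn_shift (Suc m) k \<otimes> ?ev k (v \<oplus>\<^bsub>free_mod R S\<^esub> w) =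
            sgn_shift (Suc m) k \<otimes> ?ev k v \<oplus>\<^bsub>ring_mod R\<^esub> sgn_shift (Suc m) k \<otimes> ?ev k w" if w: "w \<in> carrier (free_mod R S)"
          using sgn_shift(1) free_app[OF v] free_app[OF w] by (simp add: free_add_app r_distr ring_mod_simps)
        show "sgn_shift (Suc m) k \<otimes> ?ev k (r \<odot>\<^bsub>free_mod R S\<^esub> v) =
            r \<odot>\<^bsub>ring_mod R\<^esub> (sgn_shift (Suc m) k \<otimes> ?ev k v)" if "r \<in> carrier R"
          using that sgn_shift(1) free_app[OF v] by (simp add: free_smult_app m_lcomm ring_mod_simps)
      qed
    qed simp
    fix u assume u: "u \<in> S"
    have us: "u \<in> surjs b {..<m}" using u S by blast
    show "step_coord b (Suc m) f (ext_by R (T R b) (Suc m) (free_lift R S (fobj (T R b) {..<Suc m}) (basis_tensor (step m) b {..<Suc m})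
        (free_gen R S u)) {..<Suc (Suc m)} (univ_chain R (Suc m))) =
      finsum R (\<lambda>k. sgn_shift (Suc m) k \<otimes> ?ev k (free_gen R S u)) {1..<Suc m}"
      unfolding free_lift_gen[OF is_functorD(1)[OF T_functor X] cl u] differential_basis_tensor[OF us f]
      by (rule finsum_cong') (use u sgn_shift(1) in \<open>auto simp: free_gen_def\<close>)
  qed
  also have "\<dots> = coboundary b m c' f"
    unfolding coboundary_def
  proof (rule finsum_cong')
    fix k assume k: "k \<in> {1..<Suc m}"
    have "merges b k f \<in> surjs b {..<m}" by (rule merges_surj[OF f]) (use k in auto)
    then show "sgn_shift (Suc m) k \<otimes> ?ev k c = sgn_shift (Suc m) k \<otimes> c' (merges b k f)" using c' by simp
  next
    have "c' (merges b k f) \<in> carrier R" if k: "k \<in> {1..<Suc m}" for k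
    proof -
      have "merges b k f \<in> surjs b {..<m}" by (rule merges_surj[OF f]) (use k in auto)
      then show ?thesis using c' free_app[OF c] by simp
    qed
    then show "(\<lambda>k. sgn_shift (Suc m) k \<otimes> c' (merges b k f)) \<in> {1..<Suc m} \<rightarrow> carrier R" using sgn_shift(1) by auto
  qed simp
  finally show ?thesis .
qed


section \<open>Morphisms in coordinates\<close>

subsection \<open>Solving along the matching\<close>

lemma coboundary_at_target:
  assumes f: "f \<in> targets b (Suc m)" and c: "\<And>u. u \<in> surjs b {..<m} \<Longrightarrow> c u \<in> carrier R"
  shows "coboundary b m c f = sgn_shift (Suc m) (f (depth b f)) \<otimes> c (match b f) \<oplus>
    finsum R (\<lambda>k. sgn_shift (Suc m) k \<otimes> c (merges b k f)) ({1..<Suc m} - {f (depth b f)})"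
    and "finsum R (\<lambda>k. sgn_shift (Suc m) k \<otimes> c (merges b k f)) ({1..<Suc m} - {f (depth b f)}) \<in> carrier R"
proof -
  note D = targetD[OF f]
  have k: "f (depth b f) \<in> {1..<Suc m}" using D(4,5) by auto
  have cl: "sgn_shift (Suc m) k \<otimes> c (merges b k f) \<in> carrier R" if "k \<in> {1..<Suc m}" for k
    using c[OF merges_surj[OF D(1)]] that sgn_shift(1) by auto
  show "finsum R (\<lambda>k. sgn_shift (Suc m) k \<otimes> c (merges b k f)) ({1..<Suc m} - {f (depth b f)}) \<in> carrier R"
    using cl by (intro finsum_closed) auto
  have "coboundary b m c f = finsum R (\<lambda>k. sgn_shift (Suc m) k \<otimes> c (merges b k f)) (insert (f (depth b f)) ({1..<Suc m} - {f (depth b f)}))"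
    unfolding coboundary_def using k by (simp add: insert_absorb)
  also have "\<dots> = sgn_shift (Suc m) (f (depth b f)) \<otimes> c (match b f) \<oplus>
    finsum R (\<lambda>k. sgn_shift (Suc m) k \<otimes> c (merges b k f)) ({1..<Suc m} - {f (depth b f)})"
    unfolding match_def by (rule finsum_insert) (use cl k in auto)
  finally show "coboundary b m c f = sgn_shift (Suc m) (f (depth b f)) \<otimes> c (match b f) \<oplus>
    finsum R (\<lambda>k. sgn_shift (Suc m) k \<otimes> c (merges b k f)) ({1..<Suc m} - {f (depth b f)})" .
qed

text \<open>
  Triangularity: by induction on the rank, the equation at a target determines the value at its
  partner.
\<close>

lemma coboundary_unique:
  assumes x: "\<And>u. u \<in> surjs b {..<m} \<Longrightarrow> x u \<in> carrier R"
    and z: "\<And>u. u \<in> surjs b {..<m} \<Longrightarrow> u \<notin> sources b m \<Longrightarrow> x u = \<zero>"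
    and d: "\<And>f. f \<in> targets b (Suc m) \<Longrightarrow> coboundary b m x f = \<zero>"
  shows "u \<in> sources b m \<Longrightarrow> x u = \<zero>"
proof (induction "match_rank b u" arbitrary: u rule: less_induct)
  case less
  obtain f where f: "f \<in> targets b (Suc m)" "u = match b f"
    using match_bij[of b m] less.prems by (auto simp: bij_betw_def)
  have us: "u \<in> surjs b {..<m}" using less.prems by (simp add: sources_def)
  have "finsum R (\<lambda>k. sgn_shift (Suc m) k \<otimes> x (merges b k f)) ({1..<Suc m} - {f (depth b f)}) = \<zero>"
  proof (rule finsum_zero[THEN trans[rotated]], rule finsum_cong')
    fix k assume k: "k \<in> {1..<Suc m} - {f (depth b f)}"
    have "merges b k f \<in> surjs b {..<m}" using merges_surj[OF targetD(1)[OF f(1)]] k by auto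
    moreover have "merges b k f \<in> sources b m \<Longrightarrow> x (merges b k f) = \<zero>"
      using less.hyps merges_match_rank_less[OF f(1)] k f(2) by auto
    ultimately have "x (merges b k f) = \<zero>" using z by blast
    then show "sgn_shift (Suc m) k \<otimes> x (merges b k f) = \<zero>" using sgn_shift(1) by simp
  qed auto
  then have "sgn_shift (Suc m) (f (depth b f)) \<otimes> x u = \<zero>"
    using coboundary_at_target(1)[OF f(1) x] d[OF f(1)] f(2) x[OF us] sgn_shift(1) by simp
  then have "sgn_shift (Suc m) (f (depth b f)) \<otimes> (sgn_shift (Suc m) (f (depth b f)) \<otimes> x u) = \<zero>"
    using sgn_shift(1) by simp
  then show ?case using x[OF us] by (simp add: m_assoc[symmetric] sgn_shift)
qed

text \<open>
  The values at the sources are chosen in the order of the rank. The sign at the diagonal is its own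
  inverse, so that no division is needed.
\<close>

lemma coboundary_solve:
  assumes y: "\<And>f. f \<in> targets b (Suc m) \<Longrightarrow> y f \<in> carrier R"
  obtains x where "\<And>u. x u \<in> carrier R" "\<And>u. u \<notin> sources b m \<Longrightarrow> x u = \<zero>"
    "\<And>f. f \<in> targets b (Suc m) \<Longrightarrow> coboundary b m x f = y f"
proof -
  \<comment> \<open>Partial solutions: the equations at the targets whose partner has rank below \<open>N\<close>.\<close>
  have "\<exists>x. (\<forall>u. x u \<in> carrier R) \<and> (\<forall>u. u \<notin> sources b m \<longrightarrow> x u = \<zero>) \<and>
    (\<forall>f\<in>targets b (Suc m). match_rank b (match b f) < N \<longrightarrow> coboundary b m x f = y f)" for N
  proof (induction N)
    case 0
    show ?case by (rule exI[of _ "\<lambda>_. \<zero>"]) auto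
  next
    case (Suc N)
    then obtain x where x: "\<And>u. x u \<in> carrier R" "\<And>u. u \<notin> sources b m \<Longrightarrow> x u = \<zero>"
      "\<And>f. f \<in> targets b (Suc m) \<Longrightarrow> match_rank b (match b f) < N \<Longrightarrow> coboundary b m x f = y f" by blast
    define r where "r f = finsum R (\<lambda>k. sgn_shift (Suc m) k \<otimes> x (merges b k f)) ({1..<Suc m} - {f (depth b f)})" for f
    define pre where "pre = inv_into (targets b (Suc m)) (match b)"
    \<comment> \<open>Values at rank \<open>N\<close> enter the earlier equations nowhere; later values are reset to zero.\<close>
    define x' where "x' u = (if u \<in> sources b m \<and> match_rank b u = N
      then sgn_shift (Suc m) (pre u (depth b (pre u))) \<otimes> (y (pre u) \<ominus> r (pre u)) else if match_rank b u < N then x u else \<zero>)" for u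
    have pre: "pre (match b f) = f" if "f \<in> targets b (Suc m)" for f
      unfolding pre_def using bij_betw_inv_into_left[OF match_bij that] .
    have pret: "pre u \<in> targets b (Suc m)" if "u \<in> sources b m" for u
      unfolding pre_def using match_bij[of b m] that by (metis bij_betw_def inv_into_into)
    have rc: "r f \<in> carrier R" if "f \<in> targets b (Suc m)" for f
      unfolding r_def by (rule coboundary_at_target(2)[OF that x(1)])
    have x'c: "x' u \<in> carrier R" for u
      unfolding x'_def using x(1) sgn_shift(1) y[OF pret] rc[OF pret] by auto
    have x'z: "x' u = \<zero>" if "u \<notin> sources b m" for u using x(2)[OF that] that by (simp add: x'_def)
    have rest: "finsum R (\<lambda>k. sgn_shift (Suc m) k \<otimes> x' (merges b k f)) ({1..<Suc m} - {f (depth b f)}) = r f"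
      if f: "f \<in> targets b (Suc m)" and N: "match_rank b (match b f) < Suc N" for f
      unfolding r_def
    proof (rule finsum_cong')
      fix k assume k: "k \<in> {1..<Suc m} - {f (depth b f)}"
      have "x' (merges b k f) = x (merges b k f)"
      proof (cases "merges b k f \<in> sources b m")
        case True
        then have "match_rank b (merges b k f) < match_rank b (match b f)" using merges_match_rank_less[OF f] k by auto
        then show ?thesis using N by (simp add: x'_def)
      qed (simp add: x'z x(2))
      then show "sgn_shift (Suc m) k \<otimes> x' (merges b k f) = sgn_shift (Suc m) k \<otimes> x (merges b k f)" by simp
    qed (use x(1) sgn_shift(1) in auto)
    have "coboundary b m x' f = y f" if f: "f \<in> targets b (Suc m)" and N: "match_rank b (match b f) < Suc N" for f
    proof (cases "match_rank b (match b f) = N")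
      case True
      let ?s = "sgn_shift (Suc m) (f (depth b f))"
      have "?s \<otimes> x' (match b f) = (?s \<otimes> ?s) \<otimes> (y f \<ominus> r f)"
        using True match_depth(1)[OF f] sgn_shift(1) y[OF f] rc[OF f] by (simp add: x'_def pre[OF f] m_assoc)
      then have "?s \<otimes> x' (match b f) = y f \<ominus> r f" using y[OF f] rc[OF f] by (simp add: sgn_shift)
      then show ?thesis using coboundary_at_target(1)[OF f x'c] rest[OF f N] y[OF f] rc[OF f]
        by (simp add: minus_eq a_assoc l_neg)
    next
      case False
      then have lt: "match_rank b (match b f) < N" using N by simp
      then have "x' (match b f) = x (match b f)" by (simp add: x'_def)
      then have "coboundary b m x' f = coboundary b m x f"
        unfolding coboundary_at_target(1)[where c = x', OF f x'c] coboundary_at_target(1)[where c = x, OF f x(1)] rest[OF f N] r_def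
        by simp
      then show ?thesis using x(3)[OF f] lt by simp
    qed
    then show ?case using x'c x'z by blast
  qed
  note ex = this
  have "finite (targets b (Suc m))" using finite_surjs[of "{..<Suc m}" b] by (simp add: targets_def)
  then obtain N where "\<forall>i\<in>(match_rank b \<circ> match b) ` targets b (Suc m). i < N"
    using finite_nat_set_iff_bounded by (metis finite_imageI)
  moreover obtain x where "\<And>u. x u \<in> carrier R" "\<And>u. u \<notin> sources b m \<Longrightarrow> x u = \<zero>"
    "\<And>f. f \<in> targets b (Suc m) \<Longrightarrow> match_rank b (match b f) < N \<Longrightarrow> coboundary b m x f = y f"
    using ex[of N] by blast
  ultimately show ?thesis by (intro that[of x]) auto
qed

subsection \<open>The coordinates of a morphism\<close>

text \<open>
  If \<open>f\<close> misses the value \<open>t\<close>, then its coordinate does not see the map that identifies \<open>t\<close> and \<open>t + 1\<close>,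
  and this map kills the universal chain.
\<close>

lemma step_coord_outside_surjs:
  assumes \<eta>: "\<eta> \<in> nat_trans R (T R a) (T R b)" and f: "f \<in> tup b {..<a}" "f \<notin> surjs b {..<a}"
  shows "step_coord b a f (\<eta> {..<Suc a} (univ_chain R a)) = \<zero>"
proof -
  let ?X = "{..<Suc a}" note X = tup_fin_obj[of a]
  have "f ` {..<b} \<subseteq> {..<a}" using tup_app[OF f(1)] by auto
  then obtain t where t: "t < a" "t \<notin> f ` {..<b}" using f by (auto simp: surjs_def)
  define s where "s = (\<lambda>y\<in>?X. if y = Suc t then t else y)"
  have s: "s \<in> fin_hom ?X ?X" using t by (auto simp: s_def fin_hom_def)
  note Ts = is_functorD(2)[OF T_functor X X s]
  have "chain R a ?X s t = \<zero>\<^bsub>red R ?X\<^esub>"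
    using t diff_refl[of t ?X] by (simp add: chain_def s_def red_simps(2)[OF X])
  then have "fmor (T R a) ?X ?X s (univ_chain R a) = \<zero>\<^bsub>fobj (T R a) ?X\<^esub>"
    unfolding univ_chain_map[OF X s] T_obj by (rule tpure_zero[OF red_module[OF X] chain_closed[OF X s] t(1)])
  then have z: "fmor (T R b) ?X ?X s (\<eta> ?X (univ_chain R a)) = \<zero>\<^bsub>fobj (T R b) ?X\<^esub>"
    using nat_transD(3)[OF \<eta> X X s univ_chain_closed]
      mod_hom_zero[OF nat_transD(1)[OF \<eta> X] is_functorD(1)[OF T_functor X] is_functorD(1)[OF T_functor X]] by simp
  have inv: "step_coord b a f (fmor (T R b) ?X ?X s v) = step_coord b a f v" if v: "v \<in> carrier (fobj (T R b) ?X)" for v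
  proof (rule T_lin_eq[OF X _ step_coord_lin ring_mod_module[OF cring_axioms] _ v])
    show "lin R (fobj (T R b) ?X) (ring_mod R) (\<lambda>v. step_coord b a f (fmor (T R b) ?X ?X s v))"
      by (rule lin_comp[OF lin_of_hom[OF Ts] step_coord_lin is_functorD(1)[OF T_functor X] is_functorD(1)[OF T_functor X]])
    fix x assume x: "x \<in> tuples (red R ?X) b"
    note x' = red_tuple_map[OF X X s x]
    have sX: "s \<in> ?X \<rightarrow> ?X" using s by (auto simp: fin_hom_def)
    show "step_coord b a f (fmor (T R b) ?X ?X s (tpure R (red R ?X) b x)) = step_coord b a f (tpure R (red R ?X) b x)"
      unfolding T_map_tpure[OF X X s x] step_coord_tpure[OF x'] step_coord_tpure[OF x]
    proof (rule finprod_cong')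
      fix j assume j: "j \<in> {..<b}"
      have xj: "x j \<in> carrier (free_mod R ?X)" using j red_tuples[OF X x] by (auto simp: tuples_def PiE_iff)
      have "pairing R ?X (below (f j)) (free_map R ?X ?X s v) = pairing R ?X (below (f j)) v" if "v \<in> carrier (free_mod R ?X)" for v
      proof (rule free_lin_eq[OF _ lin_of_hom[OF pairing_hom[OF below_closed(1)]] ring_mod_module[OF cring_axioms] _ that])
        show "lin R (free_mod R ?X) (ring_mod R) (\<lambda>v. pairing R ?X (below (f j)) (free_map R ?X ?X s v))"
          by (rule lin_comp[OF lin_of_hom[OF free_map_hom[OF cring_axioms sX]] lin_of_hom[OF pairing_hom[OF below_closed(1)]]
              free_mod_module free_mod_module])
        fix y assume y: "y \<in> ?X"
        have "f j \<noteq> t" using t j by auto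
        then have "below (f j) (s y) = below (f j) y" using y by (auto simp: s_def below_def)
        then show "pairing R ?X (below (f j)) (free_map R ?X ?X s (free_gen R ?X y)) = pairing R ?X (below (f j)) (free_gen R ?X y)"
          using funcset_mem[OF sX y] y by (simp add: free_map_gen[OF cring_axioms sX y] pairing_gen[OF below_closed(1)])
      qed
      then show "pairing R ?X (below (f j)) (tuple_map b (free_map R ?X ?X s) x j) = pairing R ?X (below (f j)) (x j)"
        using xj j by (simp add: tuple_map_def)
    next
      have "x j \<in> carrier (free_mod R ?X)" if "j < b" for j using that red_tuples[OF X x] by (auto simp: tuples_def PiE_iff)
      then show "(\<lambda>j. pairing R ?X (below (f j)) (x j)) \<in> {..<b} \<rightarrow> carrier R"
        using mod_homD(2)[OF pairing_hom[OF below_closed(1)]] by (auto simp: ring_mod_simps)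
    qed simp
  qed
  have "step_coord b a f \<zero>\<^bsub>fobj (T R b) ?X\<^esub> = \<zero>"
    using mod_hom_zero[OF step_coord_hom is_functorD(1)[OF T_functor X] ring_mod_module[OF cring_axioms]] by (simp add: ring_mod_simps)
  then show ?thesis using inv[OF nat_trans_closed[OF \<eta> X univ_chain_closed]] z by simp
qed

definition morphism_coords :: "nat \<Rightarrow> nat \<Rightarrow> (nat \<Rightarrow> nat) set \<Rightarrow> (nat set \<Rightarrow> ((nat \<Rightarrow> nat \<Rightarrow> 'a) \<Rightarrow> 'a) set \<Rightarrow> ((nat \<Rightarrow> nat \<Rightarrow> 'a) \<Rightarrow> 'a) set) \<Rightarrow> (nat \<Rightarrow> nat) \<Rightarrow> 'a"
  where "morphism_coords b a S = (\<lambda>\<eta>\<in>nat_trans R (T R a) (T R b). \<lambda>f\<in>S. step_coord b a f (\<eta> {..<Suc a} (univ_chain R a)))"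

lemma Hom_T_module: "module R (Hom_mod R (T R a) (T R b))"
  by (rule Hom_module[OF T_functor T_functor cring_axioms])

lemma eval_univ_chain_lin: "lin R (Hom_mod R (T R a) (T R b)) (fobj (T R b) {..<Suc a}) (\<lambda>\<eta>. \<eta> {..<Suc a} (univ_chain R a))"
  by (rule linI[OF Hom_T_module]) (auto simp: Hom_simps(1) nat_trans_closed[OF _ tup_fin_obj univ_chain_closed] Hom_app[OF tup_fin_obj univ_chain_closed])

lemma step_coord_univ_chain_lin: "lin R (Hom_mod R (T R a) (T R b)) (ring_mod R) (\<lambda>\<eta>. step_coord b a f (\<eta> {..<Suc a} (univ_chain R a)))"
  by (rule lin_comp[OF eval_univ_chain_lin step_coord_lin Hom_T_module is_functorD(1)[OF T_functor tup_fin_obj]])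

lemma morphism_coords_hom:
  assumes "finite S"
  shows "morphism_coords b a S \<in> mod_hom R (Hom_mod R (T R a) (T R b)) (free_mod R S)"
proof -
  note l = linD[OF step_coord_univ_chain_lin Hom_T_module, unfolded ring_mod_simps]
  have "lin R (Hom_mod R (T R a) (T R b)) (free_mod R S) (\<lambda>\<eta>. \<lambda>f\<in>S. step_coord b a f (\<eta> {..<Suc a} (univ_chain R a)))"
    by (rule linI[OF Hom_T_module]) (use l assms in \<open>auto simp: free_mod_finite free_simps(3,4) intro!: restrict_ext\<close>)
  then show ?thesis by (simp add: lin_def morphism_coords_def Hom_simps(1))
qed

lemma univ_chain_zero_imp_zero:
  assumes \<eta>: "\<eta> \<in> nat_trans R (T R a) (T R b)"
    and z: "\<And>f. f \<in> surjs b {..<a} \<Longrightarrow> step_coord b a f (\<eta> {..<Suc a} (univ_chain R a)) = \<zero>"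
  shows "\<eta> = \<zero>\<^bsub>Hom_mod R (T R a) (T R b)\<^esub>"
proof (rule nat_trans_eqI_univ_chain[OF T_functor \<eta>])
  show "\<zero>\<^bsub>Hom_mod R (T R a) (T R b)\<^esub> \<in> nat_trans R (T R a) (T R b)" by (rule Hom_closed(1)[OF T_functor T_functor])
  have "\<eta> {..<Suc a} (univ_chain R a) = \<zero>\<^bsub>fobj (T R b) {..<Suc a}\<^esub>"
    by (rule forms_separate[OF dual_family_step tup_fin_obj nat_trans_closed[OF \<eta> tup_fin_obj univ_chain_closed], folded step_coord_def])
      (use z step_coord_outside_surjs[OF \<eta>] in blast)
  then show "\<eta> {..<Suc a} (univ_chain R a) = \<zero>\<^bsub>Hom_mod R (T R a) (T R b)\<^esub> {..<Suc a} (univ_chain R a)"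
    by (simp add: Hom_app[OF tup_fin_obj univ_chain_closed])
qed

text \<open>
  The value of a morphism at the universal chain is a cocycle, because the next chain maps to zero in
  \<open>T R a\<close>; hence it is determined by its coordinates at the targets.
\<close>

lemma morphism_coords_targets_zero:
  assumes \<eta>: "\<eta> \<in> nat_trans R (T R a) (T R b)" and ab: "a < b"
    and z: "\<And>f. f \<in> targets b a \<Longrightarrow> step_coord b a f (\<eta> {..<Suc a} (univ_chain R a)) = \<zero>"
  shows "\<eta> = \<zero>\<^bsub>Hom_mod R (T R a) (T R b)\<^esub>"
proof (rule univ_chain_zero_imp_zero[OF \<eta>])
  let ?X = "{..<Suc a}" and ?Y = "{..<Suc (Suc a)}" and ?S = "surjs b {..<a}"
  let ?v = "\<eta> ?X (univ_chain R a)" let ?x = "\<lambda>u. step_coord b a u ?v"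
  note X = tup_fin_obj[of a] and Y = tup_fin_obj[of "Suc a"]
  have v: "?v \<in> carrier (fobj (T R b) ?X)" by (rule nat_trans_closed[OF \<eta> X univ_chain_closed])
  have St: "?S \<subseteq> tup b {..<a}" by (auto simp: surjs_def)
  have c: "restrict ?x ?S \<in> carrier (free_mod R ?S)"
    using step_coord_closed[OF v] finite_surjs[of "{..<a}" b] by (auto simp: free_mod_finite)
  note L = basis_tensor_lift[OF dual_family_step X St]
  have h: "free_lift R ?S (fobj (T R b) ?X) (basis_tensor (step a) b ?X) (restrict ?x ?S) = ?v"
  proof (rule step_coord_eqI[OF mod_homD(2)[OF L(1) c] v])
    fix f assume f: "f \<in> tup b {..<a}"
    show "step_coord b a f (free_lift R ?S (fobj (T R b) ?X) (basis_tensor (step a) b ?X) (restrict ?x ?S)) = step_coord b a f ?v"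
      using L(2)[OF c f] step_coord_outside_surjs[OF \<eta> f] by (simp add: step_coord_def)
  qed
  have cob: "coboundary b a ?x f = \<zero>" if f: "f \<in> targets b (Suc a)" for f
  proof -
    note w = coef_closed[OF Y univ_chain_closed]
    have "ext_by R (T R b) (Suc a) ?v ?Y (univ_chain R (Suc a)) = \<eta> ?Y (yoneda R (T R a) (Suc a) (univ_chain R a) ?Y (coef R (Suc a) ?Y (univ_chain R (Suc a))))"
      unfolding ext_by_app[OF Y univ_chain_closed] by (rule yoneda_comp[OF T_functor T_functor \<eta> X univ_chain_closed Y w, symmetric])
    also have "yoneda R (T R a) (Suc a) (univ_chain R a) ?Y (coef R (Suc a) ?Y (univ_chain R (Suc a))) = \<zero>\<^bsub>fobj (T R a) ?Y\<^esub>"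
    proof (rule coef_inj[OF Y mod_homD(2)[OF yoneda_gen(1)[OF T_functor X univ_chain_closed Y] w]])
      interpret Ta: module R "fobj (T R a) ?Y" by (rule is_functorD(1)[OF T_functor Y])
      show "\<zero>\<^bsub>fobj (T R a) ?Y\<^esub> \<in> carrier (fobj (T R a) ?Y)" by simp
      show "coef R a ?Y (yoneda R (T R a) (Suc a) (univ_chain R a) ?Y (coef R (Suc a) ?Y (univ_chain R (Suc a)))) = coef R a ?Y \<zero>\<^bsub>fobj (T R a) ?Y\<^esub>"
        unfolding coef_yoneda_univ_chain[OF Y w] coef_Suc_tens(1)[OF Y univ_chain_closed]
        by (rule mod_hom_zero[OF coef_hom(1)[OF Y, folded T_obj] Ta.module_axioms free_mod_module, symmetric])
    qed
    also have "\<eta> ?Y \<zero>\<^bsub>fobj (T R a) ?Y\<^esub> = \<zero>\<^bsub>fobj (T R b) ?Y\<^esub>"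
      by (rule mod_hom_zero[OF nat_transD(1)[OF \<eta> Y] is_functorD(1)[OF T_functor Y] is_functorD(1)[OF T_functor Y]])
    finally have "step_coord b (Suc a) f (ext_by R (T R b) (Suc a) ?v ?Y (univ_chain R (Suc a))) = \<zero>"
      using mod_hom_zero[OF step_coord_hom is_functorD(1)[OF T_functor Y] ring_mod_module[OF cring_axioms]] by (simp add: ring_mod_simps)
    then show ?thesis
      using differential[OF subset_refl c targetD(1)[OF f], of ?x] unfolding h by simp
  qed
  have nz: "?x u = \<zero>" if "u \<in> ?S" "u \<notin> sources b a" for u
    using z[of u] that surjs_split[OF ab] by auto
  show "?x f = \<zero>" if f: "f \<in> ?S" for f
    using coboundary_unique[OF step_coord_closed[OF v] nz cob, of f] nz[OF f] by blast
qed

text \<open>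
  The differential is solved for a function on the sources; the combination of basis tensors with these
  coefficients serves as the value at the identity tuple.
\<close>

lemma realize_targets:
  assumes y: "\<And>f. f \<in> targets b (Suc m) \<Longrightarrow> y f \<in> carrier R"
  obtains h where "h \<in> carrier (fobj (T R b) {..<Suc m})"
    "\<And>f. f \<in> targets b (Suc m) \<Longrightarrow> step_coord b (Suc m) f (ext_by R (T R b) (Suc m) h {..<Suc (Suc m)} (univ_chain R (Suc m))) = y f"
proof -
  obtain x where x: "\<And>u. x u \<in> carrier R" "\<And>u. u \<notin> sources b m \<Longrightarrow> x u = \<zero>"
    "\<And>f. f \<in> targets b (Suc m) \<Longrightarrow> coboundary b m x f = y f"
    by (rule coboundary_solve[OF y]) auto
  let ?S = "sources b m"
  have S: "?S \<subseteq> surjs b {..<m}" by (auto simp: sources_def)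
  then have St: "?S \<subseteq> tup b {..<m}" by (auto simp: surjs_def)
  have c: "restrict x ?S \<in> carrier (free_mod R ?S)"
    using x(1) finite_subset[OF S finite_surjs[of "{..<m}" b]] by (auto simp: free_mod_finite)
  let ?h = "free_lift R ?S (fobj (T R b) {..<Suc m}) (basis_tensor (step m) b {..<Suc m}) (restrict x ?S)"
  have "?h \<in> carrier (fobj (T R b) {..<Suc m})"
    by (rule mod_homD(2)[OF basis_tensor_lift(1)[OF dual_family_step tup_fin_obj St] c])
  moreover have "step_coord b (Suc m) f (ext_by R (T R b) (Suc m) ?h {..<Suc (Suc m)} (univ_chain R (Suc m))) = y f"
    if f: "f \<in> targets b (Suc m)" for f
    using differential[OF S c targetD(1)[OF f], of x] x(2,3) f by simp
  ultimately show ?thesis by (rule that)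
qed

end


definition permute_factors :: "('k, 'r) ring_scheme \<Rightarrow> nat \<Rightarrow> (nat \<Rightarrow> nat) \<Rightarrow> nat set \<Rightarrow> ((nat \<Rightarrow> nat \<Rightarrow> 'k) \<Rightarrow> 'k) set \<Rightarrow> ((nat \<Rightarrow> nat \<Rightarrow> 'k) \<Rightarrow> 'k) set"
  where "permute_factors R b g = (\<lambda>X\<in>fin_obj. tensor_lift R (red R X) b (fobj (T R b) X)
    (\<lambda>x. tpure R (red R X) b (compose {..<b} x g)))"

lemma surjs_square_bij: "g \<in> surjs b {..<b} \<Longrightarrow> bij_betw g {..<b} {..<b}"
  using surjs_inj[of g b] by (auto simp: bij_betw_def surjs_def)

text \<open>
  Signs are defined for permutations of a whole type.
\<close>

definition extend_by_id :: "nat \<Rightarrow> (nat \<Rightarrow> nat) \<Rightarrow> nat \<Rightarrow> nat"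
  where "extend_by_id b f i = (if i < b then f i else i)"

lemma extend_by_id_permutes: "f \<in> surjs b {..<b} \<Longrightarrow> extend_by_id b f permutes {..<b}"
proof (rule bij_imp_permutes)
  show "bij_betw (extend_by_id b f) {..<b} {..<b}" if "f \<in> surjs b {..<b}"
    using surjs_square_bij[OF that] by (subst bij_betw_cong[of _ _ f]) (auto simp: extend_by_id_def)
qed (simp add: extend_by_id_def)

context cring
begin

subsection \<open>Permuting the factors\<close>

lemma permute_multilinear:
  assumes M: "module R M" and g: "g \<in> surjs b {..<b}"
  shows "multilinear R M b (tensor_pow R M b) (\<lambda>x. tpure R M b (compose {..<b} x g))"
    and "x \<in> tuples M b \<Longrightarrow> compose {..<b} x g \<in> tuples M b"
proof -
  note bij = surjs_square_bij[OF g] and t = tpure_multilinear[OF M, of b]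
  interpret M: module R M by fact
  have gb: "j < b \<Longrightarrow> g j < b" for j using surjs_bound[OF g] .
  show c: "compose {..<b} x g \<in> tuples M b" if "x \<in> tuples M b" for x
    using that gb by (auto simp: tuples_def compose_def PiE_iff)
  have upd: "\<exists>j<b. \<forall>v. compose {..<b} (x(i := v)) g = (compose {..<b} x g)(j := v)" if i: "i < b" for x :: "nat \<Rightarrow> 'c" and i
  proof -
    obtain j where j: "j < b" "g j = i" by (rule surjs_obtain[OF g i])
    have "compose {..<b} (x(i := v)) g = (compose {..<b} x g)(j := v)" for v
    proof
      fix l show "compose {..<b} (x(i := v)) g l = ((compose {..<b} x g)(j := v)) l"
        using j surjs_inj[OF g] by (cases "l < b") (auto simp: compose_def inj_on_def)
    qed
    then show ?thesis using j by blast
  qed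
  show "multilinear R M b (tensor_pow R M b) (\<lambda>x. tpure R M b (compose {..<b} x g))"
  proof (rule multilinearI[OF M])
    show "x \<in> tuples M b \<Longrightarrow> tpure R M b (compose {..<b} x g) \<in> carrier (tensor_pow R M b)" for x
      by (rule tpure_closed[OF M c])
  next
    fix x i u v assume x: "x \<in> tuples M b" and i: "i < b" and uv: "u \<in> carrier M" "v \<in> carrier M"
    obtain j where "j < b" "\<And>v. compose {..<b} (x(i := v)) g = (compose {..<b} x g)(j := v)" using upd[OF i] by blast
    then show "tpure R M b (compose {..<b} (x(i := u \<oplus>\<^bsub>M\<^esub> v)) g) =
      tpure R M b (compose {..<b} (x(i := u)) g) \<oplus>\<^bsub>tensor_pow R M b\<^esub> tpure R M b (compose {..<b} (x(i := v)) g)"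
      using multilinear_add[OF t c[OF x] _ uv M] by simp
  next
    fix x i r u assume x: "x \<in> tuples M b" and i: "i < b" and ru: "r \<in> carrier R" "u \<in> carrier M"
    obtain j where "j < b" "\<And>v. compose {..<b} (x(i := v)) g = (compose {..<b} x g)(j := v)" using upd[OF i] by blast
    then show "tpure R M b (compose {..<b} (x(i := r \<odot>\<^bsub>M\<^esub> u)) g) = r \<odot>\<^bsub>tensor_pow R M b\<^esub> tpure R M b (compose {..<b} (x(i := u)) g)"
      using multilinear_smult[OF t c[OF x] _ ru M] by simp
  qed
qed

lemma permute_factors_nat:
  assumes g: "g \<in> surjs b {..<b}"
  shows "permute_factors R b g \<in> nat_trans R (T R b) (T R b)"
    and "X \<in> fin_obj \<Longrightarrow> x \<in> tuples (red R X) b \<Longrightarrow>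
      permute_factors R b g X (tpure R (red R X) b x) = tpure R (red R X) b (compose {..<b} x g)"
proof -
  have l: "permute_factors R b g X \<in> mod_hom R (fobj (T R b) X) (fobj (T R b) X)" if X: "X \<in> fin_obj" for X
    using tensor_lift(1)[OF red_module[OF X] tensor_pow_module[OF red_module[OF X]] permute_multilinear(1)[OF red_module[OF X] g]] X
    by (simp add: permute_factors_def T_obj)
  show p: "permute_factors R b g X (tpure R (red R X) b x) = tpure R (red R X) b (compose {..<b} x g)"
    if X: "X \<in> fin_obj" and x: "x \<in> tuples (red R X) b" for X x
    using tensor_lift(2)[OF red_module[OF X] tensor_pow_module[OF red_module[OF X]] permute_multilinear(1)[OF red_module[OF X] g] x] X
    by (simp add: permute_factors_def T_obj)
  show "permute_factors R b g \<in> nat_trans R (T R b) (T R b)"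
  proof (rule nat_transI[OF l])
    fix X Y f v assume h: "X \<in> fin_obj" "Y \<in> fin_obj" "f \<in> fin_hom X Y" "v \<in> carrier (fobj (T R b) X)"
    note F = is_functorD(2)[OF T_functor h(1-3)] and TX = is_functorD(1)[OF T_functor h(1)] and TY = is_functorD(1)[OF T_functor h(2)]
    show "permute_factors R b g Y (fmor (T R b) X Y f v) = fmor (T R b) X Y f (permute_factors R b g X v)"
    proof (rule T_lin_eq[OF h(1) _ _ TY _ h(4)])
      show "lin R (fobj (T R b) X) (fobj (T R b) Y) (\<lambda>v. permute_factors R b g Y (fmor (T R b) X Y f v))"
        by (rule lin_comp[OF lin_of_hom[OF F] lin_of_hom[OF l[OF h(2)]] TX TY])
      show "lin R (fobj (T R b) X) (fobj (T R b) Y) (\<lambda>v. fmor (T R b) X Y f (permute_factors R b g X v))"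
        by (rule lin_comp[OF lin_of_hom[OF l[OF h(1)]] lin_of_hom[OF F] TX TX])
      fix x assume x: "x \<in> tuples (red R X) b"
      have "compose {..<b} (tuple_map b (free_map R X Y f) x) g = tuple_map b (free_map R X Y f) (compose {..<b} x g)"
        using surjs_bound[OF g] by (auto simp: tuple_map_def compose_def intro!: restrict_ext)
      then show "permute_factors R b g Y (fmor (T R b) X Y f (tpure R (red R X) b x)) = fmor (T R b) X Y f (permute_factors R b g X (tpure R (red R X) b x))"
        by (simp add: T_map_tpure[OF h(1-3)] x permute_multilinear(2)[OF red_module[OF h(1)] g x] p[OF h(1) x]
            p[OF h(2) red_tuple_map[OF h(1-3) x]])
    qed
  next
    show "permute_factors R b g \<in> extensional fin_obj" unfolding permute_factors_def by (rule restrict_extensional)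
  qed
qed

text \<open>
  The permutations of the factors take the universal chain to the basis tensors of bijections, so
  that in the top degree all coordinates can be prescribed.
\<close>

lemma step_coord_permute_factors:
  assumes g: "g \<in> surjs b {..<b}" and f: "f \<in> tup b {..<b}"
  shows "step_coord b b f (permute_factors R b g {..<Suc b} (univ_chain R b)) = (if f = g then \<one> else \<zero>)"
proof -
  note X = tup_fin_obj[of b]
  have c: "chain R b {..<Suc b} (\<lambda>i. i) \<in> tuples (red R {..<Suc b}) b"
    by (auto simp: chain_def tuples_def intro!: diff_closed(1)[OF X])
  have "compose {..<b} (chain R b {..<Suc b} (\<lambda>i. i)) g = (\<lambda>j\<in>{..<b}. step b (g j))"
    using surjs_bound[OF g] by (auto simp: chain_def compose_def intro!: restrict_ext)
  then have "permute_factors R b g {..<Suc b} (univ_chain R b) = basis_tensor (step b) b {..<Suc b} g"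
    unfolding univ_chain_def permute_factors_nat(2)[OF g X c] by (simp add: basis_tensor_def)
  moreover have "g \<in> tup b {..<b}" using g by (simp add: surjs_def)
  ultimately show ?thesis using dual_form_dual[OF dual_family_step X f] by (simp add: step_coord_def)
qed

section \<open>Morphisms between tensor powers\<close>

text \<open>
  Morphisms are free on a set of surjections if their coordinates there determine them and can be
  prescribed.
\<close>

lemma Hom_free:
  assumes S: "finite S" "S \<subseteq> surjs b {..<a}"
    and surj: "\<And>y. y \<in> carrier (free_mod R S) \<Longrightarrow> \<exists>\<eta>\<in>nat_trans R (T R a) (T R b). \<forall>f\<in>S. step_coord b a f (\<eta> {..<Suc a} (univ_chain R a)) = y f"
    and zero: "\<And>\<eta>. \<eta> \<in> nat_trans R (T R a) (T R b) \<Longrightarrow> (\<And>f. f \<in> S \<Longrightarrow> step_coord b a f (\<eta> {..<Suc a} (univ_chain R a)) = \<zero>) \<Longrightarrow>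
      \<eta> = \<zero>\<^bsub>Hom_mod R (T R a) (T R b)\<^esub>"
  shows "inj_on (morphism_coords b a S) (nat_trans R (T R a) (T R b))"
    and "mod_iso R (Hom_mod R (T R a) (T R b)) (free_mod R {..<card S})"
proof -
  have sj: "carrier (free_mod R S) \<subseteq> morphism_coords b a S ` carrier (Hom_mod R (T R a) (T R b))"
  proof
    fix y assume y: "y \<in> carrier (free_mod R S)"
    then obtain \<eta> where \<eta>: "\<eta> \<in> nat_trans R (T R a) (T R b)" "\<And>f. f \<in> S \<Longrightarrow> step_coord b a f (\<eta> {..<Suc a} (univ_chain R a)) = y f"
      using surj by blast
    have "y = morphism_coords b a S \<eta>"
      using \<eta> y by (intro free_eqI[OF y mod_homD(2)[OF morphism_coords_hom[OF S(1)]]]) (auto simp: morphism_coords_def Hom_simps(1))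
    then show "y \<in> morphism_coords b a S ` carrier (Hom_mod R (T R a) (T R b))" using \<eta>(1) by (auto simp: Hom_simps(1))
  qed
  have k: "\<eta> = \<zero>\<^bsub>Hom_mod R (T R a) (T R b)\<^esub>"
    if "\<eta> \<in> carrier (Hom_mod R (T R a) (T R b))" "morphism_coords b a S \<eta> = \<zero>\<^bsub>free_mod R S\<^esub>" for \<eta>
  proof (rule zero)
    show n: "\<eta> \<in> nat_trans R (T R a) (T R b)" using that by (simp add: Hom_simps(1))
    show "step_coord b a f (\<eta> {..<Suc a} (univ_chain R a)) = \<zero>" if "f \<in> S" for f
      using fun_cong[OF \<open>morphism_coords b a S \<eta> = \<zero>\<^bsub>free_mod R S\<^esub>\<close>, of f] that n by (simp add: morphism_coords_def free_simps(2))
  qed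
  note i = mod_iso_of_ker[OF morphism_coords_hom[OF S(1)] Hom_T_module free_mod_module sj k]
  show "inj_on (morphism_coords b a S) (nat_trans R (T R a) (T R b))" using i(1) by (simp add: Hom_simps(1))
  show "mod_iso R (Hom_mod R (T R a) (T R b)) (free_mod R {..<card S})"
    by (rule mod_iso_trans[OF i(2) free_mod_iso[OF cring_axioms S(1)] Hom_T_module])
qed

lemma Hom_lt:
  assumes "0 < a" "a < b"
  shows "inj_on (morphism_coords b a (targets b a)) (nat_trans R (T R a) (T R b))"
    and "mod_iso R (Hom_mod R (T R a) (T R b)) (free_mod R {..<card (targets b a)})"
proof -
  obtain m where m: "a = Suc m" using assms(1) gr0_implies_Suc by blast
  have sub: "targets b a \<subseteq> surjs b {..<a}" by (auto simp: targets_def)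
  have fin: "finite (targets b a)" by (rule finite_subset[OF sub finite_surjs]) simp
  have surj: "\<exists>\<eta>\<in>nat_trans R (T R a) (T R b). \<forall>f\<in>targets b a. step_coord b a f (\<eta> {..<Suc a} (univ_chain R a)) = y f"
    if y: "y \<in> carrier (free_mod R (targets b a))" for y
  proof -
    obtain h where h: "h \<in> carrier (fobj (T R b) {..<Suc m})"
      "\<And>f. f \<in> targets b (Suc m) \<Longrightarrow> step_coord b (Suc m) f (ext_by R (T R b) (Suc m) h {..<Suc (Suc m)} (univ_chain R (Suc m))) = y f"
      by (rule realize_targets[of b m y]) (use free_app[OF y] m in auto)
    then show ?thesis using ext_by_nat[OF T_functor tup_fin_obj h(1)] unfolding m by blast
  qed
  note H = Hom_free[OF fin sub surj morphism_coords_targets_zero[OF _ assms(2)]]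
  show "inj_on (morphism_coords b a (targets b a)) (nat_trans R (T R a) (T R b))" by (rule H(1))
  show "mod_iso R (Hom_mod R (T R a) (T R b)) (free_mod R {..<card (targets b a)})" by (rule H(2))
qed

lemma Hom_eq:
  shows "inj_on (morphism_coords b b (surjs b {..<b})) (nat_trans R (T R b) (T R b))"
    and "mod_iso R (Hom_mod R (T R b) (T R b)) (free_mod R {..<card (surjs b {..<b})})"
proof -
  let ?S = "surjs b {..<b}" let ?H = "Hom_mod R (T R b) (T R b)"
  have fin: "finite ?S" by (rule finite_surjs) simp
  have cl: "permute_factors R b \<in> ?S \<rightarrow> carrier ?H" using permute_factors_nat(1) by (auto simp: Hom_simps(1))
  note L = free_lift_hom[OF Hom_T_module cl]
  have surj: "\<exists>\<eta>\<in>nat_trans R (T R b) (T R b). \<forall>f\<in>?S. step_coord b b f (\<eta> {..<Suc b} (univ_chain R b)) = y f"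
    if y: "y \<in> carrier (free_mod R ?S)" for y
  proof (rule bexI[of _ "free_lift R ?S ?H (permute_factors R b) y"], rule ballI)
    fix f assume f: "f \<in> ?S"
    then have ft: "f \<in> tup b {..<b}" by (simp add: surjs_def)
    show "step_coord b b f (free_lift R ?S ?H (permute_factors R b) y {..<Suc b} (univ_chain R b)) = y f"
    proof (rule free_lin_eq[OF lin_comp[OF lin_of_hom[OF L] step_coord_univ_chain_lin free_mod_module Hom_T_module] _ ring_mod_module[OF cring_axioms] _ y])
      show "lin R (free_mod R ?S) (ring_mod R) (\<lambda>v. v f)" using eval_hom[OF f] by (simp add: lin_def)
      fix g assume g: "g \<in> ?S"
      show "step_coord b b f (free_lift R ?S ?H (permute_factors R b) (free_gen R ?S g) {..<Suc b} (univ_chain R b)) = free_gen R ?S g f"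
        using f g by (simp add: free_lift_gen[OF Hom_T_module cl g] step_coord_permute_factors[OF g ft]) (simp add: free_gen_def)
    qed
  next
    show "free_lift R ?S ?H (permute_factors R b) y \<in> nat_trans R (T R b) (T R b)"
      using mod_homD(2)[OF L y] by (simp add: Hom_simps(1))
  qed
  note H = Hom_free[OF fin subset_refl surj univ_chain_zero_imp_zero]
  show "inj_on (morphism_coords b b ?S) (nat_trans R (T R b) (T R b))" by (rule H(1))
  show "mod_iso R ?H (free_mod R {..<card ?S})" by (rule H(2))
qed

lemma zero_mod_module: "module R (zero_mod R)"
proof -
  have "submodule {\<zero>} R (ring_mod R)"
    by (rule submodule_of_closed[OF ring_mod_module[OF cring_axioms]]) (auto simp: ring_mod_simps)
  then show ?thesis
    using submodule.submodule_is_module[OF _ ring_mod_module[OF cring_axioms]] by (simp add: zero_mod_def)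
qed

lemma zero_mod_simps: "carrier (zero_mod R) = {\<zero>}" "\<zero>\<^bsub>zero_mod R\<^esub> = \<zero>" "x \<oplus>\<^bsub>zero_mod R\<^esub> y = x \<oplus> y" "r \<odot>\<^bsub>zero_mod R\<^esub> x = r \<otimes> x"
  by (auto simp: zero_mod_def ring_mod_def)

lemma to_zero_mod: "module R M \<Longrightarrow> (\<lambda>x\<in>carrier M. \<zero>) \<in> mod_hom R M (zero_mod R)"
  using linI[of R M "\<lambda>_. \<zero>" "zero_mod R"] by (simp add: lin_def zero_mod_simps)

lemma Hom_gt_zero:
  assumes "b < a" "\<eta> \<in> nat_trans R (T R a) (T R b)"
  shows "\<eta> = \<zero>\<^bsub>Hom_mod R (T R a) (T R b)\<^esub>"
  by (rule univ_chain_zero_imp_zero[OF assms(2)]) (use surjs_le[of _ b a] assms(1) in auto)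

lemma Hom_gt:
  assumes "b < a"
  shows "mod_iso R (Hom_mod R (T R a) (T R b)) (zero_mod R)"
proof (rule mod_iso_of_ker(2)[OF to_zero_mod[OF Hom_T_module] Hom_T_module zero_mod_module])
  have "\<zero>\<^bsub>Hom_mod R (T R a) (T R b)\<^esub> \<in> nat_trans R (T R a) (T R b)" by (rule Hom_closed(1)[OF T_functor T_functor])
  then show "carrier (zero_mod R) \<subseteq> (\<lambda>x\<in>carrier (Hom_mod R (T R a) (T R b)). \<zero>) ` carrier (Hom_mod R (T R a) (T R b))"
    by (auto simp: zero_mod_simps Hom_simps(1) image_iff)
qed (use Hom_gt_zero[OF assms] in \<open>simp add: Hom_simps(1)\<close>)

section \<open>The extension groups\<close>

lemma Ext1_zero:
  assumes "\<And>\<eta>. \<eta> \<in> nat_trans R (T R (Suc a)) (T R b) \<Longrightarrow> \<exists>h\<in>carrier (fobj (T R b) {..<Suc a}). \<eta> = ext_by R (T R b) (Suc a) h"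
  shows "mod_iso R (Ext1_mod R (T R a) (T R b)) (zero_mod R)"
proof (rule Ext1_via_obstruction[OF T_functor zero_mod_module to_zero_mod[OF Hom_T_module]])
  have "\<zero>\<^bsub>Hom_mod R (T R (Suc a)) (T R b)\<^esub> \<in> nat_trans R (T R (Suc a)) (T R b)" by (rule Hom_closed(1)[OF T_functor T_functor])
  then show "(\<lambda>x\<in>carrier (Hom_mod R (T R (Suc a)) (T R b)). \<zero>) ` nat_trans R (T R (Suc a)) (T R b) = carrier (zero_mod R)"
    by (auto simp: zero_mod_simps Hom_simps(1) image_iff)
qed (use assms in \<open>simp add: Hom_simps(1) zero_mod_simps\<close>)

text \<open>
  For \<open>b < a + 1\<close> there are no morphisms \<open>T (a + 1) \<rightarrow> T b\<close>. For \<open>b > a + 1\<close> an extendable morphism can be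
  found with the same coordinates at the targets, and these determine the morphism.
\<close>

lemma Ext1_off_diagonal:
  assumes "b \<noteq> Suc a"
  shows "mod_iso R (Ext1_mod R (T R a) (T R b)) (zero_mod R)"
proof (rule Ext1_zero)
  fix \<eta> assume \<eta>: "\<eta> \<in> nat_trans R (T R (Suc a)) (T R b)"
  note X = tup_fin_obj[of a]
  show "\<exists>h\<in>carrier (fobj (T R b) {..<Suc a}). \<eta> = ext_by R (T R b) (Suc a) h"
  proof (cases "b < Suc a")
    case True
    interpret M: module R "fobj (T R b) {..<Suc a}" by (rule is_functorD(1)[OF T_functor X])
    have z: "\<zero>\<^bsub>fobj (T R b) {..<Suc a}\<^esub> \<in> carrier (fobj (T R b) {..<Suc a})" by simp
    show ?thesis
      using Hom_gt_zero[OF True \<eta>] Hom_gt_zero[OF True ext_by_nat[OF T_functor X z]] z by metis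
  next
    case False
    then have lt: "Suc a < b" using assms by simp
    obtain h where h: "h \<in> carrier (fobj (T R b) {..<Suc a})"
      "\<And>f. f \<in> targets b (Suc a) \<Longrightarrow> step_coord b (Suc a) f (ext_by R (T R b) (Suc a) h {..<Suc (Suc a)} (univ_chain R (Suc a))) =
        step_coord b (Suc a) f (\<eta> {..<Suc (Suc a)} (univ_chain R (Suc a)))"
      by (rule realize_targets[of b a "\<lambda>f. step_coord b (Suc a) f (\<eta> {..<Suc (Suc a)} (univ_chain R (Suc a)))"])
        (use step_coord_closed[OF nat_trans_closed[OF \<eta> tup_fin_obj univ_chain_closed]] in auto)
    have e: "ext_by R (T R b) (Suc a) h \<in> nat_trans R (T R (Suc a)) (T R b)" by (rule ext_by_nat[OF T_functor X h(1)])
    have "morphism_coords b (Suc a) (targets b (Suc a)) \<eta> = morphism_coords b (Suc a) (targets b (Suc a)) (ext_by R (T R b) (Suc a) h)"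
      using \<eta> e h(2) by (auto simp: morphism_coords_def intro!: restrict_ext)
    then have "\<eta> = ext_by R (T R b) (Suc a) h" using inj_onD[OF Hom_lt(1)[OF _ lt] _ \<eta> e] by simp
    then show ?thesis using h(1) by blast
  qed
qed

text \<open>
  With \<open>b\<close> factors but only \<open>b - 1\<close> steps, a basis tensor of \<open>T b {0, \<dots>, b - 1}\<close> repeats a factor. The
  coordinates of the morphism that it defines are therefore invariant under a transposition.
\<close>

lemma step_coord_swap:
  assumes u: "u \<in> tup b {..<m}" and ij: "i < b" "j < b" "u i = u j" and b: "b = Suc m"
  shows "step_coord b (Suc m) (compose {..<b} f (transpose i j)) (ext_by R (T R b) (Suc m) (basis_tensor (step m) b {..<Suc m} u) {..<Suc (Suc m)} (univ_chain R (Suc m))) =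
    step_coord b (Suc m) f (ext_by R (T R b) (Suc m) (basis_tensor (step m) b {..<Suc m} u) {..<Suc (Suc m)} (univ_chain R (Suc m)))"
proof -
  let ?Y = "{..<Suc (Suc m)}" let ?h = "basis_tensor (step m) b {..<Suc m} u" let ?t = "transpose i j"
  note X = tup_fin_obj[of m] and Y = tup_fin_obj[of "Suc m"]
  have h: "?h \<in> carrier (fobj (T R b) {..<Suc m})" by (rule basis_tensor_closed[OF dual_family_step X u])
  note w = coef_closed[OF Y univ_chain_closed]
  have tb: "l < b \<Longrightarrow> ?t l < b" for l using ij by (auto simp: transpose_def)
  have tim: "?t ` {..<b} = {..<b}" using ij by (intro transpose_image_eq) auto
  have ut: "l < b \<Longrightarrow> u (?t l) = u l" for l using ij by (auto simp: transpose_def)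
  have "step_coord b (Suc m) (compose {..<b} f ?t) (fmor (T R b) {..<Suc m} ?Y x ?h) = step_coord b (Suc m) f (fmor (T R b) {..<Suc m} ?Y x ?h)"
    if x: "x \<in> tup (Suc m) ?Y" for x
  proof -
    let ?F = "\<lambda>l. below (f l) (x (u l)) \<ominus> below (f l) (x (Suc (u l)))"
    have "finprod R (\<lambda>l. below (compose {..<b} f ?t l) (x (u l)) \<ominus> below (compose {..<b} f ?t l) (x (Suc (u l)))) {..<b} =
      finprod R (\<lambda>l. ?F (?t l)) {..<b}"
      by (rule finprod_cong') (auto simp: compose_eq ut below_closed)
    also have "\<dots> = finprod R ?F (?t ` {..<b})"
      by (rule finprod_reindex[symmetric]) (auto simp: below_closed intro: inj_on_inverseI[of _ ?t])
    finally show ?thesis unfolding tim step_coord_image_basis_tensor[OF x u] .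
  qed
  then show ?thesis
    unfolding ext_by_app[OF Y univ_chain_closed] dual_form_yoneda[OF T_functor X h Y step_coord_lin w]
    using free_app[OF w] step_coord_closed[OF mod_homD(2)[OF is_functorD(2)[OF T_functor X Y] h]]
    by (intro finsum_cong') auto
qed

text \<open>
  The alternating sum is written as a difference of two sums, because the equal terms of opposite sign
  that a transposition exchanges must cancel even where \<open>2\<close> is a zero divisor.
\<close>

definition alternating :: "nat \<Rightarrow> ((nat \<Rightarrow> nat) \<Rightarrow> 'a) \<Rightarrow> 'a"
  where "alternating b c = finsum R c {f \<in> surjs b {..<b}. evenperm (extend_by_id b f)} \<ominus> finsum R c {f \<in> surjs b {..<b}. \<not> evenperm (extend_by_id b f)}"

lemma alternating_swap:
  assumes c: "\<And>f. f \<in> surjs b {..<b} \<Longrightarrow> c f \<in> carrier R" and ij: "i < b" "j < b" "i \<noteq> j"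
    and inv: "\<And>f. f \<in> surjs b {..<b} \<Longrightarrow> c (compose {..<b} f (transpose i j)) = c f"
  shows "alternating b c = \<zero>"
proof -
  let ?S = "surjs b {..<b}" and ?t = "transpose i j"
  let ?E = "{f \<in> ?S. evenperm (extend_by_id b f)}" and ?O = "{f \<in> ?S. \<not> evenperm (extend_by_id b f)}"
  let ?\<tau> = "\<lambda>f. compose {..<b} f ?t"
  have tb: "l < b \<Longrightarrow> ?t l < b" for l using ij by (auto simp: transpose_def)
  have ge: "\<not> l < b \<Longrightarrow> ?t l = l" for l using ij by (auto simp: transpose_def)
  have S: "?\<tau> f \<in> ?S" if f: "f \<in> ?S" for f
  proof (rule surjsI)
    show "?\<tau> f l < b" if "l < b" for l using surjs_bound[OF f tb[OF that]] that by (simp add: compose_eq)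
    fix t assume t: "t < b"
    obtain l where "l < b" "f l = t" by (rule surjs_obtain[OF f t])
    then show "\<exists>l<b. ?\<tau> f l = t" using tb[of l] by (intro exI[of _ "?t l"]) (auto simp: compose_eq)
  qed simp
  have par: "evenperm (extend_by_id b (?\<tau> f)) \<longleftrightarrow> \<not> evenperm (extend_by_id b f)" if f: "f \<in> ?S" for f
  proof -
    have "extend_by_id b (?\<tau> f) = extend_by_id b f \<circ> ?t" using tb ge by (auto simp: extend_by_id_def compose_eq fun_eq_iff)
    moreover have "permutation (extend_by_id b f)" using extend_by_id_permutes[OF f] by (auto simp: permutation_permutes)
    ultimately show ?thesis using ij by (simp add: evenperm_comp evenperm_swap permutation_swap_id)
  qed
  have invol: "?\<tau> (?\<tau> f) = f" if f: "f \<in> ?S" for f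
    using surjs_ext[OF f] tb by (intro extensionalityI[of _ "{..<b}"]) (auto simp: compose_eq)
  have im: "?\<tau> ` ?E = ?O"
  proof
    show "?\<tau> ` ?E \<subseteq> ?O" using S par by auto
    show "?O \<subseteq> ?\<tau> ` ?E"
    proof
      fix f assume "f \<in> ?O"
      then have "?\<tau> f \<in> ?E" "f = ?\<tau> (?\<tau> f)" using S[of f] par[of f] invol[of f] by auto
      then show "f \<in> ?\<tau> ` ?E" by (intro image_eqI[of _ _ "?\<tau> f"])
    qed
  qed
  have "inj_on ?\<tau> ?E" using invol by (intro inj_on_inverseI[of _ ?\<tau>]) auto
  then have "finsum R c ?O = finsum R (\<lambda>f. c (?\<tau> f)) ?E"
    unfolding im[symmetric] by (rule add.finprod_reindex[rotated]) (use c im in auto)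
  also have "\<dots> = finsum R c ?E" by (rule finsum_cong') (use inv c in auto)
  finally show ?thesis using finsum_closed[of c ?E] c by (simp add: alternating_def r_neg minus_eq Pi_def)
qed

lemma extend_by_id_id: "extend_by_id b (\<lambda>j\<in>{..<b}. j) = id"
  by (auto simp: extend_by_id_def)

lemma alternating_single:
  assumes c: "\<And>f. f \<in> surjs b {..<b} \<Longrightarrow> c f \<in> carrier R" and z: "\<And>f. f \<in> surjs b {..<b} \<Longrightarrow> f \<noteq> (\<lambda>j\<in>{..<b}. j) \<Longrightarrow> c f = \<zero>"
  shows "alternating b c = c (\<lambda>j\<in>{..<b}. j)"
proof -
  let ?i = "\<lambda>j\<in>{..<b}. j" let ?E = "{f \<in> surjs b {..<b}. evenperm (extend_by_id b f)}"
  have i: "?i \<in> ?E" using id_surj by (simp add: extend_by_id_id evenperm_id del: id_apply)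
  have fin: "finite (surjs b {..<b})" by (rule finite_surjs) simp
  have "finsum R c {f \<in> surjs b {..<b}. \<not> evenperm (extend_by_id b f)} = finsum R (\<lambda>_. \<zero>) {f \<in> surjs b {..<b}. \<not> evenperm (extend_by_id b f)}"
    by (rule finsum_cong') (use z i in auto)
  moreover have "finsum R c ?E = finsum R c (insert ?i (?E - {?i}))" using i by (simp add: insert_absorb del: mem_Collect_eq)
  moreover have "\<dots> = c ?i \<oplus> finsum R c (?E - {?i})" by (rule finsum_insert) (use fin c i in auto)
  moreover have "finsum R c (?E - {?i}) = finsum R (\<lambda>_. \<zero>) (?E - {?i})" by (rule finsum_cong') (use z in auto)
  ultimately show ?thesis using c[OF id_surj] by (simp add: alternating_def minus_eq finsum_zero)
qed

lemma alternating_lin: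
  assumes "module R M" "\<And>f. lin R M (ring_mod R) (l f)"
  shows "lin R M (ring_mod R) (\<lambda>v. alternating b (\<lambda>f. l f v))"
proof -
  have fin: "finite {f \<in> surjs b {..<b}. P f}" for P using finite_surjs[of "{..<b}" b] by simp
  note K = ring_mod_module[OF cring_axioms]
  note sl = lin_finsum[OF fin assms(2) assms(1)]
  have cl: "v \<in> carrier M \<Longrightarrow> finsum R (\<lambda>f. l f v) {f \<in> surjs b {..<b}. P f} \<in> carrier R" for v P
    using linD(1)[OF sl assms(1)] by (simp add: ring_mod_simps)
  have "lin R M (ring_mod R) (\<lambda>v. finsum R (\<lambda>f. l f v) {f \<in> surjs b {..<b}. evenperm (extend_by_id b f)} \<oplus>\<^bsub>ring_mod R\<^esub>
      (\<ominus> \<one>) \<odot>\<^bsub>ring_mod R\<^esub> finsum R (\<lambda>f. l f v) {f \<in> surjs b {..<b}. \<not> evenperm (extend_by_id b f)})"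
    by (intro lin_add lin_smult sl assms(1) K) simp
  then show ?thesis
    by (rule lin_cong) (simp add: alternating_def ring_mod_simps minus_eq l_minus cl)
qed

text \<open>
  By linearity in \<open>h\<close> only basis tensors matter, and these repeat a factor by the pigeonhole principle.
\<close>

lemma alternating_ext_by:
  assumes h: "h \<in> carrier (fobj (T R (Suc a)) {..<Suc a})"
  shows "alternating (Suc a) (\<lambda>f. step_coord (Suc a) (Suc a) f (ext_by R (T R (Suc a)) (Suc a) h {..<Suc (Suc a)} (univ_chain R (Suc a)))) = \<zero>"
proof -
  let ?b = "Suc a" let ?X = "{..<?b}" let ?Y = "{..<Suc ?b}"
  note X = tup_fin_obj[of a] and Y = tup_fin_obj[of ?b]
  note TX = is_functorD(1)[OF T_functor X, of ?b] and TY = is_functorD(1)[OF T_functor Y, of ?b]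
  note K = ring_mod_module[OF cring_axioms]
  note el = ext_by_lin[OF T_functor X Y univ_chain_closed]
  have zl: "lin R (fobj (T R ?b) ?X) (ring_mod R) (\<lambda>_. \<zero>)" by (rule linI[OF TX]) (auto simp: ring_mod_simps)
  show ?thesis
  proof (rule lin_eq_on_spanning[OF _ zl basis_tensor_span[OF dual_family_step X] TX K _ h])
    show "lin R (fobj (T R ?b) ?X) (ring_mod R) (\<lambda>h. alternating ?b (\<lambda>f. step_coord ?b ?b f (ext_by R (T R ?b) ?b h ?Y (univ_chain R ?b))))"
      by (rule alternating_lin[OF TX lin_comp[OF el step_coord_lin TX TY]])
    fix s assume "s \<in> basis_tensor (step a) ?b ?X ` tup ?b {..<a}"
    then obtain u where u: "u \<in> tup ?b {..<a}" "s = basis_tensor (step a) ?b ?X u" by blast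
    have s: "s \<in> carrier (fobj (T R ?b) ?X)" unfolding u(2) by (rule basis_tensor_closed[OF dual_family_step X u(1)])
    have "\<not> inj_on u {..<?b}"
    proof
      assume "inj_on u {..<?b}"
      then have "card {..<?b} \<le> card {..<a}" by (rule card_inj_on_le) (use tup_app[OF u(1)] in auto)
      then show False by simp
    qed
    then obtain i j where ij: "i < ?b" "j < ?b" "i \<noteq> j" "u i = u j" by (auto simp: inj_on_def)
    show "alternating ?b (\<lambda>f. step_coord ?b ?b f (ext_by R (T R ?b) ?b s ?Y (univ_chain R ?b))) = \<zero>"
    proof (rule alternating_swap[OF _ ij(1-3)])
      show "step_coord ?b ?b f (ext_by R (T R ?b) ?b s ?Y (univ_chain R ?b)) \<in> carrier R" for f
        by (rule step_coord_closed[OF nat_trans_closed[OF ext_by_nat[OF T_functor X s] Y univ_chain_closed]])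
      show "step_coord ?b ?b (compose {..<?b} f (transpose i j)) (ext_by R (T R ?b) ?b s ?Y (univ_chain R ?b)) = step_coord ?b ?b f (ext_by R (T R ?b) ?b s ?Y (univ_chain R ?b))" for f
        unfolding u(2) by (rule step_coord_swap[OF u(1) ij(1,2,4) refl])
    qed
  qed
qed

text \<open>
  All coordinates at the targets can be attained by a morphism that extends, so that only the
  coordinate at the identity is left; modulo extendable morphisms it is the alternating sum.
\<close>

lemma Ext1_diagonal: "mod_iso R (Ext1_mod R (T R a) (T R (Suc a))) (ring_mod R)"
proof -
  let ?b = "Suc a" let ?Y = "{..<Suc ?b}" let ?H = "Hom_mod R (T R ?b) (T R ?b)" let ?i = "\<lambda>j\<in>{..<?b}. j"
  note X = tup_fin_obj[of a] and Y = tup_fin_obj[of ?b]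
  define c where "c \<eta> f = step_coord ?b ?b f (\<eta> ?Y (univ_chain R ?b))" for \<eta> f
  have cc: "c \<eta> f \<in> carrier R" if "\<eta> \<in> nat_trans R (T R ?b) (T R ?b)" for \<eta> f
    unfolding c_def by (rule step_coord_closed[OF nat_trans_closed[OF that Y univ_chain_closed]])
  define \<mu> where "\<mu> = (\<lambda>\<eta>\<in>carrier ?H. alternating ?b (c \<eta>))"
  have \<mu>: "\<mu> \<in> mod_hom R ?H (ring_mod R)"
    using alternating_lin[OF Hom_T_module step_coord_univ_chain_lin] by (simp add: lin_def \<mu>_def c_def[abs_def])
  show ?thesis
  proof (rule Ext1_via_obstruction[OF T_functor ring_mod_module[OF cring_axioms] \<mu>])
    note p = permute_factors_nat(1)[OF id_surj[of ?b]]
    have "c (permute_factors R ?b ?i) f = (if f = ?i then \<one> else \<zero>)" if "f \<in> surjs ?b {..<?b}" for f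
      unfolding c_def by (rule step_coord_permute_factors[OF id_surj]) (use that in \<open>simp add: surjs_def\<close>)
    then have p1: "\<mu> (permute_factors R ?b ?i) = \<one>"
      using alternating_single[of ?b "c (permute_factors R ?b ?i)"] cc[OF p] p id_surj[of ?b] by (simp add: \<mu>_def Hom_simps(1))
    show "\<mu> ` nat_trans R (T R ?b) (T R ?b) = carrier (ring_mod R)"
    proof
      show "\<mu> ` nat_trans R (T R ?b) (T R ?b) \<subseteq> carrier (ring_mod R)"
        using mod_homD(2)[OF \<mu>] by (auto simp: Hom_simps(1))
      show "carrier (ring_mod R) \<subseteq> \<mu> ` nat_trans R (T R ?b) (T R ?b)"
      proof
        fix r assume r: "r \<in> carrier (ring_mod R)"
        then have "\<mu> (r \<odot>\<^bsub>?H\<^esub> permute_factors R ?b ?i) = r"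
          using mod_homD(4)[OF \<mu>, of r "permute_factors R ?b ?i"] p p1 by (simp add: Hom_simps(1) ring_mod_simps)
        moreover have "r \<odot>\<^bsub>?H\<^esub> permute_factors R ?b ?i \<in> nat_trans R (T R ?b) (T R ?b)"
          by (rule Hom_closed(3)[OF T_functor T_functor _ p]) (use r in \<open>simp add: ring_mod_simps\<close>)
        ultimately show "r \<in> \<mu> ` nat_trans R (T R ?b) (T R ?b)" by (metis image_eqI)
      qed
    qed
    fix \<eta> assume \<eta>: "\<eta> \<in> nat_trans R (T R ?b) (T R ?b)"
    have \<mu>e: "\<mu> (ext_by R (T R ?b) ?b h) = \<zero>" if h: "h \<in> carrier (fobj (T R ?b) {..<?b})" for h
      using alternating_ext_by[OF h] ext_by_nat[OF T_functor X h] by (simp add: \<mu>_def Hom_simps(1) c_def[abs_def])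
    show "\<mu> \<eta> = \<zero>\<^bsub>ring_mod R\<^esub> \<longleftrightarrow> (\<exists>h\<in>carrier (fobj (T R ?b) {..<?b}). \<eta> = ext_by R (T R ?b) ?b h)"
    proof
      assume z: "\<mu> \<eta> = \<zero>\<^bsub>ring_mod R\<^esub>"
      obtain h where h: "h \<in> carrier (fobj (T R ?b) {..<?b})"
        "\<And>f. f \<in> targets ?b ?b \<Longrightarrow> step_coord ?b ?b f (ext_by R (T R ?b) ?b h ?Y (univ_chain R ?b)) = c \<eta> f"
        by (rule realize_targets[of ?b a "c \<eta>"]) (use cc[OF \<eta>] in auto)
      let ?e = "ext_by R (T R ?b) ?b h"
      have e: "?e \<in> nat_trans R (T R ?b) (T R ?b)" by (rule ext_by_nat[OF T_functor X h(1)])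
      interpret H: module R ?H by (rule Hom_T_module)
      interpret KR: module R "ring_mod R" by (rule ring_mod_module[OF cring_axioms])
      define d where "d = \<eta> \<ominus>\<^bsub>?H\<^esub> ?e"
      have Hc: "\<eta> \<in> carrier ?H" "?e \<in> carrier ?H" using \<eta> e by (simp_all add: Hom_simps(1))
      have d: "d \<in> nat_trans R (T R ?b) (T R ?b)" using Hc unfolding d_def by (metis H.M.minus_closed Hom_simps(1))
      have cd: "c d f = c \<eta> f \<ominus>\<^bsub>ring_mod R\<^esub> c ?e f" for f
        using mod_hom_minus[OF step_coord_univ_chain_lin[unfolded lin_def] Hom_T_module KR.module_axioms Hc] Hc H.M.minus_closed[OF Hc]
        by (simp add: d_def c_def)
      have dz: "c d f = \<zero>" if f: "f \<in> surjs ?b {..<?b}" "f \<noteq> ?i" for f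
      proof -
        have "f \<in> targets ?b ?b" using surjs_square(1)[of ?b] f by blast
        then have "c ?e f = c \<eta> f" using h(2) by (simp add: c_def)
        then show ?thesis using cc[OF \<eta>] KR.M.r_neg[of "c \<eta> f"] by (simp add: cd KR.M.minus_eq ring_mod_simps)
      qed
      have "\<mu> d = \<mu> \<eta> \<ominus>\<^bsub>ring_mod R\<^esub> \<mu> ?e"
        unfolding d_def by (rule mod_hom_minus[OF \<mu> Hom_T_module KR.module_axioms Hc])
      also have "\<dots> = \<zero>" using z \<mu>e[OF h(1)] KR.M.r_neg[of \<zero>] by (simp add: KR.M.minus_eq ring_mod_simps)
      finally have "alternating ?b (c d) = \<zero>" using d by (simp add: \<mu>_def Hom_simps(1))
      then have "c d ?i = \<zero>" using alternating_single[OF cc[OF d] dz] by simp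
      then have "d = \<zero>\<^bsub>?H\<^esub>" using dz by (intro univ_chain_zero_imp_zero[OF d]) (auto simp: c_def)
      then have "\<eta> = ?e" unfolding d_def by (rule module_minus_zero[OF Hom_T_module Hc])
      then show "\<exists>h\<in>carrier (fobj (T R ?b) {..<?b}). \<eta> = ext_by R (T R ?b) ?b h" using h(1) by blast
    qed (use \<mu>e in \<open>auto simp: ring_mod_simps\<close>)
  qed
qed

end

section \<open>The computation\<close>

theorem theorem1:
  fixes k :: "('k, 'r) ring_scheme" and a b :: nat
  assumes "cring k"
  shows "(b \<ge> a \<and> a > 0 \<longrightarrow>
           mod_iso k (Hom_mod k (tensor_functor k (red_functor k) a) (tensor_functor k (red_functor k) b))
             (free_mod k {..<Rk b a})) \<and>
         (b < a \<longrightarrow>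
           mod_iso k (Hom_mod k (tensor_functor k (red_functor k) a) (tensor_functor k (red_functor k) b))
             (zero_mod k)) \<and>
         mod_iso k (Ext1_mod k (tensor_functor k (red_functor k) a) (tensor_functor k (red_functor k) b))
           (if b = a + 1 then ring_mod k else zero_mod k)"
proof -
  interpret cring k by fact
  have "mod_iso k (Hom_mod k (T k a) (T k b)) (free_mod k {..<Rk b a})" if "a \<le> b" "0 < a"
  proof (cases "a = b")
    case True
    have "card (surjs b {..<b}) = Rk b b"
      using card_surjs[of "{..<b}" b] surj_num_diag[of b] Rk_equations(4)[of b] by simp
    then show ?thesis using Hom_eq(2)[of b] True by simp
  next
    case False
    then show ?thesis using Hom_lt(2)[of a b] card_targets[of a b] that by simp
  qed
  moreover have "b < a \<longrightarrow> mod_iso k (Hom_mod k (T k a) (T k b)) (zero_mod k)" using Hom_gt by blast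
  moreover have "mod_iso k (Ext1_mod k (T k a) (T k b)) (if b = a + 1 then ring_mod k else zero_mod k)"
    using Ext1_diagonal[of a] Ext1_off_diagonal[of b a] by auto
  ultimately show ?thesis by blast
qed

end
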